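(* Assume that conditions (A1) and (A2) of the context hold. Let $x\in H$. For $\epsilon\in(0,1]$ let $\mu^\epsilon_x$ be the distribution on $C([0,1];H)$ of the random trajectory $t\in[0,1]\mapsto X_x(\epsilon t)$, where $(X_x(t))_{t\in[0,1]}$ is the continuous mild solution of $$dX(t)=(AX(t)+F(t,X(t)))\,dt+G(X(t))\,dW(t),\qquad X(0)=x.$$ Then the family $\{\mu^\epsilon_x:\epsilon\in(0,1]\}$ satisfies a large deviation principle with rate function $\mathcal{I}_x$.
   Context: Setting. $(H,\langle\cdot,\cdot\rangle,|\cdot|)$ and $(U,\langle\cdot,\cdot\rangle_U,|\cdot|_U)$ are separable Hilbert spaces; $L(H,H)$ denotes the bounded operators on $H$ and $L_2(U,H)$ the Hilbert–Schmidt operators from $U$ to $H$. $(S(t))_{t\ge0}$ is a strongly continuous semigroup of bounded linear operators on $H$ with generator $A$. $F:[0,1]\times H\to H$ is Borel measurable and $G:H\to L_2(U,H)$; there are $\nu\in L^2([0,1];\mathbb{R})$ and a constant $\Lambda\in(0,\infty)$ such that for all $t\in[0,1]$, $x,y\in H$: $|F(t,x)-F(t,y)|\le\nu(t)|x-y|$, $|F(t,x)|\le\nu(t)(1+|x|)$, $\|G(x)-G(y)\|_{L_2(U,H)}\le\Lambda|x-y|$, $\|G(x)\|_{L_2(U,H)}\le\Lambda(1+|x|)$. $(\Omega,\mathcal{F},P)$ is a probability space with a right continuous filtration $(\mathcal{F}_t)_{t\ge0}$ such that $\mathcal{F}_0$ contains all $P$-null sets of $\mathcal{F}$. $(g_k)$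 is an orthonormal basis of $U$, $(\beta_k)$ is an independent sequence of real $(\mathcal{F}_t)$-Brownian motions, and $W(t)=\sum_k\beta_k(t)g_k$ is the associated cylindrical Wiener process on $U$. The mild solution $(X_x(t))_{t\in[0,1]}$ is the (unique, with a continuous version, which is the one used) $(\mathcal{F}_t)$-predictable $H$-valued process with $P\{\int_0^1|X_x(t)|^2dt<\infty\}=1$ and, for each $t\in[0,1]$, $P$-a.e. $$X_x(t)=S(t)x+\int_0^tS(t-s)F(s,X_x(s))\,ds+\int_0^tS(t-s)G(X_x(s))\,dW(s).$$ For $\phi\in L^2([0,1];U)$ and $x\in H$, $z^\phi_x$ is the unique function in $C([0,1];H)$ with $z^\phi_x(t)=x+\int_0^tG(z^\phi_x(s))\phi(s)\,ds$ for all $t\in[0,1]$. For $u\in C([0,1];H)$, $$\mathcal{I}_x(u):=\tfrac12\inf\left\{\int_0^1|\psi(s)|_U^2\,ds:\psi\in L^2([0,1];U),\ u=z^\psi_x\right\},\qquad\inf\emptyset=\infty.$$ Large deviation principle: $\{\mu^\epsilon_x\}$ satisfies a large deviation principle with (good) rate function $\mathcal{I}_x$ if $\{u\in C([0,1];H):\mathcal{I}_x(u)\le r\}$ is compact for each $r\in(0,\infty)$, $\liminf_{\epsilon\to0}\epsilon\ln\mu^\epsilon_x(O)\ge-\inf_{u\in O}\mathcal{I}_x(u)$ for every open $O\subset C([0,1];H)$, and $\limsup_{\epsilon\to0}\epsilon\ln\mu^\epsilon_x(C)\le-\inf_{u\in C}\mathcal{I}_x(u)$ for every closed $C\subset C([0,1];H)$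 (supremum norm topology). $\Pi_n:U\to U$ is the orthogonal projection onto the span of $\{g_1,\dots,g_n\}$ and $I_U$ is the identity on $U$. (A1): for each $r\in(0,\infty)$, $\sup_{h\in H,|h|<r}\|G(h)(I_U-\Pi_n)\|_{L_2(U,H)}\to0$ as $n\to\infty$. (A2): for each $a\in(0,1]$ the family of functions $\{t\in[a,1]\mapsto S(\epsilon t)\in L(H,H):\epsilon\in(0,1]\}$ is uniformly equicontinuous, where $L(H,H)$ has the operator norm topology. *)

theory Defs
  imports "HOL-Probability.Probability"
begin

text \<open>
  A real separable Hilbert space is a type of sort
  \<open>{real_inner, banach, second_countable_topology}\<close>.
\<close>

section \<open>Orthonormal bases, projections, Hilbert--Schmidt operators\<close>

text \<open>
  A basis is indexed by an initial segment \<open>K\<close> of the natural numbers, so that finite-dimensional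
  spaces are covered as well; indices start at 0.
\<close>

definition orthonormal_basis :: "(nat \<Rightarrow> 'u::real_inner) \<Rightarrow> nat set \<Rightarrow> bool" where
  "orthonormal_basis g K \<longleftrightarrow>
     (K = UNIV \<or> (\<exists>N. K = {..<N})) \<and>
     (\<forall>j\<in>K. \<forall>k\<in>K. g j \<bullet> g k = (if j = k then 1 else 0)) \<and>
     closure (span (g ` K)) = UNIV"

definition orthogonal_projection :: "'u::real_inner set \<Rightarrow> 'u \<Rightarrow> 'u" where
  "orthogonal_projection V u = (THE p. p \<in> V \<and> (\<forall>v\<in>V. (u - p) \<bullet> v = 0))"

definition basis_projection :: "(nat \<Rightarrow> 'u::real_inner) \<Rightarrow> nat set \<Rightarrow> nat \<Rightarrow> 'u \<Rightarrow> 'u" where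
  "basis_projection g K n = orthogonal_projection (span (g ` (K \<inter> {..<n})))"

definition hilbert_schmidt ::
    "(nat \<Rightarrow> 'u::real_normed_vector) \<Rightarrow> nat set \<Rightarrow> ('u \<Rightarrow> 'h::real_normed_vector) \<Rightarrow> bool" where
  "hilbert_schmidt g K T \<longleftrightarrow>
     bounded_linear T \<and> (\<lambda>k. (norm (T (g k)))\<^sup>2) summable_on K"

text \<open>
  Neither notion depends on the choice of the orthonormal basis. The norm is meaningful only for
  Hilbert--Schmidt operators: \<open>infsum\<close> is 0 for non-summable families.
\<close>

definition hs_norm ::
    "(nat \<Rightarrow> 'u::real_normed_vector) \<Rightarrow> nat set \<Rightarrow> ('u \<Rightarrow> 'h::real_normed_vector) \<Rightarrow> real" where
  "hs_norm g K T = sqrt (\<Sum>\<^sub>\<infinity>k\<in>K. (norm (T (g k)))\<^sup>2)"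

section \<open>Square integrable functions and semigroups\<close>

definition L2_unit_interval :: "(real \<Rightarrow> 'a::{real_normed_vector, second_countable_topology}) set" where
  "L2_unit_interval =
     {f. f \<in> borel_measurable (lebesgue_on {0..1}) \<and>
         integrable (lebesgue_on {0..1}) (\<lambda>s. (norm (f s))\<^sup>2)}"

definition strongly_continuous_semigroup :: "(real \<Rightarrow> 'h::real_normed_vector \<Rightarrow>\<^sub>L 'h) \<Rightarrow> bool" where
  "strongly_continuous_semigroup S \<longleftrightarrow>
     S 0 = id_blinfun \<and>
     (\<forall>s\<ge>0. \<forall>t\<ge>0. S (s + t) = S s o\<^sub>L S t) \<and>
     (\<forall>x. continuous_on {0..} (\<lambda>t. S t x))"

text \<open>The generator as a graph; its domain is \<open>Domain (semigroup_generator S)\<close>.\<close>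

definition semigroup_generator ::
    "(real \<Rightarrow> 'h::real_normed_vector \<Rightarrow>\<^sub>L 'h) \<Rightarrow> ('h \<times> 'h) set" where
  "semigroup_generator S = {(x, y). ((\<lambda>t. (S t x - x) /\<^sub>R t) \<longlongrightarrow> y) (at_right 0)}"

definition uniformly_equicontinuous_on ::
    "'a::metric_space set \<Rightarrow> ('a \<Rightarrow> 'b::metric_space) set \<Rightarrow> bool" where
  "uniformly_equicontinuous_on D \<Phi> \<longleftrightarrow>
     (\<forall>e>0. \<exists>d>0. \<forall>f\<in>\<Phi>. \<forall>s\<in>D. \<forall>t\<in>D. dist s t < d \<longrightarrow> dist (f s) (f t) < e)"

section \<open>Filtrations, Brownian motions, stochastic integrals\<close>

text \<open>
  A filtration is a family of measures indexed by real times of which only \<open>t \<ge> 0\<close> is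
  meaningful, and of which only the sigma-algebras matter.
\<close>

definition usual_filtration :: "'w measure \<Rightarrow> (real \<Rightarrow> 'w measure) \<Rightarrow> bool" where
  "usual_filtration M \<F> \<longleftrightarrow>
     (\<forall>t\<ge>0. subalgebra M (\<F> t)) \<and>
     (\<forall>s t. 0 \<le> s \<longrightarrow> s \<le> t \<longrightarrow> sets (\<F> s) \<subseteq> sets (\<F> t)) \<and>
     (\<forall>t\<ge>0. sets (\<F> t) = (\<Inter>s\<in>{t<..}. sets (\<F> s))) \<and>
     null_sets M \<subseteq> sets (\<F> 0)"

definition brownian_motion ::
    "'w measure \<Rightarrow> (real \<Rightarrow> 'w measure) \<Rightarrow> (real \<Rightarrow> 'w \<Rightarrow> real) \<Rightarrow> bool" where
  "brownian_motion M \<F> B \<longleftrightarrow>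
     (\<forall>t\<ge>0. B t \<in> borel_measurable (\<F> t)) \<and>
     (AE \<omega> in M. B 0 \<omega> = 0) \<and>
     (AE \<omega> in M. continuous_on {0..} (\<lambda>t. B t \<omega>)) \<and>
     (\<forall>s t. 0 \<le> s \<longrightarrow> s < t \<longrightarrow>
        distributed M lborel (\<lambda>\<omega>. B t \<omega> - B s \<omega>) (normal_density 0 (sqrt (t - s))) \<and>
        prob_space.indep_set M (sets (\<F> s))
          {(\<lambda>\<omega>. B t \<omega> - B s \<omega>) -` C \<inter> space M | C. C \<in> sets borel})"

text \<open>
  The cylindrical Wiener process \<open>W(t) = \<Sum>k\<in>K. \<beta> k t *\<^sub>R g k\<close> is a formal series (it does not
  converge in \<open>U\<close> if \<open>K\<close> is infinite); it is represented by the sequence \<open>\<beta>\<close> and the basis \<open>g\<close>.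
\<close>

definition independent_brownian_motions ::
    "'w measure \<Rightarrow> (real \<Rightarrow> 'w measure) \<Rightarrow> nat set \<Rightarrow> (nat \<Rightarrow> real \<Rightarrow> 'w \<Rightarrow> real) \<Rightarrow> bool" where
  "independent_brownian_motions M \<F> K \<beta> \<longleftrightarrow>
     (\<forall>k\<in>K. brownian_motion M \<F> (\<beta> k)) \<and>
     prob_space.indep_vars M (\<lambda>_. \<Pi>\<^sub>M t\<in>{0..}. borel) (\<lambda>k \<omega>. \<lambda>t\<in>{0..}. \<beta> k t \<omega>) K"

definition predictable_sigma :: "'w measure \<Rightarrow> (real \<Rightarrow> 'w measure) \<Rightarrow> real \<Rightarrow> (real \<times> 'w) measure" where
  "predictable_sigma M \<F> T =
     sigma ({0..T} \<times> space M)
       ({{0} \<times> A | A. A \<in> sets (\<F> 0)} \<union>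
        {{a<..b} \<times> A | a b A. 0 \<le> a \<and> a \<le> b \<and> b \<le> T \<and> A \<in> sets (\<F> a)})"

text \<open>
  An elementary operator-valued process is a finite sum of terms
  \<open>1\<^bsub>(a,b]\<^esub>(s) \<langle>g\<^sub>k, \<cdot>\<rangle> \<xi>(\<omega>)\<close> with \<open>\<xi>\<close> bounded and \<open>\<F>\<^sub>a\<close>-measurable, given by the list of
  its tuples \<open>(a, b, k, \<xi>)\<close>. Since \<open>W(t)\<close> has the coordinate \<open>\<beta>\<^sub>k(t)\<close> along \<open>g\<^sub>k\<close>, the integral of
  such a term over \<open>[0,t]\<close> is \<open>(\<beta>\<^sub>k(b \<and> t) - \<beta>\<^sub>k(a \<and> t)) \<xi>\<close>.
\<close>

type_synonym ('w, 'h) elementary_process = "(real \<times> real \<times> nat \<times> ('w \<Rightarrow> 'h)) list"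

definition is_elementary ::
    "'w measure \<Rightarrow> (real \<Rightarrow> 'w measure) \<Rightarrow> nat set \<Rightarrow> ('w, 'h::real_normed_vector) elementary_process \<Rightarrow> bool" where
  "is_elementary M \<F> K E \<longleftrightarrow>
     (\<forall>(a, b, k, \<xi>)\<in>set E. 0 \<le> a \<and> a \<le> b \<and> k \<in> K \<and> \<xi> \<in> borel_measurable (\<F> a) \<and>
        bounded (\<xi> ` space M))"

definition elementary_integrand ::
    "(nat \<Rightarrow> 'u::real_inner) \<Rightarrow> ('w, 'h::real_vector) elementary_process \<Rightarrow> real \<Rightarrow> 'w \<Rightarrow> 'u \<Rightarrow> 'h" where
  "elementary_integrand g E s \<omega> u =
     (\<Sum>(a, b, k, \<xi>)\<leftarrow>E. (indicator {a<..b} s * (g k \<bullet> u)) *\<^sub>R \<xi> \<omega>)"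

definition elementary_integral ::
    "(nat \<Rightarrow> real \<Rightarrow> 'w \<Rightarrow> real) \<Rightarrow> ('w, 'h::real_vector) elementary_process \<Rightarrow> real \<Rightarrow> 'w \<Rightarrow> 'h" where
  "elementary_integral \<beta> E t \<omega> =
     (\<Sum>(a, b, k, \<xi>)\<leftarrow>E. (\<beta> k (min b t) \<omega> - \<beta> k (min a t) \<omega>) *\<^sub>R \<xi> \<omega>)"

definition vanishes_in_probability :: "'w measure \<Rightarrow> (nat \<Rightarrow> 'w \<Rightarrow> ennreal) \<Rightarrow> bool" where
  "vanishes_in_probability M Z \<longleftrightarrow>
     (\<forall>n. Z n \<in> borel_measurable M) \<and>
     (\<forall>e>0. (\<lambda>n. measure M {\<omega>\<in>space M. Z n \<omega> > e}) \<longlonglongrightarrow> 0)"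

text \<open>
  \<open>Y\<close> is a version of the Ito integral of \<open>\<Phi>\<close> over \<open>[0,t]\<close> with respect to \<open>W\<close>. The integrands
  are the predictable Hilbert--Schmidt-valued processes which are almost surely square integrable
  on \<open>[0,t]\<close>; predictability is stated pointwise on \<open>U\<close>, which is the same as measurability into
  the (separable) space of Hilbert--Schmidt operators. The integral is the limit in probability of
  the integrals of elementary processes \<open>E n\<close> such that the integral of
  \<open>\<parallel>E n s - \<Phi> s\<parallel>\<^sup>2\<close> over \<open>[0,t]\<close> tends to 0 in probability; it is unique up to null sets.
\<close>

definition has_stochastic_integral ::
    "'w measure \<Rightarrow> (real \<Rightarrow> 'w measure) \<Rightarrow> (nat \<Rightarrow> 'u::real_inner) \<Rightarrow> nat set \<Rightarrow>
     (nat \<Rightarrow> real \<Rightarrow> 'w \<Rightarrow> real) \<Rightarrow> real \<Rightarrow>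
     (real \<Rightarrow> 'w \<Rightarrow> 'u \<Rightarrow> 'h::{real_inner, banach, second_countable_topology}) \<Rightarrow>
     ('w \<Rightarrow> 'h) \<Rightarrow> bool" where
  "has_stochastic_integral M \<F> g K \<beta> t \<Phi> Y \<longleftrightarrow>
     (\<forall>s\<in>{0..t}. \<forall>\<omega>\<in>space M. hilbert_schmidt g K (\<Phi> s \<omega>)) \<and>
     (\<forall>u. (\<lambda>(s, \<omega>). \<Phi> s \<omega> u) \<in> borel_measurable (predictable_sigma M \<F> t)) \<and>
     (AE \<omega> in M. (\<integral>\<^sup>+ s\<in>{0..t}. ennreal ((hs_norm g K (\<Phi> s \<omega>))\<^sup>2) \<partial>lborel) < \<infinity>) \<and>
     Y \<in> borel_measurable M \<and>
     (\<exists>E. (\<forall>n. is_elementary M \<F> K (E n)) \<and>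
        vanishes_in_probability M (\<lambda>n \<omega>. \<integral>\<^sup>+ s\<in>{0..t}.
          ennreal ((hs_norm g K (\<lambda>u. elementary_integrand g (E n) s \<omega> u - \<Phi> s \<omega> u))\<^sup>2) \<partial>lborel) \<and>
        vanishes_in_probability M (\<lambda>n \<omega>. ennreal (norm (elementary_integral \<beta> (E n) t \<omega> - Y \<omega>))))"

section \<open>Mild solutions\<close>

definition mild_solution ::
    "'w measure \<Rightarrow> (real \<Rightarrow> 'w measure) \<Rightarrow> (nat \<Rightarrow> 'u::real_inner) \<Rightarrow> nat set \<Rightarrow>
     (nat \<Rightarrow> real \<Rightarrow> 'w \<Rightarrow> real) \<Rightarrow>
     (real \<Rightarrow> 'h \<Rightarrow>\<^sub>L 'h::{real_inner, banach, second_countable_topology}) \<Rightarrow>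
     (real \<Rightarrow> 'h \<Rightarrow> 'h) \<Rightarrow> ('h \<Rightarrow> 'u \<Rightarrow>\<^sub>L 'h) \<Rightarrow> 'h \<Rightarrow> (real \<Rightarrow> 'w \<Rightarrow> 'h) \<Rightarrow> bool" where
  "mild_solution M \<F> g K \<beta> S F G x X \<longleftrightarrow>
     (\<lambda>(t, \<omega>). X t \<omega>) \<in> borel_measurable (predictable_sigma M \<F> 1) \<and>
     (AE \<omega> in M. (\<integral>\<^sup>+ t\<in>{0..1}. ennreal ((norm (X t \<omega>))\<^sup>2) \<partial>lborel) < \<infinity>) \<and>
     (\<forall>t\<in>{0..1}. \<exists>Y.
        has_stochastic_integral M \<F> g K \<beta> t (\<lambda>s \<omega> u. S (t - s) (G (X s \<omega>) u)) Y \<and>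
        (AE \<omega> in M. X t \<omega> = S t x + (LINT s:{0..t}|lborel. S (t - s) (F s (X s \<omega>))) + Y \<omega>))"

definition continuous_mild_solution ::
    "'w measure \<Rightarrow> (real \<Rightarrow> 'w measure) \<Rightarrow> (nat \<Rightarrow> 'u::real_inner) \<Rightarrow> nat set \<Rightarrow>
     (nat \<Rightarrow> real \<Rightarrow> 'w \<Rightarrow> real) \<Rightarrow>
     (real \<Rightarrow> 'h \<Rightarrow>\<^sub>L 'h::{real_inner, banach, second_countable_topology}) \<Rightarrow>
     (real \<Rightarrow> 'h \<Rightarrow> 'h) \<Rightarrow> ('h \<Rightarrow> 'u \<Rightarrow>\<^sub>L 'h) \<Rightarrow> 'h \<Rightarrow> (real \<Rightarrow> 'w \<Rightarrow> 'h) \<Rightarrow> bool" where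
  "continuous_mild_solution M \<F> g K \<beta> S F G x X \<longleftrightarrow>
     mild_solution M \<F> g K \<beta> S F G x X \<and>
     (\<forall>\<omega>\<in>space M. continuous_on {0..1} (\<lambda>t. X t \<omega>))"

section \<open>Path space, rate function, large deviation principle\<close>

text \<open>\<open>C([0,1];H)\<close> with the supremum distance; its elements are extensional on \<open>{0..1}\<close>.\<close>

definition path_metric :: "(real \<Rightarrow> 'h::metric_space) metric" where
  "path_metric = cfunspace (top_of_set {0..1}) euclidean_metric"

lemma mspace_path_metric:
  "mspace (path_metric :: (real \<Rightarrow> 'h::metric_space) metric) =
     {u. u \<in> extensional {0..1} \<and> continuous_on {0..1} u}"
proof -
  have "bounded (u ` {0..1})" if "continuous_on {0..1} u" for u :: "real \<Rightarrow> 'h"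
    using that by (intro compact_imp_bounded compact_continuous_image) auto
  then show ?thesis
    by (auto simp: path_metric_def mtopology_of_def)
qed

definition path_law :: "'w measure \<Rightarrow> (real \<Rightarrow> 'w \<Rightarrow> 'h::metric_space) \<Rightarrow> (real \<Rightarrow> 'h) measure" where
  "path_law M Z =
     distr M
       (sigma (mspace path_metric) {V. openin (mtopology_of path_metric) V})
       (\<lambda>\<omega>. \<lambda>t\<in>{0..1}. Z t \<omega>)"

definition controlled_path ::
    "('h \<Rightarrow> 'u::real_normed_vector \<Rightarrow>\<^sub>L 'h::{banach, second_countable_topology}) \<Rightarrow> 'h \<Rightarrow>
     (real \<Rightarrow> 'u) \<Rightarrow> (real \<Rightarrow> 'h)" where
  "controlled_path G x \<phi> =
     (THE z. z \<in> mspace path_metric \<and>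
        (\<forall>t\<in>{0..1}. z t = x + (LINT s:{0..t}|lebesgue. G (z s) (\<phi> s))))"

definition rate_function ::
    "('h \<Rightarrow> 'u::{real_normed_vector, second_countable_topology} \<Rightarrow>\<^sub>L 'h::{banach, second_countable_topology}) \<Rightarrow>
     'h \<Rightarrow> (real \<Rightarrow> 'h) \<Rightarrow> ereal" where
  "rate_function G x u =
     ereal (1 / 2) *
     (INF \<psi>\<in>{\<psi> \<in> L2_unit_interval. u = controlled_path G x \<psi>}.
        ereal (LINT s|lebesgue_on {0..1}. (norm (\<psi> s))\<^sup>2))"

text \<open>The real \<open>ln\<close> has \<open>ln 0 = 0\<close>, which must not be used for events of probability zero.\<close>

definition ln_prob :: "real \<Rightarrow> ereal" where
  "ln_prob p = (if p = 0 then - \<infinity> else ereal (ln p))"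

definition large_deviation_principle ::
    "'a topology \<Rightarrow> (real \<Rightarrow> 'a measure) \<Rightarrow> ('a \<Rightarrow> ereal) \<Rightarrow> bool" where
  "large_deviation_principle T \<mu> I \<longleftrightarrow>
     (\<forall>r::real. r > 0 \<longrightarrow> compactin T {u \<in> topspace T. I u \<le> ereal r}) \<and>
     (\<forall>V. openin T V \<longrightarrow>
        Liminf (at_right 0) (\<lambda>\<epsilon>. ereal \<epsilon> * ln_prob (measure (\<mu> \<epsilon>) V)) \<ge> - (INF u\<in>V. I u)) \<and>
     (\<forall>C. closedin T C \<longrightarrow>
        Limsup (at_right 0) (\<lambda>\<epsilon>. ereal \<epsilon> * ln_prob (measure (\<mu> \<epsilon>) C)) \<le> - (INF u\<in>C. I u))"

end

theory Submission imports Defs "HOL-Library.Diagonal_Subsequence" begin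

text \<open>
 On \<open>[0, \<epsilon>]\<close> the drift and the semigroup are negligible, and the solution is close to the Euler
 scheme with \<open>N\<close> steps driven by the first \<open>n\<close> coordinates of \<open>W\<close>, up to an event of probability
 \<open>5 N exp (- R / \<epsilon>)\<close> with arbitrarily large \<open>R\<close>. Both ingredients of this estimate rest on an exponential
 inequality for stochastic integrals: at the grid points it is combined with an induction over the
 blocks in which the admissible error grows like \<open>exp (\<kappa> j / N)\<close>, and inside a block with chaining
 over dyadic times. The truncation to \<open>n\<close> coordinates is paid for by (A1), and the semigroup is
 uniformly close to the identity on the compact set of values of the Euler scheme.

 The Euler scheme is a continuous function of finitely many independent Gaussian variables of
 variance \<open>\<epsilon> / N\<close>, for which the large deviation bounds are elementary; driven by the increments of a
 control, it approximates the controlled path uniformly over bounded sets of controls. Compactness of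
 the level sets follows from the weak compactness of balls of controls.
\<close>

abbreviation (input) "gauss \<equiv> std_normal_distribution"
abbreviation (input) "L2 \<equiv> L2_unit_interval"
abbreviation (input) "paths \<equiv> mspace path_metric"
abbreviation (in prob_space) (input) "\<E> \<equiv> expectation"

section \<open>Orthonormal bases and Hilbert--Schmidt operators\<close>

context
 fixes g :: "nat => 'u::{real_inner, banach, second_countable_topology}" and K :: "nat set"
 assumes onb: "orthonormal_basis g K"
begin

lemma basis_inner: "j \<in> K ==> k \<in> K ==> g j \<bullet> g k = (if j = k then 1 else 0)"
 using onb by (simp add: orthonormal_basis_def)

lemma basis_norm: "k \<in> K ==> norm (g k) = 1"
 using basis_inner[of k k] by (simp add: norm_eq_sqrt_inner)

lemma basis_inj: "inj_on g K"
 by (rule inj_onI) (metis basis_inner zero_neq_one)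

lemma basis_sum_inner:
 assumes "finite J" "J \<subseteq> K" "k \<in> K"
 shows "g k \<bullet> (\<Sum>j\<in>J. c j *\<^sub>R g j) = (if k \<in> J then c k else 0)"
proof -
 have "g k \<bullet> (\<Sum>j\<in>J. c j *\<^sub>R g j) = (\<Sum>j\<in>J. if j = k then c k else 0)"
  unfolding inner_sum_right using assms by (intro sum.cong refl) (auto simp: basis_inner)
 thus ?thesis using assms(1) by simp
qed

lemma basis_sum_norm:
 assumes "finite J" "J \<subseteq> K"
 shows "(norm (\<Sum>j\<in>J. c j *\<^sub>R g j))^2 = (\<Sum>j\<in>J. (c j)\<^sup>2)"
proof -
 have "(norm (\<Sum>j\<in>J. c j *\<^sub>R g j))^2 = (\<Sum>k\<in>J. c k * (g k \<bullet> (\<Sum>j\<in>J. c j *\<^sub>R g j)))"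
  unfolding power2_norm_eq_inner by (subst inner_sum_left) simp
 also have "\<dots> = (\<Sum>j\<in>J. (c j)\<^sup>2)"
  using assms by (intro sum.cong refl, subst basis_sum_inner) (auto simp: power2_eq_square)
 finally show ?thesis .
qed

lemma basis_bessel:
 assumes "finite J" "J \<subseteq> K"
 shows "(\<Sum>k\<in>J. (g k \<bullet> u)\<^sup>2) \<le> (norm u)^2"
proof -
 define p where "p = (\<Sum>k\<in>J. (g k \<bullet> u) *\<^sub>R g k)"
 have "(norm p)^2 = (\<Sum>k\<in>J. (g k \<bullet> u)\<^sup>2)" unfolding p_def by (rule basis_sum_norm[OF assms])
 moreover have "p \<bullet> u = (\<Sum>k\<in>J. (g k \<bullet> u)\<^sup>2)" unfolding p_def by (simp add: inner_sum_left power2_eq_square)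
 moreover have "0 \<le> (norm (u - p))^2" by simp
 moreover have "(norm (u - p))^2 = (norm u)^2 - 2 * (p \<bullet> u) + (norm p)^2"
  by (simp add: power2_norm_eq_inner inner_diff_left inner_diff_right inner_commute)
 ultimately show ?thesis by linarith
qed

lemma basis_projection_eq:
 "basis_projection g K n u = (\<Sum>k\<in>K \<inter> {..<n}. (g k \<bullet> u) *\<^sub>R g k)"
proof -
 let ?J = "K \<inter> {..<n}"
 let ?p = "\<Sum>k\<in>?J. (g k \<bullet> u) *\<^sub>R g k"
 have J: "finite ?J" "?J \<subseteq> K" by auto
 have 1: "?p \<in> span (g ` ?J)" by (intro span_sum span_scale span_base) auto
 have 2: "(u - ?p) \<bullet> v = 0" if "v \<in> span (g ` ?J)" for v
  using that
 proof (induction rule: span_induct)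
  case base
  show ?case by (auto simp: subspace_def inner_add_right)
 next
  case (step x)
  then obtain k where k: "k \<in> ?J" "x = g k" by auto
  have "(u - ?p) \<bullet> g k = g k \<bullet> u - g k \<bullet> ?p" by (subst inner_commute) (rule inner_diff_right)
  also have "\<dots> = 0" using k basis_sum_inner[OF J, of k] by simp
  finally show ?case using k by simp
 qed
 show ?thesis unfolding basis_projection_def orthogonal_projection_def
 proof (rule the_equality)
  show "?p \<in> span (g ` ?J) \<and> (\<forall>v\<in>span (g ` ?J). (u - ?p) \<bullet> v = 0)" using 1 2 by blast
  fix p assume p: "p \<in> span (g ` ?J) \<and> (\<forall>v\<in>span (g ` ?J). (u - p) \<bullet> v = 0)"
  hence d: "p - ?p \<in> span (g ` ?J)" using 1 by (intro span_diff) auto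
  have "(p - ?p) \<bullet> (p - ?p) = (u - ?p) \<bullet> (p - ?p) - (u - p) \<bullet> (p - ?p)"
   by (simp add: inner_diff_left)
  also have "\<dots> = 0" using 2[OF d] p d by auto
  finally show "p = ?p" by simp
 qed
qed

lemma norm_le_hs_norm:
 assumes T: "hilbert_schmidt g K T"
 shows "norm (T u) \<le> hs_norm g K T * norm u"
proof -
 interpret T: bounded_linear T using T by (simp add: hilbert_schmidt_def)
 have sm: "(\<lambda>k. (norm (T (g k)))\<^sup>2) summable_on K" using T by (simp add: hilbert_schmidt_def)
 have "u \<in> closure (span (g ` K))" using onb by (simp add: orthonormal_basis_def)
 also have "closure (span (g ` K)) \<subseteq> {u. norm (T u) \<le> hs_norm g K T * norm u}"
 proof (rule closure_minimal)
  show "closed {u. norm (T u) \<le> hs_norm g K T * norm u}"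
   by (intro closed_Collect_le continuous_intros T.continuous_on)
  show "span (g ` K) \<subseteq> {u. norm (T u) \<le> hs_norm g K T * norm u}"
  proof
   fix v assume "v \<in> span (g ` K)"
   then obtain t r where t: "finite t" "t \<subseteq> g ` K" "v = (\<Sum>a\<in>t. r a *\<^sub>R a)"
    unfolding span_explicit by auto
   obtain J where J: "J \<subseteq> K" "finite J" "t = g ` J" using finite_subset_image[OF t(1,2)] by blast
   have v: "v = (\<Sum>j\<in>J. r (g j) *\<^sub>R g j)"
    unfolding t(3) J(3) by (rule sum.reindex_cong[OF inj_on_subset[OF basis_inj J(1)]]) auto
   have "(norm v)^2 = (\<Sum>j\<in>J. (r (g j))\<^sup>2)" unfolding v by (rule basis_sum_norm[OF J(2,1)])
   hence nv: "norm v = sqrt (\<Sum>j\<in>J. (r (g j))\<^sup>2)" by (rule real_sqrt_unique[symmetric]) simp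
   have "norm (T v) \<le> (\<Sum>j\<in>J. norm (r (g j) *\<^sub>R T (g j)))"
    unfolding v T.sum T.scaleR by (rule norm_sum)
   also have "\<dots> = (\<Sum>j\<in>J. \<bar>r (g j)\<bar> * norm (T (g j)))" by simp
   also have "\<dots> \<le> sqrt ((\<Sum>j\<in>J. \<bar>r (g j)\<bar>\<^sup>2) * (\<Sum>j\<in>J. (norm (T (g j)))\<^sup>2))"
    by (rule real_le_rsqrt[OF Cauchy_Schwarz_ineq_sum])
   also have "\<dots> = norm v * sqrt (\<Sum>j\<in>J. (norm (T (g j)))\<^sup>2)"
    unfolding nv by (simp add: real_sqrt_mult)
   also have "\<dots> \<le> norm v * hs_norm g K T"
    unfolding hs_norm_def using J by (intro mult_left_mono real_sqrt_le_mono finite_sum_le_infsum sm) auto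
   finally show "v \<in> {u. norm (T u) \<le> hs_norm g K T * norm u}" by (simp add: mult.commute)
  qed
 qed
 finally show ?thesis by simp
qed

end

text \<open>Without the junk value of \<open>hs_norm\<close> for operators which are not Hilbert--Schmidt.\<close>

definition hs2 :: "(nat => 'u) => nat set => ('u => 'h::real_normed_vector) => ennreal" where
 "hs2 g K T = (\<integral>\<^sup>+k. ennreal ((norm (T (g k)))^2) \<partial>count_space K)"

lemma hs2_eq_hs_norm:
 assumes "hilbert_schmidt g K T"
 shows "ennreal ((hs_norm g K T)^2) = hs2 g K T"
proof -
 have "(\<lambda>k. (norm (T (g k)))\<^sup>2) summable_on K" using assms by (simp add: hilbert_schmidt_def)
 hence "Infinite_Sum.abs_summable_on (\<lambda>k. (norm (T (g k)))\<^sup>2) K"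
  by (rule summable_on_iff_abs_summable_on_real[THEN iffD1])
 hence a: "Infinite_Set_Sum.abs_summable_on (\<lambda>k. (norm (T (g k)))\<^sup>2) K"
  by (rule abs_summable_equivalent[THEN iffD1])
 have "hs2 g K T = ennreal (infsetsum (\<lambda>k. (norm (T (g k)))\<^sup>2) K)"
  unfolding hs2_def by (rule nn_integral_conv_infsetsum[OF a]) simp
 also have "infsetsum (\<lambda>k. (norm (T (g k)))\<^sup>2) K = infsum (\<lambda>k. (norm (T (g k)))\<^sup>2) K"
  by (rule infsetsum_infsum[OF a])
 also have "\<dots> = (hs_norm g K T)^2" by (simp add: hs_norm_def infsum_nonneg)
 finally show ?thesis by simp
qed

lemma hs2_le_square:
 assumes "hilbert_schmidt g K T" "hs_norm g K T \<le> c"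
 shows "hs2 g K T \<le> ennreal (c^2)"
proof -
 have "0 \<le> hs_norm g K T" by (simp add: hs_norm_def infsum_nonneg)
 thus ?thesis using assms(2) by (auto simp: hs2_eq_hs_norm[OF assms(1), symmetric] intro!: ennreal_leI power_mono)
qed

lemma square_norm_add_le: "(norm (a + b))^2 \<le> 2 * (norm a)^2 + 2 * (norm b)^2"
proof -
 have "(norm (a + b))^2 \<le> (norm a + norm b)^2" by (intro power_mono norm_triangle_ineq) auto
 also have "\<dots> \<le> 2 * (norm a)^2 + 2 * (norm b)^2"
  using sum_squares_bound[of "norm a" "norm b"] by (simp add: power2_sum)
 finally show ?thesis .
qed

lemma hs2_add_le: "hs2 g K (\<lambda>u. A u + B u) \<le> 2 * hs2 g K A + 2 * hs2 g K B"
proof -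
 have "hs2 g K (\<lambda>u. A u + B u) \<le> (\<integral>\<^sup>+k. 2 * ennreal ((norm (A (g k)))^2) + 2 * ennreal ((norm (B (g k)))^2) \<partial>count_space K)"
  unfolding hs2_def
 proof (rule nn_integral_mono)
  fix k
  have "ennreal ((norm (A (g k) + B (g k)))^2) \<le> ennreal (2 * (norm (A (g k)))^2 + 2 * (norm (B (g k)))^2)"
   by (rule ennreal_leI[OF square_norm_add_le])
  thus "ennreal ((norm (A (g k) + B (g k)))^2) \<le> 2 * ennreal ((norm (A (g k)))^2) + 2 * ennreal ((norm (B (g k)))^2)"
   by (simp add: ennreal_plus ennreal_mult)
 qed
 also have "\<dots> = 2 * hs2 g K A + 2 * hs2 g K B"
  unfolding hs2_def by (simp add: nn_integral_add nn_integral_cmult)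
 finally show ?thesis .
qed

lemma hs2_diff_le: "hs2 g K (\<lambda>u. A u - B u) \<le> 2 * hs2 g K A + 2 * hs2 g K B"
 using hs2_add_le[of g K A "\<lambda>u. - B u"] by (simp add: hs2_def)

lemma hs2_blinfun_le:
 assumes "norm T \<le> c"
 shows "hs2 g K (\<lambda>u. blinfun_apply T (A u)) \<le> ennreal (c^2) * hs2 g K A"
proof -
 have "hs2 g K (\<lambda>u. T (A u)) \<le> (\<integral>\<^sup>+k. ennreal (c^2) * ennreal ((norm (A (g k)))^2) \<partial>count_space K)"
  unfolding hs2_def
 proof (rule nn_integral_mono)
  fix k
  have "norm (T (A (g k))) \<le> c * norm (A (g k))"
   using norm_blinfun[of T "A (g k)"] mult_right_mono[OF assms, of "norm (A (g k))"] by simp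
  hence "(norm (T (A (g k))))^2 \<le> (c * norm (A (g k)))^2" by (intro power_mono) auto
  thus "ennreal ((norm (T (A (g k))))^2) \<le> ennreal (c^2) * ennreal ((norm (A (g k)))^2)"
   by (simp add: power_mult_distrib flip: ennreal_mult)
 qed
 also have "\<dots> = ennreal (c^2) * hs2 g K A" unfolding hs2_def by (simp add: nn_integral_cmult)
 finally show ?thesis .
qed

section \<open>Strongly continuous semigroups\<close>

lemma uniform_boundedness:
 fixes T :: "'i => 'a::banach \<Rightarrow>\<^sub>L 'b::real_normed_vector"
 assumes bdd: "\<And>x. \<exists>B. \<forall>i\<in>I. norm (T i x) \<le> B"
 shows "\<exists>C. \<forall>i\<in>I. norm (T i) \<le> C"
proof -
 define E where "E n = {x. \<forall>i\<in>I. norm (T i x) \<le> real n}" for n :: nat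
 have cl: "closed (E n)" for n
 proof -
  have "E n = (\<Inter>i\<in>I. {x. norm (T i x) \<le> real n})" by (auto simp: E_def)
  moreover have "closed {x. norm (T i x) \<le> real n}" for i
   by (intro closed_Collect_le continuous_intros)
  ultimately show ?thesis by auto
 qed
 have U: "\<Union>(range E) = UNIV"
 proof -
  have "\<exists>n. x \<in> E n" for x
  proof -
   obtain B where "\<forall>i\<in>I. norm (T i x) \<le> B" using bdd by blast
   thus ?thesis using real_arch_simple[of B] unfolding E_def by (auto intro: order_trans)
  qed
  thus ?thesis by auto
 qed
 have "\<exists>n. interior (E n) \<noteq> {}"
 proof (rule ccontr)
  assume "\<not> (\<exists>n. interior (E n) \<noteq> {})"
  hence "Met_TC.mtopology interior_of \<Union>(range E) = {}"
   using cl by (intro Met_TC.metric_Baire_category_alt) (auto simp: complete_UNIV euclidean_interior_of)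
  thus False unfolding U by (simp add: euclidean_interior_of)
 qed
 then obtain n x0 where "x0 \<in> interior (E n)" by blast
 then obtain r where r: "r > 0" "ball x0 r \<subseteq> E n" unfolding mem_interior by blast
 have "norm (T i) \<le> 4 * real n / r" if i: "i \<in> I" for i
 proof (rule norm_blinfun_bound)
  show "0 \<le> 4 * real n / r" using r by simp
  fix y
  show "norm (T i y) \<le> 4 * real n / r * norm y"
  proof (cases "y = 0")
   case False
   define z where "z = (r / (2 * norm y)) *\<^sub>R y"
   have "norm z = r / 2" using False r by (simp add: z_def)
   hence "x0 + z \<in> E n" "x0 \<in> E n" using r by (auto simp: dist_norm intro!: subsetD[OF r(2)])
   hence "norm (T i (x0 + z)) \<le> n" "norm (T i x0) \<le> n" using i by (auto simp: E_def)
   hence "norm (T i z) \<le> 2 * n"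
    using norm_triangle_ineq4[of "T i (x0 + z)" "T i x0"] by (simp add: blinfun.add_right)
   thus ?thesis using False r by (simp add: z_def blinfun.scaleR_right field_simps)
  qed simp
 qed
 thus ?thesis by blast
qed

context
 fixes S :: "real => 'h::{real_inner, banach, second_countable_topology} \<Rightarrow>\<^sub>L 'h"
 assumes semigroup: "strongly_continuous_semigroup S"
begin

lemma semigroup_0: "S 0 x = x" and semigroup_add: "0 \<le> s ==> 0 \<le> t ==> S (s + t) x = S s (S t x)"
 and semigroup_continuous: "continuous_on {0..} (\<lambda>t. S t x)"
 using semigroup by (auto simp: strongly_continuous_semigroup_def)

lemma semigroup_bounded: "\<exists>C\<ge>1. \<forall>t\<in>{0..1}. norm (S t) \<le> C"
proof -
 have "\<exists>B. \<forall>t\<in>{0..1}. norm (S t x) \<le> B" for x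
 proof -
  have "compact ((\<lambda>t. S t x) ` {0..1})"
   by (intro compact_continuous_image continuous_on_subset[OF semigroup_continuous]) auto
  thus ?thesis by (auto dest!: compact_imp_bounded simp: bounded_iff)
 qed
 from uniform_boundedness[of "{0..1}" S, OF this]
 obtain C where "\<forall>t\<in>{0..1}. norm (S t) \<le> C" by blast
 thus ?thesis by (intro exI[of _ "max 1 C"]) (auto simp: max_def intro: order_trans)
qed

lemma semigroup_tendsto_uniformly_on_compact:
 assumes E: "compact E" and e: "e > 0"
 shows "\<exists>d>0. \<forall>s\<in>{0..d}. \<forall>h\<in>E. norm (S s h - h) \<le> e"
proof (rule ccontr)
 assume neg: "\<not> ?thesis"
 have "\<exists>s h. s \<in> {0..1 / real (Suc n)} \<and> h \<in> E \<and> \<not> norm (S s h - h) \<le> e" for n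
  using neg[simplified, rule_format, of "1 / real (Suc n)"] by fastforce
 then obtain s h where sh: "\<And>n. s n \<in> {0..1 / real (Suc n)}" "\<And>n. h n \<in> E" "\<And>n. \<not> norm (S (s n) (h n) - h n) \<le> e"
  by metis
 obtain l r where l: "l \<in> E" "strict_mono r" "(h \<circ> r) \<longlonglongrightarrow> l"
  using E sh(2) unfolding compact_def by metis
 obtain C where C: "C \<ge> 1" "\<And>t. t \<in> {0..1} ==> norm (S t) \<le> C" using semigroup_bounded by blast
 have "(\<lambda>n. 1 / real (Suc n)) \<longlonglongrightarrow> 0" by (rule LIMSEQ_Suc[OF lim_1_over_n])
 hence s0: "s \<longlonglongrightarrow> 0"
  by (rule tendsto_sandwich[rotated 2, OF tendsto_const]) (use sh(1) in auto)
 hence s0r: "(s \<circ> r) \<longlonglongrightarrow> 0" by (rule LIMSEQ_subseq_LIMSEQ[OF _ l(2)])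
 have "(\<lambda>n. S ((s \<circ> r) n) l) \<longlonglongrightarrow> S 0 l"
  by (rule continuous_on_tendsto_compose[OF semigroup_continuous s0r]) (use sh(1) in \<open>auto intro!: always_eventually\<close>)
 hence 1: "(\<lambda>n. norm (S ((s \<circ> r) n) l - l)) \<longlonglongrightarrow> 0"
  using tendsto_norm_zero[OF LIM_zero] by (simp add: semigroup_0)
 have 2: "(\<lambda>n. norm ((h \<circ> r) n - l)) \<longlonglongrightarrow> 0" using tendsto_norm_zero[OF LIM_zero[OF l(3)]] .
 have "(\<lambda>n. (C + 1) * norm ((h \<circ> r) n - l) + norm (S ((s \<circ> r) n) l - l)) \<longlonglongrightarrow> (C + 1) * 0 + 0"
  by (intro tendsto_intros 1 2)
 hence "\<forall>\<^sub>F n in sequentially. (C + 1) * norm ((h \<circ> r) n - l) + norm (S ((s \<circ> r) n) l - l) < e"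
  using e by (intro order_tendstoD) auto
 then obtain n where n: "(C + 1) * norm ((h \<circ> r) n - l) + norm (S ((s \<circ> r) n) l - l) < e"
  by (auto simp: eventually_sequentially)
 let ?s = "s (r n)" and ?h = "h (r n)"
 have s1: "?s \<in> {0..1}" using sh(1)[of "r n"] by (auto intro: order_trans)
 have "norm (S ?s ?h - ?h) = norm (S ?s (?h - l) + (S ?s l - l) - (?h - l))"
  by (simp add: blinfun.diff_right)
 also have "\<dots> \<le> norm (S ?s (?h - l)) + norm (S ?s l - l) + norm (?h - l)"
  by (rule order_trans[OF norm_triangle_ineq4 add_mono[OF norm_triangle_ineq order_refl]])
 also have "norm (S ?s (?h - l)) \<le> C * norm (?h - l)"
  using norm_blinfun[of "S ?s" "?h - l"] mult_right_mono[OF C(2)[OF s1] norm_ge_zero[of "?h - l"]] by linarith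
 finally show False using n sh(3)[of "r n"] by (simp add: algebra_simps)
qed

end

locale brownian_family = prob_space M for M :: "'w measure" +
 fixes \<F> :: "real => 'w measure" and K :: "nat set" and \<beta> :: "nat => real => 'w => real"
 assumes subalg: "\<And>t. 0 \<le> t ==> subalgebra M (\<F> t)"
  and filtration_mono: "\<And>s t. 0 \<le> s ==> s \<le> t ==> sets (\<F> s) \<subseteq> sets (\<F> t)"
  and independent: "independent_brownian_motions M \<F> K \<beta>"
begin

definition inc :: "nat => real => real => 'w => real" where
 "inc k s t om = \<beta> k t om - \<beta> k s om"

lemma space_filtration: "0 \<le> t ==> space (\<F> t) = space M"
 using subalg[of t] by (simp add: subalgebra_def)

lemma subalg_mono: "0 \<le> s ==> s \<le> t ==> subalgebra (\<F> t) (\<F> s)"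
 using filtration_mono[of s t] by (simp add: subalgebra_def space_filtration)

lemma measurable_filtration_mono:
 "f \<in> measurable (\<F> s) N ==> 0 \<le> s ==> s \<le> t ==> f \<in> measurable (\<F> t) N"
 using measurable_from_subalg[OF subalg_mono] by blast

lemma measurable_filtration_M: "f \<in> measurable (\<F> s) N ==> 0 \<le> s ==> f \<in> measurable M N"
 using measurable_from_subalg[OF subalg] by blast

lemma sets_filtration_M: "A \<in> sets (\<F> s) ==> 0 \<le> s ==> A \<in> sets M"
 using subalg[of s] by (auto simp: subalgebra_def)

lemma bm: "k \<in> K ==> brownian_motion M \<F> (\<beta> k)"
 using independent by (simp add: independent_brownian_motions_def)

lemma bm_adapted: "k \<in> K ==> 0 \<le> t ==> \<beta> k t \<in> borel_measurable (\<F> t)"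
 using bm by (simp add: brownian_motion_def)

lemma inc_adapted: "k \<in> K ==> 0 \<le> s ==> s \<le> t ==> inc k s t \<in> borel_measurable (\<F> t)"
 unfolding inc_def[abs_def]
 by (intro borel_measurable_diff bm_adapted measurable_filtration_mono[OF bm_adapted]) auto

lemma inc_measurable: "k \<in> K ==> 0 \<le> s ==> 0 \<le> t ==> inc k s t \<in> borel_measurable M"
 unfolding inc_def[abs_def]
 by (intro borel_measurable_diff measurable_filtration_M[OF bm_adapted]) auto

lemma inc_distributed:
 "k \<in> K ==> 0 \<le> s ==> s < t ==> distributed M lborel (inc k s t) (normal_density 0 (sqrt (t - s)))"
 using bm[of k] unfolding brownian_motion_def inc_def[abs_def] by auto

lemma inc_indep_var:
 fixes f :: "'w => 'b::topological_space" and \<phi> :: "real => 'b::topological_space"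
 assumes "k \<in> K" "0 \<le> s" "s < t" "f \<in> borel_measurable (\<F> s)" "\<phi> \<in> borel_measurable borel"
 shows "indep_var borel f borel (\<lambda>om. \<phi> (inc k s t om))"
proof -
 have [measurable]: "inc k s t \<in> borel_measurable M"
  using inc_measurable assms by auto
 have fM: "f \<in> borel_measurable M" using measurable_filtration_M assms by blast
 have 1: "indep_set (sets (\<F> s)) {inc k s t -` C \<inter> space M | C. C \<in> sets borel}"
  using bm[of k] assms unfolding brownian_motion_def inc_def[abs_def] by auto
 have a: "sigma_sets (space M) {f -` A \<inter> space M |A. A \<in> sets borel} \<subseteq> sets (\<F> s)"
  using assms(2) space_filtration[of s] measurable_sets[OF assms(4)]
  by (subst space_filtration[symmetric, OF assms(2)], intro sets.sigma_sets_subset) auto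
 have "{(\<lambda>om. \<phi> (inc k s t om)) -` A \<inter> space M |A. A \<in> sets borel}
   \<subseteq> sigma_sets (space M) {inc k s t -` C \<inter> space M | C. C \<in> sets borel}"
 proof safe
  fix A :: "'b set" assume "A \<in> sets borel"
  hence "\<phi> -` A \<in> sets borel" using measurable_sets[OF assms(5), of A] by simp
  moreover have "(\<lambda>om. \<phi> (inc k s t om)) -` A = inc k s t -` (\<phi> -` A)" by auto
  ultimately show "(\<lambda>om. \<phi> (inc k s t om)) -` A \<inter> space M \<in> sigma_sets (space M) {inc k s t -` C \<inter> space M | C. C \<in> sets borel}"
   by (intro sigma_sets.Basic) auto
 qed
 hence b: "sigma_sets (space M) {(\<lambda>om. \<phi> (inc k s t om)) -` A \<inter> space M |A. A \<in> sets borel}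
   \<subseteq> sigma_sets (space M) {inc k s t -` C \<inter> space M | C. C \<in> sets borel}"
  by (rule sigma_sets_mono)
 have c: "sigma_sets (space M) {inc k s t -` C \<inter> space M | C. C \<in> sets borel} = {inc k s t -` C \<inter> space M | C. C \<in> sets borel}"
  using sigma_sets_vimage_commute[of "inc k s t" "space M" "UNIV::real set" "sets borel"] sets.sigma_sets_eq[of "borel :: real measure"]
  by (simp add: setcompr_eq_image)
 show ?thesis
  unfolding indep_var_eq
 proof (intro conjI)
  show "random_variable borel f" by (rule fM)
  show "random_variable borel (\<lambda>om. \<phi> (inc k s t om))" using assms(5) by measurable
  show "indep_set (sigma_sets (space M) {f -` A \<inter> space M |A. A \<in> sets borel})
   (sigma_sets (space M) {(\<lambda>om. \<phi> (inc k s t om)) -` A \<inter> space M |A. A \<in> sets borel})"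
   unfolding indep_sets2_eq
  proof (intro conjI ballI)
   note 1 = 1[unfolded indep_sets2_eq] and bc = b[unfolded c]
   show "sigma_sets (space M) {f -` A \<inter> space M |A. A \<in> sets borel} \<subseteq> events"
    using a 1 by (blast intro: subset_trans)
   show "sigma_sets (space M) {(\<lambda>om. \<phi> (inc k s t om)) -` A \<inter> space M |A. A \<in> sets borel} \<subseteq> events"
    using bc 1 by (meson subset_trans)
   fix x y assume x: "x \<in> sigma_sets (space M) {f -` A \<inter> space M |A. A \<in> sets borel}"
    and y: "y \<in> sigma_sets (space M) {(\<lambda>om. \<phi> (inc k s t om)) -` A \<inter> space M |A. A \<in> sets borel}"
   show "prob (x \<inter> y) = prob x * prob y"
    using 1 subsetD[OF a x] subsetD[OF bc y] by meson
  qed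
 qed
qed

lemma expectation_mult_inc:
 fixes f \<phi> :: "_ => real"
 assumes "k \<in> K" "0 \<le> s" "s < t" "f \<in> borel_measurable (\<F> s)" "\<phi> \<in> borel_measurable borel"
  and "integrable M f" "integrable M (\<lambda>om. \<phi> (inc k s t om))"
 shows "integrable M (\<lambda>om. f om * \<phi> (inc k s t om))"
  and "\<E> (\<lambda>om. f om * \<phi> (inc k s t om)) = \<E> f * \<E> (\<lambda>om. \<phi> (inc k s t om))"
 using indep_var_integrable[OF inc_indep_var[OF assms(1-5)]] indep_var_lebesgue_integral[OF inc_indep_var[OF assms(1-5)]] assms(6,7)
 by auto

lemma inc_moments:
 assumes "k \<in> K" "0 \<le> s" "s < t"
 shows "integrable M (inc k s t)" "\<E> (inc k s t) = 0"
  "integrable M (\<lambda>om. (inc k s t om)\<^sup>2)" "\<E> (\<lambda>om. (inc k s t om)\<^sup>2) = t - s"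
  "integrable M (\<lambda>om. (inc k s t om)^4)" "\<E> (\<lambda>om. (inc k s t om)^4) = 3 * (t - s)^2"
proof -
 have D: "distributed M lborel (inc k s t) (normal_density 0 (sqrt (t - s)))"
  by (rule inc_distributed[OF assms])
 have p: "sqrt (t - s) > 0" using assms by simp
 note e = distributed_integrable[OF D _ normal_density_nonneg] distributed_integral[OF D _ normal_density_nonneg]
 have hb: "has_bochner_integral lborel (\<lambda>x. normal_density 0 (sqrt (t - s)) x * x ^ (2 * k)) (fact (2 * k) / ((2 / (sqrt (t - s))^2) ^ k * fact k))" for k
  using normal_moment_even[OF p, of 0 k] by simp
 have h1: "has_bochner_integral lborel (\<lambda>x. normal_density 0 (sqrt (t - s)) x * x) 0"
  using normal_moment_odd[OF p, of 0 0] by simp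
 note h2 = hb[of 1] and h4 = hb[of 2]
 have e4: "(fact (2 * 2) / ((2 / (sqrt (t - s))^2) ^ 2 * fact 2)) = 3 * (t - s)^2"
  using assms by (simp add: fact_numeral power2_eq_square field_simps)
 have e2: "(fact (2 * 1) / ((2 / (sqrt (t - s))^2) ^ 1 * fact 1)) = t - s"
  using assms by (simp add: fact_numeral power2_eq_square field_simps)
 show "integrable M (inc k s t)"
  using e(1)[of "\<lambda>x. x"] h1 by (simp add: has_bochner_integral_iff)
 show "\<E> (inc k s t) = 0"
  using e(2)[of "\<lambda>x. x"] h1 by (simp add: has_bochner_integral_iff)
 show "integrable M (\<lambda>om. (inc k s t om)\<^sup>2)"
  using e(1)[of "\<lambda>x. x\<^sup>2"] h2 by (simp add: has_bochner_integral_iff)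
 show "\<E> (\<lambda>om. (inc k s t om)\<^sup>2) = t - s"
  using e(2)[of "\<lambda>x. x\<^sup>2"] h2 unfolding e2 by (simp add: has_bochner_integral_iff)
 show "integrable M (\<lambda>om. (inc k s t om)^4)"
  using e(1)[of "\<lambda>x. x^4"] h4 by (simp add: has_bochner_integral_iff)
 show "\<E> (\<lambda>om. (inc k s t om)^4) = 3 * (t - s)^2"
  using e(2)[of "\<lambda>x. x^4"] h4 unfolding e4 by (simp add: has_bochner_integral_iff)
qed

lemma integrable_bounded_mult:
 fixes f g :: "'w => real"
 assumes "f \<in> borel_measurable M" "\<And>om. om \<in> space M ==> \<bar>f om\<bar> \<le> B" "integrable M g"
 shows "integrable M (\<lambda>om. f om * g om)"
proof (rule Bochner_Integration.integrable_bound)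
 show "integrable M (\<lambda>om. B * g om)" using assms by auto
 show "(\<lambda>om. f om * g om) \<in> borel_measurable M" using assms by auto
 show "AE x in M. norm (f x * g x) \<le> norm (B * g x)"
  using assms(2) by (intro AE_I2) (force simp: abs_mult intro!: mult_right_mono)
qed

lemma expectation_bounded_mult_inc:
 fixes Y :: "'w => real"
 assumes "k \<in> K" "0 \<le> s" "s < t" "Y \<in> borel_measurable (\<F> s)" "\<And>om. om \<in> space M ==> \<bar>Y om\<bar> \<le> B"
 shows "\<E> (\<lambda>om. Y om * inc k s t om) = 0"
  and "\<E> (\<lambda>om. Y om * (inc k s t om)^2) = (t - s) * \<E> Y"
proof -
 have YM: "Y \<in> borel_measurable M" using measurable_filtration_M assms by blast
 have i: "integrable M Y"
  using assms(5) YM by (intro integrable_const_bound[where B=B]) auto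
 show "\<E> (\<lambda>om. Y om * inc k s t om) = 0"
  using expectation_mult_inc(2)[OF assms(1-4), of "\<lambda>x. x"] i inc_moments[OF assms(1-3)] by simp
 show "\<E> (\<lambda>om. Y om * (inc k s t om)^2) = (t - s) * \<E> Y"
  using expectation_mult_inc(2)[OF assms(1-4), of "\<lambda>x. x\<^sup>2"] i inc_moments[OF assms(1-3)] by simp
qed

lemma inc_independent_pair:
 assumes "k \<in> K" "l \<in> K" "k \<noteq> l" "0 \<le> a" "a < b" "0 \<le> c" "c < d"
 shows "integrable M (\<lambda>om. (inc k a b om * inc k c d om) * (inc l a b om * inc l c d om))"
  and "\<E> (\<lambda>om. (inc k a b om * inc k c d om) * (inc l a b om * inc l c d om))
   = \<E> (\<lambda>om. inc k a b om * inc k c d om) * \<E> (\<lambda>om. inc l a b om * inc l c d om)"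
proof -
 have "indep_vars (\<lambda>_. \<Pi>\<^sub>M t\<in>{0..}. borel) (\<lambda>k om. \<lambda>t\<in>{0..}. \<beta> k t om) {k, l}"
  using independent assms unfolding independent_brownian_motions_def
  by (auto intro: indep_vars_subset)
 from indep_vars_compose2[OF this, of "\<lambda>_ p. (p b - p a) * (p d - p c)" "\<lambda>_. borel"]
 have "indep_vars (\<lambda>_. borel) (\<lambda>k om. ((\<lambda>t\<in>{0..}. \<beta> k t om) b - (\<lambda>t\<in>{0..}. \<beta> k t om) a) *
    ((\<lambda>t\<in>{0..}. \<beta> k t om) d - (\<lambda>t\<in>{0..}. \<beta> k t om) c)) {k, l}"
  using assms by simp
 hence iv: "indep_vars (\<lambda>_. borel) (\<lambda>k om. inc k a b om * inc k c d om) {k, l}"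
  using assms by (simp add: inc_def)
 have sq: "integrable M (\<lambda>om. inc k a b om * inc k c d om)" if "k \<in> K" for k
 proof (rule Bochner_Integration.integrable_bound)
  show "integrable M (\<lambda>om. (inc k a b om)\<^sup>2 + (inc k c d om)^2)"
   using inc_moments that assms by simp
  show "(\<lambda>om. inc k a b om * inc k c d om) \<in> borel_measurable M"
   using that assms by (auto intro!: borel_measurable_times inc_measurable)
  have "\<bar>x * y\<bar> \<le> x^2 + y^2" for x y :: real
   using sum_squares_bound[of "\<bar>x\<bar>" "\<bar>y\<bar>"] mult_nonneg_nonneg[of "\<bar>x\<bar>" "\<bar>y\<bar>"]
   unfolding abs_mult power2_abs by linarith
  thus "AE om in M. norm (inc k a b om * inc k c d om) \<le> norm ((inc k a b om)^2 + (inc k c d om)^2)"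
   by (intro AE_I2) (simp add: abs_of_nonneg)
 qed
 show "integrable M (\<lambda>om. (inc k a b om * inc k c d om) * (inc l a b om * inc l c d om))"
  using indep_vars_integrable[OF _ iv] sq assms by auto
 show "\<E> (\<lambda>om. (inc k a b om * inc k c d om) * (inc l a b om * inc l c d om))
   = \<E> (\<lambda>om. inc k a b om * inc k c d om) * \<E> (\<lambda>om. inc l a b om * inc l c d om)"
  using indep_vars_lebesgue_integral[OF _ iv] sq assms by auto
qed

lemma inc_split:
 assumes "n > 0"
 shows "inc k s t om = (\<Sum>i<n. inc k (s + (t - s) * real i / real n) (s + (t - s) * real (Suc i) / real n) om)"
proof -
 have "(\<Sum>i<n. inc k (s + (t - s) * real i / real n) (s + (t - s) * real (Suc i) / real n) om)
   = \<beta> k (s + (t - s) * real n / real n) om - \<beta> k (s + (t - s) * real 0 / real n) om"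
  unfolding inc_def by (rule sum_lessThan_telescope)
 thus ?thesis using assms by (simp add: inc_def)
qed

text \<open>
 The \<open>\<beta> k\<close> are only assumed to be Brownian motions with respect to \<open>\<F>\<close> one at a time; that
 they are jointly so follows because the covariation of two independent ones vanishes along
 refining partitions.
\<close>

lemma expectation_mult_inc_inc:
 fixes Y :: "'w => real"
 assumes k: "k \<in> K" and l: "l \<in> K" and kl: "k \<noteq> l" and s: "0 \<le> s" "s < t"
  and Y: "Y \<in> borel_measurable (\<F> s)" and B: "\<And>om. om \<in> space M ==> \<bar>Y om\<bar> \<le> B"
 shows "integrable M (\<lambda>om. Y om * (inc k s t om * inc l s t om))"
  and "\<E> (\<lambda>om. Y om * (inc k s t om * inc l s t om)) = 0"
proof -
 have YM: "Y \<in> borel_measurable M" using measurable_filtration_M Y s by blast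
 have i2: "integrable M (\<lambda>om. inc k a b om * inc l c d om)"
  if "k \<in> K" "l \<in> K" "0 \<le> a" "a < b" "0 \<le> c" "c < d" for k l a b c d
 proof (rule Bochner_Integration.integrable_bound)
  show "integrable M (\<lambda>om. (inc k a b om)\<^sup>2 + (inc l c d om)^2)"
   using inc_moments that by simp
  show "(\<lambda>om. inc k a b om * inc l c d om) \<in> borel_measurable M"
   using that by (auto intro!: borel_measurable_times inc_measurable)
  have "\<bar>x * y\<bar> \<le> x^2 + y^2" for x y :: real
   using sum_squares_bound[of "\<bar>x\<bar>" "\<bar>y\<bar>"] mult_nonneg_nonneg[of "\<bar>x\<bar>" "\<bar>y\<bar>"]
   unfolding abs_mult power2_abs by linarith
  thus "AE om in M. norm (inc k a b om * inc l c d om) \<le> norm ((inc k a b om)^2 + (inc l c d om)^2)"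
   by (intro AE_I2) (simp add: abs_of_nonneg)
 qed
 show "integrable M (\<lambda>om. Y om * (inc k s t om * inc l s t om))"
  by (rule integrable_bounded_mult[OF YM B i2[OF k l s s]])
 have later: "\<E> (\<lambda>om. Y om * (inc k a b om * inc l c d om)) = 0"
  if "k \<in> K" "l \<in> K" "s \<le> a" "a < b" "b \<le> c" "c < d" for k l a b c d
 proof -
  have 1: "(\<lambda>om. Y om * inc k a b om) \<in> borel_measurable (\<F> c)"
   using that s by (intro borel_measurable_times measurable_filtration_mono[OF Y]
     measurable_filtration_mono[OF inc_adapted[of k a b]]) auto
  have 2: "integrable M (\<lambda>om. Y om * inc k a b om)"
   using that s by (intro integrable_bounded_mult[OF YM B] inc_moments) auto
  have "\<E> (\<lambda>om. (Y om * inc k a b om) * inc l c d om) = 0"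
   using expectation_mult_inc(2)[OF _ _ _ 1, of l d "\<lambda>x. x"] 2 that s inc_moments(1,2)[of l c d] by simp
  thus ?thesis by (simp add: mult.assoc)
 qed
 have bound: "(\<E> (\<lambda>om. Y om * (inc k s t om * inc l s t om)))^2 \<le> B^2 * ((t - s)^2 / n)"
  if n: "n > 0" for n :: nat
 proof -
  define u where "u i = s + (t - s) * real i / real n" for i
  define D where "D k i om = inc k (u i) (u (Suc i)) om" for k i om
  have uS: "u (Suc i) = u i + (t - s) / n" for i by (simp add: u_def add_divide_distrib distrib_left)
  have u0: "s \<le> u i" for i using s n by (simp add: u_def)
  have us: "u i < u (Suc i)" "0 \<le> u i" for i using s n u0[of i] by (auto simp: uS)
  have um: "i < j ==> u (Suc i) \<le> u j" for i j using s n
   by (auto simp: u_def intro!: divide_right_mono mult_left_mono)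
  have Dint: "integrable M (\<lambda>om. D k i om * D l j om)" if "k \<in> K" "l \<in> K" for i j k l
   unfolding D_def by (rule i2) (use that us in auto)
  have Dm: "D k i \<in> borel_measurable M" if "k \<in> K" for k i
   unfolding D_def by (rule inc_measurable) (use that us in auto)
  have split: "inc k s t om * inc l s t om = (\<Sum>i<n. \<Sum>j<n. D k i om * D l j om)" for om
   using inc_split[OF n, of k s t om] inc_split[OF n, of l s t om]
   by (simp add: D_def u_def sum_product)
  define Z where "Z om = (\<Sum>i<n. D k i om * D l i om)" for om
  have Zm: "Z \<in> borel_measurable M" unfolding Z_def[abs_def] using Dm k l by auto
  have off: "\<E> (\<lambda>om. Y om * (D k i om * D l j om)) = 0" if "i \<noteq> j" for i j
  proof (cases "i < j")
   case True thus ?thesis unfolding D_def by (intro later k l u0 us um)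
  next
   case False
   hence "j < i" using that by simp
   hence "\<E> (\<lambda>om. Y om * (D l j om * D k i om)) = 0" unfolding D_def by (intro later k l u0 us um)
   thus ?thesis by (simp add: mult.commute)
  qed
  have "\<E> (\<lambda>om. Y om * (inc k s t om * inc l s t om)) = (\<Sum>i<n. \<Sum>j<n. \<E> (\<lambda>om. Y om * (D k i om * D l j om)))"
   unfolding split sum_distrib_left
   by (subst Bochner_Integration.integral_sum, intro Bochner_Integration.integrable_sum integrable_bounded_mult[OF YM B] Dint k l,
     assumption, intro sum.cong refl Bochner_Integration.integral_sum integrable_bounded_mult[OF YM B] Dint k l)
  also have "\<dots> = (\<Sum>i<n. \<E> (\<lambda>om. Y om * (D k i om * D l i om)))"
  proof (intro sum.cong refl)
   fix i assume i: "i \<in> {..<n}"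
   have "(\<Sum>j<n. \<E> (\<lambda>om. Y om * (D k i om * D l j om))) =
    (\<Sum>j<n. if j = i then \<E> (\<lambda>om. Y om * (D k i om * D l i om)) else 0)"
    by (intro sum.cong refl) (use off in auto)
   thus "(\<Sum>j<n. \<E> (\<lambda>om. Y om * (D k i om * D l j om))) = \<E> (\<lambda>om. Y om * (D k i om * D l i om))"
    using i by simp
  qed
  also have "\<dots> = \<E> (\<lambda>om. Y om * Z om)"
   unfolding Z_def sum_distrib_left
   by (subst Bochner_Integration.integral_sum) (intro integrable_bounded_mult[OF YM B] Dint k l, auto)
  finally have e1: "\<E> (\<lambda>om. Y om * (inc k s t om * inc l s t om)) = \<E> (\<lambda>om. Y om * Z om)" .
  have Z2: "(Z om)^2 = (\<Sum>i<n. \<Sum>j<n. (D k i om * D k j om) * (D l i om * D l j om))" for om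
   by (simp add: Z_def power2_eq_square sum_product mult_ac)
  have Z2i: "integrable M (\<lambda>om. (D k i om * D k j om) * (D l i om * D l j om))" for i j
   unfolding D_def by (intro inc_independent_pair k l kl us)
  have DD: "\<E> (\<lambda>om. D k i om * D k j om) = (if i = j then (t - s) / n else 0)" if "k \<in> K" for k i j
  proof -
   have *: "\<E> (\<lambda>om. inc k a b om * inc k c d om) = 0" if "0 \<le> a" "a < b" "b \<le> c" "c < d" for a b c d
    using expectation_mult_inc(2)[OF \<open>k \<in> K\<close>, of c d "inc k a b" "\<lambda>x. x"] that inc_moments(1,2)[OF \<open>k \<in> K\<close>]
     measurable_filtration_mono[OF inc_adapted[OF \<open>k \<in> K\<close>, of a b], of c] by simp
   consider "i = j" | "i < j" | "j < i" by linarith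
   thus ?thesis
   proof cases
    case 1
    thus ?thesis using inc_moments(4)[OF that us(2,1), of i] by (simp add: D_def uS power2_eq_square)
   next
    case 2
    thus ?thesis unfolding D_def using *[OF us(2,1) um us(1), of i j] by simp
   next
    case 3
    thus ?thesis unfolding D_def using *[OF us(2,1) um us(1), of j i] by (simp add: mult.commute)
   qed
  qed
  have "\<E> (\<lambda>om. (Z om)\<^sup>2) = (\<Sum>i<n. \<Sum>j<n. \<E> (\<lambda>om. (D k i om * D k j om) * (D l i om * D l j om)))"
   unfolding Z2
   by (subst Bochner_Integration.integral_sum, intro Bochner_Integration.integrable_sum Z2i,
     intro sum.cong refl Bochner_Integration.integral_sum Z2i)
  also have "\<dots> = (\<Sum>i<n. \<Sum>j<n. \<E> (\<lambda>om. D k i om * D k j om) * \<E> (\<lambda>om. D l i om * D l j om))"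
   unfolding D_def by (intro sum.cong refl inc_independent_pair k l kl us)
  also have "\<dots> = (\<Sum>i<n. \<Sum>j<n. if i = j then ((t - s) / n)\<^sup>2 else 0)"
   by (intro sum.cong refl) (simp add: DD k l power2_eq_square)
  also have "\<dots> = (t - s)^2 / n" using n by (simp add: power2_eq_square)
  finally have EZ: "\<E> (\<lambda>om. (Z om)\<^sup>2) = (t - s)^2 / n" .
  have Z2int: "integrable M (\<lambda>om. (Z om)\<^sup>2)"
   unfolding Z2 by (intro Bochner_Integration.integrable_sum Z2i)
  have Zint: "integrable M Z"
   unfolding Z_def[abs_def] by (intro Bochner_Integration.integrable_sum Dint k l)
  have Y2: "(Y om)^2 \<le> B^2" if "om \<in> space M" for om
   using B[OF that] power_mono[of "\<bar>Y om\<bar>" B 2] by simp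
  have YZ2: "integrable M (\<lambda>om. (Y om * Z om)\<^sup>2)"
   unfolding power_mult_distrib
  proof (rule integrable_bounded_mult[OF _ _ Z2int])
   show "(\<lambda>om. (Y om)\<^sup>2) \<in> borel_measurable M" using YM by simp
   show "\<bar>(Y om)\<^sup>2\<bar> \<le> B^2" if "om \<in> space M" for om using Y2[OF that] by simp
  qed
  have YZ: "integrable M (\<lambda>om. Y om * Z om)" by (rule integrable_bounded_mult[OF YM B Zint])
  have "(\<E> (\<lambda>om. Y om * Z om))^2 \<le> \<E> (\<lambda>om. (Y om * Z om)\<^sup>2)"
   using variance_eq[OF YZ YZ2] variance_positive[of "\<lambda>om. Y om * Z om"] by linarith
  also have "\<dots> \<le> \<E> (\<lambda>om. B\<^sup>2 * (Z om)^2)"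
  proof (rule integral_mono[OF YZ2])
   show "integrable M (\<lambda>om. B\<^sup>2 * (Z om)^2)" using Z2int by simp
   fix om assume "om \<in> space M"
   hence "(Y om)^2 \<le> B^2" by (rule Y2)
   thus "(Y om * Z om)^2 \<le> B^2 * (Z om)^2" by (simp add: power_mult_distrib mult_right_mono)
  qed
  finally show ?thesis by (simp add: e1 EZ)
 qed
 have "(\<lambda>n. B\<^sup>2 * ((t - s)^2 / real n)) \<longlonglongrightarrow> B\<^sup>2 * 0"
  by (intro tendsto_mult tendsto_const lim_const_over_n)
 hence "(\<E> (\<lambda>om. Y om * (inc k s t om * inc l s t om)))^2 \<le> B^2 * 0"
  by (rule Lim_bounded2[where N=1]) (use bound in auto)
 thus "\<E> (\<lambda>om. Y om * (inc k s t om * inc l s t om)) = 0" by simp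
qed

end

lemma cos_taylor_bound: "\<bar>cos x - (1 - x^2 / 2)\<bar> \<le> x ^ 4 / 24" for x :: real
proof -
 have "\<bar>Re (iexp x - (\<Sum>k\<le>3. (\<i> * x) ^ k / fact k))\<bar> \<le> \<bar>x\<bar> ^ Suc 3 / fact (Suc 3)"
  by (rule order_trans[OF abs_Re_le_cmod iexp_approx1])
 moreover have "Re (iexp x - (\<Sum>k\<le>3. (\<i> * x) ^ k / fact k)) = cos x - (1 - x^2 / 2)"
  by (simp add: numeral_eq_Suc atMost_Suc power_mult_distrib Re_exp)
 moreover have "\<bar>x\<bar> ^ Suc 3 / fact (Suc 3) = x ^ 4 / 24"
  by (simp add: fact_numeral numeral_eq_Suc power_even_abs)
 ultimately show ?thesis by (simp add: fact_numeral)
qed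

lemma sin_taylor_bound: "\<bar>sin x - x\<bar> \<le> \<bar>x\<bar> ^ 3 / 6" for x :: real
proof -
 have "\<bar>Im (iexp x - (\<Sum>k\<le>2. (\<i> * x) ^ k / fact k))\<bar> \<le> \<bar>x\<bar> ^ Suc 2 / fact (Suc 2)"
  by (rule order_trans[OF abs_Im_le_cmod iexp_approx1])
 moreover have "Im (iexp x - (\<Sum>k\<le>2. (\<i> * x) ^ k / fact k)) = sin x - x"
  by (simp add: numeral_eq_Suc atMost_Suc power_mult_distrib Im_exp)
 moreover have "\<bar>x\<bar> ^ Suc 2 / fact (Suc 2) = \<bar>x\<bar> ^ 3 / 6"
  by (simp add: fact_numeral numeral_eq_Suc)
 ultimately show ?thesis by (simp add: fact_numeral)
qed

lemma small_combination:
 fixes a b e :: real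
 assumes "0 \<le> a" "0 \<le> b" "e \<le> b"
 shows "e / 24 + (a + b) / 12 \<le> a + b"
 using assms by (simp add: field_simps)

context brownian_family
begin

lemma expectation_cos_step:
 fixes \<theta> :: "nat => real" and Y Z :: "'w => real"
 assumes J: "finite J" "J \<subseteq> K" and s: "0 \<le> s" "s < t" and t1: "t - s \<le> 1"
  and Y: "Y \<in> borel_measurable (\<F> s)" and B: "\<And>om. om \<in> space M ==> \<bar>Y om\<bar> \<le> 1"
  and Z: "Z \<in> borel_measurable (\<F> s)"
 defines "\<Theta> \<equiv> \<Sum>k\<in>J. (\<theta> k)\<^sup>2"
 shows "\<bar>\<E> (\<lambda>om. Y om * cos (Z om + (\<Sum>k\<in>J. \<theta> k * inc k s t om)))
   - (1 - \<Theta> * (t - s) / 2) * \<E> (\<lambda>om. Y om * cos (Z om))\<bar>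
   \<le> (\<Theta> + 3 * \<Theta>^2 * (card J)^2) * ((t - s) * sqrt (t - s))"
proof -
 define d where "d = t - s"
 have d: "0 < d" "d \<le> 1" using s t1 by (auto simp: d_def)
 define \<delta> where "\<delta> om = (\<Sum>k\<in>J. \<theta> k * inc k s t om)" for om
 have kK: "k \<in> J ==> k \<in> K" for k using J by auto
 have YM: "Y \<in> borel_measurable M" and ZM: "Z \<in> borel_measurable M" using measurable_filtration_M Y Z s by auto
 have incM: "k \<in> J ==> inc k s t \<in> borel_measurable M" for k
  using inc_measurable[OF kK] s by auto
 have \<delta>M[measurable]: "\<delta> \<in> borel_measurable M"
  unfolding \<delta>_def[abs_def] using incM by auto
 have Th0: "\<Theta> \<ge> 0" unfolding \<Theta>_def by (simp add: sum_nonneg)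
 have d4: "(\<delta> om)^4 \<le> \<Theta>^2 * (card J) * (\<Sum>k\<in>J. (inc k s t om)^4)" for om
 proof -
  have "(\<delta> om)^2 \<le> \<Theta> * (\<Sum>k\<in>J. (inc k s t om)\<^sup>2)"
   unfolding \<delta>_def \<Theta>_def by (rule Cauchy_Schwarz_ineq_sum)
  hence "((\<delta> om)^2)^2 \<le> (\<Theta> * (\<Sum>k\<in>J. (inc k s t om)\<^sup>2))^2"
   by (intro power_mono) auto
  also have "\<dots> = \<Theta>^2 * (\<Sum>k\<in>J. 1 * (inc k s t om)^2)^2" by (simp add: power_mult_distrib)
  also have "\<dots> \<le> \<Theta>^2 * ((\<Sum>k\<in>J. 1\<^sup>2) * (\<Sum>k\<in>J. ((inc k s t om)^2)\<^sup>2))"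
   by (intro mult_left_mono Cauchy_Schwarz_ineq_sum) auto
  finally show ?thesis by (simp add: mult.assoc flip: power_mult)
 qed
 have i4: "integrable M (\<lambda>om. (\<delta> om)^4)"
 proof (rule Bochner_Integration.integrable_bound)
  show "integrable M (\<lambda>om. \<Theta>\<^sup>2 * (card J) * (\<Sum>k\<in>J. (inc k s t om)^4))"
   using inc_moments(5)[OF kK s] by (intro integrable_mult_right Bochner_Integration.integrable_sum) auto
  show "AE om in M. norm ((\<delta> om)^4) \<le> norm (\<Theta>^2 * (card J) * (\<Sum>k\<in>J. (inc k s t om)^4))"
   using d4 by (intro AE_I2) (simp add: sum_nonneg)
 qed simp
 have E4: "\<E> (\<lambda>om. (\<delta> om)^4) \<le> 3 * \<Theta>^2 * (card J)^2 * d^2"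
 proof -
  have "\<E> (\<lambda>om. (\<delta> om)^4) \<le> \<E> (\<lambda>om. \<Theta>\<^sup>2 * (card J) * (\<Sum>k\<in>J. (inc k s t om)^4))"
   using inc_moments(5)[OF kK s] d4
   by (intro integral_mono i4 integrable_mult_right Bochner_Integration.integrable_sum) auto
  also have "\<dots> = \<Theta>^2 * (card J) * (\<Sum>k\<in>J. \<E> (\<lambda>om. (inc k s t om)^4))"
   using inc_moments(5)[OF kK s] by (simp add: Bochner_Integration.integral_sum)
  also have "(\<Sum>k\<in>J. \<E> (\<lambda>om. (inc k s t om)^4)) = (\<Sum>k\<in>J. 3 * d^2)"
   using inc_moments(6)[OF kK s] by (simp add: d_def)
  finally show ?thesis by (simp add: power2_eq_square mult_ac)
 qed
 have i1: "integrable M \<delta>" unfolding \<delta>_def[abs_def] using inc_moments(1)[OF kK s] by auto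
 have dd: "(\<delta> om)^2 = (\<Sum>k\<in>J. \<Sum>l\<in>J. \<theta> k * \<theta> l * (inc k s t om * inc l s t om))" for om
  unfolding \<delta>_def power2_eq_square sum_product by (intro sum.cong refl) (simp add: mult_ac)
 have W1: "\<E> (\<lambda>om. W om * \<delta> om) = 0" and W1i: "integrable M (\<lambda>om. W om * \<delta> om)"
  and W2: "\<E> (\<lambda>om. W om * (\<delta> om)^2) = \<Theta> * d * \<E> W"
  and W2i: "integrable M (\<lambda>om. W om * (\<delta> om)^2)"
  if W: "W \<in> borel_measurable (\<F> s)" "\<And>om. om \<in> space M ==> \<bar>W om\<bar> \<le> 1" for W
 proof -
  have WM: "W \<in> borel_measurable M" using measurable_filtration_M W s by auto
  have a: "integrable M (\<lambda>om. W om * (\<theta> k * inc k s t om))" if "k \<in> J" for k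
   using inc_moments(1)[OF kK s] that by (intro integrable_bounded_mult[OF WM W(2)]) auto
  show "integrable M (\<lambda>om. W om * \<delta> om)" by (rule integrable_bounded_mult[OF WM W(2) i1])
  show "\<E> (\<lambda>om. W om * \<delta> om) = 0"
   unfolding \<delta>_def sum_distrib_left
  proof (subst Bochner_Integration.integral_sum)
   show "(\<Sum>k\<in>J. \<E> (\<lambda>om. W om * (\<theta> k * inc k s t om))) = 0"
   proof (intro sum.neutral ballI)
    fix k assume "k \<in> J"
    have "\<E> (\<lambda>om. W om * (\<theta> k * inc k s t om)) = \<theta> k * \<E> (\<lambda>om. W om * inc k s t om)"
     by (subst integral_mult_right_zero[symmetric]) (simp add: mult_ac)
    thus "\<E> (\<lambda>om. W om * (\<theta> k * inc k s t om)) = 0"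
     using expectation_bounded_mult_inc(1)[OF kK s W] \<open>k \<in> J\<close> by simp
   qed
  qed (rule a)
  have t: "integrable M (\<lambda>om. W om * (\<theta> k * \<theta> l * (inc k s t om * inc l s t om)))
    \<and> \<E> (\<lambda>om. W om * (\<theta> k * \<theta> l * (inc k s t om * inc l s t om))) = (if k = l then (\<theta> k)\<^sup>2 * d * \<E> W else 0)"
   if "k \<in> J" "l \<in> J" for k l
  proof -
   have e: "W om * (\<theta> k * \<theta> l * (inc k s t om * inc l s t om)) = \<theta> k * \<theta> l * (W om * (inc k s t om * inc l s t om))" for om
    by simp
   show ?thesis
   proof (cases "k = l")
    case True
    have "integrable M (\<lambda>om. W om * (inc k s t om)^2)"
     by (rule integrable_bounded_mult[OF WM W(2) inc_moments(3)[OF kK s]]) (use that in auto)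
    moreover have "\<E> (\<lambda>om. W om * (inc k s t om)^2) = d * \<E> W"
     using expectation_bounded_mult_inc(2)[OF kK s W] that by (simp add: d_def)
    ultimately show ?thesis
     unfolding e using True by (simp add: power2_eq_square)
   next
    case False
    thus ?thesis unfolding e using expectation_mult_inc_inc[OF kK kK False s W] that by simp
   qed
  qed
  show "integrable M (\<lambda>om. W om * (\<delta> om)^2)"
   unfolding dd sum_distrib_left using t by (intro Bochner_Integration.integrable_sum) auto
  have "\<E> (\<lambda>om. W om * (\<delta> om)^2) =
   (\<Sum>k\<in>J. \<Sum>l\<in>J. \<E> (\<lambda>om. W om * (\<theta> k * \<theta> l * (inc k s t om * inc l s t om))))"
   unfolding dd sum_distrib_left using t
   by (subst Bochner_Integration.integral_sum, intro Bochner_Integration.integrable_sum, simp,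
     intro sum.cong refl Bochner_Integration.integral_sum) auto
  also have "\<dots> = (\<Sum>k\<in>J. \<Sum>l\<in>J. if l = k then (\<theta> k)\<^sup>2 * d * \<E> W else 0)"
   using t by (intro sum.cong refl) auto
  also have "\<dots> = \<Theta> * d * \<E> W"
   using J by (simp add: \<Theta>_def sum_distrib_right)
  finally show "\<E> (\<lambda>om. W om * (\<delta> om)^2) = \<Theta> * d * \<E> W" .
 qed
 have one: "\<E> (\<lambda>om. (\<delta> om)\<^sup>2) = \<Theta> * d" "integrable M (\<lambda>om. (\<delta> om)\<^sup>2)"
  using W2[of "\<lambda>_. 1"] W2i[of "\<lambda>_. 1"] by (auto simp: prob_space)
 define C where "C om = Y om * cos (Z om)" for om
 define D where "D om = Y om * sin (Z om)" for om
 have CD: "C \<in> borel_measurable (\<F> s)" "D \<in> borel_measurable (\<F> s)"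
  unfolding C_def[abs_def] D_def[abs_def] using Y Z by auto
 have CD1: "\<bar>C om\<bar> \<le> 1" "\<bar>D om\<bar> \<le> 1" if "om \<in> space M" for om
  using B[OF that] by (auto simp: C_def D_def abs_mult intro!: mult_le_one)
 have CDM: "C \<in> borel_measurable M" "D \<in> borel_measurable M"
  unfolding C_def[abs_def] D_def[abs_def] using YM ZM by auto
 have Ci: "integrable M C"
  using CD1 CDM by (intro integrable_const_bound[where B=1]) auto
 define R where "R om = Y om * cos (Z om + \<delta> om) - (C om - C om * (\<delta> om)^2 / 2 - D om * \<delta> om)" for om
 have Rb: "\<bar>R om\<bar> \<le> (\<delta> om)^4 / 24 + ((\<delta> om)^2 * sqrt d + (\<delta> om)^4 / sqrt d) / 12" if "om \<in> space M" for om
 proof -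
  have "R om = C om * (cos (\<delta> om) - (1 - (\<delta> om)^2 / 2)) - D om * (sin (\<delta> om) - \<delta> om)"
   by (simp add: R_def C_def D_def cos_add algebra_simps)
  also have "\<bar>\<dots>\<bar> \<le> 1 * ((\<delta> om)^4 / 24) + 1 * (\<bar>\<delta> om\<bar> ^ 3 / 6)"
   using CD1[OF that] cos_taylor_bound[of "\<delta> om"] sin_taylor_bound[of "\<delta> om"]
   by (intro order_trans[OF abs_triangle_ineq4] add_mono; unfold abs_mult, intro mult_mono) auto
  also have "\<bar>\<delta> om\<bar> ^ 3 \<le> ((\<delta> om)^2 * sqrt d + (\<delta> om)^4 / sqrt d) / 2"
  proof -
   define r where "r = \<bar>\<delta> om\<bar>"
   define q where "q = sqrt d"
   have q: "q > 0" using d by (simp add: q_def)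
   have "0 \<le> r^2 * (q - r)^2 / q" using q by simp
   also have "\<dots> = r^2 * q + r^4 / q - 2 * r^3"
    using q by (simp add: field_simps power2_eq_square numeral_eq_Suc)
   finally have "r ^ 3 \<le> (r^2 * q + r^4 / q) / 2" by simp
   thus ?thesis by (simp add: r_def q_def power_even_abs)
  qed
  finally show ?thesis by simp
 qed
 have bi: "integrable M (\<lambda>om. (\<delta> om)^4 / 24 + ((\<delta> om)^2 * sqrt d + (\<delta> om)^4 / sqrt d) / 12)"
  using one i4 by (intro Bochner_Integration.integrable_add integrable_divide_zero integrable_mult_left) auto
 have YC: "integrable M (\<lambda>om. Y om * cos (Z om + \<delta> om))"
  using B YM ZM by (intro integrable_const_bound[where B=1]) (auto simp: abs_mult intro!: mult_le_one)
 have Ri: "integrable M R"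
  unfolding R_def[abs_def] using YC Ci W2i[OF CD(1) CD1(1)] W1i[OF CD(2) CD1(2)] by simp
 have "\<E> R = \<E> (\<lambda>om. Y om * cos (Z om + \<delta> om)) - (\<E> C - \<Theta> * d * \<E> C / 2 - 0)"
  unfolding R_def using YC Ci W2i[OF CD(1) CD1(1)] W1i[OF CD(2) CD1(2)] W1[OF CD(2) CD1(2)] W2[OF CD(1) CD1(1)] by simp
 hence "\<E> (\<lambda>om. Y om * cos (Z om + \<delta> om)) - (1 - \<Theta> * d / 2) * \<E> C = \<E> R"
  by (simp add: algebra_simps)
 moreover have "\<bar>\<E> R\<bar> \<le> (\<Theta> + 3 * \<Theta>^2 * (card J)^2) * (d * sqrt d)"
 proof -
  have "\<bar>\<E> R\<bar> \<le> \<E> (\<lambda>om. \<bar>R om\<bar>)" by simp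
  also have "\<dots> \<le> \<E> (\<lambda>om. (\<delta> om)^4 / 24 + ((\<delta> om)^2 * sqrt d + (\<delta> om)^4 / sqrt d) / 12)"
   using Ri Rb by (intro integral_mono bi) auto
  also have "\<dots> = \<E> (\<lambda>om. (\<delta> om)^4) / 24 + (\<Theta> * d * sqrt d + \<E> (\<lambda>om. (\<delta> om)^4) / sqrt d) / 12"
   using one i4 by simp
  also have "\<dots> \<le> (3 * \<Theta>^2 * (card J)^2 * d^2) / 24 + (\<Theta> * d * sqrt d + (3 * \<Theta>^2 * (card J)^2 * d^2) / sqrt d) / 12"
   using E4 d by (intro add_mono divide_right_mono) auto
  also have "\<dots> \<le> (\<Theta> + 3 * \<Theta>^2 * (card J)^2) * (d * sqrt d)"
  proof -
   define q where "q = sqrt d"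
   have q: "0 < q" "q \<le> 1" "d = q * q" using d by (auto simp: q_def)
   define c where "c = 3 * \<Theta>^2 * (card J)^2"
   have c: "c \<ge> 0" by (simp add: c_def)
   have e: "c * d^2 / q = c * (d * q)" using q by (simp add: power2_eq_square)
   have "c * d^2 = c * (d * q) * q" by (simp add: q(3) power2_eq_square)
   also have "\<dots> \<le> c * (d * q) * 1" using c q d by (intro mult_left_mono) auto
   finally have f: "c * d^2 \<le> c * (d * q)" by simp
   have "0 \<le> \<Theta> * (d * q)" "0 \<le> c * (d * q)" using Th0 q d c by auto
   hence "c * d^2 / 24 + (\<Theta> * d * q + c * d^2 / q) / 12 \<le> (\<Theta> + c) * (d * q)"
    using f unfolding e mult.assoc distrib_right by (intro small_combination)
   thus ?thesis unfolding c_def q_def .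
  qed
  finally show ?thesis .
 qed
 ultimately show ?thesis unfolding \<delta>_def C_def d_def by simp
qed

lemma expectation_cos_inc:
 fixes \<theta> :: "nat => real" and Y :: "'w => real"
 assumes J: "finite J" "J \<subseteq> K" and s: "0 \<le> s" "s < t"
  and Y: "Y \<in> borel_measurable (\<F> s)" and B: "\<And>om. om \<in> space M ==> \<bar>Y om\<bar> \<le> 1"
 shows "\<E> (\<lambda>om. Y om * cos ((\<Sum>k\<in>J. \<theta> k * inc k s t om) + \<alpha>))
   = exp (- (\<Sum>k\<in>J. (\<theta> k)\<^sup>2) * (t - s) / 2) * cos \<alpha> * \<E> Y"
proof -
 define \<Theta> where "\<Theta> = (\<Sum>k\<in>J. (\<theta> k)\<^sup>2)"
 define c where "c = \<Theta> + 3 * \<Theta>^2 * (card J)^2"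
 have Th0: "\<Theta> \<ge> 0" unfolding \<Theta>_def by (simp add: sum_nonneg)
 define L where "L = \<E> (\<lambda>om. Y om * cos ((\<Sum>k\<in>J. \<theta> k * inc k s t om) + \<alpha>))"
 have bound: "\<bar>L - (1 - \<Theta> * (t - s) / 2 / n) ^ n * (cos \<alpha> * \<E> Y)\<bar> \<le> c * ((t - s) * sqrt ((t - s) / n))"
  if n: "real n > (t - s) * (1 + \<Theta>)" "n > 0" for n :: nat
 proof -
  define u where "u i = s + (t - s) * real i / real n" for i
  define d where "d = (t - s) / n"
  have d0: "d > 0" using s n by (simp add: d_def)
  have "(t - s) * (1 + 0) \<le> (t - s) * (1 + \<Theta>)" using Th0 s by (intro mult_left_mono) auto
  hence d1: "d \<le> 1" using n by (simp add: d_def)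
  have "\<Theta> * (t - s) \<le> (t - s) * (1 + \<Theta>)" using s by (simp add: algebra_simps)
  hence "\<Theta> * d \<le> 1" using n by (simp add: d_def pos_divide_le_eq)
  hence q: "0 \<le> 1 - \<Theta> * d / 2" "1 - \<Theta> * d / 2 \<le> 1" using Th0 d0 by auto
  have uS: "u (Suc i) = u i + d" for i by (simp add: u_def d_def add_divide_distrib distrib_left)
  have us: "0 \<le> u i" "u i < u (Suc i)" "u (Suc i) - u i = d" "s \<le> u i" for i
   using s d0 n by (auto simp: uS) (auto simp: u_def)
  define g where "g i = \<E> (\<lambda>om. Y om * cos ((\<Sum>k\<in>J. \<theta> k * inc k s (u i) om) + \<alpha>))" for i
  have step: "\<bar>g (Suc i) - (1 - \<Theta> * d / 2) * g i\<bar> \<le> c * (d * sqrt d)" for i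
  proof -
   define Z where "Z om = (\<Sum>k\<in>J. \<theta> k * inc k s (u i) om) + \<alpha>" for om
   have Zm: "Z \<in> borel_measurable (\<F> (u i))"
    unfolding Z_def[abs_def] using J s us
    by (intro borel_measurable_add borel_measurable_sum borel_measurable_times borel_measurable_const inc_adapted) auto
   have *: "(\<Sum>k\<in>J. \<theta> k * inc k s (u (Suc i)) om) + \<alpha> = Z om + (\<Sum>k\<in>J. \<theta> k * inc k (u i) (u (Suc i)) om)" for om
    by (simp add: Z_def inc_def algebra_simps sum_subtractf sum.distrib)
   show ?thesis
    unfolding g_def * using expectation_cos_step[OF J us(1,2) _ measurable_filtration_mono[OF Y s(1) us(4)] B Zm, where \<theta>=\<theta>]
    using d1 us by (simp add: Z_def c_def \<Theta>_def)
  qed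
  have "\<bar>g i - (1 - \<Theta> * d / 2) ^ i * g 0\<bar> \<le> i * (c * (d * sqrt d))" for i
  proof (induction i)
   case (Suc i)
   have "\<bar>g (Suc i) - (1 - \<Theta> * d / 2) ^ Suc i * g 0\<bar>
    \<le> \<bar>g (Suc i) - (1 - \<Theta> * d / 2) * g i\<bar> + \<bar>(1 - \<Theta> * d / 2) * (g i - (1 - \<Theta> * d / 2) ^ i * g 0)\<bar>"
    by (simp add: algebra_simps)
   also have "\<bar>(1 - \<Theta> * d / 2) * (g i - (1 - \<Theta> * d / 2) ^ i * g 0)\<bar> \<le> 1 * (i * (c * (d * sqrt d)))"
    unfolding abs_mult using q Suc by (intro mult_mono) auto
   finally show ?case using step[of i] by (simp add: algebra_simps)
  qed simp
  from this[of n] have "\<bar>g n - (1 - \<Theta> * d / 2) ^ n * g 0\<bar> \<le> n * (c * (d * sqrt d))" .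
  moreover have "g n = L" using n by (simp add: g_def L_def u_def)
  moreover have "g 0 = cos \<alpha> * \<E> Y" by (simp add: g_def u_def inc_def)
  moreover have "n * (c * (d * sqrt d)) = c * ((t - s) * sqrt ((t - s) / n))"
   using n by (simp add: d_def)
  moreover have "\<Theta> * d / 2 = \<Theta> * (t - s) / 2 / n" by (simp add: d_def)
  ultimately show ?thesis by simp
 qed
 have 1: "(\<lambda>n. \<bar>L - (1 + (- (\<Theta> * (t - s) / 2)) / real n) ^ n * (cos \<alpha> * \<E> Y)\<bar>)
   \<longlonglongrightarrow> \<bar>L - exp (- (\<Theta> * (t - s) / 2)) * (cos \<alpha> * \<E> Y)\<bar>"
  by (intro tendsto_intros tendsto_exp_limit_sequentially)
 have 2: "(\<lambda>n. c * ((t - s) * sqrt ((t - s) / real n))) \<longlonglongrightarrow> c * ((t - s) * sqrt 0)"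
  by (intro tendsto_mult tendsto_const tendsto_real_sqrt lim_const_over_n)
 have ev: "eventually (\<lambda>n. real n > (t - s) * (1 + \<Theta>) \<and> n > 0) sequentially"
  using eventually_gt_at_top[of "nat \<lceil>(t - s) * (1 + \<Theta>)\<rceil>"] eventually_gt_at_top[of 0]
  by eventually_elim (auto, linarith)
 have "\<bar>L - exp (- (\<Theta> * (t - s) / 2)) * (cos \<alpha> * \<E> Y)\<bar> \<le> c * ((t - s) * sqrt 0)"
  using ev by (intro tendsto_le[OF _ 2 1] eventually_mono[OF ev]) (use bound in auto)
 thus ?thesis by (simp add: L_def \<Theta>_def mult_ac)
qed

end

context prob_space
begin

lemma standard_normal_from_cos:
 fixes W y :: "'a => real"
 assumes [measurable]: "W \<in> borel_measurable M" "y \<in> borel_measurable M"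
  and W: "\<And>om. om \<in> space M ==> 0 \<le> W om" "integrable M W"
  and E: "\<And>\<tau> \<alpha>. \<E> (\<lambda>om. W om * cos (\<tau> * y om + \<alpha>)) = exp (- \<tau>\<^sup>2 / 2) * cos \<alpha> * \<E> W"
  and C[measurable]: "C \<in> sets borel"
 shows "\<E> (\<lambda>om. W om * indicator C (y om)) = \<E> W * measure gauss C"
proof (cases "\<E> W = 0")
 case True
 hence "AE om in M. W om = 0"
  using W integral_nonneg_eq_0_iff_AE[of M W] by (auto intro: AE_I2)
 hence "\<E> (\<lambda>om. W om * indicator C (y om)) = \<E> (\<lambda>om. 0)"
  by (intro integral_cong_AE) auto
 thus ?thesis using True by simp
next
 case False
 define m where "m = \<E> W"
 have m: "m > 0" using False W(1) integral_nonneg_AE[of W M] unfolding m_def by (simp add: order_less_le)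
 define D where "D = density M (\<lambda>om. ennreal (W om / m))"
 have "emeasure D (space D) = (\<integral>\<^sup>+om. ennreal (W om / m) \<partial>M)"
  unfolding D_def by (simp add: emeasure_density cong: nn_integral_cong)
 also have "\<dots> = ennreal (\<E> (\<lambda>om. W om / m))"
  using W m by (intro nn_integral_eq_integral) auto
 also have "\<dots> = 1" using m by (simp add: m_def)
 finally interpret D: prob_space D by (rule prob_spaceI)
 have [measurable]: "y \<in> borel_measurable D" by (simp add: D_def)
 define \<mu> where "\<mu> = distr D borel y"
 have I: "(LINT x|\<mu>. f x) = \<E> (\<lambda>om. (W om / m) *\<^sub>R f (y om))" if [measurable]: "f \<in> borel_measurable borel"
  for f :: "real => 'z::{banach,second_countable_topology}"
  unfolding \<mu>_def using W m
  by (subst integral_distr) (auto simp: D_def intro!: integral_density AE_I2)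
 have int: "integrable M (\<lambda>om. W om / m * h (y om))" if [measurable]: "h \<in> borel_measurable borel" and h: "\<And>x. \<bar>h x\<bar> \<le> 1" for h :: "real => real"
 proof (rule Bochner_Integration.integrable_bound)
  show "integrable M (\<lambda>om. W om / m)" using W by simp
  show "AE om in M. norm (W om / m * h (y om)) \<le> norm (W om / m)"
   using W(1) m by (intro AE_I2) (auto simp: abs_mult h intro!: divide_right_mono mult_left_le)
 qed simp
 have Ec: "\<E> (\<lambda>om. W om / m * cos (\<tau> * y om)) = exp (- \<tau>\<^sup>2 / 2)" for \<tau>
  using E[of \<tau> 0] m by (simp add: m_def)
 have Es: "\<E> (\<lambda>om. W om / m * sin (\<tau> * y om)) = 0" for \<tau>
  using E[of \<tau> "- pi / 2"] m by (simp add: cos_diff)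
 have "char \<mu> \<tau> = char gauss \<tau>" for \<tau>
 proof -
  have ch: "char \<mu> \<tau> = \<E> (\<lambda>om. complex_of_real (W om / m * cos (\<tau> * y om)) + \<i> * complex_of_real (W om / m * sin (\<tau> * y om)))"
   unfolding char_def
   by (subst I, measurable, intro Bochner_Integration.integral_cong refl) (simp add: complex_eq_iff scaleR_conv_of_real Re_exp Im_exp)
  have i1: "integrable M (\<lambda>om. complex_of_real (W om / m * cos (\<tau> * y om)))"
   by (intro integrable_of_real int) auto
  have i2: "integrable M (\<lambda>om. \<i> * complex_of_real (W om / m * sin (\<tau> * y om)))"
   by (intro integrable_mult_right integrable_of_real int) auto
  show ?thesis
   unfolding ch Bochner_Integration.integral_add[OF i1 i2] integral_mult_right_zero
   by (simp only: integral_complex_of_real Ec Es char_std_normal_distribution) simp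
 qed
 hence "\<mu> = gauss"
  by (intro Levy_uniqueness) (auto simp: \<mu>_def real_distribution_def real_distribution_axioms_def D.prob_space_distr prob_space_normal_density intro!: ext)
 moreover have "measure \<mu> C = \<E> (\<lambda>om. (W om / m) *\<^sub>R indicator C (y om))"
  using I[of "indicator C :: real => real"] by (simp add: \<mu>_def)
 ultimately have "measure gauss C = \<E> (\<lambda>om. W om * indicator C (y om)) / m"
  by (simp add: mult.commute)
 thus ?thesis using m by (simp add: m_def field_simps)
qed

text \<open>
 A multidimensional instance of the uniqueness theorem for characteristic functions: the
 coordinates are split off one at a time, the cosine of the remaining ones being turned into
 the nonnegative weight \<open>1 + cos\<close> so that the one-dimensional theorem applies.
\<close>

lemma standard_normal_vector_from_cos:
 fixes W :: "'a => real" and y :: "nat => 'a => real"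
 assumes "finite J" and "W \<in> borel_measurable M" and "\<And>k. k \<in> J ==> y k \<in> borel_measurable M"
  and "\<And>om. om \<in> space M ==> 0 \<le> W om" "\<And>om. om \<in> space M ==> W om \<le> 1"
  and "\<And>\<theta> \<alpha>. \<E> (\<lambda>om. W om * cos ((\<Sum>k\<in>J. \<theta> k * y k om) + \<alpha>)) = exp (- (\<Sum>k\<in>J. (\<theta> k)\<^sup>2) / 2) * cos \<alpha> * \<E> W"
  and "\<And>k. k \<in> J ==> C k \<in> sets borel"
 shows "\<E> (\<lambda>om. W om * (\<Prod>k\<in>J. indicator (C k) (y k om))) = \<E> W * (\<Prod>k\<in>J. measure gauss (C k))"
 using assms
proof (induction J arbitrary: W rule: finite_induct)
 case (insert j J W)
 note [measurable] = insert.prems(1)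
 have [measurable]: "y j \<in> borel_measurable M" "C j \<in> sets borel" using insert.prems by auto
 have ym[measurable]: "(\<lambda>om. \<Sum>k\<in>J. \<theta> k * y k om) \<in> borel_measurable M" for \<theta>
  using insert.prems by auto
 note W = insert.prems(3,4)
 have Wi: "integrable M W" using W by (intro integrable_const_bound[where B=1]) auto
 have Wci: "integrable M (\<lambda>om. W om * cos (f om))" if [measurable]: "f \<in> borel_measurable M" for f
  using W by (intro integrable_const_bound[where B=1]) (auto simp: abs_mult intro!: mult_le_one)
 have E: "\<E> (\<lambda>om. W om * cos (\<tau> * y j om + (\<Sum>k\<in>J. \<theta> k * y k om) + \<alpha>))
  = exp (- \<tau>\<^sup>2 / 2) * exp (- (\<Sum>k\<in>J. (\<theta> k)\<^sup>2) / 2) * cos \<alpha> * \<E> W" for \<theta> \<tau> \<alpha>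
 proof -
  have 1: "(\<Sum>k\<in>J. (if k = j then \<tau> else \<theta> k) * y k om) = (\<Sum>k\<in>J. \<theta> k * y k om)" for om
   using insert.hyps by (intro sum.cong) auto
  have 2: "(\<Sum>k\<in>J. (if k = j then \<tau> else \<theta> k)\<^sup>2) = (\<Sum>k\<in>J. (\<theta> k)\<^sup>2)"
   using insert.hyps by (intro sum.cong) auto
  show ?thesis
   using insert.prems(5)[of "\<lambda>k. if k = j then \<tau> else \<theta> k" \<alpha>] insert.hyps
   by (simp add: 1 2 exp_add[symmetric] add_divide_distrib diff_divide_distrib)
 qed
 define N where "N = measure gauss (C j)"
 have E1: "\<E> (\<lambda>om. W om * indicator (C j) (y j om)) = \<E> W * N"
  unfolding N_def by (rule standard_normal_from_cos[OF _ _ W(1) Wi]) (use E[of _ "\<lambda>_. 0"] in auto)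
 have E2: "\<E> (\<lambda>om. W om * indicator (C j) (y j om) * cos ((\<Sum>k\<in>J. \<theta> k * y k om) + \<alpha>))
   = exp (- (\<Sum>k\<in>J. (\<theta> k)\<^sup>2) / 2) * cos \<alpha> * \<E> (\<lambda>om. W om * indicator (C j) (y j om))" for \<theta> \<alpha>
 proof -
  define S where "S om = (\<Sum>k\<in>J. \<theta> k * y k om)" for om
  have [measurable]: "S \<in> borel_measurable M" unfolding S_def[abs_def] by simp
  define q where "q = exp (- (\<Sum>k\<in>J. (\<theta> k)\<^sup>2) / 2)"
  have S0: "\<E> (\<lambda>om. W om * cos (S om + \<alpha>)) = q * cos \<alpha> * \<E> W" for \<alpha>
   using E[of 0 \<theta> \<alpha>] by (simp add: S_def q_def)
  define V where "V om = W om + W om * cos (S om + \<alpha>)" for om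
  have EV: "\<E> V = \<E> W + q * cos \<alpha> * \<E> W"
   unfolding V_def using S0 Wi Wci by simp
  have V0: "0 \<le> V om" if "om \<in> space M" for om
  proof -
   have "0 \<le> W om * (1 + cos (S om + \<alpha>))"
    using W(1)[OF that] cos_ge_minus_one[of "S om + \<alpha>"] by (intro mult_nonneg_nonneg) linarith+
   thus ?thesis by (simp add: V_def algebra_simps)
  qed
  have prod: "V om * cos (\<tau> * y j om + \<gamma>) = W om * cos (\<tau> * y j om + \<gamma>)
    + (W om * cos (\<tau> * y j om + S om + (\<alpha> + \<gamma>)) + W om * cos ((-\<tau>) * y j om + S om + (\<alpha> - \<gamma>))) / 2" for \<tau> \<gamma> om
  proof -
   have "cos (S om + \<alpha>) * cos (\<tau> * y j om + \<gamma>) = (cos (\<tau> * y j om + S om + (\<alpha> + \<gamma>)) + cos ((-\<tau>) * y j om + S om + (\<alpha> - \<gamma>))) / 2"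
    unfolding cos_times_cos by (simp add: algebra_simps)
   thus ?thesis unfolding V_def by (simp add: algebra_simps add_divide_distrib)
  qed
  have EVc: "\<E> (\<lambda>om. V om * cos (\<tau> * y j om + \<gamma>)) = exp (- \<tau>\<^sup>2 / 2) * cos \<gamma> * \<E> V" for \<tau> \<gamma>
  proof -
   have c1: "\<E> (\<lambda>om. W om * cos (\<tau> * y j om + \<gamma>)) = exp (- \<tau>\<^sup>2 / 2) * cos \<gamma> * \<E> W"
    using E[of \<tau> "\<lambda>_. 0" \<gamma>] by simp
   have c2: "\<E> (\<lambda>om. W om * cos (\<tau> * y j om + S om + (\<alpha> + \<gamma>))) = exp (- \<tau>\<^sup>2 / 2) * q * cos (\<alpha> + \<gamma>) * \<E> W"
    using E[of \<tau> \<theta> "\<alpha> + \<gamma>"] by (simp add: S_def q_def)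
   have c3: "\<E> (\<lambda>om. W om * cos ((-\<tau>) * y j om + S om + (\<alpha> - \<gamma>))) = exp (- \<tau>\<^sup>2 / 2) * q * cos (\<alpha> - \<gamma>) * \<E> W"
    using E[of "-\<tau>" \<theta> "\<alpha> - \<gamma>"] by (simp add: S_def q_def)
   have "\<E> (\<lambda>om. V om * cos (\<tau> * y j om + \<gamma>)) = \<E> (\<lambda>om. W om * cos (\<tau> * y j om + \<gamma>))
    + (\<E> (\<lambda>om. W om * cos (\<tau> * y j om + S om + (\<alpha> + \<gamma>))) + \<E> (\<lambda>om. W om * cos ((-\<tau>) * y j om + S om + (\<alpha> - \<gamma>)))) / 2"
    unfolding prod
    by (subst Bochner_Integration.integral_add, intro Wci, measurable, intro integrable_divide_zero Bochner_Integration.integrable_add Wci, measurable,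
      subst integral_divide_zero, subst Bochner_Integration.integral_add, intro Wci, measurable, intro Wci, measurable)
   thus ?thesis unfolding c1 c2 c3 EV by (simp add: cos_add cos_diff algebra_simps add_divide_distrib)
  qed
  have Vi: "integrable M V" unfolding V_def[abs_def] using Wi Wci by auto
  have Vm[measurable]: "V \<in> borel_measurable M" unfolding V_def[abs_def] by simp
  have EVC: "\<E> (\<lambda>om. V om * indicator (C j) (y j om)) = \<E> V * N"
   unfolding N_def by (rule standard_normal_from_cos[OF _ _ V0 Vi EVc]) auto
  have i1: "integrable M (\<lambda>om. W om * indicator (C j) (y j om))"
   using W by (intro integrable_const_bound[where B=1]) (auto simp: abs_mult indicator_def)
  have i2: "integrable M (\<lambda>om. W om * indicator (C j) (y j om) * cos (S om + \<alpha>))"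
   using W by (intro integrable_const_bound[where B=1]) (auto simp: abs_mult indicator_def intro!: mult_le_one)
  have "\<E> (\<lambda>om. V om * indicator (C j) (y j om)) =
    \<E> (\<lambda>om. W om * indicator (C j) (y j om)) + \<E> (\<lambda>om. W om * indicator (C j) (y j om) * cos (S om + \<alpha>))"
   using Bochner_Integration.integral_add[OF i1 i2] by (simp add: V_def algebra_simps)
  thus ?thesis using EVC E1 unfolding EV by (simp add: S_def q_def algebra_simps)
 qed
 have "\<E> (\<lambda>om. W om * indicator (C j) (y j om) * (\<Prod>k\<in>J. indicator (C k) (y k om)))
  = \<E> (\<lambda>om. W om * indicator (C j) (y j om)) * (\<Prod>k\<in>J. measure gauss (C k))"
  using insert.prems by (intro insert.IH E2) (auto simp: indicator_def)
 thus ?case using insert.hyps E1 by (simp add: N_def mult_ac)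
qed simp

end

context brownian_family
begin

definition ninc :: "nat => real => real => 'w => real" where
 "ninc k s t om = inc k s t om / sqrt (t - s)"

lemma ninc_measurable: "k \<in> K ==> 0 \<le> s ==> 0 \<le> t ==> ninc k s t \<in> borel_measurable M"
 unfolding ninc_def[abs_def] by (intro borel_measurable_divide inc_measurable) auto

lemma prob_inter_ninc:
 assumes J: "finite J" "J \<subseteq> K" and s: "0 \<le> s" "s < t" and A: "A \<in> sets (\<F> s)"
  and C: "\<And>k. k \<in> J ==> C k \<in> sets borel"
 shows "prob (A \<inter> {om\<in>space M. \<forall>k\<in>J. ninc k s t om \<in> C k}) = prob A * (\<Prod>k\<in>J. measure gauss (C k))"
proof -
 have AM: "A \<in> sets M" using sets_filtration_M A s by auto
 have "\<E> (\<lambda>om. indicator A om * (\<Prod>k\<in>J. indicator (C k) (ninc k s t om)))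
  = \<E> (indicat_real A) * (\<Prod>k\<in>J. measure gauss (C k))"
 proof (rule standard_normal_vector_from_cos)
  fix \<theta> \<alpha>
  have "(\<Sum>k\<in>J. \<theta> k * ninc k s t om) = (\<Sum>k\<in>J. (\<theta> k / sqrt (t - s)) * inc k s t om)" for om
   by (simp add: ninc_def)
  moreover have "(\<Sum>k\<in>J. (\<theta> k / sqrt (t - s))\<^sup>2) = (\<Sum>k\<in>J. (\<theta> k)\<^sup>2) / (t - s)"
   using s by (simp add: power_divide sum_divide_distrib)
  ultimately show "\<E> (\<lambda>om. indicator A om * cos ((\<Sum>k\<in>J. \<theta> k * ninc k s t om) + \<alpha>))
    = exp (- (\<Sum>k\<in>J. (\<theta> k)\<^sup>2) / 2) * cos \<alpha> * \<E> (indicator A)"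
   using expectation_cos_inc[OF J s, of "indicator A" "\<lambda>k. \<theta> k / sqrt (t - s)" \<alpha>] A s by (simp add: indicator_def)
 qed (use J s C AM in \<open>auto simp: indicator_def intro!: ninc_measurable\<close>)
 moreover have "\<E> (\<lambda>om. indicator A om * (\<Prod>k\<in>J. indicator (C k) (ninc k s t om)))
   = \<E> (indicat_real (A \<inter> {om\<in>space M. \<forall>k\<in>J. ninc k s t om \<in> C k}))"
 proof (rule Bochner_Integration.integral_cong[OF refl])
  fix om assume "om \<in> space M"
  show "indicator A om * (\<Prod>k\<in>J. indicator (C k) (ninc k s t om))
   = (indicator (A \<inter> {om\<in>space M. \<forall>k\<in>J. ninc k s t om \<in> C k}) om :: real)"
  proof (cases "\<forall>k\<in>J. ninc k s t om \<in> C k")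
   case True
   thus ?thesis using \<open>om \<in> space M\<close> by (auto simp: indicator_def)
  next
   case False
   hence "\<exists>k\<in>J. indicator (C k) (ninc k s t om) = (0 :: real)" by (auto simp: indicator_def)
   hence "(\<Prod>k\<in>J. indicator (C k) (ninc k s t om)) = (0 :: real)" by (rule prod_zero[OF J(1)])
   thus ?thesis using False by (simp add: indicator_def)
  qed
 qed
 moreover have "A \<inter> {om\<in>space M. \<forall>k\<in>J. ninc k s t om \<in> C k} \<in> sets M"
 proof -
  have "{om\<in>space M. \<forall>k\<in>J. ninc k s t om \<in> C k} \<in> sets M"
  proof (rule sets.sets_Collect_finite_All[OF _ J(1)])
   fix k assume "k \<in> J"
   thus "{om \<in> space M. ninc k s t om \<in> C k} \<in> events"
    using measurable_sets[OF ninc_measurable[of k s t] C[of k]] J s by (auto simp: vimage_def Int_def conj_commute)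
  qed
  thus ?thesis using AM by auto
 qed
 ultimately show ?thesis using AM by simp
qed

lemma nn_integral_filtration_ninc:
 assumes J: "finite J" "J \<subseteq> K" and s: "0 \<le> s" "s < t"
  and f: "(\<lambda>(om, y). f om y) \<in> borel_measurable (\<F> s \<Otimes>\<^sub>M (\<Pi>\<^sub>M k\<in>J. borel))"
 shows "(\<integral>\<^sup>+om. f om (\<lambda>k\<in>J. ninc k s t om) \<partial>M) = (\<integral>\<^sup>+om. (\<integral>\<^sup>+y. f om y \<partial>(\<Pi>\<^sub>M k\<in>J. gauss)) \<partial>M)"
proof -
 let ?Y = "\<lambda>om. \<lambda>k\<in>J. ninc k s t om" and ?P = "\<Pi>\<^sub>M k\<in>J. gauss"
 interpret N: prob_space gauss by (rule prob_space_normal_density) simp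
 interpret P: product_prob_space "\<lambda>_. gauss" J by unfold_locales
 have setsP: "sets ?P = sets (\<Pi>\<^sub>M k\<in>J. borel)" by (intro sets_PiM_cong) auto
 have Ym[measurable]: "?Y \<in> measurable M (\<Pi>\<^sub>M k\<in>J. borel)"
  using J s by (intro measurable_restrict ninc_measurable) auto
 have idm[measurable]: "(\<lambda>om. om) \<in> measurable M (\<F> s)"
  using subalg[OF s(1)] measurable_from_subalg[OF subalg[OF s(1)] measurable_ident] by (simp add: id_def)
 let ?M1 = "distr M (\<F> s) (\<lambda>om. om)"
 interpret M1: prob_space ?M1 by (rule prob_space_distr[OF idm])
 have key: "emeasure ?M1 A * emeasure ?P B = emeasure M (A \<inter> ?Y -` B \<inter> space M)"
  if A: "A \<in> sets (\<F> s)" and B: "B \<in> sets ?P" for A B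
 proof -
  have AM[measurable]: "A \<in> sets M" using sets_filtration_M A s by auto
  have As: "A \<subseteq> space M" using sets.sets_into_space[OF AM] .
  have e1: "emeasure ?M1 A = emeasure M A"
   using A idm As by (simp add: emeasure_distr Int_absorb2)
  have B'[measurable]: "B \<in> sets (\<Pi>\<^sub>M k\<in>J. borel)" using B setsP by auto
  show ?thesis
  proof (cases "emeasure M A = 0")
   case True
   hence "emeasure M (A \<inter> ?Y -` B \<inter> space M) = 0"
    using emeasure_mono[of "A \<inter> ?Y -` B \<inter> space M" A M] by auto
   thus ?thesis using True e1 by simp
  next
   case False
   define p where "p = emeasure M A"
   have p: "p \<noteq> 0" "p \<noteq> \<infinity>" using False by (auto simp: p_def)
   define Q where "Q = distr (density M (\<lambda>om. indicator A om / p)) (\<Pi>\<^sub>M k\<in>J. borel) ?Y"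
   have Q: "emeasure Q C = emeasure M (A \<inter> ?Y -` C \<inter> space M) / p" if [measurable]: "C \<in> sets (\<Pi>\<^sub>M k\<in>J. borel)" for C
   proof -
    have [measurable]: "?Y -` C \<inter> space M \<in> sets M" by measurable
    have "emeasure Q C = (\<integral>\<^sup>+om. indicator A om / p * indicator (?Y -` C \<inter> space M) om \<partial>M)"
     unfolding Q_def by (subst emeasure_distr) (auto simp: emeasure_density)
    also have "\<dots> = (\<integral>\<^sup>+om. indicator (A \<inter> (?Y -` C \<inter> space M)) om / p \<partial>M)"
     by (intro nn_integral_cong) (auto simp: indicator_def)
    also have "\<dots> = emeasure M (A \<inter> (?Y -` C \<inter> space M)) / p"
     by (simp add: nn_integral_divide)
    finally show ?thesis by (simp add: Int_assoc)
   qed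
   have "Q = ?P"
   proof (rule P.PiM_eqI)
    show "finite J" by (rule J)
    show "sets Q = sets ?P" unfolding setsP by (simp add: Q_def)
    fix C assume C: "\<And>i. i \<in> J ==> C i \<in> sets gauss"
    hence Cb: "\<And>i. i \<in> J ==> C i \<in> sets borel" by simp
    have m: "Pi\<^sub>E J C \<in> sets (\<Pi>\<^sub>M k\<in>J. borel)" using Cb J by (intro sets_PiM_I_finite) auto
    have eq: "A \<inter> ?Y -` (Pi\<^sub>E J C) \<inter> space M = A \<inter> {om\<in>space M. \<forall>k\<in>J. ninc k s t om \<in> C k}"
     using As by (auto simp: PiE_iff)
    have pr: "prob (A \<inter> {om\<in>space M. \<forall>k\<in>J. ninc k s t om \<in> C k}) = prob A * (\<Prod>k\<in>J. measure gauss (C k))"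
     by (rule prob_inter_ninc[OF J s A Cb])
    have "emeasure Q (Pi\<^sub>E J C) = ennreal (prob A * (\<Prod>k\<in>J. measure gauss (C k))) / p"
     unfolding Q[OF m] eq emeasure_eq_measure using pr by simp
    also have "\<dots> = p * ennreal (\<Prod>k\<in>J. measure gauss (C k)) / p"
     by (simp add: ennreal_mult p_def emeasure_eq_measure prod_nonneg)
    also have "\<dots> = ennreal (\<Prod>k\<in>J. measure gauss (C k))"
     using p by (simp add: ennreal_mult_divide_eq mult.commute[of p])
    also have "\<dots> = (\<Prod>k\<in>J. emeasure gauss (C k))"
     by (simp add: N.emeasure_eq_measure prod_ennreal)
    finally show "emeasure Q (Pi\<^sub>E J C) = (\<Prod>i\<in>J. emeasure gauss (C i))" .
   qed
   hence "emeasure ?P B = emeasure M (A \<inter> ?Y -` B \<inter> space M) / p" using Q[OF B'] by simp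
   thus ?thesis using p by (simp add: e1 p_def[symmetric] ennreal_divide_times ennreal_times_divide mult.commute[of p] ennreal_mult_divide_eq)
  qed
 qed
 have eq: "?M1 \<Otimes>\<^sub>M ?P = distr M (\<F> s \<Otimes>\<^sub>M (\<Pi>\<^sub>M k\<in>J. borel)) (\<lambda>om. (om, ?Y om))"
 proof (rule pair_measure_eqI)
  show "sigma_finite_measure ?M1" by unfold_locales
  show "sigma_finite_measure ?P" by unfold_locales
  show "sets (?M1 \<Otimes>\<^sub>M ?P) = sets (distr M (\<F> s \<Otimes>\<^sub>M (\<Pi>\<^sub>M k\<in>J. borel)) (\<lambda>om. (om, ?Y om)))"
   using setsP by (simp cong: sets_pair_measure_cong)
  fix A B assume A: "A \<in> sets ?M1" and B: "B \<in> sets ?P"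
  have "A \<times> B \<in> sets (\<F> s \<Otimes>\<^sub>M (\<Pi>\<^sub>M k\<in>J. borel))" using A B setsP by auto
  hence "emeasure (distr M (\<F> s \<Otimes>\<^sub>M (\<Pi>\<^sub>M k\<in>J. borel)) (\<lambda>om. (om, ?Y om))) (A \<times> B) = emeasure M ((\<lambda>om. (om, ?Y om)) -` (A \<times> B) \<inter> space M)"
   by (subst emeasure_distr) auto
  also have "(\<lambda>om. (om, ?Y om)) -` (A \<times> B) \<inter> space M = A \<inter> ?Y -` B \<inter> space M" by auto
  finally have eq: "emeasure (distr M (\<F> s \<Otimes>\<^sub>M (\<Pi>\<^sub>M k\<in>J. borel)) (\<lambda>om. (om, ?Y om))) (A \<times> B) = emeasure M (A \<inter> ?Y -` B \<inter> space M)" .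
  show "emeasure ?M1 A * emeasure ?P B = emeasure (distr M (\<F> s \<Otimes>\<^sub>M (\<Pi>\<^sub>M k\<in>J. borel)) (\<lambda>om. (om, ?Y om))) (A \<times> B)"
   unfolding eq by (rule key[OF _ B]) (use A in simp)
 qed
 have fP: "(\<lambda>(om, y). f om y) \<in> borel_measurable (?M1 \<Otimes>\<^sub>M ?P)"
  using f setsP by (simp cong: measurable_cong_sets sets_pair_measure_cong)
 have "(\<integral>\<^sup>+om. f om (?Y om) \<partial>M) = (\<integral>\<^sup>+z. (case z of (om, y) => f om y) \<partial>(?M1 \<Otimes>\<^sub>M ?P))"
  unfolding eq by (subst nn_integral_distr) (use f in auto)
 also have "\<dots> = (\<integral>\<^sup>+om. (\<integral>\<^sup>+y. f om y \<partial>?P) \<partial>?M1)"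
  using P.P.nn_integral_fst[OF fP] by simp
 also have "\<dots> = (\<integral>\<^sup>+om. (\<integral>\<^sup>+y. f om y \<partial>?P) \<partial>M)"
  using P.P.borel_measurable_nn_integral_fst[OF fP] by (subst nn_integral_distr) auto
 finally show ?thesis .
qed

end

section \<open>Square integrable controls\<close>

definition cost :: "(real => 'u::{real_normed_vector, second_countable_topology}) => real" where
 "cost \<phi> = (LINT s|lebesgue_on {0..1}. (norm (\<phi> s))\<^sup>2)"

lemma L2_measurable: "\<phi> \<in> L2 ==> \<phi> \<in> borel_measurable (lebesgue_on {0..1})"
 and L2_integrable: "\<phi> \<in> L2 ==> integrable (lebesgue_on {0..1}) (\<lambda>s. (norm (\<phi> s))\<^sup>2)"
 by (auto simp: L2_unit_interval_def)

lemma cost_nonneg: "0 \<le> cost \<phi>"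
 by (simp add: cost_def)

lemma finite_lebesgue_unit: "finite_measure (lebesgue_on {0..1::real})"
 by (rule finite_measure_lebesgue_on) (simp add: lmeasurable_cbox[of 0 "1::real", simplified])

lemma const_integrable_unit: "integrable (lebesgue_on {0..1::real}) (\<lambda>_. c :: 'b::{banach, second_countable_topology})"
 using finite_measure.integrable_const[OF finite_lebesgue_unit] .

lemma L2_norm_integrable:
 assumes "\<phi> \<in> L2"
 shows "integrable (lebesgue_on {0..1}) (\<lambda>s. norm (\<phi> s))"
proof (rule Bochner_Integration.integrable_bound)
 show "integrable (lebesgue_on {0..1}) (\<lambda>s. 1 + (norm (\<phi> s))^2)"
  by (intro Bochner_Integration.integrable_add const_integrable_unit L2_integrable assms)
 show "(\<lambda>s. norm (\<phi> s)) \<in> borel_measurable (lebesgue_on {0..1})"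
  using L2_measurable[OF assms] by measurable
 have "x \<le> 1 + x^2" for x :: real
 proof -
  have "2 * x \<le> x^2 + 1" using sum_squares_bound[of x 1] by simp
  moreover have "0 \<le> x^2" by simp
  ultimately show ?thesis by linarith
 qed
 thus "AE s in lebesgue_on {0..1}. norm (norm (\<phi> s)) \<le> norm (1 + (norm (\<phi> s))^2)"
  by (intro AE_I2) simp
qed

lemma set_integrable_unit:
 fixes f :: "real => 'b::{banach, second_countable_topology}"
 assumes "integrable (lebesgue_on {0..1}) f" "T \<in> sets lebesgue" "T \<subseteq> {0..1}"
 shows "set_integrable lebesgue T f"
proof (rule set_integrable_subset)
 show "set_integrable lebesgue {0..1} f"
  using assms(1) by (subst (asm) integrable_restrict_space) (auto simp: set_integrable_def)
qed (use assms in auto)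

lemma set_lebesgue_integral_unit:
 fixes f :: "real => 'b::{banach, second_countable_topology}"
 shows "(LINT s:{0..1}|lebesgue. f s) = (LINT s|lebesgue_on {0..1}. f s)"
 by (subst integral_restrict_space) (auto simp: set_lebesgue_integral_def)

lemma norm_set_integral_le:
 fixes f :: "real => 'b::{banach, second_countable_topology}"
 assumes "set_integrable lebesgue T w" "\<And>s. s \<in> T ==> norm (f s) \<le> w s"
 shows "norm (LINT s:T|lebesgue. f s) \<le> (LINT s:T|lebesgue. w s)"
proof -
 have "norm (LINT s:T|lebesgue. f s) \<le> (LINT s|lebesgue. norm (indicator T s *\<^sub>R f s))"
  unfolding set_lebesgue_integral_def by (rule integral_norm_bound)
 also have "\<dots> \<le> (LINT s:T|lebesgue. w s)"
  unfolding set_lebesgue_integral_def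
 proof (rule integral_mono')
  show "integrable lebesgue (\<lambda>s. indicator T s *\<^sub>R w s)" using assms(1) by (simp add: set_integrable_def)
  show "norm (indicator T s *\<^sub>R f s) \<le> indicator T s *\<^sub>R w s" for s using assms(2) by (auto simp: indicator_def)
  show "0 \<le> indicator T s *\<^sub>R w s" for s using order_trans[OF norm_ge_zero assms(2)[of s]] by (auto simp: indicator_def)
 qed
 finally show ?thesis .
qed

lemma L2_set_integral_le_cost:
 assumes "\<phi> \<in> L2" "T \<in> sets lebesgue" "T \<subseteq> {0..1}"
 shows "(LINT s:T|lebesgue. (norm (\<phi> s))\<^sup>2) \<le> cost \<phi>"
 unfolding cost_def set_lebesgue_integral_unit[symmetric] set_lebesgue_integral_def
 by (rule integral_mono') (use set_integrable_unit[OF L2_integrable[OF assms(1)], of "{0..1}"] assms(3) in \<open>auto simp: set_integrable_def indicator_def\<close>)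

lemma L2_norm_integral_le:
 assumes \<phi>: "\<phi> \<in> L2" and T: "T \<in> sets lebesgue" "T \<subseteq> {a..b}" and ab: "0 \<le> a" "a \<le> b" "b \<le> 1"
 shows "(LINT s:T|lebesgue. norm (\<phi> s)) \<le> sqrt ((b - a) * (LINT s:T|lebesgue. (norm (\<phi> s))\<^sup>2))"
proof -
 have T1: "T \<subseteq> {0..1}" using T ab by auto
 define q where "q = (LINT s:T|lebesgue. (norm (\<phi> s))\<^sup>2)"
 have q0: "q \<ge> 0" by (simp add: q_def set_lebesgue_integral_def)
 have i2: "set_integrable lebesgue T (\<lambda>s. (norm (\<phi> s))\<^sup>2)" by (rule set_integrable_unit[OF L2_integrable[OF \<phi>] T(1) T1])
 have i1: "set_integrable lebesgue T (\<lambda>s. norm (\<phi> s))" by (rule set_integrable_unit[OF L2_norm_integrable[OF \<phi>] T(1) T1])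
 have ic: "set_integrable lebesgue T (\<lambda>s. c::real)" for c by (rule set_integrable_unit[OF const_integrable_unit T(1) T1])
 have "emeasure lebesgue T \<le> emeasure lebesgue {a..b}" by (rule emeasure_mono[OF T(2)]) simp
 also have "\<dots> = ennreal (b - a)" using ab by simp
 finally have mT: "measure lebesgue T \<le> b - a" using ab by (metis diff_ge_0_iff_ge enn2real_leI measure_def)
 have main: "(LINT s:T|lebesgue. norm (\<phi> s)) \<le> (\<alpha> * (b - a) + q / \<alpha>) / 2" if \<alpha>: "\<alpha> > 0" for \<alpha>
 proof -
  have pt: "x \<le> (\<alpha> + x^2 / \<alpha>) / 2" for x :: real
  proof -
   have "0 \<le> (x - \<alpha>)^2 / \<alpha>" using \<alpha> by simp
   also have "(x - \<alpha>)^2 / \<alpha> = x^2 / \<alpha> - 2 * x + \<alpha>" using \<alpha> by (simp add: power2_eq_square field_simps)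
   finally show ?thesis by simp
  qed
  have "(LINT s:T|lebesgue. norm (\<phi> s)) \<le> (LINT s:T|lebesgue. (\<alpha> + (norm (\<phi> s))^2 / \<alpha>) / 2)"
   by (intro set_integral_mono i1 set_integrable_divide set_integral_add(1) ic i2 pt)
  also have "\<dots> = (\<alpha> * measure lebesgue T + q / \<alpha>) / 2"
  proof -
   have "(LINT s:T|lebesgue. \<alpha>) = \<alpha> * measure lebesgue T"
    using ic[of 1] by (simp add: set_lebesgue_integral_def mult.commute)
   thus ?thesis using set_integral_add(2)[OF ic, of "\<lambda>s. (norm (\<phi> s))\<^sup>2 / \<alpha>" \<alpha>] i2
    by (simp add: q_def)
  qed
  also have "\<dots> \<le> (\<alpha> * (b - a) + q / \<alpha>) / 2" using mT \<alpha> by simp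
  finally show ?thesis .
 qed
 show ?thesis
 proof (cases "a = b")
  case True
  have "(LINT s:T|lebesgue. norm (\<phi> s)) \<le> x" if "x > 0" for x
  proof -
   have "q / (q / x + 1) \<le> 2 * x"
   proof -
    have "q \<le> x * (q / x + 1)" using that by (simp add: field_simps)
    hence "q / (q / x + 1) \<le> x" using that q0 by (simp add: pos_divide_le_eq add_nonneg_pos)
    thus ?thesis using that by simp
   qed
   moreover have "q / x + 1 > 0" using that q0 by (simp add: add_nonneg_pos)
   ultimately have f: "(LINT s:T|lebesgue. norm (\<phi> s)) \<le> ((q / x + 1) * (b - a) + q / (q / x + 1)) / 2"
    "q / (q / x + 1) \<le> 2 * x" "(q / x + 1) * (b - a) = 0" using main[of "q / x + 1"] True by auto
   have gen: "A \<le> X" if "A \<le> (Z + B) / 2" "B \<le> 2 * X" "Z = 0" for A B X Z :: real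
    using that by simp
   show ?thesis by (rule gen[OF f])
  qed
  thus ?thesis using True field_le_epsilon[of "LINT s:T|lebesgue. norm (\<phi> s)" 0] by simp
 next
  case False
  hence d: "b - a > 0" using ab by simp
  show ?thesis
  proof (cases "q = 0")
   case True
   have "(LINT s:T|lebesgue. norm (\<phi> s)) \<le> 0 + x" if "x > 0" for x
    using main[of "x / (b - a)"] True d that by simp
   hence "(LINT s:T|lebesgue. norm (\<phi> s)) \<le> 0" by (rule field_le_epsilon)
   thus ?thesis using True by (simp add: q_def[symmetric])
  next
   case False
   hence q: "q > 0" using q0 by simp
   define \<alpha> where "\<alpha> = sqrt (q / (b - a))"
   have \<alpha>: "\<alpha> > 0" using q d by (simp add: \<alpha>_def)
   define p where "p = sqrt ((b - a) * q)"
   have "\<alpha> * (b - a) = p"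
   proof -
    have "\<alpha> * (b - a) = sqrt (q / (b - a)) * sqrt ((b - a)^2)" using d by (simp add: \<alpha>_def)
    also have "\<dots> = p" unfolding p_def real_sqrt_mult[symmetric] using d by (simp add: power2_eq_square mult.commute)
    finally show ?thesis .
   qed
   moreover have "q / \<alpha> = p"
   proof -
    have "p * \<alpha> = sqrt (q^2)" unfolding p_def \<alpha>_def real_sqrt_mult[symmetric] using d by (simp add: power2_eq_square)
    thus ?thesis using \<alpha> q by (simp add: field_simps)
   qed
   ultimately show ?thesis using main[OF \<alpha>] by (simp add: p_def q_def)
  qed
 qed
qed

lemma L2_norm_integral_le_cost:
 assumes \<phi>: "\<phi> \<in> L2" and T: "T \<in> sets lebesgue" "T \<subseteq> {a..b}" and ab: "0 \<le> a" "a \<le> b" "b \<le> 1"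
  and r: "cost \<phi> \<le> r"
 shows "(LINT s:T|lebesgue. norm (\<phi> s)) \<le> sqrt ((b - a) * r)"
proof (rule order_trans[OF L2_norm_integral_le[OF \<phi> T ab]])
 have "T \<subseteq> {0..1}" using T ab by auto
 hence "(LINT s:T|lebesgue. (norm (\<phi> s))\<^sup>2) \<le> r" using L2_set_integral_le_cost[OF \<phi> T(1)] r by simp
 thus "sqrt ((b - a) * (LINT s:T|lebesgue. (norm (\<phi> s))\<^sup>2)) \<le> sqrt ((b - a) * r)"
  using ab by (intro real_sqrt_le_mono mult_left_mono) auto
qed

lemma exp_set_integrable_unit:
 assumes "\<phi> \<in> L2" "T \<in> sets lebesgue" "T \<subseteq> {0..1}"
 shows "set_integrable lebesgue T (\<lambda>s. exp (\<kappa> * s) * norm (\<phi> s))"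
proof (rule set_integrable_unit[OF _ assms(2,3)])
 show "integrable (lebesgue_on {0..1}) (\<lambda>s. exp (\<kappa> * s) * norm (\<phi> s))"
 proof (rule Bochner_Integration.integrable_bound)
  show "integrable (lebesgue_on {0..1}) (\<lambda>s. exp \<bar>\<kappa>\<bar> * norm (\<phi> s))" by (intro integrable_mult_right L2_norm_integrable assms(1))
  have [measurable]: "(\<lambda>s. exp (\<kappa> * s)) \<in> borel_measurable (lebesgue_on {0..1})"
   by (intro continuous_imp_measurable_on_sets_lebesgue continuous_intros) auto
  show "(\<lambda>s. exp (\<kappa> * s) * norm (\<phi> s)) \<in> borel_measurable (lebesgue_on {0..1})"
   using L2_measurable[OF assms(1)] by measurable
  have "exp (\<kappa> * s) \<le> exp \<bar>\<kappa>\<bar>" if "s \<in> {0..1}" for s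
  proof -
   have "\<kappa> * s \<le> \<bar>\<kappa>\<bar> * 1" using that by (intro mult_mono) auto
   thus ?thesis by simp
  qed
  thus "AE s in lebesgue_on {0..1}. norm (exp (\<kappa> * s) * norm (\<phi> s)) \<le> norm (exp \<bar>\<kappa>\<bar> * norm (\<phi> s))"
   by (intro AE_I2) (auto simp: space_restrict_space abs_mult intro!: mult_right_mono)
 qed
qed

lemma L2_exp_integral_le:
 assumes \<phi>: "\<phi> \<in> L2" and t: "0 \<le> t" "t \<le> 1" and r: "cost \<phi> \<le> r" "r > 0" and \<kappa>: "\<kappa> > 0"
 shows "(LINT s:{0..t}|lebesgue. exp (\<kappa> * s) * norm (\<phi> s)) \<le> exp (\<kappa> * t) * sqrt (r / (2 * \<kappa>))"
proof -
 define p where "p = sqrt (2 * \<kappa> * r)"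
 have p: "p > 0" "p^2 = 2 * \<kappa> * r" using r \<kappa> by (auto simp: p_def)
 define \<alpha> where "\<alpha> = p * exp (- \<kappa> * t)"
 have \<alpha>: "\<alpha> > 0" using p by (simp add: \<alpha>_def)
 have T1: "{0..t} \<in> sets lebesgue" "{0..t} \<subseteq> {0..1}" using t by auto
 have i2: "set_integrable lebesgue {0..t} (\<lambda>s. (norm (\<phi> s))\<^sup>2)" by (rule set_integrable_unit[OF L2_integrable[OF \<phi>] T1])
 have E: "((\<lambda>s. exp (2 * \<kappa> * s)) has_integral (exp (2 * \<kappa> * t) / (2 * \<kappa>) - exp (2 * \<kappa> * 0) / (2 * \<kappa>))) {0..t}"
  using t \<kappa> by (intro fundamental_theorem_of_calculus) (auto intro!: derivative_eq_intros simp flip: has_real_derivative_iff_has_vector_derivative)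
 have iE: "set_integrable lebesgue {0..t} (\<lambda>s. exp (2 * \<kappa> * s))"
 proof -
  have "(\<lambda>s. exp (2 * \<kappa> * s)) absolutely_integrable_on {0..t}"
   by (intro absolutely_integrable_continuous_real continuous_intros)
  thus ?thesis by (simp add: absolutely_integrable_on_def set_integrable_def) 
 qed
 have "(LINT s:{0..t}|lebesgue. exp (2 * \<kappa> * s)) = integral {0..t} (\<lambda>s. exp (2 * \<kappa> * s))"
  by (rule set_lebesgue_integral_eq_integral(2)[OF iE])
 also have "\<dots> \<le> exp (2 * \<kappa> * t) / (2 * \<kappa>)" using integral_unique[OF E] \<kappa> by simp
 finally have E2: "(LINT s:{0..t}|lebesgue. exp (2 * \<kappa> * s)) \<le> exp (2 * \<kappa> * t) / (2 * \<kappa>)" .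
 have pt: "exp (\<kappa> * s) * x \<le> (\<alpha> * exp (2 * \<kappa> * s) + x^2 / \<alpha>) / 2" for x s :: real
 proof -
  define w where "w = exp (\<kappa> * s)"
  have "0 \<le> (x - \<alpha> * w)^2 / \<alpha>" using \<alpha> by simp
  also have "(x - \<alpha> * w)^2 / \<alpha> = x^2 / \<alpha> - 2 * (w * x) + \<alpha> * w^2" using \<alpha> by (simp add: power2_eq_square field_simps)
  also have "w^2 = exp (2 * \<kappa> * s)" by (simp add: w_def power2_eq_square flip: exp_add)
  finally show ?thesis by (simp add: w_def)
 qed
 have "(LINT s:{0..t}|lebesgue. exp (\<kappa> * s) * norm (\<phi> s)) \<le> (LINT s:{0..t}|lebesgue. (\<alpha> * exp (2 * \<kappa> * s) + (norm (\<phi> s))^2 / \<alpha>) / 2)"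
  by (intro set_integral_mono exp_set_integrable_unit[OF \<phi> T1] set_integrable_divide set_integral_add(1) set_integrable_mult_right iE i2 pt)
 also have "\<dots> = (\<alpha> * (LINT s:{0..t}|lebesgue. exp (2 * \<kappa> * s)) + (LINT s:{0..t}|lebesgue. (norm (\<phi> s))\<^sup>2) / \<alpha>) / 2"
  using set_integral_add(2)[of lebesgue "{0..t}" "\<lambda>s. \<alpha> * exp (2 * \<kappa> * s)" "\<lambda>s. (norm (\<phi> s))\<^sup>2 / \<alpha>"] iE i2 by simp
 also have "\<dots> \<le> (\<alpha> * (exp (2 * \<kappa> * t) / (2 * \<kappa>)) + r / \<alpha>) / 2"
  using E2 L2_set_integral_le_cost[OF \<phi> T1] r \<alpha> by (intro divide_right_mono add_mono mult_left_mono) auto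
 also have "\<dots> = exp (\<kappa> * t) * sqrt (r / (2 * \<kappa>))"
 proof -
  define w where "w = exp (\<kappa> * t)"
  have w: "w > 0" "exp (2 * \<kappa> * t) = w^2" "exp (- \<kappa> * t) = 1 / w"
   by (auto simp: w_def power2_eq_square exp_minus inverse_eq_divide simp flip: exp_add)
  have sq: "sqrt (r / (2 * \<kappa>)) = p / (2 * \<kappa>)"
   using \<kappa> r by (intro real_sqrt_unique) (auto simp: power_divide p_def power2_eq_square)
  have rp: "r = p^2 / (2 * \<kappa>)" using p \<kappa> by simp
  have \<alpha>w: "\<alpha> = p / w" by (simp add: \<alpha>_def w_def exp_minus inverse_eq_divide)
  have "\<alpha> * (w^2 / (2 * \<kappa>)) = w * (p / (2 * \<kappa>))"
   using w(1) \<kappa> by (simp add: \<alpha>w power2_eq_square)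
  note a1 = this
  have a2: "r / \<alpha> = w * (p / (2 * \<kappa>))"
  proof -
   have "p^2 / (2 * \<kappa>) / \<alpha> = w * (p / (2 * \<kappa>))"
    using w(1) p(1) \<kappa> by (simp add: \<alpha>w power2_eq_square)
   thus ?thesis using rp by simp
  qed
  have half: "(A + A) / 2 = A" for A :: real by simp
  show ?thesis unfolding sq w(2) w_def[symmetric] a1 a2 by (rule half)
 qed
 finally show ?thesis .
qed

text \<open>
 A Gronwall inequality without any measurability of \<open>y\<close>: apply the hypothesis to the least
 \<open>\<theta>\<close> such that \<open>y \<le> \<theta> e\<^sup>\<kappa>\<^sup>t\<close>.
\<close>

lemma weighted_sup_bound:
 fixes y :: "real => real"
 assumes bdd: "\<And>t. t \<in> {0..1} ==> y t \<le> B" and y0: "\<And>t. t \<in> {0..1} ==> 0 \<le> y t" and \<kappa>: "\<kappa> \<ge> 0"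
  and step: "\<And>\<theta> t. 0 \<le> \<theta> ==> (\<And>s. s \<in> {0..1} ==> y s \<le> \<theta> * exp (\<kappa> * s)) ==> t \<in> {0..1} ==> y t \<le> \<theta> / 2 * exp (\<kappa> * t) + b"
  and b: "b \<ge> 0" and t: "t \<in> {0..1}"
 shows "y t \<le> 2 * b * exp (\<kappa> * t)"
proof -
 define \<theta> where "\<theta> = (SUP t\<in>{0..1}. y t * exp (- \<kappa> * t))"
 have B: "y t * exp (- \<kappa> * t) \<le> B" if t: "t \<in> {0..1}" for t
 proof -
  have "y t * exp (- \<kappa> * t) \<le> y t * 1" using y0[OF t] \<kappa> t by (intro mult_left_mono) auto
  thus ?thesis using bdd[OF t] by simp
 qed
 hence ba: "bdd_above ((\<lambda>t. y t * exp (- \<kappa> * t)) ` {0..1})" by (intro bdd_aboveI2[where M=B])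
 have up: "y s * exp (- \<kappa> * s) \<le> \<theta>" if "s \<in> {0..1}" for s unfolding \<theta>_def by (rule cSUP_upper[OF that ba])
 have \<theta>0: "\<theta> \<ge> 0" using up[of 0] y0[of 0] by simp
 have conv: "y s \<le> c * exp (\<kappa> * s) \<longleftrightarrow> y s * exp (- \<kappa> * s) \<le> c" for s c
  by (simp add: exp_minus field_simps)
 have "y s * exp (- \<kappa> * s) \<le> \<theta> / 2 + b" if s: "s \<in> {0..1}" for s
 proof -
  have "y s \<le> \<theta> / 2 * exp (\<kappa> * s) + b" by (rule step[OF \<theta>0 _ s]) (use up in \<open>simp only: conv\<close>)
  also have "b \<le> b * exp (\<kappa> * s)" using b \<kappa> s by (simp add: mult_le_cancel_left1)
  finally have "y s \<le> (\<theta> / 2 + b) * exp (\<kappa> * s)" by (simp add: distrib_right)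
  thus ?thesis by (simp only: conv)
 qed
 hence "\<theta> \<le> \<theta> / 2 + b" unfolding \<theta>_def by (intro cSUP_least) auto
 hence "y t * exp (- \<kappa> * t) \<le> 2 * b" using up[OF t] by simp
 thus ?thesis by (simp only: conv)
qed

section \<open>The controlled equation\<close>

lemma hilbert_schmidt_diff:
 assumes "hilbert_schmidt g K A" "hilbert_schmidt g K B"
 shows "hilbert_schmidt g K (\<lambda>u. A u - B u)"
proof -
 have "(\<lambda>k. 2 * (norm (A (g k)))^2 + 2 * (norm (- B (g k)))^2) summable_on K"
  using assms unfolding hilbert_schmidt_def by (intro summable_on_add summable_on_cmult_right) auto
 hence "(\<lambda>k. (norm (A (g k) - B (g k)))\<^sup>2) summable_on K"
  by (rule summable_on_comparison_test) (use square_norm_add_le[of _ "- _"] in auto)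
 thus ?thesis
  using assms unfolding hilbert_schmidt_def by (auto intro: bounded_linear_sub)
qed

lemma set_integral_unit_diff:
 fixes f :: "real => 'b::{banach, second_countable_topology}"
 assumes "integrable (lebesgue_on {0..1}) f" "0 \<le> s" "s \<le> t" "t \<le> 1"
 shows "(LINT r:{0..t}|lebesgue. f r) = (LINT r:{0..s}|lebesgue. f r) + (LINT r:{s<..t}|lebesgue. f r)"
proof -
 have "{0..t} = {0..s} \<union> {s<..t}" using assms by auto
 moreover have "(LINT r:{0..s} \<union> {s<..t}|lebesgue. f r) = (LINT r:{0..s}|lebesgue. f r) + (LINT r:{s<..t}|lebesgue. f r)"
  using assms by (intro set_integral_Un set_integrable_unit) auto
 ultimately show ?thesis by simp
qed

lemma continuous_unit_bounded:
 fixes f :: "real => 'b::real_normed_vector"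
 assumes "continuous_on {0..1} f"
 obtains B where "0 \<le> B" "\<And>s. s \<in> {0..1} ==> norm (f s) \<le> B"
proof -
 have "compact (f ` {0..1})" by (intro compact_continuous_image assms) auto
 hence "bounded (f ` {0..1})" by (rule compact_imp_bounded)
 then obtain B where B: "\<And>s. s \<in> {0..1} ==> norm (f s) \<le> B" unfolding bounded_iff by blast
 hence "0 \<le> B" using order_trans[OF norm_ge_zero B[of 0]] by simp
 thus thesis using B that by blast
qed

locale coefficient =
 fixes g :: "nat => 'u::{real_inner, banach, second_countable_topology}" and K :: "nat set"
  and G :: "'h::{real_inner, banach, second_countable_topology} => 'u \<Rightarrow>\<^sub>L 'h" and \<Lambda> :: real
 assumes onb: "orthonormal_basis g K"
  and hs: "\<And>y. hilbert_schmidt g K (G y)"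
  and \<Lambda>: "0 < \<Lambda>"
  and lipschitz: "\<And>y z. hs_norm g K (\<lambda>u. G y u - G z u) \<le> \<Lambda> * norm (y - z)"
  and growth: "\<And>y. hs_norm g K (G y) \<le> \<Lambda> * (1 + norm y)"
  and A1: "\<And>r::real. 0 < r ==>
   (\<lambda>n. SUP h\<in>{h. norm h < r}. ereal (hs_norm g K (\<lambda>u. G h (u - basis_projection g K n u)))) \<longlonglongrightarrow> 0"
begin

abbreviation (input) "proj \<equiv> basis_projection g K"

lemma G_lipschitz: "norm (G y u - G z u) \<le> \<Lambda> * norm (y - z) * norm u"
 using norm_le_hs_norm[OF onb hilbert_schmidt_diff[OF hs[of y] hs[of z]], of u] mult_right_mono[OF lipschitz[of y z] norm_ge_zero[of u]]
 by linarith

lemma G_growth: "norm (G y u) \<le> \<Lambda> * (1 + norm y) * norm u"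
 using norm_le_hs_norm[OF onb hs[of y], of u] mult_right_mono[OF growth[of y] norm_ge_zero[of u]] by linarith

lemma G_continuous_pair: "continuous_on UNIV (\<lambda>p. G (fst p) (snd p))"
 unfolding continuous_on_def
proof
 fix p :: "'h \<times> 'u"
 have "((\<lambda>q. norm (G (fst q) (snd q) - G (fst p) (snd p))) \<longlongrightarrow> 0) (at p)"
 proof (rule tendsto_sandwich[OF always_eventually always_eventually tendsto_const])
  show "\<forall>q. 0 \<le> norm (G (fst q) (snd q) - G (fst p) (snd p))" by simp
  show "\<forall>q. norm (G (fst q) (snd q) - G (fst p) (snd p))
   \<le> \<Lambda> * norm (fst q - fst p) * norm (snd q) + \<Lambda> * (1 + norm (fst p)) * norm (snd q - snd p)"
  proof
   fix q
   have e: "G (fst q) (snd q) - G (fst p) (snd p) = (G (fst q) (snd q) - G (fst p) (snd q)) + G (fst p) (snd q - snd p)"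
    by (simp add: blinfun.diff_right)
   show "norm (G (fst q) (snd q) - G (fst p) (snd p))
    \<le> \<Lambda> * norm (fst q - fst p) * norm (snd q) + \<Lambda> * (1 + norm (fst p)) * norm (snd q - snd p)"
    unfolding e by (rule order_trans[OF norm_triangle_ineq add_mono[OF G_lipschitz G_growth]])
  qed
  have "((\<lambda>q. \<Lambda> * norm (fst q - fst p) * norm (snd q) + \<Lambda> * (1 + norm (fst p)) * norm (snd q - snd p)) \<longlongrightarrow>
   \<Lambda> * norm (fst p - fst p) * norm (snd p) + \<Lambda> * (1 + norm (fst p)) * norm (snd p - snd p)) (at p)"
   by (intro tendsto_intros)
  thus "((\<lambda>q. \<Lambda> * norm (fst q - fst p) * norm (snd q) + \<Lambda> * (1 + norm (fst p)) * norm (snd q - snd p)) \<longlongrightarrow> 0) (at p)"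
   by simp
 qed
 hence "((\<lambda>q. G (fst q) (snd q)) \<longlongrightarrow> G (fst p) (snd p)) (at p)"
  by (simp add: tendsto_norm_zero_iff LIM_zero_iff)
 thus "((\<lambda>q. G (fst q) (snd q)) \<longlongrightarrow> G (fst p) (snd p)) (at p within UNIV)" by simp
qed

lemma G_continuous: "continuous_on A (\<lambda>y. G y u)"
 by (rule continuous_on_subset[OF continuous_on_compose2[OF G_continuous_pair, of UNIV "\<lambda>y. (y, u)", simplified]])
  (auto intro!: continuous_intros)

lemma G_path_integrable:
 assumes z: "continuous_on {0..1} z" and \<phi>: "\<phi> \<in> L2"
 shows "integrable (lebesgue_on {0..1}) (\<lambda>s. G (z s) (\<phi> s))"
proof -
 obtain B where B0: "0 \<le> B" and B: "\<And>s. s \<in> {0..1} ==> norm (z s) \<le> B" using continuous_unit_bounded[OF z] by blast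
 show ?thesis
 proof (rule Bochner_Integration.integrable_bound)
  show "integrable (lebesgue_on {0..1}) (\<lambda>s. \<Lambda> * (1 + B) * norm (\<phi> s))" by (intro integrable_mult_right L2_norm_integrable \<phi>)
  have zm: "z \<in> borel_measurable (lebesgue_on {0..1})"
   by (intro continuous_imp_measurable_on_sets_lebesgue z) auto
  show "(\<lambda>s. G (z s) (\<phi> s)) \<in> borel_measurable (lebesgue_on {0..1})"
   by (rule borel_measurable_continuous_Pair[OF zm L2_measurable[OF \<phi>] G_continuous_pair])
  have "norm (G (z s) (\<phi> s)) \<le> norm (\<Lambda> * (1 + B) * norm (\<phi> s))" if "s \<in> {0..1}" for s
  proof -
   have "norm (G (z s) (\<phi> s)) \<le> \<Lambda> * (1 + norm (z s)) * norm (\<phi> s)" by (rule G_growth)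
   also have "\<dots> \<le> \<Lambda> * (1 + B) * norm (\<phi> s)" using B[OF that] \<Lambda> by (intro mult_right_mono mult_left_mono) auto
   finally show ?thesis by (simp add: order_trans[OF _ abs_ge_self])
  qed
  thus "AE s in lebesgue_on {0..1}. norm (G (z s) (\<phi> s)) \<le> norm (\<Lambda> * (1 + B) * norm (\<phi> s))"
   by (intro AE_I2) (auto simp: space_restrict_space)
 qed
qed

definition solution :: "'h => (real => 'u) => (real => 'h) => bool" where
 "solution x \<phi> z \<longleftrightarrow> z \<in> paths \<and> (\<forall>t\<in>{0..1}. z t = x + (LINT s:{0..t}|lebesgue. G (z s) (\<phi> s)))"

lemma weighted_integral_le:
 assumes \<phi>: "\<phi> \<in> L2" "cost \<phi> \<le> r" "r > 0" and t: "t \<in> {0..1}" and \<theta>: "0 \<le> \<theta>"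
  and f: "\<And>s. s \<in> {0..t} ==> norm (f s) \<le> \<Lambda> * (\<theta> * exp (2 * \<Lambda>^2 * r * s)) * norm (\<phi> s)"
 shows "norm (LINT s:{0..t}|lebesgue. f s :: 'h) \<le> \<theta> / 2 * exp (2 * \<Lambda>^2 * r * t)"
proof -
 define \<kappa> where "\<kappa> = 2 * \<Lambda>^2 * r"
 have \<kappa>: "\<kappa> > 0" using \<phi>(3) \<Lambda> by (simp add: \<kappa>_def)
 have T: "{0..t} \<in> sets lebesgue" "{0..t} \<subseteq> {0..1}" using t by auto
 have "norm (LINT s:{0..t}|lebesgue. f s) \<le> (LINT s:{0..t}|lebesgue. (\<Lambda> * \<theta>) * (exp (\<kappa> * s) * norm (\<phi> s)))"
 proof (rule norm_set_integral_le)
  show "set_integrable lebesgue {0..t} (\<lambda>s. (\<Lambda> * \<theta>) * (exp (\<kappa> * s) * norm (\<phi> s)))"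
   by (intro set_integrable_mult_right exp_set_integrable_unit \<phi> T)
  show "norm (f s) \<le> (\<Lambda> * \<theta>) * (exp (\<kappa> * s) * norm (\<phi> s))" if "s \<in> {0..t}" for s
   using f[OF that] by (simp add: \<kappa>_def mult.assoc)
 qed
 also have "\<dots> = (\<Lambda> * \<theta>) * (LINT s:{0..t}|lebesgue. exp (\<kappa> * s) * norm (\<phi> s))" by simp
 also have "\<dots> \<le> (\<Lambda> * \<theta>) * (exp (\<kappa> * t) * sqrt (r / (2 * \<kappa>)))"
  using \<Lambda> \<theta> t by (intro mult_left_mono L2_exp_integral_le \<phi> \<kappa>) auto
 also have "sqrt (r / (2 * \<kappa>)) = 1 / (2 * \<Lambda>)"
  using \<phi>(3) \<Lambda> by (intro real_sqrt_unique) (auto simp: \<kappa>_def power2_eq_square)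
 finally show ?thesis using \<Lambda> by (simp add: \<kappa>_def mult_ac)
qed

lemma solution_unique:
 assumes \<phi>: "\<phi> \<in> L2" and z: "solution x \<phi> z" and w: "solution x \<phi> w"
 shows "z = w"
proof -
 have zc: "continuous_on {0..1} z" "z \<in> extensional {0..1}" and wc: "continuous_on {0..1} w" "w \<in> extensional {0..1}"
  using z w by (auto simp: solution_def mspace_path_metric)
 define r where "r = cost \<phi> + 1"
 have r: "cost \<phi> \<le> r" "r > 0" using cost_nonneg[of \<phi>] by (auto simp: r_def)
 have "continuous_on {0..1} (\<lambda>s. z s - w s)" using zc wc by (intro continuous_intros)
 then obtain B where B: "\<And>s. s \<in> {0..1} ==> norm (z s - w s) \<le> B"
  using continuous_unit_bounded by blast
 have "norm (z t - w t) \<le> 2 * 0 * exp (2 * \<Lambda>^2 * r * t)" if t: "t \<in> {0..1}" for t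
 proof (rule weighted_sup_bound[OF B _ _ _ _ t])
  fix \<theta> t assume h: "0 \<le> \<theta>" "\<And>s. s \<in> {0..1} ==> norm (z s - w s) \<le> \<theta> * exp (2 * \<Lambda>^2 * r * s)" "t \<in> {0..1::real}"
  have T: "{0..t} \<in> sets lebesgue" "{0..t} \<subseteq> {0..1}" using h by auto
  have "z t - w t = (LINT s:{0..t}|lebesgue. G (z s) (\<phi> s)) - (LINT s:{0..t}|lebesgue. G (w s) (\<phi> s))"
   using z w h(3) by (simp add: solution_def)
  also have "\<dots> = (LINT s:{0..t}|lebesgue. G (z s) (\<phi> s) - G (w s) (\<phi> s))"
   by (intro set_integral_diff(2)[symmetric] set_integrable_unit[OF G_path_integrable] zc wc \<phi> T)
  finally have e: "z t - w t = (LINT s:{0..t}|lebesgue. G (z s) (\<phi> s) - G (w s) (\<phi> s))" .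
  have "norm (z t - w t) \<le> \<theta> / 2 * exp (2 * \<Lambda>^2 * r * t)"
   unfolding e
  proof (rule weighted_integral_le[OF \<phi> r h(3,1)])
   fix s assume s: "s \<in> {0..t}"
   have "norm (G (z s) (\<phi> s) - G (w s) (\<phi> s)) \<le> \<Lambda> * norm (z s - w s) * norm (\<phi> s)" by (rule G_lipschitz)
   also have "\<dots> \<le> \<Lambda> * (\<theta> * exp (2 * \<Lambda>^2 * r * s)) * norm (\<phi> s)"
    using h(2)[of s] s h(3) \<Lambda> by (intro mult_right_mono mult_left_mono) auto
   finally show "norm (G (z s) (\<phi> s) - G (w s) (\<phi> s)) \<le> \<Lambda> * (\<theta> * exp (2 * \<Lambda>^2 * r * s)) * norm (\<phi> s)" .
  qed
  thus "norm (z t - w t) \<le> \<theta> / 2 * exp (2 * \<Lambda>^2 * r * t) + 0" by simp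
 qed (use r in auto)
 hence "z t = w t" if "t \<in> {0..1}" for t using that by simp
 thus ?thesis using zc wc by (intro extensionalityI) auto
qed

lemma integral_path_continuous:
 assumes z: "continuous_on {0..1} z" and \<phi>: "\<phi> \<in> L2"
 shows "continuous_on {0..1} (\<lambda>t. LINT s:{0..t}|lebesgue. G (z s) (\<phi> s))"
proof -
 obtain B where B0: "0 \<le> B" and B: "\<And>s. s \<in> {0..1} ==> norm (z s) \<le> B" using continuous_unit_bounded[OF z] by blast
 define c where "c = \<Lambda> * (1 + B)"
 have c: "c \<ge> 0" using \<Lambda> B0 by (simp add: c_def)
 let ?I = "\<lambda>t. LINT s:{0..t}|lebesgue. G (z s) (\<phi> s)"
 have main: "norm (?I t - ?I s) \<le> c * sqrt ((t - s) * cost \<phi>)" if "0 \<le> s" "s \<le> t" "t \<le> 1" for s t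
 proof -
  have T: "{s<..t} \<in> sets lebesgue" "{s<..t} \<subseteq> {s..t}" "{s<..t} \<subseteq> {0..1}" using that by auto
  have "?I t - ?I s = (LINT r:{s<..t}|lebesgue. G (z r) (\<phi> r))"
   using set_integral_unit_diff[OF G_path_integrable[OF z \<phi>] that] by simp
  also have "norm \<dots> \<le> (LINT r:{s<..t}|lebesgue. c * norm (\<phi> r))"
  proof (rule norm_set_integral_le)
   show "set_integrable lebesgue {s<..t} (\<lambda>r. c * norm (\<phi> r))"
    by (intro set_integrable_mult_right set_integrable_unit[OF L2_norm_integrable[OF \<phi>]] T)
   fix r assume "r \<in> {s<..t}"
   hence "norm (z r) \<le> B" using B that by auto
   hence "\<Lambda> * (1 + norm (z r)) * norm (\<phi> r) \<le> c * norm (\<phi> r)"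
    unfolding c_def using \<Lambda> by (intro mult_right_mono mult_left_mono) auto
   thus "norm (G (z r) (\<phi> r)) \<le> c * norm (\<phi> r)" using G_growth[of "z r" "\<phi> r"] by linarith
  qed
  also have "\<dots> = c * (LINT r:{s<..t}|lebesgue. norm (\<phi> r))" by simp
  also have "\<dots> \<le> c * sqrt ((t - s) * cost \<phi>)"
   by (intro mult_left_mono L2_norm_integral_le_cost \<phi> T that c) auto
  finally show ?thesis .
 qed
 show ?thesis
 proof (rule continuous_onI)
  fix t e :: real assume t: "t \<in> {0..1}" and e: "e > 0"
  define q where "q = c^2 * cost \<phi> + 1"
  have q: "q > 0" using cost_nonneg[of \<phi>] by (auto simp: q_def intro: add_nonneg_pos)
  have "dist (?I s) (?I t) \<le> e" if s: "s \<in> {0..1}" "dist s t < e^2 / q" for s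
  proof -
   have "norm (?I s - ?I t) \<le> c * sqrt (\<bar>s - t\<bar> * cost \<phi>)"
    using main[of s t] main[of t s] s t by (cases "s \<le> t") (auto simp: norm_minus_commute)
   also have "\<dots> = sqrt (\<bar>s - t\<bar> * (c^2 * cost \<phi>))" using c by (simp add: real_sqrt_mult)
   also have "\<dots> \<le> sqrt (e^2 / q * q)"
    using s(2) cost_nonneg[of \<phi>] by (intro real_sqrt_le_mono mult_mono) (auto simp: dist_real_def q_def)
   also have "\<dots> = e" using q e by simp
   finally show ?thesis by (simp add: dist_norm)
  qed
  moreover have "e^2 / q > 0" using e q by simp
  ultimately show "\<exists>d>0. \<forall>x'\<in>{0..1}. dist x' t < d --> dist (?I x') (?I t) \<le> e" by blast
 qed
qed

lemma solution_exists:
 assumes \<phi>: "\<phi> \<in> L2"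
 shows "\<exists>z. solution x \<phi> z"
proof -
 define r where "r = cost \<phi> + 1"
 have r: "cost \<phi> \<le> r" "r > 0" using cost_nonneg[of \<phi>] by (auto simp: r_def)
 define \<kappa> where "\<kappa> = 2 * \<Lambda>^2 * r"
 define cl :: "real => real" where "cl t = max 0 (min 1 t)" for t
 have cl: "cl t \<in> {0..1}" for t by (auto simp: cl_def)
 have cl_id: "t \<in> {0..1} ==> cl t = t" for t by (auto simp: cl_def)
 have clc: "continuous_on UNIV cl" unfolding cl_def by (intro continuous_intros)
 define H where "H v t = exp (- \<kappa> * t) *\<^sub>R (x + (LINT s:{0..t}|lebesgue. G (exp (\<kappa> * s) *\<^sub>R v s) (\<phi> s)))" for v :: "real => 'h" and t
 have vc: "continuous_on {0..1} (\<lambda>s. exp (\<kappa> * s) *\<^sub>R v s)" if "continuous_on UNIV v" for v :: "real => 'h"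
  by (intro continuous_intros continuous_on_subset[OF that]) auto
 have Hc: "continuous_on {0..1} (H v)" if "continuous_on UNIV v" for v
  unfolding H_def by (intro continuous_intros integral_path_continuous vc \<phi> that)
 define T where "T v = Bcontfun (\<lambda>t. H (apply_bcontfun v) (cl t))" for v
 have Tb: "(\<lambda>t. H (apply_bcontfun v) (cl t)) \<in> bcontfun" for v
 proof -
  have c: "continuous_on {0..1} (H (apply_bcontfun v))" by (rule Hc) (simp add: continuous_on_apply_bcontfun)
  have "compact (H (apply_bcontfun v) ` {0..1})" by (intro compact_continuous_image c) auto
  hence "bounded (range (\<lambda>t. H (apply_bcontfun v) (cl t)))"
   using cl by (intro bounded_subset[OF compact_imp_bounded]) auto
  moreover have "continuous_on UNIV (\<lambda>t. H (apply_bcontfun v) (cl t))"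
   by (rule continuous_on_compose2[OF c clc]) (use cl in auto)
  ultimately show ?thesis by (simp add: bcontfun_def)
 qed
 have Ta: "apply_bcontfun (T v) t = H (apply_bcontfun v) (cl t)" for v t
  unfolding T_def by (simp add: Bcontfun_inverse[OF Tb])
 have "\<exists>!v. T v = v"
 proof (rule banach_fix_type)
  show "\<forall>v w. dist (T v) (T w) \<le> 1 / 2 * dist v w"
  proof (intro allI)
   fix v w :: "real \<Rightarrow>\<^sub>C 'h"
   show "dist (T v) (T w) \<le> 1 / 2 * dist v w"
   proof (rule dist_bound)
    fix t0
    define t where "t = cl t0"
    have t: "t \<in> {0..1}" unfolding t_def by (rule cl)
    have TT: "{0..t} \<in> sets lebesgue" "{0..t} \<subseteq> {0..1}" using t by auto
    have cv: "continuous_on {0..1} (\<lambda>s. exp (\<kappa> * s) *\<^sub>R apply_bcontfun v s)" "continuous_on {0..1} (\<lambda>s. exp (\<kappa> * s) *\<^sub>R apply_bcontfun w s)"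
     by (intro vc, simp add: continuous_on_apply_bcontfun)+
    have "H (apply_bcontfun v) t - H (apply_bcontfun w) t = exp (- \<kappa> * t) *\<^sub>R
     ((LINT s:{0..t}|lebesgue. G (exp (\<kappa> * s) *\<^sub>R v s) (\<phi> s)) - (LINT s:{0..t}|lebesgue. G (exp (\<kappa> * s) *\<^sub>R w s) (\<phi> s)))"
     by (simp add: H_def scaleR_diff_right[symmetric])
    also have "(LINT s:{0..t}|lebesgue. G (exp (\<kappa> * s) *\<^sub>R v s) (\<phi> s)) - (LINT s:{0..t}|lebesgue. G (exp (\<kappa> * s) *\<^sub>R w s) (\<phi> s))
     = (LINT s:{0..t}|lebesgue. G (exp (\<kappa> * s) *\<^sub>R v s) (\<phi> s) - G (exp (\<kappa> * s) *\<^sub>R w s) (\<phi> s))"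
     by (intro set_integral_diff(2)[symmetric] set_integrable_unit[OF G_path_integrable] cv \<phi> TT)
    finally have e: "norm (H (apply_bcontfun v) t - H (apply_bcontfun w) t) = exp (- \<kappa> * t) *
     norm (LINT s:{0..t}|lebesgue. G (exp (\<kappa> * s) *\<^sub>R v s) (\<phi> s) - G (exp (\<kappa> * s) *\<^sub>R w s) (\<phi> s))" by simp
    have "norm (LINT s:{0..t}|lebesgue. G (exp (\<kappa> * s) *\<^sub>R v s) (\<phi> s) - G (exp (\<kappa> * s) *\<^sub>R w s) (\<phi> s))
     \<le> dist v w / 2 * exp (2 * \<Lambda>^2 * r * t)"
    proof (rule weighted_integral_le[OF \<phi> r t])
     fix s
     have "norm (G (exp (\<kappa> * s) *\<^sub>R v s) (\<phi> s) - G (exp (\<kappa> * s) *\<^sub>R w s) (\<phi> s))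
      \<le> \<Lambda> * norm (exp (\<kappa> * s) *\<^sub>R v s - exp (\<kappa> * s) *\<^sub>R w s) * norm (\<phi> s)" by (rule G_lipschitz)
     also have "norm (exp (\<kappa> * s) *\<^sub>R v s - exp (\<kappa> * s) *\<^sub>R w s) = exp (\<kappa> * s) * dist (v s) (w s)"
      by (simp add: dist_norm flip: scaleR_diff_right)
     also have "\<Lambda> * (exp (\<kappa> * s) * dist (v s) (w s)) * norm (\<phi> s) \<le> \<Lambda> * (exp (\<kappa> * s) * dist v w) * norm (\<phi> s)"
      using \<Lambda> dist_bounded[of v s w] by (intro mult_right_mono mult_left_mono) auto
     finally show "norm (G (exp (\<kappa> * s) *\<^sub>R v s) (\<phi> s) - G (exp (\<kappa> * s) *\<^sub>R w s) (\<phi> s)) \<le> \<Lambda> * (dist v w * exp (2 * \<Lambda>^2 * r * s)) * norm (\<phi> s)"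
      by (simp add: \<kappa>_def mult_ac)
    qed simp
    hence "norm (H (apply_bcontfun v) t - H (apply_bcontfun w) t) \<le> exp (- \<kappa> * t) * (dist v w / 2 * exp (\<kappa> * t))"
     unfolding e \<kappa>_def by (intro mult_left_mono) auto
    also have "\<dots> = 1 / 2 * dist v w" by (simp add: exp_minus field_simps)
    finally show "dist (T v t0) (T w t0) \<le> 1 / 2 * dist v w" by (simp add: Ta t_def dist_norm)
   qed
  qed
 qed auto
 then obtain v where v: "T v = v" by blast
 define z where "z = restrict (\<lambda>s. exp (\<kappa> * s) *\<^sub>R v s) {0..1}"
 have "solution x \<phi> z" unfolding solution_def
 proof (intro conjI ballI)
  have "continuous_on {0..1} z"
   by (rule continuous_on_cong[THEN iffD2, OF refl _ vc[of v]]) (auto simp: z_def continuous_on_apply_bcontfun)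
  thus "z \<in> paths" by (simp add: mspace_path_metric z_def)
  fix t :: real assume t: "t \<in> {0..1}"
  have "v t = H v t" using Ta[of v t] t by (simp add: v cl_id)
  hence "exp (\<kappa> * t) *\<^sub>R v t = x + (LINT s:{0..t}|lebesgue. G (exp (\<kappa> * s) *\<^sub>R v s) (\<phi> s))"
   unfolding H_def by (simp add: exp_minus) 
  moreover have "(LINT s:{0..t}|lebesgue. G (exp (\<kappa> * s) *\<^sub>R v s) (\<phi> s)) = (LINT s:{0..t}|lebesgue. G (z s) (\<phi> s))"
   using t by (intro set_lebesgue_integral_cong) (auto simp: z_def)
  ultimately show "z t = x + (LINT s:{0..t}|lebesgue. G (z s) (\<phi> s))" using t by (simp add: z_def)
 qed
 thus "\<exists>z. solution x \<phi> z" by blast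
qed

lemma controlled_path_solution:
 assumes "\<phi> \<in> L2"
 shows "solution x \<phi> (controlled_path G x \<phi>)"
proof -
 obtain z where z: "solution x \<phi> z" using solution_exists[OF assms] by blast
 have "controlled_path G x \<phi> = (THE z. solution x \<phi> z)" unfolding controlled_path_def solution_def ..
 also have "\<dots> = z" using z solution_unique[OF assms] by (intro the_equality) auto
 finally show ?thesis using z by simp
qed

end

section \<open>Euler polygons\<close>

lemma L2_integrable_self:
 assumes "\<phi> \<in> (L2 :: (real => 'u::{banach, second_countable_topology}) set)"
 shows "integrable (lebesgue_on {0..1}) \<phi>"
 by (rule Bochner_Integration.integrable_bound[OF L2_norm_integrable[OF assms] L2_measurable[OF assms]]) simp

lemma set_integral_bounded_linear:
 fixes f :: "real => 'b::{banach, second_countable_topology}" and L :: "'b => 'c::{banach, second_countable_topology}"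
 assumes L: "bounded_linear L" and f: "set_integrable lebesgue T f"
 shows "set_integrable lebesgue T (\<lambda>s. L (f s))" "(LINT s:T|lebesgue. L (f s)) = L (LINT s:T|lebesgue. f s)"
proof -
 interpret L: bounded_linear L by (rule L)
 have e: "indicat_real T s *\<^sub>R L (f s) = L (indicator T s *\<^sub>R f s)" for s by (simp add: L.scaleR)
 show "set_integrable lebesgue T (\<lambda>s. L (f s))"
  using integrable_bounded_linear[OF L f[unfolded set_integrable_def]] unfolding set_integrable_def e .
 show "(LINT s:T|lebesgue. L (f s)) = L (LINT s:T|lebesgue. f s)"
  using integral_bounded_linear[OF L f[unfolded set_integrable_def]] unfolding set_lebesgue_integral_def e .
qed

definition block :: "nat => nat => real set" where
 "block N i = {real i / real N<..real (Suc i) / real N}"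

definition block_index :: "nat => real => nat" where
 "block_index N s = nat \<lceil>real N * s\<rceil> - 1"

lemma block_index_eq: "N > 0 ==> s \<in> block N i ==> block_index N s = i"
proof -
 assume N: "N > 0" and s: "s \<in> block N i"
 have "real i < real N * s" "real N * s \<le> real i + 1"
  using s N by (auto simp: block_def field_simps)
 hence "\<lceil>real N * s\<rceil> = int i + 1" by (intro ceiling_unique) auto
 thus ?thesis by (simp add: block_index_def)
qed

lemma block_index_0: "block_index N 0 = 0"
 by (simp add: block_index_def)

lemma block_index_mem:
 assumes "N > 0" "0 < s" "s \<le> 1"
 shows "s \<in> block N (block_index N s)" "block_index N s < N"
proof -
 define c where "c = \<lceil>real N * s\<rceil>"
 have "real N * s > 0" using assms by simp
 hence c: "c \<ge> 1" "real_of_int c - 1 < real N * s" "real N * s \<le> real_of_int c"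
  unfolding c_def by linarith+
 have i: "real (block_index N s) = real_of_int c - 1"
  using c by (simp add: block_index_def c_def[symmetric] of_nat_diff)
 show "s \<in> block N (block_index N s)"
  using assms c i by (auto simp: block_def field_simps)
 have "real N * s \<le> real N" using assms by (simp add: mult_left_le)
 hence "real (block_index N s) < real N" using i c by linarith
 thus "block_index N s < N" by simp
qed

lemma block_subset:
 assumes "i < N"
 shows "block N i \<subseteq> {real i / real N..real (Suc i) / real N}" "block N i \<subseteq> {0..1}"
  "0 \<le> real i / real N \<and> real i / real N \<le> real (Suc i) / real N \<and> real (Suc i) / real N \<le> 1"
proof -
 show 1: "block N i \<subseteq> {real i / real N..real (Suc i) / real N}" by (auto simp: block_def)
 show 3: "0 \<le> real i / real N \<and> real i / real N \<le> real (Suc i) / real N \<and> real (Suc i) / real N \<le> 1"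
  using assms by (auto intro: divide_right_mono)
 show "block N i \<subseteq> {0..1}" 
 proof
  fix s assume "s \<in> block N i"
  hence s: "real i / real N \<le> s" "s \<le> real (Suc i) / real N" using 1 by auto
  have "0 \<le> s" by (rule order_trans[OF _ s(1)]) simp
  moreover have "s \<le> 1" by (rule order_trans[OF s(2)]) (use 3 in blast)
  ultimately show "s \<in> {0..1}" by simp
 qed
qed

lemma block_lebesgue: "block N i \<in> sets lebesgue"
 by (simp add: block_def)

definition increment :: "(real => 'u::{banach, second_countable_topology}) => nat => nat => 'u" where
 "increment \<phi> N i = (LINT s:block N i|lebesgue. \<phi> s)"

lemma sum_block_integrals_le:
 assumes f: "integrable (lebesgue_on {0..1}) f" and f0: "\<And>s. 0 \<le> (f s :: real)" and N: "N > 0"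
 shows "(\<Sum>i<N. LINT s:block N i|lebesgue. f s) \<le> (LINT s|lebesgue_on {0..1}. f s)"
proof -
 have "m \<le> N ==> (\<Sum>i<m. LINT s:block N i|lebesgue. f s) \<le> (LINT s:{0..real m / real N}|lebesgue. f s)" for m
 proof (induction m)
  case 0
  show ?case using f0 by (simp add: set_lebesgue_integral_def)
 next
  case (Suc m)
  have "(LINT s:{0..real (Suc m) / real N}|lebesgue. f s) = (LINT s:{0..real m / real N}|lebesgue. f s) + (LINT s:block N m|lebesgue. f s)"
   unfolding block_def using Suc.prems block_subset(3)[of m N] by (intro set_integral_unit_diff f) auto
  thus ?case using Suc by simp
 qed
 from this[of N] show ?thesis using N by (simp add: set_lebesgue_integral_unit)
qed

context coefficient
begin

definition modes :: "nat => nat set" where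
 "modes n = K \<inter> {..<n}"

lemma modes: "finite (modes n)" "modes n \<subseteq> K"
 by (auto simp: modes_def)

lemma projection_eq: "proj n u = (\<Sum>k\<in>modes n. (g k \<bullet> u) *\<^sub>R g k)"
 by (simp add: basis_projection_eq[OF onb] modes_def)

lemma projection_bounded_linear: "bounded_linear (proj n)"
 unfolding projection_eq[abs_def]
 by (intro bounded_linear_sum bounded_linear_scaleR_const bounded_linear_inner_right)

lemma G_complement_hilbert_schmidt: "hilbert_schmidt g K (\<lambda>u. G h (u - proj n u))"
 unfolding hilbert_schmidt_def
proof
 show "bounded_linear (\<lambda>u. G h (u - proj n u))"
  by (intro bounded_linear_compose[OF blinfun.bounded_linear_right] bounded_linear_sub bounded_linear_ident projection_bounded_linear)
 have "(\<lambda>k. (norm (G h (g k)))\<^sup>2) summable_on K" using hs by (simp add: hilbert_schmidt_def)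
 thus "(\<lambda>k. (norm (G h (g k - proj n (g k))))\<^sup>2) summable_on K"
 proof (rule summable_on_comparison_test)
  fix k assume k: "k \<in> K"
  have "proj n (g k) = (\<Sum>j\<in>modes n. if j = k then g k else 0)"
   unfolding projection_eq
  proof (intro sum.cong refl)
   fix j assume "j \<in> modes n"
   hence "j \<in> K" using modes(2) by auto
   thus "(g j \<bullet> g k) *\<^sub>R g j = (if j = k then g k else 0)" using basis_inner[OF onb _ k] by auto
  qed
  also have "\<dots> = (if k \<in> modes n then g k else 0)" using modes(1) by simp
  finally show "(norm (G h (g k - proj n (g k))))^2 \<le> (norm (G h (g k)))^2" by simp
 qed simp
qed

lemma G_complement_small:
 assumes "0 < (r::real)" "0 < e"
 shows "\<exists>m. \<forall>n\<ge>m. \<forall>h. norm h < r --> hs_norm g K (\<lambda>u. G h (u - proj n u)) \<le> e"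
proof -
 have "\<forall>\<^sub>F n in sequentially. (SUP h\<in>{h. norm h < r}. ereal (hs_norm g K (\<lambda>u. G h (u - proj n u)))) < ereal e"
  using order_tendstoD(2)[OF A1[OF assms(1)], of "ereal e"] assms(2) by simp
 then obtain m where m: "\<And>n. n \<ge> m ==> (SUP h\<in>{h. norm h < r}. ereal (hs_norm g K (\<lambda>u. G h (u - proj n u)))) < ereal e"
  by (auto simp: eventually_sequentially)
 have "hs_norm g K (\<lambda>u. G h (u - proj n u)) \<le> e" if "n \<ge> m" "norm h < r" for n h
 proof -
  have "ereal (hs_norm g K (\<lambda>u. G h (u - proj n u))) \<le> (SUP h\<in>{h. norm h < r}. ereal (hs_norm g K (\<lambda>u. G h (u - proj n u))))"
   using that by (intro SUP_upper) auto
  also have "\<dots> < ereal e" by (rule m[OF that(1)])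
  finally show ?thesis by simp
 qed
 thus ?thesis by blast
qed

primrec euler :: "'h => nat => (nat => nat => real) => nat => 'h" where
 "euler x n v 0 = x"
| "euler x n v (Suc i) = euler x n v i + (\<Sum>k\<in>modes n. v i k *\<^sub>R G (euler x n v i) (g k))"

lemma euler_step: "euler x n v (Suc i) = euler x n v i + G (euler x n v i) (\<Sum>k\<in>modes n. v i k *\<^sub>R g k)"
 by (simp add: blinfun.sum_right blinfun.scaleR_right)

definition noise_cost :: "nat => nat => (nat => nat => real) => real" where
 "noise_cost n N v = real N * (\<Sum>i<N. \<Sum>k\<in>modes n. (v i k)\<^sup>2)"

lemma euler_bound:
 assumes N: "N > 0" and r: "noise_cost n N v \<le> r" and i: "i \<le> N"
 shows "1 + norm (euler x n v i) \<le> (1 + norm x) * exp (\<Lambda> * sqrt r)"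
proof -
 define w where "w j = norm (\<Sum>k\<in>modes n. v j k *\<^sub>R g k)" for j
 have w2: "(w j)^2 = (\<Sum>k\<in>modes n. (v j k)\<^sup>2)" for j
  unfolding w_def by (rule basis_sum_norm[OF onb modes])
 have "1 + norm (euler x n v i) \<le> (1 + norm x) * exp (\<Lambda> * (\<Sum>j<i. w j))" for i
 proof (induction i)
  case (Suc i)
  let ?e = "euler x n v i"
  have "1 + norm (euler x n v (Suc i)) \<le> 1 + (norm ?e + \<Lambda> * (1 + norm ?e) * w i)"
   unfolding euler_step w_def by (intro add_left_mono order_trans[OF norm_triangle_ineq] G_growth)
  also have "\<dots> = (1 + norm ?e) * (1 + \<Lambda> * w i)" by (simp add: algebra_simps)
  also have "\<dots> \<le> ((1 + norm x) * exp (\<Lambda> * (\<Sum>j<i. w j))) * exp (\<Lambda> * w i)"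
   using \<Lambda> by (intro mult_mono Suc.IH exp_ge_add_one_self) (auto simp: w_def)
  also have "\<dots> = (1 + norm x) * exp (\<Lambda> * (\<Sum>j<Suc i. w j))" by (simp add: algebra_simps exp_add)
  finally show ?case .
 qed simp
 hence E: "1 + norm (euler x n v i) \<le> (1 + norm x) * exp (\<Lambda> * (\<Sum>j<i. w j))" .
 have "(\<Sum>j<i. w j) \<le> (\<Sum>j<N. 1 * w j)" using i by (simp, intro sum_mono2) (auto simp: w_def)
 also have "(\<Sum>j<N. 1 * w j) \<le> sqrt ((\<Sum>j<N. 1\<^sup>2) * (\<Sum>j<N. (w j)\<^sup>2))"
  by (rule real_le_rsqrt[OF Cauchy_Schwarz_ineq_sum])
 also have "\<dots> \<le> sqrt r" using r by (simp add: w2 noise_cost_def)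
 finally have "\<Lambda> * (\<Sum>j<i. w j) \<le> \<Lambda> * sqrt r" using \<Lambda> by (intro mult_left_mono) auto
 hence "(1 + norm x) * exp (\<Lambda> * (\<Sum>j<i. w j)) \<le> (1 + norm x) * exp (\<Lambda> * sqrt r)"
  by (intro mult_left_mono) auto
 with E show ?thesis by linarith
qed

definition control_increment :: "(real => 'u) => nat => nat => nat => real" where
 "control_increment \<phi> N i k = g k \<bullet> increment \<phi> N i"

lemma control_increment_cost:
 assumes \<phi>: "\<phi> \<in> L2" and N: "N > 0"
 shows "noise_cost n N (control_increment \<phi> N) \<le> cost \<phi>"
proof -
 have "real N * (\<Sum>k\<in>modes n. (control_increment \<phi> N i k)\<^sup>2) \<le> (LINT s:block N i|lebesgue. (norm (\<phi> s))\<^sup>2)" if i: "i < N" for i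
 proof -
  define q where "q = (LINT s:block N i|lebesgue. (norm (\<phi> s))\<^sup>2)"
  have q: "q \<ge> 0" by (simp add: q_def set_lebesgue_integral_def)
  have "norm (increment \<phi> N i) \<le> (LINT s:block N i|lebesgue. norm (\<phi> s))"
   unfolding increment_def by (intro norm_set_integral_le set_integrable_unit[OF L2_norm_integrable[OF \<phi>]] block_lebesgue block_subset i) simp
  also have "\<dots> \<le> sqrt ((real (Suc i) / N - real i / N) * q)"
   unfolding q_def using block_subset(3)[OF i] by (intro L2_norm_integral_le[OF \<phi> block_lebesgue block_subset(1)[OF i]]) auto
  also have "real (Suc i) / N - real i / N = 1 / N" by (simp add: diff_divide_distrib[symmetric])
  finally have "(norm (increment \<phi> N i))^2 \<le> (sqrt (1 / N * q))^2" by (intro power_mono) auto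
  also have "\<dots> = q / N" using q by simp
  finally have "real N * (norm (increment \<phi> N i))^2 \<le> q" using N by (simp add: field_simps)
  moreover have "(\<Sum>k\<in>modes n. (control_increment \<phi> N i k)\<^sup>2) \<le> (norm (increment \<phi> N i))^2"
   unfolding control_increment_def by (rule basis_bessel[OF onb modes])
  hence "real N * (\<Sum>k\<in>modes n. (control_increment \<phi> N i k)\<^sup>2) \<le> real N * (norm (increment \<phi> N i))^2"
   by (intro mult_left_mono) auto
  ultimately show ?thesis unfolding q_def by linarith
 qed
 hence "noise_cost n N (control_increment \<phi> N) \<le> (\<Sum>i<N. LINT s:block N i|lebesgue. (norm (\<phi> s))\<^sup>2)"
  unfolding noise_cost_def sum_distrib_left by (intro sum_mono) auto
 also have "\<dots> \<le> cost \<phi>" unfolding cost_def by (intro sum_block_integrals_le L2_integrable \<phi> N) simp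
 finally show ?thesis .
qed

lemma step_operator_integrable:
 assumes \<phi>: "\<phi> \<in> L2" and N: "N > 0" and A: "bounded_linear (A :: 'u => 'u)" and i: "i \<le> N"
 shows "set_integrable lebesgue {0..real i / real N} (\<lambda>s. G (e (block_index N s)) (A (\<phi> s)))"
  and "(LINT s:{0..real i / real N}|lebesgue. G (e (block_index N s)) (A (\<phi> s))) = (\<Sum>j<i. G (e j) (A (increment \<phi> N j)))"
proof -
 have "i \<le> N ==> set_integrable lebesgue {0..real i / real N} (\<lambda>s. G (e (block_index N s)) (A (\<phi> s))) \<and>
  (LINT s:{0..real i / real N}|lebesgue. G (e (block_index N s)) (A (\<phi> s))) = (\<Sum>j<i. G (e j) (A (increment \<phi> N j)))"
 proof (induction i)
  case 0
  have a: "set_integrable lebesgue {0..0} (\<lambda>s. G (e (block_index N s)) (A (\<phi> s)))"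
   "(LINT s:{0..0}|lebesgue. G (e (block_index N s)) (A (\<phi> s))) = 0"
  proof -
   have ae: "AE s in lebesgue. indicat_real {0} s *\<^sub>R G (e (block_index N s)) (A (\<phi> s)) = 0"
    by (rule AE_I[where N="{0}"]) (auto simp: indicator_def)
   have eq: "(\<lambda>s. indicat_real {0} s *\<^sub>R G (e (block_index N s)) (A (\<phi> s))) = (\<lambda>s. indicator {0} s *\<^sub>R G (e (block_index N 0)) (A (\<phi> 0)))"
    by (auto simp: indicator_def)
   show "set_integrable lebesgue {0..0} (\<lambda>s. G (e (block_index N s)) (A (\<phi> s)))"
    unfolding set_integrable_def by (simp add: eq)
   show "(LINT s:{0..0}|lebesgue. G (e (block_index N s)) (A (\<phi> s))) = 0"
    unfolding set_lebesgue_integral_def by (simp add: eq)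
  qed
  thus ?case by simp
 next
  case (Suc i)
  hence iN: "i < N" by simp
  let ?L = "\<lambda>u. G (e i) (A u)"
  have L: "bounded_linear ?L" by (intro bounded_linear_compose[OF blinfun.bounded_linear_right A])
  have si: "set_integrable lebesgue (block N i) \<phi>"
   by (rule set_integrable_unit[OF L2_integrable_self[OF \<phi>] block_lebesgue block_subset(2)[OF iN]])
  have c: "set_integrable lebesgue (block N i) (\<lambda>s. G (e (block_index N s)) (A (\<phi> s))) \<longleftrightarrow> set_integrable lebesgue (block N i) (\<lambda>s. ?L (\<phi> s))"
   by (intro set_integrable_cong refl) (simp add: block_index_eq[OF N])
  have c2: "(LINT s:block N i|lebesgue. G (e (block_index N s)) (A (\<phi> s))) = (LINT s:block N i|lebesgue. ?L (\<phi> s))"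
   by (intro set_lebesgue_integral_cong block_lebesgue) (simp add: block_index_eq[OF N])
  have b: "set_integrable lebesgue (block N i) (\<lambda>s. G (e (block_index N s)) (A (\<phi> s)))"
   unfolding c by (rule set_integral_bounded_linear[OF L si])
  have IH: "set_integrable lebesgue {0..real i / real N} (\<lambda>s. G (e (block_index N s)) (A (\<phi> s)))"
   "(LINT s:{0..real i / real N}|lebesgue. G (e (block_index N s)) (A (\<phi> s))) = (\<Sum>j<i. G (e j) (A (increment \<phi> N j)))"
   using Suc by auto
  have U: "{0..real (Suc i) / real N} = {0..real i / real N} \<union> block N i" "{0..real i / real N} \<inter> block N i = {}"
  proof -
   define a b where "a = real i / real N" and "b = real (Suc i) / real N"
   have "0 \<le> a" "a \<le> b" using block_subset(3)[OF iN] by (auto simp: a_def b_def)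
   thus "{0..real (Suc i) / real N} = {0..real i / real N} \<union> block N i" "{0..real i / real N} \<inter> block N i = {}"
    unfolding block_def a_def[symmetric] b_def[symmetric] by auto
  qed
  show ?case unfolding U(1)
  proof
   show "set_integrable lebesgue ({0..real i / real N} \<union> block N i) (\<lambda>s. G (e (block_index N s)) (A (\<phi> s)))"
    by (intro set_integrable_Un IH b block_lebesgue) auto
   show "(LINT s:{0..real i / real N} \<union> block N i|lebesgue. G (e (block_index N s)) (A (\<phi> s))) = (\<Sum>j<Suc i. G (e j) (A (increment \<phi> N j)))"
    unfolding set_integral_Un[OF U(2) IH(1) b] IH(2) c2 set_integral_bounded_linear(2)[OF L si] by (simp add: increment_def)
  qed
 qed
 thus "set_integrable lebesgue {0..real i / real N} (\<lambda>s. G (e (block_index N s)) (A (\<phi> s)))"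
  "(LINT s:{0..real i / real N}|lebesgue. G (e (block_index N s)) (A (\<phi> s))) = (\<Sum>j<i. G (e j) (A (increment \<phi> N j)))"
  using i by auto
qed

lemma euler_control:
 "euler x n (control_increment \<phi> N) i = x + (\<Sum>j<i. G (euler x n (control_increment \<phi> N) j) (proj n (increment \<phi> N j)))"
proof (induction i)
 case (Suc i)
 have "(\<Sum>k\<in>modes n. control_increment \<phi> N i k *\<^sub>R g k) = proj n (increment \<phi> N i)"
  by (simp add: projection_eq control_increment_def)
 thus ?case unfolding euler_step using Suc by simp
qed simp

lemma solution_bound:
 assumes \<phi>: "\<phi> \<in> L2" "cost \<phi> \<le> r" "r > 0" and z: "solution x \<phi> z" and t: "t \<in> {0..1}"
 shows "1 + norm (z t) \<le> 2 * (1 + norm x) * exp (2 * \<Lambda>^2 * r)"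
proof -
 have zc: "continuous_on {0..1} z" using z by (auto simp: solution_def mspace_path_metric)
 obtain B where B: "\<And>s. s \<in> {0..1} ==> norm (z s) \<le> B" using continuous_unit_bounded[OF zc] by blast
 have "1 + norm (z t) \<le> 2 * (1 + norm x) * exp (2 * \<Lambda>^2 * r * t)"
 proof (rule weighted_sup_bound[of "\<lambda>t. 1 + norm (z t)" "1 + B", OF _ _ _ _ _ t])
  fix \<theta> t assume h: "0 \<le> \<theta>" "\<And>s. s \<in> {0..1} ==> 1 + norm (z s) \<le> \<theta> * exp (2 * \<Lambda>^2 * r * s)" "t \<in> {0..1::real}"
  have "norm (LINT s:{0..t}|lebesgue. G (z s) (\<phi> s)) \<le> \<theta> / 2 * exp (2 * \<Lambda>^2 * r * t)"
  proof (rule weighted_integral_le[OF \<phi> h(3,1)])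
   fix s assume "s \<in> {0..t}"
   hence "\<Lambda> * (1 + norm (z s)) * norm (\<phi> s) \<le> \<Lambda> * (\<theta> * exp (2 * \<Lambda>^2 * r * s)) * norm (\<phi> s)"
    using h(2)[of s] h(3) \<Lambda> by (intro mult_right_mono mult_left_mono) auto
   thus "norm (G (z s) (\<phi> s)) \<le> \<Lambda> * (\<theta> * exp (2 * \<Lambda>^2 * r * s)) * norm (\<phi> s)"
    using G_growth[of "z s" "\<phi> s"] by linarith
  qed
  moreover have "z t = x + (LINT s:{0..t}|lebesgue. G (z s) (\<phi> s))" using z h(3) by (simp add: solution_def)
  ultimately show "1 + norm (z t) \<le> \<theta> / 2 * exp (2 * \<Lambda>^2 * r * t) + (1 + norm x)"
   using norm_triangle_ineq[of x "LINT s:{0..t}|lebesgue. G (z s) (\<phi> s)"] by simp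
 qed (use B \<phi>(3) in auto)
 also have "\<dots> \<le> 2 * (1 + norm x) * exp (2 * \<Lambda>^2 * r)"
  using t \<phi>(3) by (intro mult_left_mono) (auto simp: mult_left_le)
 finally show ?thesis .
qed

lemma euler_error:
 assumes \<phi>: "\<phi> \<in> L2" "cost \<phi> \<le> r" "r > 0" and z: "solution x \<phi> z" and N: "N > 0"
  and R: "\<And>t. t \<in> {0..1} ==> 1 + norm (z t) \<le> R"
  and e: "\<And>i u. i \<le> N ==> norm (G (euler x n (control_increment \<phi> N) i) (u - proj n u)) \<le> \<delta> * norm u"
  and \<delta>: "\<delta> \<ge> 0" and t: "t \<in> {0..1}"
 shows "norm (z t - euler x n (control_increment \<phi> N) (block_index N t)) \<le> 2 * (\<delta> * sqrt r + \<Lambda> * R * sqrt (r / N)) * exp (2 * \<Lambda>^2 * r)"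
proof -
 let ?e = "euler x n (control_increment \<phi> N)"
 let ?P = "proj n"
 have zc: "continuous_on {0..1} z" using z by (auto simp: solution_def mspace_path_metric)
 have R0: "R \<ge> 1" using R[of 0] norm_ge_zero[of "z 0"] by (simp del: norm_ge_zero)
 have eb: "norm (?e i) \<le> (1 + norm x) * exp (\<Lambda> * sqrt r)" if "i \<le> N" for i
  using euler_bound[OF N _ that, of n "control_increment \<phi> N" r x] control_increment_cost[OF \<phi>(1) N, of n] \<phi>(2) by linarith
 have bi: "block_index N t \<le> N" if "t \<in> {0..1}" for t
  using block_index_mem(2)[OF N, of t] that by (cases "t = 0") (auto simp: block_index_0)
 define b where "b = \<delta> * sqrt r + \<Lambda> * R * sqrt (r / N)"
 have b0: "b \<ge> 0" using \<delta> \<Lambda> R0 \<phi>(3) by (simp add: b_def)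
 have "norm (z t - ?e (block_index N t)) \<le> 2 * b * exp (2 * \<Lambda>^2 * r * t)"
 proof (rule weighted_sup_bound[of "\<lambda>t. norm (z t - ?e (block_index N t))" "R + (1 + norm x) * exp (\<Lambda> * sqrt r)", OF _ _ _ _ b0 t])
  fix t :: real assume t: "t \<in> {0..1}"
  have "norm (z t - ?e (block_index N t)) \<le> norm (z t) + norm (?e (block_index N t))" by (rule norm_triangle_ineq4)
  thus "norm (z t - ?e (block_index N t)) \<le> R + (1 + norm x) * exp (\<Lambda> * sqrt r)"
   using R[OF t] eb[OF bi[OF t]] by linarith
 next
  fix \<theta> t assume h: "0 \<le> \<theta>" "\<And>s. s \<in> {0..1} ==> norm (z s - ?e (block_index N s)) \<le> \<theta> * exp (2 * \<Lambda>^2 * r * s)" "t \<in> {0..1::real}"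
  show "norm (z t - ?e (block_index N t)) \<le> \<theta> / 2 * exp (2 * \<Lambda>^2 * r * t) + b"
  proof (cases "t = 0")
   case True
   have "z 0 = x + (LINT s:{0..0}|lebesgue. G (z s) (\<phi> s))" using z by (simp add: solution_def)
   also have "(LINT s:{0..0}|lebesgue. G (z s) (\<phi> s)) = 0"
   proof -
    have "(\<lambda>s. indicat_real {0} s *\<^sub>R G (z s) (\<phi> s)) = (\<lambda>s. indicator {0} s *\<^sub>R G (z 0) (\<phi> 0))" by (auto simp: indicator_def)
    thus ?thesis unfolding set_lebesgue_integral_def by simp
   qed
   finally show ?thesis using True h(1) b0 by (simp add: block_index_0)
  next
   case False
   hence t: "0 < t" "t \<le> 1" using h(3) by auto
   define i where "i = block_index N t"
   have i: "i < N" "t \<in> block N i" using block_index_mem[OF N t] by (auto simp: i_def)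
   define a where "a = real i / real N"
   have a: "0 \<le> a" "a < t" "t - a \<le> 1 / N" "a \<le> 1"
    using i N t by (auto simp: a_def block_def add_divide_distrib)
   have Ta: "{0..a} \<in> sets lebesgue" "{0..a} \<subseteq> {0..1}" using a by auto
   have Tt: "{a<..t} \<in> sets lebesgue" "{a<..t} \<subseteq> {a..t}" "{a<..t} \<subseteq> {0..1}" using a t by auto
   note I = step_operator_integrable[OF \<phi>(1) N _ less_imp_le[OF i(1)], folded a_def, where e = ?e]
   have I1: "set_integrable lebesgue {0..a} (\<lambda>s. G (?e (block_index N s)) (\<phi> s))"
    using I(1)[OF bounded_linear_ident] .
   have bl: "bounded_linear (\<lambda>u. u - ?P u)" by (intro bounded_linear_sub bounded_linear_ident projection_bounded_linear)
   have I2: "set_integrable lebesgue {0..a} (\<lambda>s. G (?e (block_index N s)) (\<phi> s - ?P (\<phi> s)))"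
    by (rule I(1)[OF bl])
   have I0: "set_integrable lebesgue {0..a} (\<lambda>s. G (z s) (\<phi> s))"
    by (rule set_integrable_unit[OF G_path_integrable[OF zc \<phi>(1)] Ta])
   have ei: "?e i = x + (LINT s:{0..a}|lebesgue. G (?e (block_index N s)) (?P (\<phi> s)))"
    unfolding I(2)[OF projection_bounded_linear] by (rule euler_control)
   have split: "G (?e (block_index N s)) (?P (\<phi> s)) = G (z s) (\<phi> s) - ((G (z s) (\<phi> s) - G (?e (block_index N s)) (\<phi> s)) + G (?e (block_index N s)) (\<phi> s - ?P (\<phi> s)))" for s
    by (simp add: blinfun.diff_right)
   have ei2: "(LINT s:{0..a}|lebesgue. G (?e (block_index N s)) (?P (\<phi> s))) = (LINT s:{0..a}|lebesgue. G (z s) (\<phi> s))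
     - ((LINT s:{0..a}|lebesgue. G (z s) (\<phi> s) - G (?e (block_index N s)) (\<phi> s)) + (LINT s:{0..a}|lebesgue. G (?e (block_index N s)) (\<phi> s - ?P (\<phi> s))))"
    unfolding split[abs_def]
    by (subst set_integral_diff(2)[OF I0 set_integral_add(1)[OF set_integral_diff(1)[OF I0 I1] I2]],
      subst set_integral_add(2)[OF set_integral_diff(1)[OF I0 I1] I2]) simp
   have zt: "z t = x + ((LINT s:{0..a}|lebesgue. G (z s) (\<phi> s)) + (LINT s:{a<..t}|lebesgue. G (z s) (\<phi> s)))"
    using z h(3) set_integral_unit_diff[OF G_path_integrable[OF zc \<phi>(1)], of a t] a t by (simp add: solution_def)
   have D: "z t - ?e i = (LINT s:{0..a}|lebesgue. G (z s) (\<phi> s) - G (?e (block_index N s)) (\<phi> s))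
    + (LINT s:{0..a}|lebesgue. G (?e (block_index N s)) (\<phi> s - ?P (\<phi> s))) + (LINT s:{a<..t}|lebesgue. G (z s) (\<phi> s))"
    unfolding zt ei ei2 by simp
   have d1: "norm (LINT s:{0..a}|lebesgue. G (z s) (\<phi> s) - G (?e (block_index N s)) (\<phi> s)) \<le> \<theta> / 2 * exp (2 * \<Lambda>^2 * r * t)"
   proof -
    have "norm (LINT s:{0..a}|lebesgue. G (z s) (\<phi> s) - G (?e (block_index N s)) (\<phi> s)) \<le> \<theta> / 2 * exp (2 * \<Lambda>^2 * r * a)"
    proof (rule weighted_integral_le[OF \<phi> _ h(1)])
     fix s assume s: "s \<in> {0..a}"
     have "norm (G (z s) (\<phi> s) - G (?e (block_index N s)) (\<phi> s)) \<le> \<Lambda> * norm (z s - ?e (block_index N s)) * norm (\<phi> s)" by (rule G_lipschitz)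
     also have "\<dots> \<le> \<Lambda> * (\<theta> * exp (2 * \<Lambda>^2 * r * s)) * norm (\<phi> s)"
      using h(2)[of s] s a \<Lambda> by (intro mult_right_mono mult_left_mono) auto
     finally show "norm (G (z s) (\<phi> s) - G (?e (block_index N s)) (\<phi> s)) \<le> \<Lambda> * (\<theta> * exp (2 * \<Lambda>^2 * r * s)) * norm (\<phi> s)" .
    qed (use a in auto)
    also have "\<dots> \<le> \<theta> / 2 * exp (2 * \<Lambda>^2 * r * t)"
     using a h(1) \<phi>(3) by (intro mult_left_mono) (auto intro!: mult_left_mono)
    finally show ?thesis .
   qed
   have d2: "norm (LINT s:{0..a}|lebesgue. G (?e (block_index N s)) (\<phi> s - ?P (\<phi> s))) \<le> \<delta> * sqrt r"
   proof -
    have "norm (LINT s:{0..a}|lebesgue. G (?e (block_index N s)) (\<phi> s - ?P (\<phi> s))) \<le> (LINT s:{0..a}|lebesgue. \<delta> * norm (\<phi> s))"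
    proof (rule norm_set_integral_le)
     show "set_integrable lebesgue {0..a} (\<lambda>s. \<delta> * norm (\<phi> s))"
      by (intro set_integrable_mult_right set_integrable_unit[OF L2_norm_integrable[OF \<phi>(1)]] Ta)
     fix s assume s: "s \<in> {0..a}"
     hence "block_index N s \<le> N" using a by (intro bi) auto
     thus "norm (G (?e (block_index N s)) (\<phi> s - ?P (\<phi> s))) \<le> \<delta> * norm (\<phi> s)" by (rule e)
    qed
    also have "\<dots> = \<delta> * (LINT s:{0..a}|lebesgue. norm (\<phi> s))" by simp
    also have "\<dots> \<le> \<delta> * sqrt ((a - 0) * r)"
     using a \<delta> by (intro mult_left_mono L2_norm_integral_le_cost \<phi> Ta) auto
    also have "\<dots> \<le> \<delta> * sqrt (1 * r)" using a \<delta> \<phi>(3) by (intro mult_left_mono real_sqrt_le_mono mult_right_mono) auto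
    finally show ?thesis by simp
   qed
   have d3: "norm (LINT s:{a<..t}|lebesgue. G (z s) (\<phi> s)) \<le> \<Lambda> * R * sqrt (r / N)"
   proof -
    have "norm (LINT s:{a<..t}|lebesgue. G (z s) (\<phi> s)) \<le> (LINT s:{a<..t}|lebesgue. (\<Lambda> * R) * norm (\<phi> s))"
    proof (rule norm_set_integral_le)
     show "set_integrable lebesgue {a<..t} (\<lambda>s. (\<Lambda> * R) * norm (\<phi> s))"
      by (intro set_integrable_mult_right set_integrable_unit[OF L2_norm_integrable[OF \<phi>(1)]] Tt)
     fix s assume "s \<in> {a<..t}"
     hence "\<Lambda> * (1 + norm (z s)) * norm (\<phi> s) \<le> (\<Lambda> * R) * norm (\<phi> s)"
      using R[of s] a t \<Lambda> by (intro mult_right_mono mult_left_mono) auto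
     thus "norm (G (z s) (\<phi> s)) \<le> (\<Lambda> * R) * norm (\<phi> s)" using G_growth[of "z s" "\<phi> s"] by linarith
    qed
    also have "\<dots> = (\<Lambda> * R) * (LINT s:{a<..t}|lebesgue. norm (\<phi> s))" by simp
    also have "\<dots> \<le> (\<Lambda> * R) * sqrt ((t - a) * r)"
     using a t \<Lambda> R0 by (intro mult_left_mono L2_norm_integral_le_cost[OF \<phi>(1) Tt(1,2)] \<phi>) auto
    also have "\<dots> \<le> (\<Lambda> * R) * sqrt (1 / N * r)"
     using a \<Lambda> R0 \<phi>(3) by (intro mult_left_mono real_sqrt_le_mono mult_right_mono) auto
    finally show ?thesis by simp
   qed
   have "norm (z t - ?e i) \<le> \<theta> / 2 * exp (2 * \<Lambda>^2 * r * t) + \<delta> * sqrt r + \<Lambda> * R * sqrt (r / N)"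
    unfolding D by (intro order_trans[OF norm_triangle_ineq] add_mono d1 d2 d3)
   thus ?thesis by (simp add: b_def i_def)
  qed
 qed (use \<phi>(3) in auto)
 also have "\<dots> \<le> 2 * b * exp (2 * \<Lambda>^2 * r)"
  using t \<phi>(3) b0 by (intro mult_left_mono) (auto simp: mult_left_le)
 finally show ?thesis by (simp add: b_def)
qed

lemma euler_approximation:
 assumes r: "r > 0" and e: "e > 0"
 shows "\<exists>m>0. \<forall>n\<ge>m. \<forall>N\<ge>m. \<forall>\<phi>\<in>L2. cost \<phi> \<le> r -->
  (\<forall>t\<in>{0..1}. norm (controlled_path G x \<phi> t - euler x n (control_increment \<phi> N) (block_index N t)) \<le> e)"
proof -
 define \<kappa> where "\<kappa> = exp (2 * \<Lambda>^2 * r)"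
 define R where "R = 2 * (1 + norm x) * \<kappa>"
 define q where "q = (1 + norm x) * exp (\<Lambda> * sqrt r)"
 define \<delta> where "\<delta> = e / (4 * \<kappa> * sqrt r)"
 have \<kappa>: "\<kappa> > 0" by (simp add: \<kappa>_def)
 have \<delta>: "\<delta> > 0" using r e \<kappa> by (simp add: \<delta>_def)
 have q: "q > 0" by (simp add: q_def add_pos_nonneg)
 obtain m1 where m1: "\<And>n h. n \<ge> m1 ==> norm h < q ==> hs_norm g K (\<lambda>u. G h (u - proj n u)) \<le> \<delta>"
  using G_complement_small[OF q \<delta>] by blast
 have "(\<lambda>N. 2 * (\<Lambda> * R * sqrt (r / real N)) * \<kappa>) \<longlonglongrightarrow> 2 * (\<Lambda> * R * sqrt 0) * \<kappa>"
  by (intro tendsto_intros lim_const_over_n)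
 hence "\<forall>\<^sub>F N in sequentially. 2 * (\<Lambda> * R * sqrt (r / real N)) * \<kappa> < e / 2"
  using e by (intro order_tendstoD(2)) auto
 then obtain m2 where m2: "\<And>N. N \<ge> m2 ==> 2 * (\<Lambda> * R * sqrt (r / real N)) * \<kappa> < e / 2"
  by (auto simp: eventually_sequentially)
 define m where "m = Suc (max m1 m2)"
 have "norm (controlled_path G x \<phi> t - euler x n (control_increment \<phi> N) (block_index N t)) \<le> e"
  if n: "n \<ge> m" "N \<ge> m" and \<phi>: "\<phi> \<in> L2" "cost \<phi> \<le> r" and t: "t \<in> {0..1}" for n N \<phi> t
 proof -
  have N: "N > 0" using n by (simp add: m_def)
  have "norm (controlled_path G x \<phi> t - euler x n (control_increment \<phi> N) (block_index N t)) \<le> 2 * (\<delta> * sqrt r + \<Lambda> * R * sqrt (r / N)) * exp (2 * \<Lambda>^2 * r)"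
  proof (rule euler_error[OF \<phi> r controlled_path_solution[OF \<phi>(1)] N _ _ _ t])
   show "1 + norm (controlled_path G x \<phi> t) \<le> R" if "t \<in> {0..1}" for t
    unfolding R_def \<kappa>_def by (rule solution_bound[OF \<phi> r controlled_path_solution[OF \<phi>(1)] that])
   fix i u assume i: "i \<le> N"
   let ?h = "euler x n (control_increment \<phi> N) i"
   have "1 + norm ?h \<le> q" unfolding q_def
    using control_increment_cost[OF \<phi>(1) N, of n] \<phi>(2) by (intro euler_bound[OF N _ i]) simp
   hence "norm ?h < q" by simp
   hence h: "hs_norm g K (\<lambda>u. G ?h (u - proj n u)) \<le> \<delta>" using n by (intro m1) (auto simp: m_def)
   show "norm (G ?h (u - proj n u)) \<le> \<delta> * norm u"
    using norm_le_hs_norm[OF onb G_complement_hilbert_schmidt[of ?h n], of u] mult_right_mono[OF h norm_ge_zero[of u]] by linarith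
  qed (use \<delta> in simp)
  also have "\<dots> = 2 * \<delta> * sqrt r * \<kappa> + 2 * (\<Lambda> * R * sqrt (r / N)) * \<kappa>" by (simp add: \<kappa>_def algebra_simps)
  also have "2 * \<delta> * sqrt r * \<kappa> = e / 2" using r \<kappa> by (simp add: \<delta>_def)
  also have "e / 2 + 2 * (\<Lambda> * R * sqrt (r / N)) * \<kappa> \<le> e" 
  proof -
   have "N \<ge> m2" using n by (simp add: m_def)
   thus ?thesis using m2[of N] by simp
  qed
  finally show ?thesis .
 qed
 moreover have "m > 0" by (simp add: m_def)
 ultimately show ?thesis by blast
qed

end

section \<open>Weak compactness of balls of controls\<close>

lemma L2_comb:
 assumes "\<phi> \<in> L2" "\<psi> \<in> L2"
 shows "(\<lambda>s. a *\<^sub>R \<phi> s + b *\<^sub>R \<psi> s) \<in> L2"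
proof -
 note [measurable] = assms[THEN L2_measurable]
 have "integrable (lebesgue_on {0..1}) (\<lambda>s. (norm (a *\<^sub>R \<phi> s + b *\<^sub>R \<psi> s))\<^sup>2)"
 proof (rule Bochner_Integration.integrable_bound)
  show "integrable (lebesgue_on {0..1}) (\<lambda>s. 2 * (a^2 * (norm (\<phi> s))^2) + 2 * (b^2 * (norm (\<psi> s))^2))"
   using assms[THEN L2_integrable] by (intro Bochner_Integration.integrable_add integrable_mult_right)
  show "AE s in lebesgue_on {0..1}. norm ((norm (a *\<^sub>R \<phi> s + b *\<^sub>R \<psi> s))^2) \<le> norm (2 * (a^2 * (norm (\<phi> s))^2) + 2 * (b^2 * (norm (\<psi> s))^2))"
   using square_norm_add_le[of "a *\<^sub>R \<phi> _" "b *\<^sub>R \<psi> _"] by (intro AE_I2) (simp add: power_mult_distrib)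
 qed measurable
 thus ?thesis by (simp add: L2_unit_interval_def)
qed

lemma L2_diff: "\<phi> \<in> L2 ==> \<psi> \<in> L2 ==> (\<lambda>s. \<phi> s - \<psi> s) \<in> L2"
 using L2_comb[of \<phi> \<psi> 1 "-1"] by simp

lemma cost_parallelogram:
 fixes \<phi> \<psi> :: "real => 'u::{real_inner, banach, second_countable_topology}"
 assumes "\<phi> \<in> L2" "\<psi> \<in> L2"
 shows "cost (\<lambda>s. \<phi> s - \<psi> s) = 2 * cost \<phi> + 2 * cost \<psi> - 4 * cost (\<lambda>s. (1/2) *\<^sub>R \<phi> s + (1/2) *\<^sub>R \<psi> s)"
proof -
 have pt: "(norm (a - b))^2 = 2 * (norm a)^2 + 2 * (norm b)^2 - 4 * (norm ((1/2) *\<^sub>R a + (1/2) *\<^sub>R b))^2" for a b :: 'u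
  by (simp add: power2_norm_eq_inner inner_add_left inner_add_right inner_diff_left inner_diff_right inner_commute algebra_simps)
 show ?thesis
  unfolding cost_def pt using assms[THEN L2_integrable] L2_integrable[OF L2_comb[OF assms, of "1/2" "1/2"]] by simp
qed

lemma cost_eq_nn_integral:
 assumes "\<phi> \<in> L2"
 shows "ennreal (cost \<phi>) = (\<integral>\<^sup>+s. ennreal ((norm (\<phi> s))^2) \<partial>lebesgue_on {0..1})"
 unfolding cost_def by (rule nn_integral_eq_integral[symmetric, OF L2_integrable[OF assms]]) simp

lemma emeasure_unit_interval: "emeasure (lebesgue_on {0..1::real}) {0..1} = 1"
 by (simp add: emeasure_restrict_space)

lemma L2_complete:
 fixes \<psi> :: "nat => real => 'u::{real_inner, banach, second_countable_topology}"
 assumes L: "\<And>p. \<psi> p \<in> L2" and \<eta>: "\<And>p q. p \<le> q ==> cost (\<lambda>s. \<psi> p s - \<psi> q s) \<le> \<eta> p" "\<eta> \<longlonglongrightarrow> 0"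
 shows "\<exists>\<phi>\<in>L2. \<forall>p. cost (\<lambda>s. \<psi> p s - \<phi> s) \<le> \<eta> p"
proof -
 let ?M = "lebesgue_on {0..1::real}"
 note [measurable] = L2_measurable[OF L]
 have "\<exists>p. \<forall>q\<ge>p. \<eta> q \<le> (1/4)^j" for j
 proof -
  have "\<forall>\<^sub>F q in sequentially. \<eta> q < (1/4)^j" using \<eta>(2) by (rule order_tendstoD) simp
  thus ?thesis by (force simp: eventually_sequentially)
 qed
 then obtain p where p: "\<And>j q. q \<ge> p j ==> \<eta> q \<le> (1/4)^j" by metis
 define a where "a j = j + (\<Sum>i\<le>j. p i)" for j
 have a: "a j \<ge> p j" "a j \<ge> j" "a j \<le> a (Suc j)" for j
  using member_le_sum[of j "{..j}" p] by (auto simp: a_def)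
 define D where "D j s = norm (\<psi> (a (Suc j)) s - \<psi> (a j) s)" for j s
 have [measurable]: "D j \<in> borel_measurable ?M" for j unfolding D_def[abs_def] by measurable
 have Dint: "(\<integral>\<^sup>+s. ennreal (D j s) \<partial>?M) \<le> ennreal ((1/2)^j)" for j
 proof -
  define c :: real where "c = 2^j"
  have c: "c > 0" by (simp add: c_def)
  have dL: "(\<lambda>s. \<psi> (a j) s - \<psi> (a (Suc j)) s) \<in> L2" by (intro L2_diff L)
  have "(\<integral>\<^sup>+s. ennreal (D j s) \<partial>?M) \<le> (\<integral>\<^sup>+s. ennreal (1 / (2 * c)) + ennreal (c / 2) * ennreal ((norm (\<psi> (a j) s - \<psi> (a (Suc j)) s))^2) \<partial>?M)"
  proof (rule nn_integral_mono)
   fix s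
   have "x \<le> 1 / (2 * c) + c / 2 * x^2" for x :: real
   proof -
    have "0 \<le> (c * x - 1)^2 / (2 * c)" using c by simp
    also have "\<dots> = 1 / (2 * c) + c / 2 * x^2 - x" using c by (simp add: power2_eq_square field_simps)
    finally show ?thesis by simp
   qed
   hence "ennreal (D j s) \<le> ennreal (1 / (2 * c) + c / 2 * (norm (\<psi> (a j) s - \<psi> (a (Suc j)) s))^2)"
    unfolding D_def by (intro ennreal_leI) (simp add: norm_minus_commute)
   thus "ennreal (D j s) \<le> ennreal (1 / (2 * c)) + ennreal (c / 2) * ennreal ((norm (\<psi> (a j) s - \<psi> (a (Suc j)) s))^2)"
    using c by (simp add: ennreal_mult[symmetric])
  qed
  also have "\<dots> = ennreal (1 / (2 * c)) + ennreal (c / 2) * ennreal (cost (\<lambda>s. \<psi> (a j) s - \<psi> (a (Suc j)) s))"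
   unfolding cost_eq_nn_integral[OF dL]
   by (subst nn_integral_add) (auto simp: nn_integral_cmult emeasure_unit_interval)
  also have "\<dots> \<le> ennreal (1 / (2 * c)) + ennreal (c / 2) * ennreal ((1/4)^j)"
   using order_trans[OF \<eta>(1)[OF a(3)[of j]] p[OF a(1)[of j]]] by (intro add_left_mono mult_left_mono ennreal_leI) auto
  also have "\<dots> = ennreal ((1/2)^j)"
  proof -
   have q: "(1/4)^j = 1 / (c * c)" "(1/2)^j = 1 / c" by (simp_all add: c_def power_divide power_mult_distrib[symmetric])
   show ?thesis unfolding q using c by (simp add: ennreal_mult[symmetric] ennreal_plus[symmetric] field_simps del: ennreal_plus)
  qed
  finally show ?thesis .
 qed
 have "(\<integral>\<^sup>+s. (\<Sum>j. ennreal (D j s)) \<partial>?M) = (\<Sum>j. \<integral>\<^sup>+s. ennreal (D j s) \<partial>?M)"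
  by (rule nn_integral_suminf) measurable
 also have "\<dots> \<le> (\<Sum>j. ennreal ((1/2)^j))" by (intro suminf_le Dint) auto
 also have "\<dots> = ennreal (\<Sum>j. (1/2)^j)" by (intro suminf_ennreal2) (auto intro: summable_geometric)
 also have "\<dots> < \<infinity>" by simp
 finally have "AE s in ?M. (\<Sum>j. ennreal (D j s)) \<noteq> \<infinity>" by (intro nn_integral_noteq_infinite) auto
 hence conv: "AE s in ?M. convergent (\<lambda>j. \<psi> (a j) s)"
 proof eventually_elim
  case (elim s)
  hence "summable (\<lambda>j. norm (\<psi> (a (Suc j)) s - \<psi> (a j) s))"
   unfolding D_def by (intro summable_suminf_not_top) auto
  hence "summable (\<lambda>j. \<psi> (a (Suc j)) s - \<psi> (a j) s)" by (rule summable_norm_cancel)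
  hence "convergent (\<lambda>n. \<Sum>j<n. \<psi> (a (Suc j)) s - \<psi> (a j) s)" by (simp add: summable_iff_convergent)
  hence "convergent (\<lambda>n. (\<Sum>j<n. \<psi> (a (Suc j)) s - \<psi> (a j) s) + \<psi> (a 0) s)"
   by (intro convergent_add convergent_const)
  thus ?case by (simp add: sum_lessThan_telescope[of "\<lambda>j. \<psi> (a j) s"])
 qed
 define \<phi> where "\<phi> s = lim (\<lambda>j. \<psi> (a j) s)" for s
 have [measurable]: "\<phi> \<in> borel_measurable ?M" unfolding \<phi>_def[abs_def] by (intro borel_measurable_lim_metric) measurable
 have bound: "(\<integral>\<^sup>+s. ennreal ((norm (\<psi> p s - \<phi> s))^2) \<partial>?M) \<le> ennreal (\<eta> p)" for p
 proof -
  have "(\<integral>\<^sup>+s. ennreal ((norm (\<psi> p s - \<phi> s))^2) \<partial>?M) = (\<integral>\<^sup>+s. liminf (\<lambda>j. ennreal ((norm (\<psi> p s - \<psi> (a j) s))^2)) \<partial>?M)"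
  proof (rule nn_integral_cong_AE)
   show "AE s in ?M. ennreal ((norm (\<psi> p s - \<phi> s))^2) = liminf (\<lambda>j. ennreal ((norm (\<psi> p s - \<psi> (a j) s))^2))"
    using conv
   proof eventually_elim
    case (elim s)
    hence "(\<lambda>j. \<psi> (a j) s) \<longlonglongrightarrow> \<phi> s" unfolding \<phi>_def by (simp add: convergent_LIMSEQ_iff)
    hence "(\<lambda>j. ennreal ((norm (\<psi> p s - \<psi> (a j) s))^2)) \<longlonglongrightarrow> ennreal ((norm (\<psi> p s - \<phi> s))^2)"
     by (intro tendsto_intros)
    thus ?case by (intro lim_imp_Liminf[symmetric]) auto
   qed
  qed
  also have "\<dots> \<le> liminf (\<lambda>j. \<integral>\<^sup>+s. ennreal ((norm (\<psi> p s - \<psi> (a j) s))^2) \<partial>?M)"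
   by (intro nn_integral_liminf) measurable
  also have "\<dots> \<le> ennreal (\<eta> p)"
  proof (rule Liminf_le)
   show "\<forall>\<^sub>F j in sequentially. (\<integral>\<^sup>+s. ennreal ((norm (\<psi> p s - \<psi> (a j) s))^2) \<partial>?M) \<le> ennreal (\<eta> p)"
    using eventually_ge_at_top[of p]
   proof eventually_elim
    case (elim j)
    hence "p \<le> a j" using a(2)[of j] by simp
    thus ?case
     unfolding cost_eq_nn_integral[OF L2_diff[OF L L], symmetric] by (intro ennreal_leI \<eta>(1))
   qed
  qed simp
  finally show ?thesis .
 qed
 have d: "(\<lambda>s. \<psi> p s - \<phi> s) \<in> L2" for p
 proof -
  have "integrable ?M (\<lambda>s. (norm (\<psi> p s - \<phi> s))\<^sup>2)"
   using bound[of p] by (intro integrableI_bounded) (auto intro: le_less_trans)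
  thus ?thesis by (simp add: L2_unit_interval_def)
 qed
 have "\<phi> \<in> L2" using L2_diff[OF L[of 0] d[of 0]] by simp
 moreover have "cost (\<lambda>s. \<psi> p s - \<phi> s) \<le> \<eta> p" for p
 proof -
  have "0 \<le> \<eta> p" using order_trans[OF cost_nonneg \<eta>(1)[of p p]] by simp
  thus ?thesis using bound[of p] unfolding cost_eq_nn_integral[OF d, symmetric] by simp
 qed
 ultimately show ?thesis by blast
qed

lemma cost_le_of_close:
 fixes \<phi> \<psi> :: "real => 'u::{real_inner, banach, second_countable_topology}"
 assumes "\<phi> \<in> L2" "\<psi> \<in> L2" "\<delta> > 0"
 shows "cost \<phi> \<le> (1 + \<delta>) * cost \<psi> + (1 + 1 / \<delta>) * cost (\<lambda>s. \<psi> s - \<phi> s)"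
proof -
 have pt: "(norm a)^2 \<le> (1 + \<delta>) * (norm b)^2 + (1 + 1 / \<delta>) * (norm (b - a))^2" for a b :: 'u
 proof -
  have "norm a \<le> norm b + norm (b - a)" by (metis norm_minus_commute norm_triangle_sub)
  hence "(norm a)^2 \<le> (norm b + norm (b - a))^2" by (intro power_mono) auto
  also have "\<dots> \<le> (1 + \<delta>) * (norm b)^2 + (1 + 1 / \<delta>) * (norm (b - a))^2"
  proof -
   define x y where "x = norm b" and "y = norm (b - a)"
   have "0 \<le> (\<delta> * x - y)^2 / \<delta>" using assms(3) by simp
   also have "\<dots> = \<delta> * x^2 - 2 * x * y + y^2 / \<delta>" using assms(3) by (simp add: power2_eq_square field_simps)
   finally show ?thesis unfolding x_def[symmetric] y_def[symmetric] by (simp add: power2_eq_square algebra_simps)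
  qed
  finally show ?thesis .
 qed
 have "cost \<phi> \<le> (LINT s|lebesgue_on {0..1}. (1 + \<delta>) * (norm (\<psi> s))^2 + (1 + 1 / \<delta>) * (norm (\<psi> s - \<phi> s))^2)"
  unfolding cost_def using L2_integrable[OF assms(1)] L2_integrable[OF assms(2)] L2_integrable[OF L2_diff[OF assms(2,1)]] pt
  by (intro integral_mono Bochner_Integration.integrable_add integrable_mult_right)
 also have "\<dots> = (1 + \<delta>) * cost \<psi> + (1 + 1 / \<delta>) * cost (\<lambda>s. \<psi> s - \<phi> s)"
  unfolding cost_def using L2_integrable[OF assms(2)] L2_integrable[OF L2_diff[OF assms(2,1)]] by simp
 finally show ?thesis .
qed

text \<open>
 The weak limit is the limit of near-minimisers of the cost over the decreasing sets of controls
 on which the first functionals are close to their limits; these sets are midpoint convex, so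
 that near-minimisers form a Cauchy sequence by the parallelogram law.
\<close>

lemma L2_weakly_compact:
 fixes \<phi> :: "nat => real => 'u::{real_inner, banach, second_countable_topology}" and l :: "nat => (real => 'u) => real"
 assumes L: "\<And>m. \<phi> m \<in> L2" and \<rho>: "\<And>m. cost (\<phi> m) \<le> \<rho> m" "\<rho> \<longlonglongrightarrow> r"
  and mid: "\<And>n \<psi> \<psi>'. \<psi> \<in> L2 ==> \<psi>' \<in> L2 ==> l n (\<lambda>s. (1/2) *\<^sub>R \<psi> s + (1/2) *\<^sub>R \<psi>' s) = (l n \<psi> + l n \<psi>') / 2"
  and cont: "\<And>n \<psi> \<psi>'. \<psi> \<in> L2 ==> \<psi>' \<in> L2 ==> \<bar>l n \<psi> - l n \<psi>'\<bar> \<le> sqrt (cost (\<lambda>s. \<psi> s - \<psi>' s))"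
  and bdd: "\<And>n \<psi>. \<psi> \<in> L2 ==> \<bar>l n \<psi>\<bar> \<le> sqrt (cost \<psi>)"
 shows "\<exists>(s :: nat => nat) \<psi>. strict_mono s \<and> \<psi> \<in> L2 \<and> cost \<psi> \<le> r \<and> (\<forall>n. (\<lambda>m. l n (\<phi> (s m))) \<longlonglongrightarrow> l n \<psi>)"
proof -
 obtain B where B: "\<And>m. \<bar>\<rho> m\<bar> \<le> B" using convergent_imp_Bseq[OF convergentI[OF \<rho>(2)]] by (auto simp: Bseq_def)
 have lb: "l n (\<phi> m) \<in> {- sqrt B..sqrt B}" for n m
 proof -
  have "sqrt (cost (\<phi> m)) \<le> sqrt B" using \<rho>(1)[of m] B[of m] by simp
  hence "\<bar>l n (\<phi> m)\<bar> \<le> sqrt B" using bdd[OF L, of n m] by linarith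
  thus ?thesis by (auto simp: abs_le_iff)
 qed
 interpret subseqs "\<lambda>n s. convergent (\<lambda>m. l n (\<phi> (s m)))"
 proof
  fix n and s :: "nat => nat"
  have "compact {- sqrt B..sqrt B}" by simp
  then obtain c q where "strict_mono q" "((\<lambda>m. l n (\<phi> (s m))) \<circ> q) \<longlonglongrightarrow> c"
   using lb unfolding compact_def by (metis (no_types, lifting))
  thus "\<exists>r'. strict_mono r' \<and> convergent (\<lambda>m. l n (\<phi> ((s \<circ> r') m)))"
   by (intro exI[of _ q]) (auto simp: convergent_def o_def)
 qed
 define s where "s = diagseq"
 have s: "strict_mono s" unfolding s_def by (rule subseq_diagseq)
 have "convergent (\<lambda>m. l n (\<phi> (s m)))" for n
 proof -
  have "convergent (\<lambda>m. l n (\<phi> ((diagseq \<circ> ((+) (Suc n))) m)))"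
  proof (rule diagseq_holds)
   fix r s :: "nat => nat" and n assume "strict_mono r" "convergent (\<lambda>m. l n (\<phi> (s m)))"
   thus "convergent (\<lambda>m. l n (\<phi> ((s \<circ> r) m)))"
    using LIMSEQ_subseq_LIMSEQ[of "\<lambda>m. l n (\<phi> (s m))" _ r] by (auto simp: convergent_def o_def)
  qed
  hence "convergent (\<lambda>m. l n (\<phi> (s (m + Suc n))))" by (simp add: s_def o_def add.commute)
  thus ?thesis using convergent_ignore_initial_segment[of "\<lambda>m. l n (\<phi> (s m))" "Suc n"] by simp
 qed
 then obtain c where c: "\<And>n. (\<lambda>m. l n (\<phi> (s m))) \<longlonglongrightarrow> c n" unfolding convergent_def by metis
 define C where "C p = {\<psi> \<in> L2. \<forall>n\<le>p. \<bar>l n \<psi> - c n\<bar> \<le> 1 / real (Suc p)}" for p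
 have C_L: "\<psi> \<in> C p ==> \<psi> \<in> L2" for \<psi> p by (simp add: C_def)
 have C_mono: "C q \<subseteq> C p" if "p \<le> q" for p q
 proof
  fix \<psi> assume \<psi>: "\<psi> \<in> C q"
  have "1 / real (Suc q) \<le> 1 / real (Suc p)" using that by (intro divide_left_mono) auto
  moreover have "\<bar>l n \<psi> - c n\<bar> \<le> 1 / real (Suc q)" if "n \<le> p" for n
   using \<psi> that \<open>p \<le> q\<close> by (simp add: C_def)
  ultimately have "\<bar>l n \<psi> - c n\<bar> \<le> 1 / real (Suc p)" if "n \<le> p" for n
   using that by (blast intro: order_trans)
  thus "\<psi> \<in> C p" using \<psi> by (simp add: C_def)
 qed
 have C_ev: "\<forall>\<^sub>F m in sequentially. \<phi> (s m) \<in> C p" for p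
 proof -
  have "\<forall>\<^sub>F m in sequentially. \<forall>n\<in>{..p}. dist (l n (\<phi> (s m))) (c n) < 1 / real (Suc p)"
   using c by (intro eventually_ball_finite) (auto intro!: tendstoD)
  thus ?thesis by eventually_elim (use L in \<open>auto simp: C_def dist_real_def less_imp_le\<close>)
 qed
 define d where "d p = Inf (cost ` C p)" for p
 have bb: "bdd_below (cost ` C p)" for p using cost_nonneg by (intro bdd_belowI2[where m=0]) auto
 have C_ne: "C p \<noteq> {}" for p using C_ev[of p] by (auto simp: eventually_sequentially)
 have d_le: "d p \<le> cost \<psi>" if "\<psi> \<in> C p" for p \<psi> unfolding d_def using that by (intro cINF_lower bb)
 have d_r: "d p \<le> r" for p
 proof (rule tendsto_lowerbound)
  show "(\<lambda>m. \<rho> (s m)) \<longlonglongrightarrow> r" using LIMSEQ_subseq_LIMSEQ[OF \<rho>(2) s] by (simp add: o_def)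
  show "\<forall>\<^sub>F m in sequentially. d p \<le> \<rho> (s m)"
   using C_ev[of p] by eventually_elim (use d_le \<rho>(1) order_trans in blast)
 qed simp
 have d_mono: "d p \<le> d q" if "p \<le> q" for p q
  unfolding d_def by (intro cInf_superset_mono image_mono C_mono that bb) (use C_ne in auto)
 have "\<exists>\<psi>\<in>C p. cost \<psi> < d p + 1 / real (Suc p)" for p
 proof -
  have "Inf (cost ` C p) < d p + 1 / real (Suc p)" by (simp add: d_def)
  thus ?thesis using cInf_lessD[of "cost ` C p"] C_ne by blast
 qed
 then obtain \<psi> where \<psi>: "\<And>p. \<psi> p \<in> C p" "\<And>p. cost (\<psi> p) < d p + 1 / real (Suc p)" by metis
 have inc: "incseq d" using d_mono by (simp add: incseq_def)
 then obtain D where D: "d \<longlonglongrightarrow> D" "\<And>p. d p \<le> D"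
  using incseq_convergent[of d r] d_r by blast
 define \<eta> where "\<eta> p = 2 * (D - d p) + 4 / real (Suc p)" for p
 have \<eta>0: "\<eta> \<longlonglongrightarrow> 0"
 proof -
  have "\<eta> \<longlonglongrightarrow> 2 * (D - D) + 0"
   unfolding \<eta>_def by (intro tendsto_intros D(1) LIMSEQ_Suc[OF lim_const_over_n])
  thus ?thesis by simp
 qed
 have cauchy: "cost (\<lambda>s. \<psi> p s - \<psi> q s) \<le> \<eta> p" if pq: "p \<le> q" for p q
 proof -
  have Lp: "\<psi> p \<in> L2" "\<psi> q \<in> L2" using \<psi>(1) C_L by auto
  let ?h = "\<lambda>s. (1/2) *\<^sub>R \<psi> p s + (1/2) *\<^sub>R \<psi> q s"
  have qC: "\<psi> q \<in> C p" using \<psi>(1)[of q] C_mono[OF pq] by auto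
  have "?h \<in> C p"
  proof -
   have "\<bar>l n ?h - c n\<bar> \<le> 1 / real (Suc p)" if n: "n \<le> p" for n
   proof -
    have "\<bar>l n (\<psi> p) - c n\<bar> \<le> 1 / real (Suc p)" "\<bar>l n (\<psi> q) - c n\<bar> \<le> 1 / real (Suc p)"
     using \<psi>(1)[of p] qC n by (auto simp: C_def)
    thus ?thesis unfolding mid[OF Lp] by (simp add: abs_le_iff field_simps)
   qed
   thus ?thesis using L2_comb[OF Lp] by (simp add: C_def)
  qed
  hence 1: "d p \<le> cost ?h" by (rule d_le)
  have 2: "cost (\<psi> q) < D + 1 / real (Suc p)"
  proof -
   have "1 / real (Suc q) \<le> 1 / real (Suc p)" using pq by (intro divide_left_mono) auto
   thus ?thesis using \<psi>(2)[of q] D(2)[of q] by linarith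
  qed
  have gen: "2 * P + 2 * Q - 4 * H \<le> 2 * (D - d') + 4 * u" if "d' \<le> H" "P < d' + u" "Q < D + u" for P Q H d' u :: real
   using that by simp
  show ?thesis unfolding cost_parallelogram[OF Lp] \<eta>_def using gen[OF 1 \<psi>(2) 2] by simp
 qed
 obtain \<xi> where \<xi>: "\<xi> \<in> L2" "\<And>p. cost (\<lambda>s. \<psi> p s - \<xi> s) \<le> \<eta> p"
  using L2_complete[of \<psi> \<eta>] \<psi>(1) C_L cauchy \<eta>0 by blast
 have "cost \<xi> \<le> r"
 proof -
  have a: "cost \<xi> \<le> (1 + \<delta>) * r" if \<delta>: "\<delta> > 0" for \<delta>
  proof (rule tendsto_lowerbound)
   show "(\<lambda>p. (1 + \<delta>) * (r + 1 / real (Suc p)) + (1 + 1 / \<delta>) * \<eta> p) \<longlonglongrightarrow> (1 + \<delta>) * r"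
   proof -
    have "(\<lambda>p. (1 + \<delta>) * (r + 1 / real (Suc p)) + (1 + 1 / \<delta>) * \<eta> p) \<longlonglongrightarrow> (1 + \<delta>) * (r + 0) + (1 + 1 / \<delta>) * 0"
     by (intro tendsto_intros \<eta>0 LIMSEQ_Suc[OF lim_const_over_n])
    thus ?thesis by simp
   qed
   show "\<forall>\<^sub>F p in sequentially. cost \<xi> \<le> (1 + \<delta>) * (r + 1 / real (Suc p)) + (1 + 1 / \<delta>) * \<eta> p"
   proof (intro always_eventually allI)
    fix p
    have "cost \<xi> \<le> (1 + \<delta>) * cost (\<psi> p) + (1 + 1 / \<delta>) * cost (\<lambda>s. \<psi> p s - \<xi> s)"
     using \<psi>(1) C_L by (intro cost_le_of_close \<xi>(1) \<delta>) auto
    also have "\<dots> \<le> (1 + \<delta>) * (r + 1 / real (Suc p)) + (1 + 1 / \<delta>) * \<eta> p"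
     using \<psi>(2)[of p] d_r[of p] \<xi>(2)[of p] \<delta> by (intro add_mono mult_left_mono) auto
    finally show "cost \<xi> \<le> (1 + \<delta>) * (r + 1 / real (Suc p)) + (1 + 1 / \<delta>) * \<eta> p" .
   qed
  qed simp
  show ?thesis
  proof (rule tendsto_lowerbound)
   show "((\<lambda>\<delta>. (1 + \<delta>) * r) \<longlongrightarrow> r) (at_right 0)" by (auto intro!: tendsto_eq_intros)
   show "\<forall>\<^sub>F \<delta> in at_right 0. cost \<xi> \<le> (1 + \<delta>) * r" using a by (auto simp: eventually_at_right_less intro: eventually_mono[OF eventually_at_right_less])
  qed simp
 qed
 moreover have "l n \<xi> = c n" for n
 proof -
  have 1: "(\<lambda>p. l n (\<psi> p)) \<longlonglongrightarrow> c n"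
  proof (rule LIMSEQ_I)
   fix e :: real assume "e > 0"
   then obtain N where N: "1 / real (Suc N) < e" using nat_approx_posE by blast
   have "norm (l n (\<psi> p) - c n) < e" if "p \<ge> max n N" for p
   proof -
    have "\<bar>l n (\<psi> p) - c n\<bar> \<le> 1 / real (Suc p)" using \<psi>(1)[of p] that by (auto simp: C_def)
    also have "\<dots> \<le> 1 / real (Suc N)" using that by (intro divide_left_mono) auto
    finally show ?thesis using N by simp
   qed
   thus "\<exists>no. \<forall>p\<ge>no. norm (l n (\<psi> p) - c n) < e" by blast
  qed
  have 2: "(\<lambda>p. l n (\<psi> p)) \<longlonglongrightarrow> l n \<xi>"
  proof (rule LIM_zero_cancel, rule tendsto_rabs_zero_cancel, rule tendsto_sandwich[OF _ _ tendsto_const])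
   show "(\<lambda>p. sqrt (\<eta> p)) \<longlonglongrightarrow> 0" using tendsto_real_sqrt[OF \<eta>0] by simp
   show "\<forall>\<^sub>F p in sequentially. \<bar>l n (\<psi> p) - l n \<xi>\<bar> \<le> sqrt (\<eta> p)"
   proof (intro always_eventually allI)
    fix p
    have "\<bar>l n (\<psi> p) - l n \<xi>\<bar> \<le> sqrt (cost (\<lambda>s. \<psi> p s - \<xi> s))" using \<psi>(1) C_L \<xi>(1) by (intro cont) auto
    also have "\<dots> \<le> sqrt (\<eta> p)" using \<xi>(2) by simp
    finally show "\<bar>l n (\<psi> p) - l n \<xi>\<bar> \<le> sqrt (\<eta> p)" .
   qed
  qed auto
  show ?thesis by (rule LIMSEQ_unique[OF 2 1])
 qed
 ultimately show ?thesis using s \<xi>(1) c by (intro exI[of _ s] exI[of _ \<xi>]) auto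
qed

lemma increment_comb:
 fixes \<phi> \<psi> :: "real => 'u::{real_inner, banach, second_countable_topology}"
 assumes "\<phi> \<in> L2" "\<psi> \<in> L2" "i < N"
 shows "increment (\<lambda>s. a *\<^sub>R \<phi> s + b *\<^sub>R \<psi> s) N i = a *\<^sub>R increment \<phi> N i + b *\<^sub>R increment \<psi> N i"
proof -
 have "set_integrable lebesgue (block N i) \<phi>" "set_integrable lebesgue (block N i) \<psi>"
  using assms by (auto intro!: set_integrable_unit L2_integrable_self block_lebesgue block_subset(2))
 thus ?thesis unfolding increment_def by (simp add: set_integral_add(2))
qed

lemma norm_increment_le:
 assumes "\<phi> \<in> L2" "i < N"
 shows "norm (increment \<phi> N i) \<le> sqrt (cost \<phi>)"
proof -
 note b = block_subset[OF assms(2)]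
 have "norm (increment \<phi> N i) \<le> (LINT s:block N i|lebesgue. norm (\<phi> s))"
  unfolding increment_def by (intro norm_set_integral_le set_integrable_unit[OF L2_norm_integrable[OF assms(1)]] block_lebesgue b) simp
 also have "\<dots> \<le> sqrt ((1 - 0) * cost \<phi>)"
  by (rule L2_norm_integral_le_cost[OF assms(1) block_lebesgue b(2)]) auto
 finally show ?thesis by simp
qed

context coefficient
begin

lemma control_increments_weakly_compact:
 assumes L: "\<And>m. \<phi> m \<in> L2" and \<rho>: "\<And>m. cost (\<phi> m) \<le> \<rho> m" "\<rho> \<longlonglongrightarrow> r"
 shows "\<exists>(s :: nat => nat) \<psi>. strict_mono s \<and> \<psi> \<in> L2 \<and> cost \<psi> \<le> r \<and>
  (\<forall>N i k. i < N --> k \<in> K --> (\<lambda>m. control_increment (\<phi> (s m)) N i k) \<longlonglongrightarrow> control_increment \<psi> N i k)"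
proof -
 define l where "l n \<psi> = (case from_nat n of (N, i, k) => if i < N \<and> k \<in> K then control_increment \<psi> N i k else 0)" for n :: nat and \<psi>
 have gk: "\<bar>g k \<bullet> u\<bar> \<le> norm u" if "k \<in> K" for k u
  using Cauchy_Schwarz_ineq2[of "g k" u] basis_norm[OF onb that] by simp
 have "\<exists>s \<psi>. strict_mono s \<and> \<psi> \<in> L2 \<and> cost \<psi> \<le> r \<and> (\<forall>n. (\<lambda>m. l n (\<phi> (s m))) \<longlonglongrightarrow> l n \<psi>)"
 proof (rule L2_weakly_compact[OF L \<rho>])
  fix n :: nat and \<psi> \<psi>' :: "real => 'u" assume \<psi>: "\<psi> \<in> L2" "\<psi>' \<in> L2"
  obtain N i k where n: "from_nat n = (N :: nat, i :: nat, k :: nat)" using prod_cases3 by blast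
  show "l n (\<lambda>s. (1/2) *\<^sub>R \<psi> s + (1/2) *\<^sub>R \<psi>' s) = (l n \<psi> + l n \<psi>') / 2"
   by (simp add: l_def n control_increment_def increment_comb[OF \<psi>] inner_add_right)
  show "\<bar>l n \<psi> - l n \<psi>'\<bar> \<le> sqrt (cost (\<lambda>s. \<psi> s - \<psi>' s))"
  proof (cases "i < N \<and> k \<in> K")
   case True
   have "l n \<psi> - l n \<psi>' = g k \<bullet> increment (\<lambda>s. \<psi> s - \<psi>' s) N i"
    using increment_comb[OF \<psi>, of i N 1 "-1"] True by (simp add: l_def n control_increment_def inner_diff_right)
   thus ?thesis using gk[of k "increment (\<lambda>s. \<psi> s - \<psi>' s) N i"] norm_increment_le[OF L2_diff[OF \<psi>], of i N] True by simp
  next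
   case False
   hence "l n \<psi> = 0" "l n \<psi>' = 0" by (auto simp: l_def n)
   thus ?thesis by (simp add: cost_nonneg)
  qed
 next
  fix n :: nat and \<psi> :: "real => 'u" assume \<psi>: "\<psi> \<in> L2"
  obtain N i k where n: "from_nat n = (N :: nat, i :: nat, k :: nat)" using prod_cases3 by blast
  show "\<bar>l n \<psi>\<bar> \<le> sqrt (cost \<psi>)"
   using gk[of k "increment \<psi> N i"] norm_increment_le[OF \<psi>, of i N] by (auto simp: l_def n control_increment_def cost_nonneg)
 qed
 then obtain s \<psi> where s: "strict_mono s" "\<psi> \<in> L2" "cost \<psi> \<le> r" "\<And>n. (\<lambda>m. l n (\<phi> (s m))) \<longlonglongrightarrow> l n \<psi>"
  by blast
 have "(\<lambda>m. control_increment (\<phi> (s m)) N i k) \<longlonglongrightarrow> control_increment \<psi> N i k" if "i < N" "k \<in> K" for N i k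
  using s(4)[of "to_nat (N, i, k)"] that by (simp add: l_def)
 thus ?thesis using s by blast
qed

lemma euler_tendsto:
 assumes "\<And>j k. j < N ==> k \<in> K ==> (\<lambda>m. v m j k) \<longlonglongrightarrow> w j k" "i \<le> N"
 shows "(\<lambda>m. euler x n (v m) i) \<longlonglongrightarrow> euler x n w i"
 using assms(2)
proof (induction i)
 case (Suc i)
 hence IH: "(\<lambda>m. euler x n (v m) i) \<longlonglongrightarrow> euler x n w i" by simp
 have "(\<lambda>m. G (euler x n (v m) i) (g k)) \<longlonglongrightarrow> G (euler x n w i) (g k)" for k
  by (rule continuous_on_tendsto_compose[OF G_continuous[of UNIV] IH]) auto
 thus ?case
  unfolding euler.simps using Suc.prems modes(2)
  by (intro tendsto_add IH tendsto_sum tendsto_scaleR assms(1)) auto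
qed simp

lemma controlled_paths_compact:
 assumes L: "\<And>m. \<phi> m \<in> L2" and \<rho>: "\<And>m. cost (\<phi> m) \<le> \<rho> m" "\<rho> \<longlonglongrightarrow> r"
 shows "\<exists>(s :: nat => nat) \<psi>. strict_mono s \<and> \<psi> \<in> L2 \<and> cost \<psi> \<le> r \<and>
  (\<forall>e>0. \<exists>m0. \<forall>m\<ge>m0. \<forall>t\<in>{0..1}. norm (controlled_path G x (\<phi> (s m)) t - controlled_path G x \<psi> t) \<le> e)"
proof -
 obtain s \<psi> where s: "strict_mono s" "\<psi> \<in> L2" "cost \<psi> \<le> r"
  and v: "\<And>N i k. i < N ==> k \<in> K ==> (\<lambda>m. control_increment (\<phi> (s m)) N i k) \<longlonglongrightarrow> control_increment \<psi> N i k"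
  using control_increments_weakly_compact[OF L \<rho>] by blast
 obtain B where B: "\<And>m. \<bar>\<rho> m\<bar> \<le> B" using convergent_imp_Bseq[OF convergentI[OF \<rho>(2)]] by (auto simp: Bseq_def)
 define R where "R = max 1 (max B r)"
 have R: "R > 0" "cost \<psi> \<le> R" "cost (\<phi> m) \<le> R" for m
  using s(3) order_trans[OF \<rho>(1)[of m]] B[of m] by (auto simp: R_def le_max_iff_disj abs_le_iff intro: order_trans[OF \<rho>(1)])
 have "\<exists>m0. \<forall>m\<ge>m0. \<forall>t\<in>{0..1}. norm (controlled_path G x (\<phi> (s m)) t - controlled_path G x \<psi> t) \<le> e" if e: "e > 0" for e
 proof -
  have e3: "e / 3 > 0" using e by simp
  obtain N where N: "N > 0" and ap: "\<And>\<phi> t. \<phi> \<in> L2 ==> cost \<phi> \<le> R ==> t \<in> {0..1} ==>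
    norm (controlled_path G x \<phi> t - euler x N (control_increment \<phi> N) (block_index N t)) \<le> e / 3"
   using euler_approximation[OF R(1) e3, of x] by blast
  have "\<forall>\<^sub>F m in sequentially. \<forall>i\<in>{..N}. dist (euler x N (control_increment (\<phi> (s m)) N) i) (euler x N (control_increment \<psi> N) i) < e / 3"
  proof (rule eventually_ball_finite)
   show "\<forall>i\<in>{..N}. \<forall>\<^sub>F m in sequentially. dist (euler x N (control_increment (\<phi> (s m)) N) i) (euler x N (control_increment \<psi> N) i) < e / 3"
    using v by (intro ballI tendstoD[OF _ e3] euler_tendsto[of N]) auto
  qed simp
  then obtain m0 where m0: "\<And>m i. m \<ge> m0 ==> i \<le> N ==> dist (euler x N (control_increment (\<phi> (s m)) N) i) (euler x N (control_increment \<psi> N) i) < e / 3"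
   by (auto simp: eventually_sequentially)
  have "norm (controlled_path G x (\<phi> (s m)) t - controlled_path G x \<psi> t) \<le> e" if m: "m \<ge> m0" and t: "t \<in> {0..1}" for m t
  proof -
   let ?i = "block_index N t"
   have i: "?i \<le> N" using block_index_mem(2)[OF N, of t] t by (cases "t = 0") (auto simp: block_index_0)
   have 1: "norm (controlled_path G x (\<phi> (s m)) t - euler x N (control_increment (\<phi> (s m)) N) ?i) \<le> e / 3" by (rule ap[OF L R(3) t])
   have 2: "norm (controlled_path G x \<psi> t - euler x N (control_increment \<psi> N) ?i) \<le> e / 3" by (rule ap[OF s(2) R(2) t])
   have 3: "norm (euler x N (control_increment (\<phi> (s m)) N) ?i - euler x N (control_increment \<psi> N) ?i) \<le> e / 3"
    using m0[OF m i] by (simp add: dist_norm)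
   have "norm ((a - b) + (b - c) - (d - c)) \<le> norm (a - b) + norm (b - c) + norm (d - c)" for a b c d :: 'h
    by (rule order_trans[OF norm_triangle_ineq4 add_mono[OF norm_triangle_ineq order_refl]])
   from this[of "controlled_path G x (\<phi> (s m)) t" "euler x N (control_increment (\<phi> (s m)) N) ?i" "euler x N (control_increment \<psi> N) ?i" "controlled_path G x \<psi> t"]
   show ?thesis using 1 2 3 by simp
  qed
  thus ?thesis by blast
 qed
 thus ?thesis using s by (intro exI[of _ s] exI[of _ \<psi>] conjI allI impI) auto
qed

definition step_control :: "nat => nat => (nat => nat => real) => real => 'u" where
 "step_control n N v s = (\<Sum>i<N. indicator (block N i) s *\<^sub>R (real N *\<^sub>R (\<Sum>k\<in>modes n. v i k *\<^sub>R g k)))"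

lemma step_control:
 assumes N: "N > 0"
 shows "step_control n N v \<in> L2" "cost (step_control n N v) = noise_cost n N v"
  and "i < N ==> increment (step_control n N v) N i = (\<Sum>k\<in>modes n. v i k *\<^sub>R g k)"
proof -
 define c where "c i = real N *\<^sub>R (\<Sum>k\<in>modes n. v i k *\<^sub>R g k)" for i
 have dis: "s \<in> block N j \<longleftrightarrow> j = i" if "s \<in> block N i" for i j s
  using that block_index_eq[OF N that] block_index_eq[OF N, of s j] by auto
 have val: "step_control n N v s = c i" if "i < N" "s \<in> block N i" for i s
 proof -
  have "step_control n N v s = (\<Sum>j<N. if j = i then c i else 0)"
   unfolding step_control_def c_def by (intro sum.cong refl) (auto simp: indicator_def dis[OF that(2)])
  thus ?thesis using that(1) by simp
 qed
 have off: "step_control n N v s = 0" if "\<And>i. i < N ==> s \<notin> block N i" for s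
  unfolding step_control_def using that by (intro sum.neutral) auto
 have sq: "(norm (step_control n N v s))^2 = (\<Sum>i<N. indicator (block N i) s * (norm (c i))^2)" for s
 proof (cases "\<exists>i<N. s \<in> block N i")
  case True
  then obtain i where i: "i < N" "s \<in> block N i" by blast
  have "(\<Sum>j<N. indicator (block N j) s * (norm (c j))^2) = (\<Sum>j<N. if j = i then (norm (c i))\<^sup>2 else 0)"
   by (intro sum.cong refl) (auto simp: indicator_def dis[OF i(2)])
  thus ?thesis using val[OF i] i by simp
 next
  case False
  hence "(\<Sum>j<N. indicator (block N j) s * (norm (c j))^2) = 0" by (intro sum.neutral) auto
  thus ?thesis using off[of s] False by auto
 qed
 have mb: "block N i \<in> sets (lebesgue_on {0..1})" if "i < N" for i
  using block_lebesgue block_subset(2)[OF that] by (simp add: sets_restrict_space_iff)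
 have em: "emeasure lebesgue (block N i) = ennreal (1 / N)" if "i < N" for i
  using N by (simp add: block_def add_divide_distrib divide_right_mono)
 have mm: "measure lebesgue (block N i) = 1 / N" if "i < N" for i using em[OF that] by (simp add: measure_def)
 have emr: "emeasure (lebesgue_on {0..1}) (block N i) = ennreal (1 / N)" if "i < N" for i
  using em[OF that] block_subset(2)[OF that] block_lebesgue by (subst emeasure_restrict_space) auto
 have ii: "integrable (lebesgue_on {0..1}) (\<lambda>s. indicator (block N i) s * (norm (c i))^2)" if "i < N" for i
  using mb[OF that] emr[OF that] by (intro integrable_mult_left integrable_real_indicator) auto
 have "step_control n N v \<in> borel_measurable (lebesgue_on {0..1})"
  unfolding step_control_def[abs_def] using mb by (intro borel_measurable_sum borel_measurable_scaleR borel_measurable_indicator) auto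
 moreover have "integrable (lebesgue_on {0..1}) (\<lambda>s. (norm (step_control n N v s))\<^sup>2)"
  unfolding sq using ii by (intro Bochner_Integration.integrable_sum) auto
 ultimately show "step_control n N v \<in> L2" by (simp add: L2_unit_interval_def)
 have "cost (step_control n N v) = (\<Sum>i<N. (LINT s|lebesgue_on {0..1}. indicator (block N i) s * (norm (c i))^2))"
  unfolding cost_def sq using ii by (intro Bochner_Integration.integral_sum) auto
 also have "\<dots> = (\<Sum>i<N. 1 / N * (norm (c i))^2)"
 proof (intro sum.cong refl)
  fix i assume "i \<in> {..<N}"
  hence i: "i < N" by simp
  have "block N i \<inter> space (lebesgue_on {0..1}) = block N i" using block_subset(2)[OF i] by (auto simp: space_restrict_space)
  hence "(LINT s|lebesgue_on {0..1}. indicat_real (block N i) s) = 1 / N"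
   using emr[OF i] by (simp add: measure_def)
  thus "(LINT s|lebesgue_on {0..1}. indicator (block N i) s * (norm (c i))^2) = 1 / N * (norm (c i))^2"
   by simp
 qed
 also have "\<dots> = noise_cost n N v"
  unfolding noise_cost_def sum_distrib_left c_def
  using N basis_sum_norm[OF onb modes] by (intro sum.cong refl) (simp add: power_mult_distrib power2_eq_square[of "real N"] sum_distrib_left)
 finally show "cost (step_control n N v) = noise_cost n N v" .
 assume i: "i < N"
 have "increment (step_control n N v) N i = (LINT s:block N i|lebesgue. c i)"
  unfolding increment_def by (intro set_lebesgue_integral_cong block_lebesgue) (use val[OF i] in auto)
 also have "\<dots> = measure lebesgue (block N i) *\<^sub>R c i"
  unfolding set_lebesgue_integral_def using em[OF i] block_lebesgue[of N i]
  by (subst integral_scaleR_left) (auto intro: integrable_real_indicator)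
 also have "\<dots> = (\<Sum>k\<in>modes n. v i k *\<^sub>R g k)" using N mm[OF i] by (simp add: c_def)
 finally show "increment (step_control n N v) N i = (\<Sum>k\<in>modes n. v i k *\<^sub>R g k)" .
qed

lemma euler_cong:
 "(\<And>j k. j < i ==> k \<in> modes n ==> v j k = w j k) ==> euler x n v i = euler x n w i"
 by (induction i) (auto intro!: arg_cong2[where f="(+)"] sum.cong)

lemma euler_step_control:
 assumes N: "N > 0" "i \<le> N"
 shows "euler x n (control_increment (step_control n N v) N) i = euler x n v i"
proof (rule euler_cong)
 fix j k assume j: "j < i" and k: "k \<in> modes n"
 have "k \<in> K" using k modes(2) by auto
 thus "control_increment (step_control n N v) N j k = v j k"
  using N j k by (simp add: control_increment_def step_control(3)[OF N(1)] basis_sum_inner[OF onb modes \<open>k \<in> K\<close>])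
qed

end

lemma hs2_measurable:
 fixes A :: "'s => 'u => 'h::{real_normed_vector, second_countable_topology}"
 assumes "\<And>k. k \<in> K ==> (\<lambda>s. A s (g k)) \<in> borel_measurable N"
 shows "(\<lambda>s. hs2 g K (A s)) \<in> borel_measurable N"
proof -
 have "hs2 g K (A s) = (\<Sum>k. indicator K k * ennreal ((norm (A s (g k)))^2))" for s
  unfolding hs2_def
  by (subst nn_integral_count_space_indicator) (auto simp: nn_integral_count_space_nat mult.commute)
 moreover have "(\<lambda>s. indicator K k * ennreal ((norm (A s (g k)))^2)) \<in> borel_measurable N" for k
 proof (cases "k \<in> K")
  case True
  note [measurable] = assms[OF True]
  show ?thesis by measurable
 qed simp
 ultimately show ?thesis by simp
qed

lemma hs2_finite_support:
 assumes "finite J" "J \<subseteq> K" "\<And>k. k \<in> K - J ==> A (g k) = 0"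
 shows "hs2 g K A = ennreal (\<Sum>k\<in>J. (norm (A (g k)))\<^sup>2)"
proof -
 have "hs2 g K A = (\<Sum>k\<in>J. ennreal ((norm (A (g k)))^2))"
  unfolding hs2_def using assms by (intro nn_integral_count_space'[OF assms(1)]) auto
 thus ?thesis by (simp add: sum_ennreal)
qed

section \<open>An exponential supermartingale\<close>

lemma normal_exp_square:
 fixes m \<sigma> :: "'h::real_inner"
 assumes b: "2 * (norm \<sigma>)^2 < b"
 shows "(\<integral>\<^sup>+y. ennreal (exp ((norm (m + y *\<^sub>R \<sigma>))^2 / b)) \<partial>gauss)
  \<le> ennreal (sqrt (b / (b - 2 * (norm \<sigma>)^2)) * exp ((norm m)^2 / (b - 2 * (norm \<sigma>)^2)))"
proof -
 define q where "q = (norm \<sigma>)^2"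
 define p where "p = m \<bullet> \<sigma>"
 define B where "B = b - 2 * q"
 have q: "q \<ge> 0" by (simp add: q_def)
 have B: "B > 0" "b > 0" "b = B + 2 * q" using b q unfolding B_def q_def by linarith+
 define v where "v = b / B"
 have v: "v > 0" using B by (simp add: v_def)
 define \<mu> where "\<mu> = 2 * p / B"
 define L where "L = (norm m)^2 / b + 2 * p^2 / (b * B)"
 have pt: "exp ((norm (m + y *\<^sub>R \<sigma>))^2 / b) * std_normal_density y = sqrt v * exp L * normal_density \<mu> (sqrt v) y" for y
 proof -
  have e: "(norm (m + y *\<^sub>R \<sigma>))^2 = (norm m)^2 + 2 * y * p + y^2 * q"
   unfolding p_def q_def power2_norm_eq_inner
   by (simp add: inner_add_left inner_add_right inner_commute power2_eq_square algebra_simps)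
  have "((norm m)^2 + 2 * y * p + y^2 * q) / b - y^2 / 2 = L - (y - \<mu>)^2 / (2 * v)"
  proof -
   have "(y - \<mu>)^2 / (2 * v) = (y * B - 2 * p)^2 / (2 * b * B)"
    using B(1,2) by (simp add: v_def \<mu>_def field_simps power2_eq_square)
   also have "\<dots> = (y^2 * B) / (2 * b) - 2 * y * p / b + 2 * p^2 / (b * B)"
    using B(1,2) by (simp add: field_simps power2_eq_square)
   also have "(y^2 * B) / (2 * b) = y^2 / 2 - y^2 * q / b"
    using B by (simp add: field_simps power2_eq_square)
   finally show ?thesis by (simp add: L_def add_divide_distrib)
  qed
  hence "exp ((norm (m + y *\<^sub>R \<sigma>))^2 / b) * exp (- y\<^sup>2 / 2) = exp L * exp (- (y - \<mu>)\<^sup>2 / (2 * v))"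
   unfolding e exp_add[symmetric] by simp
  thus ?thesis
   using v by (simp add: normal_density_def real_sqrt_mult field_simps)
 qed
 have nd: "(\<integral>\<^sup>+y. ennreal (normal_density \<mu> (sqrt v) y) \<partial>lborel) = 1"
 proof -
  interpret N: prob_space "density lborel (normal_density \<mu> (sqrt v))"
   using v by (intro prob_space_normal_density) simp
  show ?thesis using N.emeasure_space_1 by (simp add: emeasure_density)
 qed
 have "(\<integral>\<^sup>+y. ennreal (exp ((norm (m + y *\<^sub>R \<sigma>))^2 / b)) \<partial>gauss)
  = (\<integral>\<^sup>+y. ennreal (sqrt v * exp L) * ennreal (normal_density \<mu> (sqrt v) y) \<partial>lborel)"
 proof (subst nn_integral_density)
  have [measurable]: "(\<lambda>y. norm (m + y *\<^sub>R \<sigma>)) \<in> borel_measurable borel"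
   by (intro borel_measurable_continuous_onI continuous_intros)
  show "(\<lambda>y. ennreal (exp ((norm (m + y *\<^sub>R \<sigma>))^2 / b))) \<in> borel_measurable lborel" by simp
  show "(\<integral>\<^sup>+ x. ennreal (std_normal_density x) * ennreal (exp ((norm (m + x *\<^sub>R \<sigma>))^2 / b)) \<partial>lborel) =
   (\<integral>\<^sup>+y. ennreal (sqrt v * exp L) * ennreal (normal_density \<mu> (sqrt v) y) \<partial>lborel)"
   using pt v by (intro nn_integral_cong) (simp add: ennreal_mult[symmetric] mult.commute)
 qed auto
 also have "\<dots> = ennreal (sqrt v * exp L)"
  by (subst nn_integral_cmult) (auto simp: nd)
 also have "\<dots> \<le> ennreal (sqrt v * exp ((norm m)^2 / B))"
 proof (intro ennreal_leI mult_left_mono)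
  have "p^2 \<le> (norm m)^2 * q"
   unfolding p_def q_def power2_norm_eq_inner by (rule Cauchy_Schwarz_ineq)
  hence "2 * p^2 / (b * B) \<le> 2 * ((norm m)^2 * q) / (b * B)"
   using B by (intro divide_right_mono mult_left_mono) auto
  moreover have "(norm m)^2 / b + 2 * ((norm m)^2 * q) / (b * B) = (norm m)^2 / B"
  proof -
   have "(norm m)^2 / b + 2 * ((norm m)^2 * q) / (b * B) = (norm m)^2 * (B + 2 * q) / (b * B)"
    using B(1,2) by (simp add: field_simps)
   thus ?thesis using B by simp
  qed
  ultimately show "exp L \<le> exp ((norm m)^2 / B)" by (simp add: L_def)
 qed (use v in auto)
 finally show ?thesis by (simp add: v_def B_def q_def)
qed

lemma normal_vector_exp_square:
 fixes m :: "'h::{real_inner, banach, second_countable_topology}" and \<sigma> :: "nat => 'h"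
 assumes "finite J" "2 * (\<Sum>k\<in>J. (norm (\<sigma> k))\<^sup>2) < b"
 shows "(\<integral>\<^sup>+y. ennreal (exp ((norm (m + (\<Sum>k\<in>J. y k *\<^sub>R \<sigma> k)))^2 / b)) \<partial>(\<Pi>\<^sub>M k\<in>J. gauss))
  \<le> ennreal (sqrt (b / (b - 2 * (\<Sum>k\<in>J. (norm (\<sigma> k))\<^sup>2))) * exp ((norm m)^2 / (b - 2 * (\<Sum>k\<in>J. (norm (\<sigma> k))\<^sup>2))))"
 using assms
proof (induction J arbitrary: m b rule: finite_induct)
 case empty
 interpret N: prob_space gauss by (rule prob_space_normal_density) simp
 interpret P: product_prob_space "\<lambda>_::nat. gauss" "{}" by unfold_locales
 show ?case using empty by (simp add: P.P.emeasure_space_1)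
next
 case (insert j J m b)
 interpret N: prob_space gauss by (rule prob_space_normal_density) simp
 interpret P: product_prob_space "\<lambda>_::nat. gauss" J by unfold_locales
 let ?P = "\<lambda>J. \<Pi>\<^sub>M k\<in>J. gauss"
 define q where "q = (norm (\<sigma> j))^2"
 define r where "r = (\<Sum>k\<in>J. (norm (\<sigma> k))\<^sup>2)"
 have r: "r \<ge> 0" by (simp add: r_def sum_nonneg)
 have sum: "(\<Sum>k\<in>insert j J. (norm (\<sigma> k))\<^sup>2) = q + r" using insert by (simp add: q_def r_def)
 have b: "2 * q + 2 * r < b" using insert.prems unfolding sum by simp
 have q0: "q \<ge> 0" by (simp add: q_def)
 have meas: "(\<lambda>y. norm (m + (\<Sum>k\<in>I. y k *\<^sub>R \<sigma> k))) \<in> borel_measurable (?P I)" for I m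
  by (intro measurable_compose[OF _ borel_measurable_norm] borel_measurable_add borel_measurable_const borel_measurable_sum
    borel_measurable_scaleR) (auto intro!: measurable_component_singleton[THEN measurable_compose] )
 have meas': "(\<lambda>y. ennreal (exp ((norm (m + (\<Sum>k\<in>I. y k *\<^sub>R \<sigma> k)))^2 / b))) \<in> borel_measurable (?P I)" for I m b
  using meas[of m I] by simp
 have "(\<integral>\<^sup>+y. ennreal (exp ((norm (m + (\<Sum>k\<in>insert j J. y k *\<^sub>R \<sigma> k)))^2 / b)) \<partial>?P (insert j J))
  = (\<integral>\<^sup>+x. (\<integral>\<^sup>+y. ennreal (exp ((norm (m + (\<Sum>k\<in>insert j J. (x(j := y)) k *\<^sub>R \<sigma> k)))^2 / b)) \<partial>gauss) \<partial>?P J)"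
  using insert by (intro P.product_nn_integral_insert meas') auto
 also have "\<dots> = (\<integral>\<^sup>+x. (\<integral>\<^sup>+y. ennreal (exp ((norm ((m + (\<Sum>k\<in>J. x k *\<^sub>R \<sigma> k)) + y *\<^sub>R \<sigma> j))^2 / b)) \<partial>gauss) \<partial>?P J)"
 proof -
  have "(\<Sum>k\<in>insert j J. (x(j := y)) k *\<^sub>R \<sigma> k) = (\<Sum>k\<in>J. x k *\<^sub>R \<sigma> k) + y *\<^sub>R \<sigma> j" for x y
  proof -
   have "(\<Sum>k\<in>J. (x(j := y)) k *\<^sub>R \<sigma> k) = (\<Sum>k\<in>J. x k *\<^sub>R \<sigma> k)"
    using insert.hyps by (intro sum.cong) auto
   thus ?thesis using insert.hyps by (simp add: add.commute)
  qed
  thus ?thesis by (simp add: add.assoc)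
 qed
 also have "\<dots> \<le> (\<integral>\<^sup>+x. ennreal (sqrt (b / (b - 2 * q))) * ennreal (exp ((norm (m + (\<Sum>k\<in>J. x k *\<^sub>R \<sigma> k)))^2 / (b - 2 * q))) \<partial>?P J)"
 proof (rule nn_integral_mono)
  fix x
  have "2 * (norm (\<sigma> j))^2 < b" using b r by (simp add: q_def)
  moreover have "0 \<le> b / (b - 2 * (norm (\<sigma> j))^2)" using b q0 r unfolding q_def[symmetric] by simp
  ultimately show "(\<integral>\<^sup>+y. ennreal (exp ((norm ((m + (\<Sum>k\<in>J. x k *\<^sub>R \<sigma> k)) + y *\<^sub>R \<sigma> j))^2 / b)) \<partial>gauss)
    \<le> ennreal (sqrt (b / (b - 2 * q))) * ennreal (exp ((norm (m + (\<Sum>k\<in>J. x k *\<^sub>R \<sigma> k)))^2 / (b - 2 * q)))"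
   unfolding q_def using normal_exp_square[of "\<sigma> j" b "m + (\<Sum>k\<in>J. x k *\<^sub>R \<sigma> k)"] by (subst ennreal_mult[symmetric]) auto
 qed
 also have "\<dots> = ennreal (sqrt (b / (b - 2 * q))) * (\<integral>\<^sup>+x. ennreal (exp ((norm (m + (\<Sum>k\<in>J. x k *\<^sub>R \<sigma> k)))^2 / (b - 2 * q))) \<partial>?P J)"
  by (intro nn_integral_cmult meas')
 also have "\<dots> \<le> ennreal (sqrt (b / (b - 2 * q))) * ennreal (sqrt ((b - 2 * q) / ((b - 2 * q) - 2 * r)) * exp ((norm m)^2 / ((b - 2 * q) - 2 * r)))"
  using b unfolding r_def by (intro mult_left_mono insert.IH) auto
 also have "\<dots> = ennreal (sqrt (b / (b - 2 * (q + r))) * exp ((norm m)^2 / (b - 2 * (q + r))))"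
 proof -
  have "sqrt (b / (b - 2 * q)) * sqrt ((b - 2 * q) / ((b - 2 * q) - 2 * r)) = sqrt (b / (b - 2 * (q + r)))"
  proof -
   have x: "b - 2 * q \<noteq> 0" "b - 2 * q - 2 * r = b - 2 * (q + r)" using b r by auto
   show ?thesis unfolding real_sqrt_mult[symmetric] x(2) using x(1) by simp
  qed
  thus ?thesis using b q0 r by (simp add: ennreal_mult[symmetric] mult.assoc[symmetric] diff_diff_eq distrib_left)
 qed
 finally show ?case unfolding sum .
qed

definition energy :: "real => 'h::real_normed_vector => real => ennreal" where
 "energy c m Q = ennreal (exp ((norm m)^2 / (c + 2 * Q)) / sqrt (c + 2 * Q))"

context brownian_family
begin

lemma energy_step:
 fixes m :: "'w => 'h::{real_inner, banach, second_countable_topology}" and \<sigma> :: "nat => 'w => 'h"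
 assumes J: "finite J" "J \<subseteq> K" and p: "0 \<le> p" "p < u" and c: "c > 0"
  and m: "m \<in> borel_measurable (\<F> p)" and \<sigma>: "\<And>k. k \<in> J ==> \<sigma> k \<in> borel_measurable (\<F> p)"
  and Q: "Q \<in> borel_measurable (\<F> p)" "\<And>om. om \<in> space M ==> 0 \<le> Q om"
 shows "(\<integral>\<^sup>+om. energy c (m om + (\<Sum>k\<in>J. inc k p u om *\<^sub>R \<sigma> k om)) (Q om + (u - p) * (\<Sum>k\<in>J. (norm (\<sigma> k om))\<^sup>2)) \<partial>M)
  \<le> (\<integral>\<^sup>+om. energy c (m om) (Q om) \<partial>M)"
proof -
 define q where "q om = (u - p) * (\<Sum>k\<in>J. (norm (\<sigma> k om))\<^sup>2)" for om
 have qm: "q \<in> borel_measurable (\<F> p)" unfolding q_def[abs_def] using \<sigma> by auto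
 define f where "f om y = energy c (m om + (\<Sum>k\<in>J. y k *\<^sub>R (sqrt (u - p) *\<^sub>R \<sigma> k om))) (Q om + q om)" for om y
 have mm: "(\<lambda>z. m (fst z)) \<in> borel_measurable (\<F> p \<Otimes>\<^sub>M (\<Pi>\<^sub>M k\<in>J. borel))"
  "(\<lambda>z. Q (fst z)) \<in> borel_measurable (\<F> p \<Otimes>\<^sub>M (\<Pi>\<^sub>M k\<in>J. borel))"
  "(\<lambda>z. q (fst z)) \<in> borel_measurable (\<F> p \<Otimes>\<^sub>M (\<Pi>\<^sub>M k\<in>J. borel))"
  using m Q(1) qm by (auto intro: measurable_compose[OF measurable_fst])
 have ms: "(\<lambda>z. snd z k *\<^sub>R (sqrt (u - p) *\<^sub>R \<sigma> k (fst z))) \<in> borel_measurable (\<F> p \<Otimes>\<^sub>M (\<Pi>\<^sub>M k\<in>J. borel))"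
  if "k \<in> J" for k
  using \<sigma>[OF that] that
  by (intro borel_measurable_scaleR borel_measurable_const measurable_compose[OF measurable_fst \<sigma>[OF that]]
    measurable_compose[OF measurable_snd measurable_component_singleton]) auto
 have fm: "(\<lambda>(om, y). f om y) \<in> borel_measurable (\<F> p \<Otimes>\<^sub>M (\<Pi>\<^sub>M k\<in>J. borel))"
 proof -
  have n: "(\<lambda>z. norm (m (fst z) + (\<Sum>k\<in>J. snd z k *\<^sub>R (sqrt (u - p) *\<^sub>R \<sigma> k (fst z))))) \<in> borel_measurable (\<F> p \<Otimes>\<^sub>M (\<Pi>\<^sub>M k\<in>J. borel))"
   by (intro measurable_compose[OF _ borel_measurable_norm] borel_measurable_add borel_measurable_sum mm ms)
  show ?thesis
   unfolding f_def energy_def case_prod_beta using n mm(2,3) by measurable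
 qed
 have "(\<integral>\<^sup>+om. energy c (m om + (\<Sum>k\<in>J. inc k p u om *\<^sub>R \<sigma> k om)) (Q om + (u - p) * (\<Sum>k\<in>J. (norm (\<sigma> k om))\<^sup>2)) \<partial>M)
  = (\<integral>\<^sup>+om. f om (\<lambda>k\<in>J. ninc k p u om) \<partial>M)"
 proof (intro nn_integral_cong)
  fix om
  have "(\<Sum>k\<in>J. (\<lambda>k\<in>J. ninc k p u om) k *\<^sub>R (sqrt (u - p) *\<^sub>R \<sigma> k om)) = (\<Sum>k\<in>J. inc k p u om *\<^sub>R \<sigma> k om)"
   using p by (intro sum.cong refl) (auto simp: ninc_def)
  thus "energy c (m om + (\<Sum>k\<in>J. inc k p u om *\<^sub>R \<sigma> k om)) (Q om + (u - p) * (\<Sum>k\<in>J. (norm (\<sigma> k om))\<^sup>2))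
    = f om (\<lambda>k\<in>J. ninc k p u om)" unfolding f_def q_def by simp
 qed
 also have "\<dots> = (\<integral>\<^sup>+om. (\<integral>\<^sup>+y. f om y \<partial>(\<Pi>\<^sub>M k\<in>J. gauss)) \<partial>M)"
  by (rule nn_integral_filtration_ninc[OF J p fm])
 also have "\<dots> \<le> (\<integral>\<^sup>+om. energy c (m om) (Q om) \<partial>M)"
 proof (rule nn_integral_mono)
  fix om assume om: "om \<in> space M"
  define b where "b = c + 2 * (Q om + q om)"
  define a where "a = c + 2 * Q om"
  have q0: "q om \<ge> 0" using p by (simp add: q_def sum_nonneg)
  have ab: "a > 0" "b > 0" "b - 2 * q om = a" "2 * q om < b" using c Q(2)[OF om] q0 by (auto simp: a_def b_def)
  have qs: "(\<Sum>k\<in>J. (norm (sqrt (u - p) *\<^sub>R \<sigma> k om))\<^sup>2) = q om"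
   using p by (simp add: q_def power_mult_distrib sum_distrib_left)
  have fe: "f om y = ennreal (1 / sqrt b) * ennreal (exp ((norm (m om + (\<Sum>k\<in>J. y k *\<^sub>R (sqrt (u - p) *\<^sub>R \<sigma> k om))))^2 / b))" for y
   unfolding f_def energy_def b_def[symmetric] using ab by (simp add: ennreal_mult[symmetric])
  have ms: "(\<lambda>y. norm (m om + (\<Sum>k\<in>J. y k *\<^sub>R (sqrt (u - p) *\<^sub>R \<sigma> k om)))) \<in> borel_measurable (\<Pi>\<^sub>M k\<in>J. gauss)"
   by (intro measurable_compose[OF _ borel_measurable_norm] borel_measurable_add borel_measurable_const borel_measurable_sum
    borel_measurable_scaleR) (auto intro!: measurable_component_singleton[THEN measurable_compose])
  have "(\<integral>\<^sup>+y. f om y \<partial>(\<Pi>\<^sub>M k\<in>J. gauss))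
   = ennreal (1 / sqrt b) * (\<integral>\<^sup>+y. ennreal (exp ((norm (m om + (\<Sum>k\<in>J. y k *\<^sub>R (sqrt (u - p) *\<^sub>R \<sigma> k om))))^2 / b)) \<partial>(\<Pi>\<^sub>M k\<in>J. gauss))"
   unfolding fe by (rule nn_integral_cmult) (use ms in measurable)
  also have "\<dots> \<le> ennreal (1 / sqrt b) * ennreal (sqrt (b / (b - 2 * q om)) * exp ((norm (m om))^2 / (b - 2 * q om)))"
   using normal_vector_exp_square[OF J(1), of "\<lambda>k. sqrt (u - p) *\<^sub>R \<sigma> k om" b "m om"] ab(4) unfolding qs
   by (intro mult_left_mono) auto
  also have "\<dots> = energy c (m om) (Q om)"
   unfolding ab energy_def a_def[symmetric] using ab(1,2) by (simp add: ennreal_mult[symmetric] real_sqrt_divide)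
  finally show "(\<integral>\<^sup>+y. f om y \<partial>(\<Pi>\<^sub>M k\<in>J. gauss)) \<le> energy c (m om) (Q om)" .
 qed
 finally show ?thesis .
qed

end

locale wiener_family = brownian_family M \<F> K \<beta>
 for M :: "'w measure" and \<F> :: "real => 'w measure" and K :: "nat set" and \<beta> :: "nat => real => 'w => real" +
 fixes g :: "nat => 'u::{real_inner, banach, second_countable_topology}"
 assumes onb: "orthonormal_basis g K"
begin

abbreviation (input) "integrand \<equiv> elementary_integrand g"
abbreviation (input) "stoch_int \<equiv> elementary_integral \<beta>"

abbreviation (input) "term_start E i \<equiv> fst (E ! i)"
abbreviation (input) "term_end E i \<equiv> fst (snd (E ! i))"
abbreviation (input) "term_index E i \<equiv> fst (snd (snd (E ! i)))"
abbreviation (input) "term_value E i \<equiv> snd (snd (snd (E ! i)))"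

lemma elementary_integral_sum:
 "stoch_int E t om = (\<Sum>i<length E. (\<beta> (term_index E i) (min (term_end E i) t) om
   - \<beta> (term_index E i) (min (term_start E i) t) om) *\<^sub>R term_value E i om)"
 by (simp add: elementary_integral_def sum_list_sum_nth atLeast0LessThan case_prod_beta)

lemma elementary_integrand_sum:
 "integrand E s om u = (\<Sum>i<length E. (indicator {term_start E i<..term_end E i} s * (g (term_index E i) \<bullet> u)) *\<^sub>R term_value E i om)"
 by (simp add: elementary_integrand_def sum_list_sum_nth atLeast0LessThan case_prod_beta)

lemma elementary_term:
 assumes "is_elementary M \<F> K E" "i < length E"
 shows "0 \<le> term_start E i" "term_start E i \<le> term_end E i" "term_index E i \<in> K"
  "term_value E i \<in> borel_measurable (\<F> (term_start E i))"
 using assms nth_mem[OF assms(2)] unfolding is_elementary_def by (auto simp: case_prod_beta)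

lemma elementary_integrand_measurable:
 fixes E :: "('w, 'h::{real_inner, banach, second_countable_topology}) elementary_process"
 shows "(\<lambda>s. integrand E s om u) \<in> borel_measurable borel"
 unfolding elementary_integrand_sum by measurable

lemma elementary_integrand_basis:
 assumes E: "is_elementary M \<F> K E" and k: "k \<in> K"
 shows "integrand E s om (g k) =
  (\<Sum>i<length E. if term_index E i = k \<and> term_start E i < s \<and> s \<le> term_end E i then term_value E i om else 0)"
 unfolding elementary_integrand_sum
proof (intro sum.cong refl)
 fix i assume "i \<in> {..<length E}"
 hence "term_index E i \<in> K" using elementary_term[OF E] by auto
 thus "(indicat_real {term_start E i<..term_end E i} s * (g (term_index E i) \<bullet> g k)) *\<^sub>R term_value E i om
  = (if term_index E i = k \<and> term_start E i < s \<and> s \<le> term_end E i then term_value E i om else 0)"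
  using basis_inner[OF onb _ k] by (auto simp: indicator_def)
qed

lemma elementary_energy:
 fixes E :: "('w, 'h::{real_inner, banach, second_countable_topology}) elementary_process"
 assumes E: "is_elementary M \<F> K E" and c: "c > 0"
  and D: "finite D" "0 \<in> D" "D \<subseteq> {0..}" "\<And>i. i < length E ==> term_start E i \<in> D \<and> term_end E i \<in> D"
  and u: "u \<in> D"
 shows "\<exists>Q. Q \<in> borel_measurable (\<F> u) \<and> stoch_int E u \<in> borel_measurable (\<F> u) \<and>
  (\<forall>om\<in>space M. 0 \<le> Q om \<and> (\<integral>\<^sup>+s\<in>{0..u}. hs2 g K (integrand E s om) \<partial>lborel) = ennreal (Q om)) \<and>
  (\<integral>\<^sup>+om. energy c (stoch_int E u om) (Q om) \<partial>M) \<le> ennreal (1 / sqrt c)"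
 using u
proof (induction "card {d\<in>D. d < u}" arbitrary: u rule: less_induct)
 case (less u)
 note T = elementary_term[OF E]
 show ?case
 proof (cases "u = 0")
  case True
  have "stoch_int E 0 om = 0" for om
   unfolding elementary_integral_sum
  proof (intro sum.neutral ballI)
   fix i assume "i \<in> {..<length E}"
   hence "min (term_end E i) 0 = 0" "min (term_start E i) 0 = 0"
    using T(1,2)[of i] by auto
   thus "(\<beta> (term_index E i) (min (term_end E i) 0) om - \<beta> (term_index E i) (min (term_start E i) 0) om) *\<^sub>R term_value E i om = 0"
    by simp
  qed
  hence I0: "stoch_int E 0 = (\<lambda>_. 0)" by auto
  have "(\<integral>\<^sup>+s\<in>{0..0}. hs2 g K (integrand E s om) \<partial>lborel) = (\<integral>\<^sup>+s. 0 \<partial>(lborel :: real measure))" for om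
   by (intro nn_integral_cong_AE AE_I[where N="{0}"]) (auto simp: indicator_def)
  thus ?thesis unfolding True I0
   by (intro exI[of _ "\<lambda>_. 0"]) (auto simp: energy_def emeasure_space_1)
 next
  case False
  define L where "L = {d\<in>D. d < u}"
  have L: "finite L" "L \<noteq> {}" using D False less.prems by (auto simp: L_def intro!: exI[of _ 0])
  define p where "p = Max L"
  have "p \<in> L" unfolding p_def by (rule Max_in[OF L])
  hence p: "p \<in> D" "p < u" "0 \<le> p" using D by (auto simp: L_def)
  have gap: "d \<le> p \<or> u \<le> d" if "d \<in> D" for d
   using that Max_ge[OF L(1), of d] unfolding p_def[symmetric] by (auto simp: L_def not_less[symmetric])
  have "card {d\<in>D. d < p} < card {d\<in>D. d < u}"
   using D(1) p by (intro psubset_card_mono) auto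
  from less.hyps[OF this p(1)] obtain Q where Q: "Q \<in> borel_measurable (\<F> p)"
   "stoch_int E p \<in> borel_measurable (\<F> p)"
   "\<And>om. om \<in> space M ==> 0 \<le> Q om"
   "\<And>om. om \<in> space M ==> (\<integral>\<^sup>+s\<in>{0..p}. hs2 g K (integrand E s om) \<partial>lborel) = ennreal (Q om)"
   "(\<integral>\<^sup>+om. energy c (stoch_int E p om) (Q om) \<partial>M) \<le> ennreal (1 / sqrt c)"
   by blast
  define J where "J = (\<lambda>i. term_index E i) ` {..<length E}"
  have J: "finite J" "J \<subseteq> K" using T by (auto simp: J_def)
  define \<sigma> where "\<sigma> k om = (\<Sum>i<length E. if term_index E i = k \<and> term_start E i \<le> p \<and> u \<le> term_end E i then term_value E i om else 0)" for k om
  have \<sigma>m: "\<sigma> k \<in> borel_measurable (\<F> p)" for k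
   unfolding \<sigma>_def[abs_def]
  proof (intro borel_measurable_sum)
   fix i assume i: "i \<in> {..<length E}"
   show "(\<lambda>om. if term_index E i = k \<and> term_start E i \<le> p \<and> u \<le> term_end E i then term_value E i om else 0) \<in> borel_measurable (\<F> p)"
    using measurable_filtration_mono[OF T(4)] T(1) i by (cases "term_start E i \<le> p") auto
  qed
  have in_gap: "term_start E i < s \<and> s \<le> term_end E i \<longleftrightarrow> term_start E i \<le> p \<and> u \<le> term_end E i"
   if "i < length E" "p < s" "s \<le> u" for i s
   using gap[of "term_start E i"] gap[of "term_end E i"] D(4)[OF that(1)] that p by auto
  have step: "stoch_int E u om = stoch_int E p om + (\<Sum>k\<in>J. inc k p u om *\<^sub>R \<sigma> k om)" for om
  proof -
   have 1: "(\<Sum>k\<in>J. inc k p u om *\<^sub>R \<sigma> k om) = (\<Sum>i<length E. if term_start E i \<le> p \<and> u \<le> term_end E i then inc (term_index E i) p u om *\<^sub>R term_value E i om else 0)"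
    unfolding \<sigma>_def scaleR_sum_right
   proof (subst sum.swap, intro sum.cong refl)
    fix i assume i: "i \<in> {..<length E}"
    have "(\<Sum>k\<in>J. inc k p u om *\<^sub>R (if term_index E i = k \<and> term_start E i \<le> p \<and> u \<le> term_end E i then term_value E i om else 0))
     = (\<Sum>k\<in>J. if k = term_index E i then (if term_start E i \<le> p \<and> u \<le> term_end E i then inc (term_index E i) p u om *\<^sub>R term_value E i om else 0) else 0)"
     by (intro sum.cong refl) auto
    thus "(\<Sum>k\<in>J. inc k p u om *\<^sub>R (if term_index E i = k \<and> term_start E i \<le> p \<and> u \<le> term_end E i then term_value E i om else 0))
     = (if term_start E i \<le> p \<and> u \<le> term_end E i then inc (term_index E i) p u om *\<^sub>R term_value E i om else 0)"
     using i J(1) by (simp add: J_def)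
   qed
   show ?thesis unfolding 1 unfolding elementary_integral_sum sum.distrib[symmetric]
   proof (intro sum.cong refl)
    fix i assume "i \<in> {..<length E}"
    hence i: "i < length E" by simp
    define a b k \<xi> where "a = term_start E i" and "b = term_end E i" and "k = term_index E i" and "\<xi> = term_value E i"
    have ab: "a \<le> b" "a \<le> p \<or> u \<le> a" "b \<le> p \<or> u \<le> b" using T[OF i] D(4)[OF i] gap by (auto simp: a_def b_def)
    have "(\<beta> k (min b u) om - \<beta> k (min a u) om) = (\<beta> k (min b p) om - \<beta> k (min a p) om) + (if a \<le> p \<and> u \<le> b then inc k p u om else 0)"
     using ab p(2) by (auto simp: min_def inc_def)
    hence "(\<beta> k (min b u) om - \<beta> k (min a u) om) *\<^sub>R \<xi> om = (\<beta> k (min b p) om - \<beta> k (min a p) om) *\<^sub>R \<xi> om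
      + (if a \<le> p \<and> u \<le> b then inc k p u om *\<^sub>R \<xi> om else 0)"
     by (simp add: scaleR_add_left)
    thus "(\<beta> (term_index E i) (min (term_end E i) u) om - \<beta> (term_index E i) (min (term_start E i) u) om) *\<^sub>R term_value E i om
     = (\<beta> (term_index E i) (min (term_end E i) p) om - \<beta> (term_index E i) (min (term_start E i) p) om) *\<^sub>R term_value E i om +
      (if term_start E i \<le> p \<and> u \<le> term_end E i then inc (term_index E i) p u om *\<^sub>R term_value E i om else 0)"
     unfolding a_def b_def k_def \<xi>_def .
   qed
  qed
  define Q' where "Q' om = Q om + (u - p) * (\<Sum>k\<in>J. (norm (\<sigma> k om))\<^sup>2)" for om
  have Q'm: "Q' \<in> borel_measurable (\<F> u)"
  proof (rule measurable_filtration_mono[of _ p])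
   note [measurable] = \<sigma>m Q(1)
   show "Q' \<in> borel_measurable (\<F> p)" unfolding Q'_def[abs_def] by measurable
  qed (use p in simp_all)
  have Im: "stoch_int E u \<in> borel_measurable (\<F> u)"
  proof -
   have "(\<lambda>om. stoch_int E p om + (\<Sum>k\<in>J. inc k p u om *\<^sub>R \<sigma> k om)) \<in> borel_measurable (\<F> u)"
    using p J by (intro borel_measurable_add borel_measurable_sum borel_measurable_scaleR
      measurable_filtration_mono[OF Q(2)] measurable_filtration_mono[OF \<sigma>m] inc_adapted) auto
   moreover have "stoch_int E u = (\<lambda>om. stoch_int E p om + (\<Sum>k\<in>J. inc k p u om *\<^sub>R \<sigma> k om))"
    by (rule ext) (rule step)
   ultimately show ?thesis by (rule ssubst[rotated])
  qed
  have hs: "(\<integral>\<^sup>+s\<in>{0..u}. hs2 g K (integrand E s om) \<partial>lborel) = ennreal (Q' om)" if om: "om \<in> space M" for om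
  proof -
   define f where "f s = hs2 g K (integrand E s om)" for s
   have [measurable]: "f \<in> borel_measurable borel"
    unfolding f_def[abs_def] by (intro hs2_measurable elementary_integrand_measurable)
   have fs: "f s = ennreal (\<Sum>k\<in>J. (norm (\<sigma> k om))\<^sup>2)" if s: "p < s" "s \<le> u" for s
   proof -
    have e: "integrand E s om (g k) = \<sigma> k om" if "k \<in> K" for k
     unfolding elementary_integrand_basis[OF E that] \<sigma>_def
     using in_gap[OF _ s] by (intro sum.cong refl) auto
    have z: "\<sigma> k om = 0" if "k \<notin> J" for k
     unfolding \<sigma>_def using that by (intro sum.neutral) (auto simp: J_def)
    have "f s = ennreal (\<Sum>k\<in>J. (norm (integrand E s om (g k)))\<^sup>2)"
     unfolding f_def by (rule hs2_finite_support[OF J]) (use e z in auto)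
    also have "(\<Sum>k\<in>J. (norm (integrand E s om (g k)))\<^sup>2) = (\<Sum>k\<in>J. (norm (\<sigma> k om))\<^sup>2)"
     using e J by (intro sum.cong refl) auto
    finally show ?thesis .
   qed
   have "(\<integral>\<^sup>+s\<in>{0..u}. f s \<partial>lborel) = (\<integral>\<^sup>+s. f s * indicator {0..p} s + ennreal (\<Sum>k\<in>J. (norm (\<sigma> k om))\<^sup>2) * indicator {p<..u} s \<partial>lborel)"
    using p fs by (intro nn_integral_cong) (auto simp: indicator_def not_le)
   also have "\<dots> = (\<integral>\<^sup>+s\<in>{0..p}. f s \<partial>lborel) + ennreal (\<Sum>k\<in>J. (norm (\<sigma> k om))\<^sup>2) * emeasure lborel {p<..u}"
    by (subst nn_integral_add) (auto simp: nn_integral_cmult_indicator)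
   also have "\<dots> = ennreal (Q' om)"
    using Q(3,4)[OF om] p unfolding f_def Q'_def
    by (simp add: sum_nonneg ennreal_mult[symmetric] ennreal_plus[symmetric] mult.commute del: ennreal_plus)
   finally show ?thesis unfolding f_def .
  qed
  have "(\<integral>\<^sup>+om. energy c (stoch_int E u om) (Q' om) \<partial>M) \<le> (\<integral>\<^sup>+om. energy c (stoch_int E p om) (Q om) \<partial>M)"
   unfolding step Q'_def by (rule energy_step[OF J p(3,2) c Q(2) \<sigma>m Q(1,3)])
  also note Q(5)
  finally show ?thesis
   using Q'm Im hs Q(3) p by (intro exI[of _ Q']) (auto simp: Q'_def sum_nonneg)
 qed
qed

lemma elementary_exponential_bound:
 fixes E :: "('w, 'h::{real_inner, banach, second_countable_topology}) elementary_process"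
 assumes E: "is_elementary M \<F> K E" and t: "0 \<le> t" and \<delta>: "\<delta> > 0" and \<eta>: "\<eta> > 0"
 shows "\<exists>A\<in>sets M. prob A \<le> sqrt 2 * exp (- \<delta>\<^sup>2 / (4 * \<eta>)) \<and>
  (\<forall>om\<in>space M - A. (\<integral>\<^sup>+s\<in>{0..t}. hs2 g K (integrand E s om) \<partial>lborel) \<le> ennreal \<eta>
    --> norm (stoch_int E t om) \<le> \<delta>)"
proof -
 define D where "D = {0, t} \<union> (\<lambda>i. term_start E i) ` {..<length E} \<union> (\<lambda>i. term_end E i) ` {..<length E}"
 have D: "finite D" "0 \<in> D" "t \<in> D" "D \<subseteq> {0..}" "\<And>i. i < length E ==> term_start E i \<in> D \<and> term_end E i \<in> D"
  using t elementary_term(1,2)[OF E] unfolding D_def by (auto, (blast intro: order_trans)?)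
 define c where "c = 2 * \<eta>"
 have c: "c > 0" using \<eta> by (simp add: c_def)
 obtain Q where Q: "Q \<in> borel_measurable (\<F> t)" "stoch_int E t \<in> borel_measurable (\<F> t)"
  "\<And>om. om \<in> space M ==> 0 \<le> Q om"
  "\<And>om. om \<in> space M ==> (\<integral>\<^sup>+s\<in>{0..t}. hs2 g K (integrand E s om) \<partial>lborel) = ennreal (Q om)"
  "(\<integral>\<^sup>+om. energy c (stoch_int E t om) (Q om) \<partial>M) \<le> ennreal (1 / sqrt c)"
  using elementary_energy[OF E c D(1,2,4,5,3)] by blast
 have [measurable]: "Q \<in> borel_measurable M" "stoch_int E t \<in> borel_measurable M"
  using measurable_filtration_M[OF Q(1) t] measurable_filtration_M[OF Q(2) t] by auto
 define A where "A = {om\<in>space M. Q om \<le> \<eta> \<and> \<delta> < norm (stoch_int E t om)}"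
 have Am[measurable]: "A \<in> sets M" unfolding A_def by measurable
 define \<kappa> where "\<kappa> = exp (\<delta>^2 / (4 * \<eta>)) / sqrt (4 * \<eta>)"
 have \<kappa>: "\<kappa> > 0" using \<eta> by (simp add: \<kappa>_def)
 have "ennreal (\<kappa> * prob A) = (\<integral>\<^sup>+om. ennreal \<kappa> * indicator A om \<partial>M)"
  using \<kappa> by (simp add: nn_integral_cmult_indicator emeasure_eq_measure ennreal_mult)
 also have "\<dots> \<le> (\<integral>\<^sup>+om. energy c (stoch_int E t om) (Q om) \<partial>M)"
 proof (rule nn_integral_mono)
  fix om assume om: "om \<in> space M"
  show "ennreal \<kappa> * indicator A om \<le> energy c (stoch_int E t om) (Q om)"
  proof (cases "om \<in> A")
   case True
   hence a: "Q om \<le> \<eta>" "\<delta> < norm (stoch_int E t om)" by (auto simp: A_def)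
   have q: "0 < c + 2 * Q om" "c + 2 * Q om \<le> 4 * \<eta>" using a(1) c Q(3)[OF om] by (auto simp: c_def)
   have "\<delta>^2 / (4 * \<eta>) \<le> (norm (stoch_int E t om))^2 / (c + 2 * Q om)"
    using a(2) q \<delta> by (intro frac_le power_mono) auto
   hence "\<kappa> \<le> exp ((norm (stoch_int E t om))^2 / (c + 2 * Q om)) / sqrt (c + 2 * Q om)"
    unfolding \<kappa>_def using q by (intro frac_le) auto
   thus ?thesis using True by (simp add: energy_def ennreal_leI)
  qed simp
 qed
 also note Q(5)
 finally have "\<kappa> * prob A \<le> 1 / sqrt c" using c by (subst (asm) ennreal_le_iff) auto
 hence "prob A \<le> 1 / sqrt c / \<kappa>" using \<kappa> by (subst pos_le_divide_eq) (auto simp: mult.commute)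
 also have "\<dots> = sqrt 2 * exp (- \<delta>\<^sup>2 / (4 * \<eta>))"
 proof -
  have "sqrt (4 * \<eta>) = sqrt 2 * sqrt c" by (simp add: c_def flip: real_sqrt_mult)
  thus ?thesis using c by (simp add: \<kappa>_def exp_minus field_simps)
 qed
 finally show ?thesis
  using Q(3,4) \<eta> by (intro bexI[OF _ Am]) (auto simp: A_def ennreal_le_iff not_less)
qed

section \<open>Stochastic integrals\<close>

lemma elementary_append:
 "stoch_int (E @ E') t om = stoch_int E t om + stoch_int E' t om"
 "integrand (E @ E') s om u = integrand E s om u + integrand E' s om u"
 "is_elementary M \<F> K (E @ E') \<longleftrightarrow> is_elementary M \<F> K E \<and> is_elementary M \<F> K E'"
 by (simp_all add: elementary_integral_def elementary_integrand_def is_elementary_def ball_Un)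

lemma is_elementary_alt:
 "is_elementary M \<F> K E \<longleftrightarrow> (\<forall>x\<in>set E. 0 \<le> fst x \<and> fst x \<le> fst (snd x) \<and> fst (snd (snd x)) \<in> K \<and>
   snd (snd (snd x)) \<in> borel_measurable (\<F> (fst x)) \<and> bounded (snd (snd (snd x)) ` space M))"
 unfolding is_elementary_def case_prod_beta ..

definition elementary_map :: "('h => 'h2) => ('w, 'h) elementary_process => ('w, 'h2) elementary_process" where
 "elementary_map f E = map (\<lambda>(a, b, k, \<xi>). (a, b, k, \<lambda>om. f (\<xi> om))) E"

lemma elementary_map_linear:
 fixes f :: "'h::real_normed_vector => 'h2::real_normed_vector"
 assumes f: "bounded_linear f"
 shows "stoch_int (elementary_map f E) t om = f (stoch_int E t om)"
  and "integrand (elementary_map f E) s om u = f (integrand E s om u)"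
  and "is_elementary M \<F> K E ==> is_elementary M \<F> K (elementary_map f E)"
proof -
 interpret f: bounded_linear f by (rule f)
 show "stoch_int (elementary_map f E) t om = f (stoch_int E t om)"
  unfolding elementary_integral_def elementary_map_def
  by (induction E) (auto simp: f.zero f.add f.scaleR)
 show "integrand (elementary_map f E) s om u = f (integrand E s om u)"
  unfolding elementary_integrand_def elementary_map_def
  by (induction E) (auto simp: f.zero f.add f.scaleR)
 assume E: "is_elementary M \<F> K E"
 have [measurable]: "f \<in> borel_measurable borel"
  by (intro borel_measurable_continuous_onI linear_continuous_on f)
 have "bounded ((\<lambda>om. f (\<xi> om)) ` space M)" if "bounded (\<xi> ` space M)" for \<xi>
  using bounded_linear_image[OF that f] by (simp add: image_image)
 thus "is_elementary M \<F> K (elementary_map f E)"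
  using E unfolding is_elementary_alt elementary_map_def
  by (simp add: case_prod_beta measurable_compose[OF _ \<open>f \<in> borel_measurable borel\<close>])
qed

definition elementary_stop :: "real => ('w, 'h) elementary_process => ('w, 'h) elementary_process" where
 "elementary_stop r E = map (\<lambda>(a, b, k, \<xi>). (a, max a (min b r), k, \<xi>)) E"

lemma elementary_stop:
 fixes E :: "('w, 'h::real_normed_vector) elementary_process"
 assumes "r \<le> t" "is_elementary M \<F> K E"
 shows "stoch_int (elementary_stop r E) t om = stoch_int E r om"
  and "integrand (elementary_stop r E) s om u = (if s \<le> r then integrand E s om u else 0)"
  and "is_elementary M \<F> K (elementary_stop r E)"
proof -
 have a: "a \<le> b ==> \<beta> k (min (max a (min b r)) t) om - \<beta> k (min a t) om = \<beta> k (min b r) om - \<beta> k (min a r) om" for a b k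
  using assms(1) by (auto simp: min_def max_def)
 show "stoch_int (elementary_stop r E) t om = stoch_int E r om"
  using assms(2) unfolding elementary_integral_def elementary_stop_def is_elementary_def
  by (induction E) (auto simp: a)
 have b: "a \<le> b ==> indicat_real {a<..max a (min b r)} s = (if s \<le> r then indicat_real {a<..b} s else 0)" for a b
  by (auto simp: indicator_def)
 show "integrand (elementary_stop r E) s om u = (if s \<le> r then integrand E s om u else 0)"
  using assms(2) unfolding elementary_integrand_def elementary_stop_def is_elementary_def
  by (induction E) (auto simp: b)
 show "is_elementary M \<F> K (elementary_stop r E)"
  using assms(2) unfolding is_elementary_alt elementary_stop_def
  by (simp add: case_prod_beta)
qed

lemma elementary_hilbert_schmidt:
 fixes E :: "('w, 'h::real_normed_vector) elementary_process"
 assumes E: "is_elementary M \<F> K E"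
 shows "hilbert_schmidt g K (integrand E s om)"
proof -
 have "bounded_linear (\<lambda>u. \<Sum>i<length E. (indicator {term_start E i<..term_end E i} s * (g (term_index E i) \<bullet> u)) *\<^sub>R term_value E i om)"
  by (intro bounded_linear_sum bounded_linear_scaleR_const bounded_linear_const_mult bounded_linear_inner_right)
 hence bl: "bounded_linear (integrand E s om)"
  unfolding elementary_integrand_sum[abs_def] elementary_integrand_sum by simp
 have "(\<lambda>k. (norm (integrand E s om (g k)))\<^sup>2) summable_on K"
 proof (rule summable_on_cong_neutral[THEN iffD1])
  let ?J = "(\<lambda>i. term_index E i) ` {..<length E}"
  show "(\<lambda>k. (norm (integrand E s om (g k)))\<^sup>2) summable_on ?J" by (rule summable_on_finite) simp
  fix k assume "k \<in> K - ?J"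
  hence "integrand E s om (g k) = 0"
   using elementary_integrand_basis[OF E, of k s om] by (auto intro!: sum.neutral)
  thus "(norm (integrand E s om (g k)))^2 = 0" by simp
 qed (use elementary_term(3)[OF E] in auto)
 thus ?thesis using bl by (simp add: hilbert_schmidt_def)
qed

text \<open>
 A working form of \<open>has_stochastic_integral\<close>: convergence in probability is expressed by
 exceptional events, so that \<open>\<Phi>\<close> only has to be measurable in time.
\<close>

definition has_int :: "real => (real => 'w => 'u => 'h::{real_inner, banach, second_countable_topology}) => ('w => 'h) => bool" where
 "has_int t \<Phi> Y \<longleftrightarrow>
  (\<forall>om\<in>space M. \<forall>k\<in>K. (\<lambda>s. \<Phi> s om (g k)) \<in> borel_measurable (restrict_space borel {0..t})) \<and>
  (\<forall>e>0. \<exists>E A. is_elementary M \<F> K E \<and> A \<in> sets M \<and> prob A \<le> e \<and>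
   (\<forall>om\<in>space M - A. (\<integral>\<^sup>+s\<in>{0..t}. hs2 g K (\<lambda>u. integrand E s om u - \<Phi> s om u) \<partial>lborel) \<le> ennreal e \<and>
     norm (stoch_int E t om - Y om) \<le> e))"

lemma predictable_section_measurable:
 assumes f: "f \<in> borel_measurable (predictable_sigma M \<F> t)" and om: "om \<in> space M"
 shows "(\<lambda>s. f (s, om)) \<in> borel_measurable (restrict_space borel {0..t})"
proof (rule measurable_compose[OF _ f])
 let ?G = "{{0} \<times> A | A. A \<in> sets (\<F> 0)} \<union> {{a<..b} \<times> A | a b A. 0 \<le> a \<and> a \<le> b \<and> b \<le> t \<and> A \<in> sets (\<F> a)}"
 show "(\<lambda>s. (s, om)) \<in> measurable (restrict_space borel {0..t}) (predictable_sigma M \<F> t)"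
 proof (cases "0 \<le> t")
  case True
  have G: "?G \<subseteq> Pow ({0..t} \<times> space M)"
  proof -
   have sub: "A \<subseteq> space M" if "A \<in> sets (\<F> a)" "0 \<le> a" for A a
    using sets.sets_into_space[OF that(1)] space_filtration[OF that(2)] by simp
   show ?thesis
   proof (intro Un_least subsetI)
    fix y :: "(real \<times> 'w) set" assume "y \<in> {{0} \<times> A | A. A \<in> sets (\<F> 0)}"
    then obtain A where "y = {0} \<times> A" "A \<in> sets (\<F> 0)" by blast
    thus "y \<in> Pow ({0..t} \<times> space M)" using sub[of A 0] True by auto
   next
    fix y :: "(real \<times> 'w) set" assume "y \<in> {{a<..b} \<times> A | a b A. 0 \<le> a \<and> a \<le> b \<and> b \<le> t \<and> A \<in> sets (\<F> a)}"
    then obtain a b A where "y = {a<..b} \<times> A" "0 \<le> a" "b \<le> t" "A \<in> sets (\<F> a)" by blast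
    thus "y \<in> Pow ({0..t} \<times> space M)" using sub[of A a] by auto
   qed
  qed
  show ?thesis
   unfolding predictable_sigma_def
  proof (rule measurable_measure_of[OF G])
   show "(\<lambda>s. (s, om)) \<in> space (restrict_space borel {0..t}) \<rightarrow> {0..t} \<times> space M"
    using om by (auto simp: space_restrict_space)
   fix y assume "y \<in> ?G"
   then obtain I A where y: "y = I \<times> A" "I \<in> sets borel" by auto
   have "(\<lambda>s. (s, om)) -` y \<inter> space (restrict_space borel {0..t}) = (if om \<in> A then {0..t} \<inter> I else {})"
    by (auto simp: y space_restrict_space)
   thus "(\<lambda>s. (s, om)) -` y \<inter> space (restrict_space borel {0..t}) \<in> sets (restrict_space borel {0..t})"
    using y(2) by (auto simp: sets_restrict_space)
  qed
 next
  case False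
  hence e: "{0..t} = {}" by simp
  have "(\<lambda>s. (s, om)) -` y \<inter> space (restrict_space borel {}) \<in> sets (restrict_space borel {})" for y
   by (simp add: space_restrict_space)
  thus ?thesis unfolding e by (simp add: measurable_def space_restrict_space)
 qed
qed

lemma set_nn_integral_add_le:
 fixes f f' h :: "real => ennreal"
 assumes "f \<in> borel_measurable (restrict_space borel T)" "f' \<in> borel_measurable (restrict_space borel T)" "T \<in> sets borel"
  and le: "\<And>s. s \<in> T ==> h s \<le> a * f s + b * f' s"
 shows "(\<integral>\<^sup>+s\<in>T. h s \<partial>lborel) \<le> a * (\<integral>\<^sup>+s\<in>T. f s \<partial>lborel) + b * (\<integral>\<^sup>+s\<in>T. f' s \<partial>lborel)"
proof -
 have [measurable]: "(\<lambda>s. f s * indicator T s) \<in> borel_measurable borel" "(\<lambda>s. f' s * indicator T s) \<in> borel_measurable borel"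
  using assms(1-3) by (auto simp: borel_measurable_restrict_space_iff_ennreal)
 have "(\<integral>\<^sup>+s\<in>T. h s \<partial>lborel) \<le> (\<integral>\<^sup>+s. a * (f s * indicator T s) + b * (f' s * indicator T s) \<partial>lborel)"
  using le by (intro nn_integral_mono) (auto simp: indicator_def)
 also have "\<dots> = a * (\<integral>\<^sup>+s\<in>T. f s \<partial>lborel) + b * (\<integral>\<^sup>+s\<in>T. f' s \<partial>lborel)"
  by (simp add: nn_integral_add nn_integral_cmult)
 finally show ?thesis .
qed

lemma has_int_measurable:
 assumes "has_int t \<Phi> Y" "om \<in> space M"
 shows "(\<lambda>s. hs2 g K (\<Phi> s om)) \<in> borel_measurable (restrict_space borel {0..t})"
 using assms unfolding has_int_def by (intro hs2_measurable) auto

lemma has_int_diff_measurable: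
 assumes "has_int t \<Phi> Y" "om \<in> space M"
 shows "(\<lambda>s. hs2 g K (\<lambda>u. integrand E s om u - \<Phi> s om u)) \<in> borel_measurable (restrict_space borel {0..t})"
 using assms unfolding has_int_def
 by (intro hs2_measurable borel_measurable_diff measurable_restrict_space1[OF elementary_integrand_measurable]) auto

lemma has_int_approx:
 assumes "has_int t \<Phi> Y" "e > 0"
 obtains E A where "is_elementary M \<F> K E" "A \<in> sets M" "prob A \<le> e"
  "\<And>om. om \<in> space M - A ==> (\<integral>\<^sup>+s\<in>{0..t}. hs2 g K (\<lambda>u. integrand E s om u - \<Phi> s om u) \<partial>lborel) \<le> ennreal e"
  "\<And>om. om \<in> space M - A ==> norm (stoch_int E t om - Y om) \<le> e"
 using assms unfolding has_int_def by meson

lemma has_stochastic_integral_imp_has_int: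
 fixes \<Phi> :: "real => 'w => 'u => 'h::{real_inner, banach, second_countable_topology}"
 assumes "has_stochastic_integral M \<F> g K \<beta> t \<Phi> Y"
 shows "has_int t \<Phi> Y"
 unfolding has_int_def
proof (intro conjI ballI allI impI)
 note S = assms[unfolded has_stochastic_integral_def]
 fix om k assume "om \<in> space M"
 thus "(\<lambda>s. \<Phi> s om (g k)) \<in> borel_measurable (restrict_space borel {0..t})"
  using predictable_section_measurable[of "\<lambda>(s, om). \<Phi> s om (g k)" t om] S by simp
next
 note S = assms[unfolded has_stochastic_integral_def]
 fix e :: real assume e: "e > 0"
 obtain E where E: "\<And>n. is_elementary M \<F> K (E n)"
  and v1: "vanishes_in_probability M (\<lambda>n om. \<integral>\<^sup>+ s\<in>{0..t}.
     ennreal ((hs_norm g K (\<lambda>u. integrand (E n) s om u - \<Phi> s om u))^2) \<partial>lborel)"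
  and v2: "vanishes_in_probability M (\<lambda>n om. ennreal (norm (stoch_int (E n) t om - Y om)))"
  using S by blast
 define Z1 where "Z1 n om = (\<integral>\<^sup>+ s\<in>{0..t}. ennreal ((hs_norm g K (\<lambda>u. integrand (E n) s om u - \<Phi> s om u))^2) \<partial>lborel)" for n om
 define Z2 where "Z2 n om = ennreal (norm (stoch_int (E n) t om - Y om))" for n om
 have m: "Z1 n \<in> borel_measurable M" "Z2 n \<in> borel_measurable M" for n
  using v1 v2 unfolding vanishes_in_probability_def Z1_def Z2_def by auto
 have l: "(\<lambda>n. prob {om\<in>space M. Z1 n om > ennreal e}) \<longlonglongrightarrow> 0" "(\<lambda>n. prob {om\<in>space M. Z2 n om > ennreal e}) \<longlonglongrightarrow> 0"
  using v1 v2 e unfolding vanishes_in_probability_def Z1_def Z2_def by auto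
 have "\<forall>\<^sub>F n in sequentially. prob {om\<in>space M. Z1 n om > ennreal e} < e / 2 \<and> prob {om\<in>space M. Z2 n om > ennreal e} < e / 2"
  using order_tendstoD(2)[OF l(1), of "e / 2"] order_tendstoD(2)[OF l(2), of "e / 2"] e by (auto elim: eventually_elim2)
 then obtain n where n: "prob {om\<in>space M. Z1 n om > ennreal e} < e / 2" "prob {om\<in>space M. Z2 n om > ennreal e} < e / 2"
  by (auto simp: eventually_sequentially)
 define A where "A = {om\<in>space M. Z1 n om > ennreal e} \<union> {om\<in>space M. Z2 n om > ennreal e}"
 have mm: "{om\<in>space M. Z1 n om > ennreal e} \<in> sets M" "{om\<in>space M. Z2 n om > ennreal e} \<in> sets M"
  using m[of n] by auto
 have "prob A \<le> e" using measure_Un_le[OF mm] n unfolding A_def by linarith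
 moreover have "(\<integral>\<^sup>+s\<in>{0..t}. hs2 g K (\<lambda>u. integrand (E n) s om u - \<Phi> s om u) \<partial>lborel) \<le> ennreal e \<and>
   norm (stoch_int (E n) t om - Y om) \<le> e" if om: "om \<in> space M - A" for om
 proof
  have z: "Z1 n om \<le> ennreal e" "Z2 n om \<le> ennreal e" using om by (auto simp: A_def not_less)
  show "norm (stoch_int (E n) t om - Y om) \<le> e" using z(2) e by (simp add: Z2_def)
  have "hs2 g K (\<lambda>u. integrand (E n) s om u - \<Phi> s om u) = ennreal ((hs_norm g K (\<lambda>u. integrand (E n) s om u - \<Phi> s om u))^2)"
   if s: "s \<in> {0..t}" for s
  proof (rule hs2_eq_hs_norm[symmetric])
   have a: "hilbert_schmidt g K (integrand (E n) s om)" by (rule elementary_hilbert_schmidt[OF E])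
   have b: "hilbert_schmidt g K (\<Phi> s om)" using S s om by auto
   have "(\<lambda>k. 2 * (norm (integrand (E n) s om (g k)))^2 + 2 * (norm (- \<Phi> s om (g k)))^2) summable_on K"
    using a b unfolding hilbert_schmidt_def by (intro summable_on_add summable_on_cmult_right) auto
   hence "(\<lambda>k. (norm (integrand (E n) s om (g k) - \<Phi> s om (g k)))\<^sup>2) summable_on K"
    by (rule summable_on_comparison_test) (use square_norm_add_le[of _ "- _"] in auto)
   thus "hilbert_schmidt g K (\<lambda>u. integrand (E n) s om u - \<Phi> s om u)"
    using a b unfolding hilbert_schmidt_def by (auto intro: bounded_linear_sub)
  qed
  hence "(\<integral>\<^sup>+s\<in>{0..t}. hs2 g K (\<lambda>u. integrand (E n) s om u - \<Phi> s om u) \<partial>lborel) = Z1 n om"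
   unfolding Z1_def by (intro nn_integral_cong) (auto simp: indicator_def)
  thus "(\<integral>\<^sup>+s\<in>{0..t}. hs2 g K (\<lambda>u. integrand (E n) s om u - \<Phi> s om u) \<partial>lborel) \<le> ennreal e"
   using z(1) by simp
 qed
 ultimately show "\<exists>E A. is_elementary M \<F> K E \<and> A \<in> sets M \<and> prob A \<le> e \<and>
   (\<forall>om\<in>space M - A. (\<integral>\<^sup>+s\<in>{0..t}. hs2 g K (\<lambda>u. integrand E s om u - \<Phi> s om u) \<partial>lborel) \<le> ennreal e \<and>
     norm (stoch_int E t om - Y om) \<le> e)"
  using E mm unfolding A_def by (intro exI[of _ "E n"] exI[of _ A]) (auto simp: A_def)
qed

lemma has_int_elementary:
 fixes E :: "('w, 'h::{real_inner, banach, second_countable_topology}) elementary_process"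
 assumes "is_elementary M \<F> K E"
 shows "has_int t (integrand E) (stoch_int E t)"
 unfolding has_int_def
proof (intro conjI ballI allI impI)
 fix e :: real assume "e > 0"
 thus "\<exists>E' A. is_elementary M \<F> K E' \<and> A \<in> sets M \<and> prob A \<le> e \<and>
   (\<forall>om\<in>space M - A. (\<integral>\<^sup>+s\<in>{0..t}. hs2 g K (\<lambda>u. integrand E' s om u - integrand E s om u) \<partial>lborel) \<le> ennreal e \<and>
     norm (stoch_int E' t om - stoch_int E t om) \<le> e)"
  using assms by (intro exI[of _ E] exI[of _ "{}"]) (auto simp: hs2_def)
qed (intro measurable_restrict_space1 elementary_integrand_measurable)

lemma has_int_diff:
 fixes Y Y' :: "'w => 'h::{real_inner, banach, second_countable_topology}"
 assumes P: "has_int t \<Phi> Y" and P': "has_int t \<Phi>' Y'"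
 shows "has_int t (\<lambda>s om u. \<Phi> s om u - \<Phi>' s om u) (\<lambda>om. Y om - Y' om)"
 unfolding has_int_def
proof (intro conjI ballI allI impI)
 fix om k assume "om \<in> space M" "k \<in> K"
 thus "(\<lambda>s. \<Phi> s om (g k) - \<Phi>' s om (g k)) \<in> borel_measurable (restrict_space borel {0..t})"
  using P P' unfolding has_int_def by (intro borel_measurable_diff) auto
next
 fix e :: real assume e: "e > 0"
 hence e4: "e / 4 > 0" by simp
 obtain E A where E: "is_elementary M \<F> K E" "A \<in> sets M" "prob A \<le> e / 4"
  "\<And>om. om \<in> space M - A ==> (\<integral>\<^sup>+s\<in>{0..t}. hs2 g K (\<lambda>u. integrand E s om u - \<Phi> s om u) \<partial>lborel) \<le> ennreal (e / 4)"
  "\<And>om. om \<in> space M - A ==> norm (stoch_int E t om - Y om) \<le> e / 4"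
  using has_int_approx[OF P e4] by blast
 obtain E' A' where E': "is_elementary M \<F> K E'" "A' \<in> sets M" "prob A' \<le> e / 4"
  "\<And>om. om \<in> space M - A' ==> (\<integral>\<^sup>+s\<in>{0..t}. hs2 g K (\<lambda>u. integrand E' s om u - \<Phi>' s om u) \<partial>lborel) \<le> ennreal (e / 4)"
  "\<And>om. om \<in> space M - A' ==> norm (stoch_int E' t om - Y' om) \<le> e / 4"
  using has_int_approx[OF P' e4] by blast
 have bm: "bounded_linear (\<lambda>x::'h. - x)" by (rule bounded_linear_minus[OF bounded_linear_ident])
 define E2 where "E2 = E @ elementary_map (\<lambda>x. - x) E'"
 have E2: "is_elementary M \<F> K E2" unfolding E2_def elementary_append using E(1) elementary_map_linear(3)[OF bm E'(1)] by simp
 have "prob (A \<union> A') \<le> e" using measure_Un_le[OF E(2) E'(2)] E(3) E'(3) e by linarith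
 moreover have "(\<integral>\<^sup>+s\<in>{0..t}. hs2 g K (\<lambda>u. integrand E2 s om u - (\<Phi> s om u - \<Phi>' s om u)) \<partial>lborel) \<le> ennreal e \<and>
    norm (stoch_int E2 t om - (Y om - Y' om)) \<le> e" if om: "om \<in> space M - (A \<union> A')" for om
 proof
  have omM: "om \<in> space M" using om by auto
  have "(\<integral>\<^sup>+s\<in>{0..t}. hs2 g K (\<lambda>u. integrand E2 s om u - (\<Phi> s om u - \<Phi>' s om u)) \<partial>lborel)
   \<le> 2 * (\<integral>\<^sup>+s\<in>{0..t}. hs2 g K (\<lambda>u. integrand E s om u - \<Phi> s om u) \<partial>lborel)
    + 2 * (\<integral>\<^sup>+s\<in>{0..t}. hs2 g K (\<lambda>u. integrand E' s om u - \<Phi>' s om u) \<partial>lborel)"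
  proof (rule set_nn_integral_add_le)
   fix s
   have "hs2 g K (\<lambda>u. integrand E2 s om u - (\<Phi> s om u - \<Phi>' s om u))
    = hs2 g K (\<lambda>u. (integrand E s om u - \<Phi> s om u) - (integrand E' s om u - \<Phi>' s om u))"
    by (simp add: E2_def elementary_append elementary_map_linear(2)[OF bm] algebra_simps)
   thus "hs2 g K (\<lambda>u. integrand E2 s om u - (\<Phi> s om u - \<Phi>' s om u)) \<le>
    2 * hs2 g K (\<lambda>u. integrand E s om u - \<Phi> s om u) + 2 * hs2 g K (\<lambda>u. integrand E' s om u - \<Phi>' s om u)"
    using hs2_diff_le by simp
  qed (use has_int_diff_measurable[OF P omM] has_int_diff_measurable[OF P' omM] in auto)
  also have "\<dots> \<le> 2 * ennreal (e / 4) + 2 * ennreal (e / 4)"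
   using E(4) E'(4) om by (intro add_mono mult_left_mono) auto
  also have "\<dots> = ennreal (2 * (e / 4) + 2 * (e / 4))" using e by (simp only: ennreal_plus ennreal_mult) simp
  also have "2 * (e / 4) + 2 * (e / 4) = e" by simp
  finally show "(\<integral>\<^sup>+s\<in>{0..t}. hs2 g K (\<lambda>u. integrand E2 s om u - (\<Phi> s om u - \<Phi>' s om u)) \<partial>lborel) \<le> ennreal e" .
  have "stoch_int E2 t om - (Y om - Y' om) = (stoch_int E t om - Y om) - (stoch_int E' t om - Y' om)"
   by (simp add: E2_def elementary_append elementary_map_linear(1)[OF bm])
  hence "norm (stoch_int E2 t om - (Y om - Y' om)) \<le> norm (stoch_int E t om - Y om) + norm (stoch_int E' t om - Y' om)"
   by (simp only: norm_triangle_ineq4)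
  also have "\<dots> \<le> e / 4 + e / 4" using E(5) E'(5) om by (intro add_mono) auto
  finally show "norm (stoch_int E2 t om - (Y om - Y' om)) \<le> e" using e by simp
 qed
 ultimately show "\<exists>E A. is_elementary M \<F> K E \<and> A \<in> sets M \<and> prob A \<le> e \<and>
   (\<forall>om\<in>space M - A. (\<integral>\<^sup>+s\<in>{0..t}. hs2 g K (\<lambda>u. integrand E s om u - (\<Phi> s om u - \<Phi>' s om u)) \<partial>lborel) \<le> ennreal e \<and>
     norm (stoch_int E t om - (Y om - Y' om)) \<le> e)"
  using E2 E(2) E'(2) by (intro exI[of _ E2] exI[of _ "A \<union> A'"]) auto
qed

lemma has_int_blinfun_extend:
 fixes T :: "'h::{real_inner, banach, second_countable_topology} \<Rightarrow>\<^sub>L 'h"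
 assumes P: "has_int r \<Phi> Y" and r: "0 \<le> r" "r \<le> t"
 shows "has_int t (\<lambda>s om u. if s \<le> r then T (\<Phi> s om u) else 0) (\<lambda>om. T (Y om))"
 unfolding has_int_def
proof (intro conjI ballI allI impI)
 have Tm: "blinfun_apply T \<in> borel_measurable borel"
  by (intro borel_measurable_continuous_onI continuous_intros)
 fix om k assume om: "om \<in> space M" "k \<in> K"
 have 1: "(\<lambda>s. T (\<Phi> s om (g k))) \<in> borel_measurable (restrict_space borel {0..r})"
  using P om unfolding has_int_def by (intro measurable_compose[OF _ Tm]) auto
 hence "(\<lambda>s. indicator {0..r} s *\<^sub>R T (\<Phi> s om (g k))) \<in> borel_measurable borel"
  by (subst (asm) borel_measurable_restrict_space_iff) auto
 hence "(\<lambda>s. indicator {0..r} s *\<^sub>R T (\<Phi> s om (g k))) \<in> borel_measurable (restrict_space borel {0..t})"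
  by (rule measurable_restrict_space1)
 thus "(\<lambda>s. if s \<le> r then T (\<Phi> s om (g k)) else 0) \<in> borel_measurable (restrict_space borel {0..t})"
  by (rule measurable_cong[THEN iffD1, rotated]) (auto simp: space_restrict_space indicator_def)
next
 fix e :: real assume e: "e > 0"
 define c where "c = 1 + norm T"
 have c: "c \<ge> 1" "norm T \<le> c" by (auto simp: c_def)
 define d where "d = e / c^2"
 have c2: "c \<le> c^2" "1 \<le> c^2" using c by (auto simp: power2_eq_square one_le_mult_iff intro: order_trans[OF _ mult_mono[of 1 c 1 c]])
 have d: "d > 0" "d \<le> e" "c^2 * d = e" "c * d \<le> e"
 proof -
  have "0 < c^2" using c2 by linarith
  thus "d > 0" "c^2 * d = e" using e by (auto simp: d_def)
  thus "d \<le> e" "c * d \<le> e" using mult_right_mono[OF c2(2), of d] mult_right_mono[OF c2(1), of d] by auto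
 qed
 obtain E A where E: "is_elementary M \<F> K E" "A \<in> sets M" "prob A \<le> d"
  "\<And>om. om \<in> space M - A ==> (\<integral>\<^sup>+s\<in>{0..r}. hs2 g K (\<lambda>u. integrand E s om u - \<Phi> s om u) \<partial>lborel) \<le> ennreal d"
  "\<And>om. om \<in> space M - A ==> norm (stoch_int E r om - Y om) \<le> d"
  using has_int_approx[OF P d(1)] by blast
 define E2 where "E2 = elementary_stop r (elementary_map (blinfun_apply T) E)"
 have bl: "bounded_linear (blinfun_apply T)" by (rule blinfun.bounded_linear_right)
 note E' = elementary_map_linear(3)[OF bl E(1)]
 note st = elementary_stop[OF r(2) E']
 have "(\<integral>\<^sup>+s\<in>{0..t}. hs2 g K (\<lambda>u. integrand E2 s om u - (if s \<le> r then T (\<Phi> s om u) else 0)) \<partial>lborel) \<le> ennreal e \<and>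
    norm (stoch_int E2 t om - T (Y om)) \<le> e" if om: "om \<in> space M - A" for om
 proof
  have omM: "om \<in> space M" using om by auto
  have "(\<integral>\<^sup>+s\<in>{0..t}. hs2 g K (\<lambda>u. integrand E2 s om u - (if s \<le> r then T (\<Phi> s om u) else 0)) \<partial>lborel)
   = (\<integral>\<^sup>+s\<in>{0..r}. hs2 g K (\<lambda>u. T (integrand E s om u - \<Phi> s om u)) \<partial>lborel)"
   using r by (intro nn_integral_cong) (auto simp: E2_def st(2) elementary_map_linear(2)[OF bl] indicator_def blinfun.diff_right hs2_def)
  also have "\<dots> \<le> ennreal (c^2) * (\<integral>\<^sup>+s\<in>{0..r}. hs2 g K (\<lambda>u. integrand E s om u - \<Phi> s om u) \<partial>lborel) + 0 * (\<integral>\<^sup>+s\<in>{0..r}. 0 \<partial>lborel)"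
   using hs2_blinfun_le[OF c(2)] by (intro set_nn_integral_add_le has_int_diff_measurable[OF P omM]) auto
  also have "\<dots> \<le> ennreal (c^2) * ennreal d" using E(4)[OF om] by (simp add: mult_left_mono)
  also have "\<dots> = ennreal e" using d by (simp flip: ennreal_mult)
  finally show "(\<integral>\<^sup>+s\<in>{0..t}. hs2 g K (\<lambda>u. integrand E2 s om u - (if s \<le> r then T (\<Phi> s om u) else 0)) \<partial>lborel) \<le> ennreal e" .
  have "stoch_int E2 t om - T (Y om) = T (stoch_int E r om - Y om)"
   by (simp add: E2_def st(1) elementary_map_linear(1)[OF bl] blinfun.diff_right)
  hence "norm (stoch_int E2 t om - T (Y om)) \<le> norm T * norm (stoch_int E r om - Y om)"
   by (simp add: norm_blinfun)
  also have "\<dots> \<le> c * d" using c E(5)[OF om] by (intro mult_mono) auto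
  finally show "norm (stoch_int E2 t om - T (Y om)) \<le> e" using d by simp
 qed
 thus "\<exists>E A. is_elementary M \<F> K E \<and> A \<in> sets M \<and> prob A \<le> e \<and>
   (\<forall>om\<in>space M - A. (\<integral>\<^sup>+s\<in>{0..t}. hs2 g K (\<lambda>u. integrand E s om u - (if s \<le> r then T (\<Phi> s om u) else 0)) \<partial>lborel) \<le> ennreal e \<and>
     norm (stoch_int E t om - T (Y om)) \<le> e)"
  using st(3) E(2,3) d by (intro exI[of _ E2] exI[of _ A]) (auto simp: E2_def)
qed

theorem has_int_exponential_bound:
 assumes P: "has_int t \<Phi> Y" and t: "0 \<le> t" and \<delta>: "\<delta> > 0" and \<eta>: "\<eta> > 0"
 shows "\<exists>A\<in>sets M. prob A \<le> 3 * exp (- \<delta>\<^sup>2 / (64 * \<eta>)) \<and>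
  (\<forall>om\<in>space M - A. (\<integral>\<^sup>+s\<in>{0..t}. hs2 g K (\<Phi> s om) \<partial>lborel) \<le> ennreal \<eta> --> norm (Y om) \<le> \<delta>)"
proof -
 define e where "e = min (\<delta> / 2) (min \<eta> (exp (- \<delta>\<^sup>2 / (64 * \<eta>))))"
 have e: "e > 0" "e \<le> \<delta> / 2" "e \<le> \<eta>" "e \<le> exp (- \<delta>\<^sup>2 / (64 * \<eta>))" using \<delta> \<eta> by (auto simp: e_def)
 obtain E A where E: "is_elementary M \<F> K E" "A \<in> sets M" "prob A \<le> e"
  "\<And>om. om \<in> space M - A ==> (\<integral>\<^sup>+s\<in>{0..t}. hs2 g K (\<lambda>u. integrand E s om u - \<Phi> s om u) \<partial>lborel) \<le> ennreal e"
  "\<And>om. om \<in> space M - A ==> norm (stoch_int E t om - Y om) \<le> e"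
  using has_int_approx[OF P e(1)] by blast
 have "\<delta> / 2 > 0" "4 * \<eta> > 0" using \<delta> \<eta> by auto
 then obtain A' where A': "A' \<in> sets M" "prob A' \<le> sqrt 2 * exp (- (\<delta> / 2)\<^sup>2 / (4 * (4 * \<eta>)))"
  "\<And>om. om \<in> space M - A' ==> (\<integral>\<^sup>+s\<in>{0..t}. hs2 g K (integrand E s om) \<partial>lborel) \<le> ennreal (4 * \<eta>) ==>
    norm (stoch_int E t om) \<le> \<delta> / 2"
  using elementary_exponential_bound[OF E(1) t, of "\<delta> / 2" "4 * \<eta>"] by meson
 have "- (\<delta> / 2)\<^sup>2 / (4 * (4 * \<eta>)) = - \<delta>\<^sup>2 / (64 * \<eta>)" by (simp add: power_divide)
 hence "prob A' \<le> sqrt 2 * exp (- \<delta>\<^sup>2 / (64 * \<eta>))" using A'(2) by simp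
 also have "\<dots> \<le> 2 * exp (- \<delta>\<^sup>2 / (64 * \<eta>))" by (intro mult_right_mono) (auto simp: real_sqrt_le_iff intro: real_le_lsqrt)
 finally have "prob (A \<union> A') \<le> 3 * exp (- \<delta>\<^sup>2 / (64 * \<eta>))"
  using measure_Un_le[OF E(2) A'(1)] E(3) e(4) by linarith
 moreover have "norm (Y om) \<le> \<delta>" if om: "om \<in> space M - (A \<union> A')" and le: "(\<integral>\<^sup>+s\<in>{0..t}. hs2 g K (\<Phi> s om) \<partial>lborel) \<le> ennreal \<eta>" for om
 proof -
  have om': "om \<in> space M" "om \<in> space M - A" "om \<in> space M - A'" using om by auto
  have "(\<integral>\<^sup>+s\<in>{0..t}. hs2 g K (integrand E s om) \<partial>lborel)
   \<le> 2 * (\<integral>\<^sup>+s\<in>{0..t}. hs2 g K (\<lambda>u. integrand E s om u - \<Phi> s om u) \<partial>lborel) + 2 * (\<integral>\<^sup>+s\<in>{0..t}. hs2 g K (\<Phi> s om) \<partial>lborel)"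
  proof (rule set_nn_integral_add_le)
   fix s
   show "hs2 g K (integrand E s om) \<le> 2 * hs2 g K (\<lambda>u. integrand E s om u - \<Phi> s om u) + 2 * hs2 g K (\<Phi> s om)"
    using hs2_add_le[of g K "\<lambda>u. integrand E s om u - \<Phi> s om u" "\<Phi> s om"] by simp
  qed (use has_int_diff_measurable[OF P om'(1)] has_int_measurable[OF P om'(1)] in auto)
  also have "\<dots> \<le> 2 * ennreal \<eta> + 2 * ennreal \<eta>"
   using E(4)[OF om'(2)] e(3) le by (intro add_mono mult_left_mono) (auto intro: order_trans ennreal_leI)
  also have "\<dots> = ennreal (2 * \<eta> + 2 * \<eta>)" using \<eta> by (simp only: ennreal_plus ennreal_mult) simp
  finally have "norm (stoch_int E t om) \<le> \<delta> / 2" by (intro A'(3)[OF om'(3)]) simp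
  moreover have "norm (stoch_int E t om - Y om) \<le> \<delta> / 2" using E(5)[OF om'(2)] e(2) by simp
  moreover have "norm (Y om) \<le> norm (stoch_int E t om) + norm (stoch_int E t om - Y om)"
   by (metis norm_triangle_sub norm_minus_commute)
  ultimately show ?thesis by linarith
 qed
 ultimately show ?thesis using E(2) A'(1) by (intro bexI[of _ "A \<union> A'"]) auto
qed

end

section \<open>Increments of the stochastic convolution\<close>

lemma norm_set_integral_lborel_le:
 fixes f :: "real => 'b::{banach, second_countable_topology}"
 assumes w: "set_integrable lebesgue T w" and T: "T \<in> sets borel" and f: "\<And>s. s \<in> T ==> norm (f s) \<le> w s"
 shows "norm (LINT s:T|lborel. f s) \<le> (LINT s:T|lebesgue. w s)"
proof (cases "integrable lborel (\<lambda>s. indicator T s *\<^sub>R f s)")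
 case True
 hence "(LINT s:T|lborel. f s) = (LINT s:T|lebesgue. f s)"
  unfolding set_lebesgue_integral_def by (subst integral_completion) auto
 thus ?thesis using norm_set_integral_le[OF w f] by simp
next
 case False
 hence "(LINT s:T|lborel. f s) = 0" unfolding set_lebesgue_integral_def by (rule not_integrable_integral_eq)
 moreover have "0 \<le> (LINT s:T|lebesgue. w s)"
  unfolding set_lebesgue_integral_def
  by (intro integral_nonneg_AE AE_I2) (use order_trans[OF norm_ge_zero f] in \<open>auto simp: indicator_def\<close>)
 ultimately show ?thesis by simp
qed

locale mild_process = wiener_family M \<F> K \<beta> g + coefficient g K G \<Lambda>
 for M :: "'w measure" and \<F> :: "real => 'w measure" and K :: "nat set" and \<beta> :: "nat => real => 'w => real"
  and g :: "nat => 'u::{real_inner, banach, second_countable_topology}"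
  and G :: "'h::{real_inner, banach, second_countable_topology} => 'u \<Rightarrow>\<^sub>L 'h" and \<Lambda> :: real +
 fixes S :: "real => 'h \<Rightarrow>\<^sub>L 'h" and F :: "real => 'h => 'h" and \<nu> :: "real => real"
  and x :: 'h and X :: "real => 'w => 'h" and C :: real and Y :: "real => 'w => 'h"
 assumes semigroup: "strongly_continuous_semigroup S"
  and \<nu>: "\<nu> \<in> L2"
  and F_growth: "\<And>t y. t \<in> {0..1} ==> norm (F t y) \<le> \<nu> t * (1 + norm y)"
  and X_continuous: "\<And>om. om \<in> space M ==> continuous_on {0..1} (\<lambda>t. X t om)"
  and C: "1 \<le> C" "\<And>t. t \<in> {0..1} ==> norm (S t) \<le> C"
  and Y: "\<And>t. t \<in> {0..1} ==> has_int t (\<lambda>s om u. S (t - s) (G (X s om) u)) (Y t)"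
  and X_eq: "\<And>t. t \<in> {0..1} ==> AE om in M. X t om = S t x + (LINT s:{0..t}|lborel. S (t - s) (F s (X s om))) + Y t om"
begin

lemma S_norm: "t \<in> {0..1} ==> norm (S t h) \<le> C * norm h"
 using norm_blinfun[of "S t" h] mult_right_mono[OF C(2)[of t] norm_ge_zero[of h]] by linarith

lemma S_add: "0 \<le> s ==> 0 \<le> t ==> S (s + t) h = S s (S t h)"
 by (rule semigroup_add[OF semigroup])

definition drift :: "real => 'w => 'h" where
 "drift t om = (LINT s:{0..t}|lborel. S (t - s) (F s (X s om)))"

lemma drift_bound:
 assumes t: "0 \<le> t" "t \<le> eps" "eps \<le> 1" and \<rho>: "\<And>s. s \<in> {0..t} ==> norm (X s om) \<le> \<rho>"
 shows "norm (drift t om) \<le> C * (1 + \<rho>) * sqrt (eps * cost \<nu>)"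
proof -
 have T: "{0..t} \<in> sets lebesgue" "{0..t} \<subseteq> {0..1}" using t by auto
 have \<rho>0: "0 \<le> \<rho>" using order_trans[OF norm_ge_zero \<rho>[of 0]] t by simp
 have "norm (drift t om) \<le> (LINT s:{0..t}|lebesgue. C * (1 + \<rho>) * norm (\<nu> s))"
  unfolding drift_def
 proof (rule norm_set_integral_lborel_le)
  show "set_integrable lebesgue {0..t} (\<lambda>s. C * (1 + \<rho>) * norm (\<nu> s))"
   by (intro set_integrable_mult_right set_integrable_unit[OF L2_norm_integrable[OF \<nu>]] T)
  fix s assume s: "s \<in> {0..t}"
  have "norm (S (t - s) (F s (X s om))) \<le> C * norm (F s (X s om))" using s t by (intro S_norm) auto
  also have "norm (F s (X s om)) \<le> norm (\<nu> s) * (1 + \<rho>)"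
  proof (rule order_trans[OF F_growth])
   show "s \<in> {0..1}" using s t by auto
   show "\<nu> s * (1 + norm (X s om)) \<le> norm (\<nu> s) * (1 + \<rho>)" using \<rho>[OF s] by (intro mult_mono) auto
  qed
  finally show "norm (S (t - s) (F s (X s om))) \<le> C * (1 + \<rho>) * norm (\<nu> s)" using C(1) by (simp add: mult_ac)
 qed simp
 also have "\<dots> = C * (1 + \<rho>) * (LINT s:{0..t}|lebesgue. norm (\<nu> s))" by simp
 also have "\<dots> \<le> C * (1 + \<rho>) * sqrt ((t - 0) * cost \<nu>)"
  using C(1) \<rho>0 t by (intro mult_left_mono L2_norm_integral_le_cost \<nu> T) auto
 also have "\<dots> \<le> C * (1 + \<rho>) * sqrt (eps * cost \<nu>)"
  using C(1) \<rho>0 t cost_nonneg[of \<nu>] by (intro mult_left_mono real_sqrt_le_mono mult_right_mono) auto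
 finally show ?thesis .
qed

definition conv :: "real => real => 'w => 'h" where
 "conv a b om = Y b om - S (b - a) (Y a om)"

lemma conv_bound:
 assumes ab: "0 \<le> a" "a < b" "b \<le> 1" and \<rho>: "\<rho> \<ge> 0" and \<delta>: "\<delta> > 0"
 shows "\<exists>A\<in>sets M. prob A \<le> 3 * exp (- \<delta>\<^sup>2 / (64 * C^2 * \<Lambda>^2 * (1 + \<rho>)^2 * (b - a))) \<and>
  (\<forall>om\<in>space M - A. (\<forall>s\<in>{a..b}. norm (X s om) \<le> \<rho>) --> norm (conv a b om) \<le> \<delta>)"
proof -
 define \<Phi> where "\<Phi> s om u = S (b - s) (G (X s om) u) - (if s \<le> a then S (b - a) (S (a - s) (G (X s om) u)) else 0)" for s om u
 define q where "q = C^2 * (\<Lambda> * (1 + \<rho>))^2"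
 define \<eta> where "\<eta> = q * (b - a)"
 have q: "q > 0" using C(1) \<Lambda> \<rho> by (simp add: q_def)
 hence \<eta>: "\<eta> > 0" using ab by (simp add: \<eta>_def)
 have I: "has_int b \<Phi> (conv a b)"
  unfolding \<Phi>_def conv_def
  by (rule has_int_diff[OF Y has_int_blinfun_extend[OF Y]]) (use ab in auto)
 have z: "hs2 g K (\<Phi> s om) = 0" if "s \<in> {0..a}" for s om
 proof -
  have "S (b - s) h = S (b - a) (S (a - s) h)" for h
   using S_add[of "b - a" "a - s" h] that ab by simp
  thus ?thesis using that by (simp add: \<Phi>_def hs2_def)
 qed
 have p: "hs2 g K (\<Phi> s om) \<le> ennreal q" if s: "s \<in> {a<..b}" and X: "norm (X s om) \<le> \<rho>" for s om
 proof -
  have "hs2 g K (\<Phi> s om) = hs2 g K (\<lambda>u. S (b - s) (G (X s om) u))" using s by (simp add: \<Phi>_def hs2_def)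
  also have "\<dots> \<le> ennreal (C^2) * hs2 g K (G (X s om))" using s ab by (intro hs2_blinfun_le C(2)) auto
  also have "hs2 g K (G (X s om)) \<le> ennreal ((\<Lambda> * (1 + \<rho>))^2)"
   using \<Lambda> X by (intro hs2_le_square hs order_trans[OF growth] mult_left_mono) auto
  hence "ennreal (C^2) * hs2 g K (G (X s om)) \<le> ennreal (C^2) * ennreal ((\<Lambda> * (1 + \<rho>))^2)" by (rule mult_left_mono) simp
  also have "\<dots> = ennreal q" by (simp add: q_def ennreal_mult)
  finally show ?thesis .
 qed
 obtain A where A: "A \<in> sets M" "prob A \<le> 3 * exp (- \<delta>\<^sup>2 / (64 * \<eta>))"
  "\<And>om. om \<in> space M - A ==> (\<integral>\<^sup>+s\<in>{0..b}. hs2 g K (\<Phi> s om) \<partial>lborel) \<le> ennreal \<eta> ==> norm (conv a b om) \<le> \<delta>"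
  using has_int_exponential_bound[OF I _ \<delta> \<eta>] ab by auto
 have "norm (conv a b om) \<le> \<delta>" if om: "om \<in> space M - A" and X: "\<forall>s\<in>{a..b}. norm (X s om) \<le> \<rho>" for om
 proof (rule A(3)[OF om])
  have "(\<integral>\<^sup>+s\<in>{0..b}. hs2 g K (\<Phi> s om) \<partial>lborel) \<le> (\<integral>\<^sup>+s. ennreal q * indicator {a<..b} s \<partial>lborel)"
  proof (rule nn_integral_mono)
   fix s
   consider "s \<in> {0..a}" | "s \<in> {a<..b}" | "s \<notin> {0..b}" using ab by fastforce
   thus "hs2 g K (\<Phi> s om) * indicator {0..b} s \<le> ennreal q * indicator {a<..b} s"
   proof cases
    case 2
    thus ?thesis using p[OF 2, of om] X ab by (auto simp: indicator_def)
   qed (simp_all add: z)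
  qed
  also have "\<dots> = ennreal q * ennreal (b - a)" using ab by (simp add: nn_integral_cmult_indicator)
  also have "\<dots> = ennreal \<eta>" using q ab by (simp add: \<eta>_def ennreal_mult)
  finally show "(\<integral>\<^sup>+s\<in>{0..b}. hs2 g K (\<Phi> s om) \<partial>lborel) \<le> ennreal \<eta>" .
 qed
 moreover have eq: "64 * C^2 * \<Lambda>^2 * (1 + \<rho>)^2 * (b - a) = 64 * \<eta>" by (simp add: \<eta>_def q_def power_mult_distrib)
 ultimately show ?thesis unfolding eq using A(1,2) by (intro bexI[of _ A]) auto
qed

lemma conv_chain:
 assumes "0 \<le> a" "a \<le> s" "s \<le> t"
 shows "conv a t om = conv s t om + S (t - s) (conv a s om)"
proof -
 have "S (t - a) (Y a om) = S (t - s) (S (s - a) (Y a om))"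
  using S_add[of "t - s" "s - a"] assms by simp
 thus ?thesis by (simp add: conv_def blinfun.diff_right)
qed

lemma chaining_constant: "(\<Sum>l<L. (sqrt (3/4))^l) \<le> (8::real)"
proof -
 have q: "sqrt (3/4) \<le> (7/8::real)" by (rule real_le_lsqrt) (auto simp: power2_eq_square)
 have "(\<Sum>l<L. (sqrt (3/4))^l) \<le> (\<Sum>l<L. (7/8::real)^l)"
  using q by (intro sum_mono power_mono) auto
 also have "\<dots> = (1 - (7/8)^L) / (1 - 7/8)" by (subst sum_gp_strict) auto
 also have "\<dots> \<le> 8" by simp
 finally show ?thesis .
qed

lemma chaining_exponent: "q \<ge> 0 ==> q + 2 * real l + 2 \<le> 4 * (q + 1) * (3/2)^l"
proof -
 assume q: "q \<ge> 0"
 have "2 * real l + 2 \<le> 4 * (3/2)^l"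
 proof (induction l)
  case (Suc l)
  have "1 \<le> (3/2::real)^l" by (rule one_le_power) simp
  moreover have "4 * (3/2::real) ^ Suc l = 4 * (3/2)^l + 2 * (3/2)^l" by simp
  ultimately show ?case using Suc unfolding of_nat_Suc distrib_left by linarith
 qed simp
 hence "(q + 1) * (2 * real l + 2) \<le> (q + 1) * (4 * (3/2)^l)" using q by (intro mult_left_mono) auto
 moreover have "q + 2 * real l + 2 \<le> (q + 1) * (2 * real l + 2)"
 proof -
  have "0 \<le> q * real l" using q by simp
  thus ?thesis using q by (simp add: algebra_simps)
 qed
 ultimately have "q + 2 * real l + 2 \<le> (q + 1) * (4 * (3/2)^l)" by (rule order_trans[rotated])
 also have "(q + 1) * (4 * (3/2)^l) = 4 * (q + 1) * (3/2)^l" by simp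
 finally show ?thesis .
qed

text \<open>
 The semigroup property replaces a maximal inequality: up to the bounded factors \<open>S\<close>, the
 convolution at a dyadic time is a sum of convolutions over dyadic intervals, one of each length.
\<close>

lemma conv_dyadic_bound:
 assumes a: "0 \<le> a" "0 < h" "a + h \<le> 1" and \<rho>: "\<rho> \<ge> 0" and q: "q \<ge> 0"
 defines "B \<equiv> 64 * C^2 * \<Lambda>^2 * (1 + \<rho>)^2"
 shows "\<exists>A\<in>sets M. prob A \<le> 2 * exp (- q) \<and>
  (\<forall>om\<in>space M - A. \<forall>L i. i \<le> 2^L --> (\<forall>s\<in>{a..a + h * real i / 2^L}. norm (X s om) \<le> \<rho>)
    --> norm (conv a (a + h * real i / 2^L) om) \<le> 16 * C * sqrt (B * h * (q + 1)))"
proof -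
 have B: "B > 0" using C(1) \<Lambda> \<rho> by (simp add: B_def)
 define d where "d l = 2 * sqrt (B * h * (q + 1)) * (sqrt (3/4))^l" for l :: nat
 have d: "d l > 0" for l using B a q by (simp add: d_def)
 define \<tau> where "\<tau> l i = a + h * real i / 2^l" for l i :: nat
 have \<tau>S: "\<tau> l (Suc i) = \<tau> l i + h / 2^l" for l i by (simp add: \<tau>_def add_divide_distrib distrib_left)
 have \<tau>0: "a \<le> \<tau> l i" for l i using a by (simp add: \<tau>_def)
 have \<tau>1: "\<tau> l i \<le> a + h" if "i \<le> 2^l" for l i
 proof -
  have "real i \<le> 2^l" using that by (metis of_nat_le_iff of_nat_numeral of_nat_power)
  hence "h * (real i / 2^l) \<le> h * 1" using a by (intro mult_left_mono) auto
  thus ?thesis by (simp add: \<tau>_def)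
 qed
 have "\<exists>A\<in>sets M. prob A \<le> 3/4 * exp (- q) * (1/4)^l \<and>
  (\<forall>om\<in>space M - A. (\<forall>s\<in>{\<tau> l i..\<tau> l (Suc i)}. norm (X s om) \<le> \<rho>) --> norm (conv (\<tau> l i) (\<tau> l (Suc i)) om) \<le> d l)"
  if i: "i < 2^l" for l i
 proof -
  have h: "0 \<le> \<tau> l i" "\<tau> l i < \<tau> l (Suc i)" "\<tau> l (Suc i) \<le> 1"
   using \<tau>0[of l i] \<tau>1[of "Suc i" l] i a by (auto simp: \<tau>S)
  have e: "(d l)^2 / (B * (\<tau> l (Suc i) - \<tau> l i)) = 4 * (q + 1) * (3/2)^l"
  proof -
   have "(d l)^2 = 4 * (B * h * (q + 1)) * (3/4)^l"
    using B a q by (simp add: d_def power_mult_distrib power_mult[symmetric] mult.commute[of l]) (simp add: power_mult)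
   hence "(d l)^2 / (B * (\<tau> l (Suc i) - \<tau> l i)) = 4 * (q + 1) * ((3/4)^l * 2^l)"
    using B a by (simp add: \<tau>S)
   thus ?thesis by (simp add: power_mult_distrib[symmetric])
  qed
  have "3 * exp (- (d l)\<^sup>2 / (B * (\<tau> l (Suc i) - \<tau> l i))) \<le> 3/4 * exp (- q) * (1/4)^l"
  proof -
   have "- (d l)\<^sup>2 / (B * (\<tau> l (Suc i) - \<tau> l i)) \<le> - (q + 2 * real l + 2)" using chaining_exponent[OF q, of l] e by simp
   hence "3 * exp (- (d l)\<^sup>2 / (B * (\<tau> l (Suc i) - \<tau> l i))) \<le> 3 * exp (- (q + 2 * real l + 2))" by simp
   also have "\<dots> = 3 * (exp (- q) * (exp (-2) * exp (-2) ^ l))"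
    by (simp add: exp_add[symmetric] exp_of_nat_mult[symmetric] algebra_simps)
   also have "\<dots> \<le> 3 * (exp (- q) * ((1/4) * (1/4) ^ l))"
   proof -
    have "(4::real) = 2 * 2" by simp
    also have "\<dots> \<le> exp 1 * exp 1" using exp_ge_add_one_self[of 1] by (intro mult_mono) auto
    finally have "4 \<le> exp (2::real)" by (simp flip: exp_add)
    hence "exp (-2) \<le> (1/4::real)" by (simp add: exp_minus field_simps)
    thus ?thesis by (intro mult_left_mono mult_mono power_mono) auto
   qed
   finally show ?thesis by simp
  qed
  moreover have "B * (\<tau> l (Suc i) - \<tau> l i) = 64 * C^2 * \<Lambda>^2 * (1 + \<rho>)^2 * (\<tau> l (Suc i) - \<tau> l i)" by (simp add: B_def)
  ultimately have le: "3 * exp (- (d l)\<^sup>2 / (64 * C^2 * \<Lambda>^2 * (1 + \<rho>)^2 * (\<tau> l (Suc i) - \<tau> l i))) \<le> 3/4 * exp (- q) * (1/4)^l" by simp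
  obtain A where A: "A \<in> sets M" "prob A \<le> 3 * exp (- (d l)\<^sup>2 / (64 * C^2 * \<Lambda>^2 * (1 + \<rho>)^2 * (\<tau> l (Suc i) - \<tau> l i)))"
   "\<forall>om\<in>space M - A. (\<forall>s\<in>{\<tau> l i..\<tau> l (Suc i)}. norm (X s om) \<le> \<rho>) --> norm (conv (\<tau> l i) (\<tau> l (Suc i)) om) \<le> d l"
   using conv_bound[OF h \<rho> d[of l]] by (elim bexE conjE)
  show ?thesis by (intro bexI[OF _ A(1)] conjI order_trans[OF A(2) le] A(3))
 qed
 hence "\<forall>l i. \<exists>A. i < 2^l --> A \<in> sets M \<and> prob A \<le> 3/4 * exp (- q) * (1/4)^l \<and>
  (\<forall>om\<in>space M - A. (\<forall>s\<in>{\<tau> l i..\<tau> l (Suc i)}. norm (X s om) \<le> \<rho>) --> norm (conv (\<tau> l i) (\<tau> l (Suc i)) om) \<le> d l)"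
  by (simp only: Bex_def) (intro allI, case_tac "i < 2^l", simp_all)
 then obtain A where A': "\<forall>l i. i < 2^l --> A l i \<in> sets M \<and> prob (A l i) \<le> 3/4 * exp (- q) * (1/4)^l \<and>
  (\<forall>om\<in>space M - A l i. (\<forall>s\<in>{\<tau> l i..\<tau> l (Suc i)}. norm (X s om) \<le> \<rho>) --> norm (conv (\<tau> l i) (\<tau> l (Suc i)) om) \<le> d l)"
  unfolding choice_iff by (elim exE)
 have A: "A l i \<in> sets M" "prob (A l i) \<le> 3/4 * exp (- q) * (1/4)^l"
  "om \<in> space M - A l i ==> (\<forall>s\<in>{\<tau> l i..\<tau> l (Suc i)}. norm (X s om) \<le> \<rho>) ==> norm (conv (\<tau> l i) (\<tau> l (Suc i)) om) \<le> d l"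
  if "i < 2^l" for l i om
  using A'[rule_format, OF that] by auto
 define U where "U l = (\<Union>i<2^l. A l i)" for l :: nat
 have U: "U l \<in> sets M" for l unfolding U_def using A(1) by auto
 have pU: "prob (U l) \<le> exp (- q) * (1/2)^l" for l
 proof -
  have "prob (U l) \<le> (\<Sum>i<2^l. prob (A l i))"
   unfolding U_def using A(1) by (intro finite_measure_subadditive_finite) auto
  also have "\<dots> \<le> (\<Sum>i<(2::nat)^l. 3/4 * exp (- q) * (1/4)^l)" using A(2) by (intro sum_mono) auto
  also have "\<dots> = 3/4 * exp (- q) * (2^l * (1/4)^l)" by simp
  also have "2^l * (1/4::real)^l = (1/2)^l" by (simp add: power_mult_distrib[symmetric])
  also have "3/4 * exp (- q) * (1/2)^l \<le> exp (- q) * (1/2)^l" by simp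
  finally show ?thesis .
 qed
 define V where "V = (\<Union>l. U l)"
 have V: "V \<in> sets M" unfolding V_def using U by auto
 have s: "summable (\<lambda>l. exp (- q) * (1/2)^l)" by (intro summable_mult summable_geometric) simp
 have sU: "summable (\<lambda>l. prob (U l))" by (rule summable_comparison_test'[OF s, of 0]) (use pU in simp)
 have "prob V \<le> (\<Sum>l. prob (U l))" unfolding V_def using U sU by (intro finite_measure_subadditive_countably) auto
 also have "\<dots> \<le> (\<Sum>l. exp (- q) * (1/2)^l)" by (intro suminf_le pU sU s)
 also have "\<dots> = 2 * exp (- q)" by (subst suminf_mult) (auto simp: suminf_geometric intro: summable_geometric)
 finally have pV: "prob V \<le> 2 * exp (- q)" .
 have chain: "i \<le> 2^L ==> (\<forall>s\<in>{a..\<tau> L i}. norm (X s om) \<le> \<rho>) ==> 0 \<le> v ==> v + (\<tau> L i - a) \<le> 1 ==>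
   norm (S v (conv a (\<tau> L i) om)) \<le> C * (\<Sum>l<Suc L. d l)" if om: "om \<in> space M - V" for om L i v
 proof (induction L arbitrary: i v)
  case 0
  show ?case
  proof (cases "i = 0")
   case True
   thus ?thesis using d[of 0] C(1) by (simp add: \<tau>_def conv_def semigroup_0[OF semigroup] blinfun.zero_right)
  next
   case False
   hence i: "i = Suc 0" using 0 by simp
   have "om \<notin> A 0 0" using om by (auto simp: V_def U_def)
   hence "norm (conv (\<tau> 0 0) (\<tau> 0 (Suc 0)) om) \<le> d 0" using A(3)[of 0 0 om] 0(2) om i by (auto simp: \<tau>_def)
   hence "norm (conv a (\<tau> 0 i) om) \<le> d 0" using i by (simp add: \<tau>_def)
   moreover have "v \<in> {0..1}" using 0(3,4) \<tau>0[of 0 i] by auto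
   ultimately show ?thesis using S_norm[of v "conv a (\<tau> 0 i) om"] C(1) by (auto intro: order_trans mult_left_mono)
  qed
 next
  case (Suc L)
  show ?case
  proof (cases "even i")
   case True
   then obtain i' where i': "i = 2 * i'" by blast
   have e: "\<tau> (Suc L) i = \<tau> L i'" by (simp add: \<tau>_def i')
   have "norm (S v (conv a (\<tau> L i') om)) \<le> C * (\<Sum>l<Suc L. d l)"
    using Suc.prems unfolding e by (intro Suc.IH) (auto simp: i')
   also have "\<dots> \<le> C * (\<Sum>l<Suc (Suc L). d l)" using C(1) d[of "Suc L"] by (intro mult_left_mono) auto
   finally show ?thesis unfolding e .
  next
   case False
   then obtain i' where i': "i = Suc (2 * i')" using oddE by (metis Suc_eq_plus1)
   have e: "\<tau> (Suc L) (2 * i') = \<tau> L i'" by (simp add: \<tau>_def)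
   have lt: "2 * i' < 2^Suc L" using Suc.prems(1) i' by simp
   have st: "\<tau> L i' \<le> \<tau> (Suc L) i" unfolding i' \<tau>S e using a by simp
   have "om \<notin> A (Suc L) (2 * i')" using om lt by (auto simp: V_def U_def)
   hence "norm (conv (\<tau> (Suc L) (2 * i')) (\<tau> (Suc L) (Suc (2 * i'))) om) \<le> d (Suc L)"
    using A(3)[OF lt, of om] Suc.prems(2) om \<tau>0[of "Suc L" "2 * i'"] by (auto simp: i')
   hence n1: "norm (conv (\<tau> L i') (\<tau> (Suc L) i) om) \<le> d (Suc L)" unfolding e i' .
   have v1: "v \<in> {0..1}" using Suc.prems(3,4) \<tau>0[of "Suc L" i] by auto
   have "S v (conv a (\<tau> (Suc L) i) om) = S v (conv (\<tau> L i') (\<tau> (Suc L) i) om) + S (v + (\<tau> (Suc L) i - \<tau> L i')) (conv a (\<tau> L i') om)"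
    using conv_chain[OF a(1) \<tau>0 st] S_add[of v "\<tau> (Suc L) i - \<tau> L i'"] Suc.prems(3) st by (simp add: blinfun.add_right)
   also have "norm \<dots> \<le> C * d (Suc L) + C * (\<Sum>l<Suc L. d l)"
   proof (intro order_trans[OF norm_triangle_ineq] add_mono)
    show "norm (S v (conv (\<tau> L i') (\<tau> (Suc L) i) om)) \<le> C * d (Suc L)"
     using S_norm[OF v1, of "conv (\<tau> L i') (\<tau> (Suc L) i) om"] mult_left_mono[OF n1, of C] C(1) by linarith
    show "norm (S (v + (\<tau> (Suc L) i - \<tau> L i')) (conv a (\<tau> L i') om)) \<le> C * (\<Sum>l<Suc L. d l)"
     using Suc.prems st lt by (intro Suc.IH) auto
   qed
   finally show ?thesis by (simp add: algebra_simps)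
  qed
 qed
 have "norm (conv a (\<tau> L i) om) \<le> 16 * C * sqrt (B * h * (q + 1))"
  if "om \<in> space M - V" "i \<le> 2^L" "\<forall>s\<in>{a..\<tau> L i}. norm (X s om) \<le> \<rho>" for om L i
 proof -
  have "norm (S 0 (conv a (\<tau> L i) om)) \<le> C * (\<Sum>l<Suc L. d l)"
   using that \<tau>1[OF that(2)] a by (intro chain) auto
  also have "(\<Sum>l<Suc L. d l) = 2 * sqrt (B * h * (q + 1)) * (\<Sum>l<Suc L. (sqrt (3/4))^l)"
   unfolding d_def sum_distrib_left ..
  also have "C * (2 * sqrt (B * h * (q + 1)) * (\<Sum>l<Suc L. (sqrt (3/4))^l)) \<le> C * (2 * sqrt (B * h * (q + 1)) * 8)"
   using C(1) B a q by (intro mult_left_mono chaining_constant) auto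
  finally show ?thesis by (simp add: semigroup_0[OF semigroup])
 qed
 thus ?thesis using V pV unfolding \<tau>_def by (intro bexI[OF _ V]) auto
qed

end

section \<open>Exponentially good approximation\<close>

lemma dyadic_between:
 fixes a h u w :: real
 assumes "0 < h" "a \<le> u" "u < w" "w \<le> a + h"
 shows "\<exists>L i. i \<le> 2^L \<and> u < a + h * real i / 2^L \<and> a + h * real i / 2^L < w"
proof -
 obtain L where L: "(1/2::real)^L < (w - u) / h" using real_arch_pow_inv[of "(w - u) / h" "1/2"] assms by auto
 define z where "z = (2::real)^L"
 have z: "z > 0" by (simp add: z_def)
 have hz: "h / z < w - u" using L assms(1) z by (simp add: z_def power_divide field_simps)
 define p where "p = (u - a) * z / h"
 have p: "p \<ge> 0" using assms z by (simp add: p_def)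
 define i where "i = nat (\<lfloor>p\<rfloor> + 1)"
 have i: "p < real i" "real i \<le> p + 1" using p unfolding i_def by linarith+
 have ph: "h * p / z = u - a" using assms(1) z by (simp add: p_def)
 have 1: "u < a + h * real i / z"
 proof -
  have "h * p / z < h * real i / z" using i(1) assms(1) z by (intro divide_strict_right_mono mult_strict_left_mono) auto
  thus ?thesis using ph by simp
 qed
 have 2: "a + h * real i / z < w"
 proof -
  have "h * real i / z \<le> h * (p + 1) / z" using i(2) assms(1) z by (intro divide_right_mono mult_left_mono) auto
  also have "\<dots> = (u - a) + h / z" using ph by (simp add: distrib_left add_divide_distrib)
  finally show ?thesis using hz by simp
 qed
 have "h * real i / z < h * 1" using 2 assms(4) by simp
 hence "real i < z" using assms(1) z by (simp add: field_simps)
 hence "i \<le> 2^L" unfolding z_def by (metis less_imp_le of_nat_less_iff of_nat_numeral of_nat_power)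
 thus ?thesis using 1 2 unfolding z_def by blast
qed

context mild_process
begin

lemma drift_0: "drift 0 om = 0"
proof -
 have "(\<lambda>s. indicat_real {0} s *\<^sub>R S (0 - s) (F s (X s om))) = (\<lambda>s. indicator {0} s *\<^sub>R S (0 - 0) (F 0 (X 0 om)))"
 proof
  fix s :: real show "indicat_real {0} s *\<^sub>R S (0 - s) (F s (X s om)) = indicator {0} s *\<^sub>R S (0 - 0) (F 0 (X 0 om))"
   by (cases "s = 0") auto
 qed
 thus ?thesis unfolding drift_def set_lebesgue_integral_def by simp
qed

lemma block_bound:
 assumes a: "0 \<le> a" "0 < h" "a + h \<le> 1" and \<rho>: "\<rho> \<ge> 0" and q: "q \<ge> 0"
 shows "\<exists>A\<in>sets M. prob A \<le> 2 * exp (- q) \<and>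
  (\<forall>om\<in>space M - A. \<forall>e b d0 d1. norm (X a om - e) \<le> d0 --> (\<forall>s\<in>{0..h}. norm (S s e - e) \<le> d1) -->
   norm e + b \<le> \<rho> --> (\<forall>s\<in>{0..a}. norm (X s om) \<le> \<rho>) --> 0 < b -->
   C * d0 + d1 + (1 + C) * (C * (1 + \<rho>) * sqrt ((a + h) * cost \<nu>))
    + 16 * C * sqrt (64 * C^2 * \<Lambda>^2 * (1 + \<rho>)^2 * h * (q + 1)) \<le> b / 2 -->
   (\<forall>t\<in>{a..a + h}. norm (X t om - e) \<le> b))"
proof -
 define \<tau> where "\<tau> L i = a + h * real i / 2^L" for L i :: nat
 have \<tau>: "\<tau> L i \<in> {a..a + h}" if "i \<le> 2^L" for L i
 proof -
  have "real i \<le> 2^L" using that by (metis of_nat_le_iff of_nat_numeral of_nat_power)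
  hence "h * (real i / 2^L) \<le> h * 1" using a by (intro mult_left_mono) auto
  thus ?thesis using a by (simp add: \<tau>_def)
 qed
 define d2 where "d2 = C * (1 + \<rho>) * sqrt ((a + h) * cost \<nu>)"
 define d3 where "d3 = 16 * C * sqrt (64 * C^2 * \<Lambda>^2 * (1 + \<rho>)^2 * h * (q + 1))"
 have d23: "d2 \<ge> 0" "d3 \<ge> 0" using C(1) \<rho> a q cost_nonneg[of \<nu>] by (simp_all add: d2_def d3_def)
 obtain A where A: "A \<in> sets M" "prob A \<le> 2 * exp (- q)"
  "\<And>om L i. om \<in> space M - A ==> i \<le> 2^L ==> \<forall>s\<in>{a..\<tau> L i}. norm (X s om) \<le> \<rho> ==> norm (conv a (\<tau> L i) om) \<le> d3"
  using conv_dyadic_bound[OF a \<rho> q] unfolding d3_def \<tau>_def by blast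
 have "AE om in M. \<forall>L i. i \<le> 2^L --> X (\<tau> L i) om = S (\<tau> L i) x + drift (\<tau> L i) om + Y (\<tau> L i) om"
 proof (intro AE_all_countable[THEN iffD2] allI)
  fix L i
  show "AE om in M. i \<le> 2^L --> X (\<tau> L i) om = S (\<tau> L i) x + drift (\<tau> L i) om + Y (\<tau> L i) om"
  proof (cases "i \<le> 2^L")
   case True
   hence "\<tau> L i \<in> {0..1}" using \<tau>[OF True] a by auto
   from X_eq[OF this] show ?thesis unfolding drift_def by eventually_elim simp
  qed simp
 qed
 then obtain Z where Z: "Z \<in> null_sets M"
  "\<And>om L i. om \<in> space M - Z ==> i \<le> 2^L ==> X (\<tau> L i) om = S (\<tau> L i) x + drift (\<tau> L i) om + Y (\<tau> L i) om"
  by (auto elim!: AE_E3)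
 have AZ: "A \<union> Z \<in> sets M" "prob (A \<union> Z) \<le> 2 * exp (- q)"
  using A(1,2) Z(1) by (auto simp: measure_Un_null_set)
 have "norm (X t om - e) \<le> b"
  if om: "om \<in> space M - (A \<union> Z)" and e: "norm (X a om - e) \<le> d0" "\<And>s. s \<in> {0..h} ==> norm (S s e - e) \<le> d1"
   "norm e + b \<le> \<rho>" and X: "\<And>s. s \<in> {0..a} ==> norm (X s om) \<le> \<rho>" and b: "0 < b"
   and le: "C * d0 + d1 + (1 + C) * d2 + d3 \<le> b / 2" and t: "t \<in> {a..a + h}" for om e b d0 d1 t
 proof (rule ccontr)
  assume neg: "\<not> norm (X t om - e) \<le> b"
  have om': "om \<in> space M" "om \<in> space M - A" "om \<in> space M - Z" using om by auto
  define f where "f s = norm (X s om - e)" for s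
  have fc: "continuous_on {a..a + h} f"
   unfolding f_def using a by (intro continuous_intros continuous_on_subset[OF X_continuous[OF om'(1)]]) auto
  have d01: "0 \<le> d0" "0 \<le> d1" using order_trans[OF norm_ge_zero e(1)] order_trans[OF norm_ge_zero e(2)[of 0]] a by auto
  have Cd0: "d0 \<le> C * d0" using C(1) d01 by (simp add: mult_le_cancel_right1)
  have nn: "0 \<le> (1 + C) * d2" using C(1) d23 by simp
  have fa: "f a \<le> b / 2" using e(1) Cd0 le d01 d23 nn unfolding f_def by linarith
  have dy: "f (\<tau> L i) \<le> b / 2" if i: "i \<le> 2^L" and Xs: "\<And>s. s \<in> {0..\<tau> L i} ==> norm (X s om) \<le> \<rho>" for L i
  proof -
   define u where "u = \<tau> L i"
   have u: "a \<le> u" "u \<le> a + h" using \<tau>[OF i] by (auto simp: u_def)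
   have ua: "u - a \<in> {0..1}" "u - a \<in> {0..h}" using u a by auto
   have eu: "X u om = S u x + drift u om + Y u om" unfolding u_def by (rule Z(2)[OF om'(3) i])
   have "\<tau> 0 0 = a" by (simp add: \<tau>_def)
   hence ea: "X a om = S a x + drift a om + Y a om" using Z(2)[OF om'(3), of 0 0] by simp
   have Sx: "S u x = S (u - a) (S a x)" using S_add[of "u - a" a x] u a by simp
   have D: "X u om - e = S (u - a) (X a om - e) + (S (u - a) e - e) + (drift u om - S (u - a) (drift a om)) + conv a u om"
    unfolding conv_def eu unfolding ea Sx by (simp add: blinfun.add_right blinfun.diff_right)
   have 1: "norm (S (u - a) (X a om - e)) \<le> C * d0"
    using S_norm[OF ua(1), of "X a om - e"] mult_left_mono[OF e(1), of C] C(1) by linarith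
   have 2: "norm (S (u - a) e - e) \<le> d1" by (rule e(2)[OF ua(2)])
   have 3: "norm (drift u om) \<le> d2" unfolding d2_def
    using u a Xs by (intro drift_bound) (auto simp: u_def)
   have 4: "norm (drift a om) \<le> d2" unfolding d2_def using a X by (intro drift_bound) auto
   have 5: "norm (S (u - a) (drift a om)) \<le> C * d2"
    using S_norm[OF ua(1), of "drift a om"] mult_left_mono[OF 4, of C] C(1) by linarith
   have 6: "norm (conv a u om) \<le> d3" unfolding u_def using Xs a by (intro A(3)[OF om'(2) i]) auto
   have 7: "norm (drift u om - S (u - a) (drift a om)) \<le> d2 + C * d2"
    by (rule order_trans[OF norm_triangle_ineq4 add_mono[OF 3 5]])
   have "norm (X u om - e) \<le> C * d0 + d1 + (d2 + C * d2) + d3"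
    unfolding D by (intro order_trans[OF norm_triangle_ineq] add_mono 1 2 7 6)
   thus ?thesis using le unfolding f_def u_def by (simp add: distrib_right)
  qed
  define T where "T = {s \<in> {a..a + h}. b \<le> f s}"
  have "closed T" unfolding T_def by (rule continuous_on_closed_Collect_le[OF continuous_on_const fc]) auto
  moreover have "t \<in> T" using neg t by (simp add: T_def f_def)
  moreover have bb: "bdd_below T" unfolding T_def by (intro bdd_belowI[of _ a]) auto
  ultimately have mT: "Inf T \<in> T" by (intro closed_contains_Inf) auto
  define t' where "t' = Inf T"
  have t': "t' \<in> {a..a + h}" "b \<le> f t'" using mT by (auto simp: t'_def T_def)
  have before: "f s < b" if "s \<in> {a..a + h}" "s < t'" for s
  proof (rule ccontr)
   assume "\<not> f s < b"
   hence "s \<in> T" using that by (simp add: T_def)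
   hence "t' \<le> s" unfolding t'_def by (intro cInf_lower bb)
   thus False using that by simp
  qed
  have at': "a < t'" using t' fa b by (cases "t' = a") auto
  obtain d where d: "d > 0" "\<And>s. s \<in> {a..a + h} ==> dist s t' < d ==> dist (f s) (f t') < b / 2"
   using fc t'(1) b unfolding continuous_on_iff by (metis half_gt_zero)
  have "max a (t' - d) < t'" using at' d(1) by simp
  then obtain L i where Li: "i \<le> 2^L" "max a (t' - d) < \<tau> L i" "\<tau> L i < t'"
   using dyadic_between[OF a(2), of a "max a (t' - d)" t'] t'(1) unfolding \<tau>_def by auto
  have "f (\<tau> L i) \<le> b / 2"
  proof (rule dy[OF Li(1)])
   fix s assume s: "s \<in> {0..\<tau> L i}"
   show "norm (X s om) \<le> \<rho>"
   proof (cases "s \<le> a")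
    case True thus ?thesis using X s by auto
   next
    case False
    hence "f s < b" using s Li t'(1) by (intro before) auto
    moreover have "norm (X s om) \<le> norm e + f s" unfolding f_def by (metis norm_triangle_sub)
    ultimately show ?thesis using e(3) by linarith
   qed
  qed
  moreover have "dist (f (\<tau> L i)) (f t') < b / 2" using Li t'(1) by (intro d(2)) (auto simp: dist_real_def)
  ultimately show False using t'(2) unfolding dist_real_def abs_less_iff by linarith
 qed
 note main = this
 show ?thesis
 proof (intro bexI[OF _ AZ(1)] conjI ballI allI impI)
  show "prob (A \<union> Z) \<le> 2 * exp (- q)" by (rule AZ(2))
  fix om e b d0 d1 t
  assume h: "om \<in> space M - (A \<union> Z)" "norm (X a om - e) \<le> d0" "\<forall>s\<in>{0..h}. norm (S s e - e) \<le> d1"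
   "norm e + b \<le> \<rho>" "\<forall>s\<in>{0..a}. norm (X s om) \<le> \<rho>" "0 < b"
   "C * d0 + d1 + (1 + C) * (C * (1 + \<rho>) * sqrt ((a + h) * cost \<nu>))
    + 16 * C * sqrt (64 * C^2 * \<Lambda>^2 * (1 + \<rho>)^2 * h * (q + 1)) \<le> b / 2" "t \<in> {a..a + h}"
  show "norm (X t om - e) \<le> b"
   by (rule main[OF h(1,2) bspec[OF h(3)] h(4) bspec[OF h(5)] h(6) h(7)[folded d2_def d3_def] h(8)])
 qed
qed

definition noise :: "real => nat => 'w => nat => nat => real" where
 "noise eps N om i k = inc k (eps * real i / real N) (eps * real (Suc i) / real N) om"

lemma euler_adapted:
 assumes "N > 0" "0 \<le> eps"
 shows "(\<lambda>om. euler x n (noise eps N om) i) \<in> borel_measurable (\<F> (eps * real i / real N))"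
proof (induction i)
 case (Suc i)
 have t: "0 \<le> eps * real i / real N" "eps * real i / real N \<le> eps * real (Suc i) / real N"
  using assms by (auto intro!: divide_right_mono mult_left_mono)
 have e: "(\<lambda>om. euler x n (noise eps N om) i) \<in> borel_measurable (\<F> (eps * real (Suc i) / real N))"
  by (rule measurable_filtration_mono[OF Suc t])
 have G: "(\<lambda>y. G y (g k)) \<in> borel_measurable borel" for k
  by (rule borel_measurable_continuous_onI[OF G_continuous])
 show ?case
  unfolding euler.simps
 proof (intro borel_measurable_add e borel_measurable_sum borel_measurable_scaleR)
  fix k assume "k \<in> modes n"
  thus "(\<lambda>om. noise eps N om i k) \<in> borel_measurable (\<F> (eps * real (Suc i) / real N))"
   unfolding noise_def using modes(2) t by (intro inc_adapted) auto
  show "(\<lambda>om. G (euler x n (noise eps N om) i) (g k)) \<in> borel_measurable (\<F> (eps * real (Suc i) / real N))"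
   by (rule measurable_compose[OF e G])
 qed
qed simp

text \<open>The truncation at \<open>q\<close> makes the coefficients bounded, as \<open>is_elementary\<close> demands.\<close>

definition euler_process :: "nat => real => real => nat => ('w, 'h) elementary_process" where
 "euler_process n q eps N = map (\<lambda>(i, k). (eps * real i / real N, eps * real (Suc i) / real N, k,
   \<lambda>om. if norm (euler x n (noise eps N om) i) \<le> q then G (euler x n (noise eps N om) i) (g k) else 0))
   (List.product [0..<N] (sorted_list_of_set (modes n)))"

lemma sum_list_product:
 fixes f :: "nat \<times> nat => 'b::comm_monoid_add"
 shows "sum_list (map f (List.product [0..<N] (sorted_list_of_set (modes n)))) = (\<Sum>i<N. \<Sum>k\<in>modes n. f (i, k))"
proof -
 have "distinct (List.product [0..<N] (sorted_list_of_set (modes n)))" by (intro distinct_product) auto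
 hence "sum_list (map f (List.product [0..<N] (sorted_list_of_set (modes n)))) = sum f ({0..<N} \<times> modes n)"
  using modes(1) by (simp add: sum_list_distinct_conv_sum_set)
 thus ?thesis by (simp add: sum.cartesian_product atLeast0LessThan)
qed

lemma euler_process_elementary:
 assumes "N > 0" "0 \<le> eps"
 shows "is_elementary M \<F> K (euler_process n q eps N)"
 unfolding is_elementary_alt
proof
 fix p assume "p \<in> set (euler_process n q eps N)"
 then obtain i k where p: "p = (eps * real i / real N, eps * real (Suc i) / real N, k,
   \<lambda>om. if norm (euler x n (noise eps N om) i) \<le> q then G (euler x n (noise eps N om) i) (g k) else 0)" and k: "k \<in> modes n"
  unfolding euler_process_def using modes(1) by auto
 have kK: "k \<in> K" using k modes(2) by auto
 note [measurable] = euler_adapted[OF assms, of n i]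
 have [measurable]: "(\<lambda>y. G y (g k)) \<in> borel_measurable borel" by (rule borel_measurable_continuous_onI[OF G_continuous])
 have m: "(\<lambda>om. if norm (euler x n (noise eps N om) i) \<le> q then G (euler x n (noise eps N om) i) (g k) else 0) \<in> borel_measurable (\<F> (eps * real i / real N))"
  by measurable
 have "norm (if norm y \<le> q then G y (g k) else 0) \<le> \<Lambda> * (1 + \<bar>q\<bar>)" for y
 proof (cases "norm y \<le> q")
  case True
  have "norm (G y (g k)) \<le> \<Lambda> * (1 + norm y)" using G_growth[of y "g k"] basis_norm[OF onb kK] by simp
  also have "\<dots> \<le> \<Lambda> * (1 + \<bar>q\<bar>)" using True \<Lambda> by (intro mult_left_mono) auto
  finally show ?thesis using True by simp
 qed (use \<Lambda> in auto)
 hence bd: "bounded ((\<lambda>om. if norm (euler x n (noise eps N om) i) \<le> q then G (euler x n (noise eps N om) i) (g k) else 0) ` space M)"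
  unfolding bounded_iff by blast
 have "0 \<le> eps * real i / real N" "eps * real i / real N \<le> eps * real (Suc i) / real N"
  using assms by (auto intro!: divide_right_mono mult_left_mono)
 thus "0 \<le> fst p \<and> fst p \<le> fst (snd p) \<and> fst (snd (snd p)) \<in> K \<and>
   snd (snd (snd p)) \<in> borel_measurable (\<F> (fst p)) \<and> bounded (snd (snd (snd p)) ` space M)"
  unfolding p using kK m bd by simp
qed

lemma euler_process_integral:
 assumes N: "N > 0" "0 \<le> eps" "j \<le> N" and q: "\<And>i. i \<le> N ==> norm (euler x n (noise eps N om) i) \<le> q"
 shows "stoch_int (euler_process n q eps N) (eps * real j / real N) om = euler x n (noise eps N om) j - x"
proof -
 let ?e = "euler x n (noise eps N om)"
 define T where "T i = eps * real i / real N" for i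
 have Tm: "T i \<le> T j" if "i \<le> j" for i j using that N by (auto simp: T_def intro!: divide_right_mono mult_left_mono)
 have "stoch_int (euler_process n q eps N) (T j) om =
  (\<Sum>i<N. \<Sum>k\<in>modes n. (\<beta> k (min (T (Suc i)) (T j)) om - \<beta> k (min (T i) (T j)) om) *\<^sub>R (if norm (?e i) \<le> q then G (?e i) (g k) else 0))"
  unfolding elementary_integral_def euler_process_def T_def map_map o_def case_prod_beta sum_list_product by (simp cong: if_cong)
 also have "\<dots> = (\<Sum>i<N. if i < j then ?e (Suc i) - ?e i else 0)"
 proof (intro sum.cong refl)
  fix i assume "i \<in> {..<N}"
  hence qi: "norm (?e i) \<le> q" using q[of i] by simp
  show "(\<Sum>k\<in>modes n. (\<beta> k (min (T (Suc i)) (T j)) om - \<beta> k (min (T i) (T j)) om) *\<^sub>R (if norm (?e i) \<le> q then G (?e i) (g k) else 0)) = (if i < j then ?e (Suc i) - ?e i else 0)"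
  proof (cases "i < j")
   case True
   hence "min (T (Suc i)) (T j) = T (Suc i)" "min (T i) (T j) = T i" using Tm by (auto simp: min_def Suc_le_eq)
   thus ?thesis using True qi by (simp add: noise_def inc_def T_def)
  next
   case False
   hence "min (T (Suc i)) (T j) = T j" "min (T i) (T j) = T j" using Tm[of j i] Tm[of j "Suc i"] by auto
   thus ?thesis using False by simp
  qed
 qed
 also have "\<dots> = (\<Sum>i<j. ?e (Suc i) - ?e i)"
  using N(3) by (intro sum.mono_neutral_cong_right) auto
 also have "\<dots> = ?e j - ?e 0" by (rule sum_lessThan_telescope)
 finally show ?thesis by (simp add: T_def)
qed

lemma euler_process_integrand:
 assumes N: "N > 0" "0 < eps" and i: "i < N" and q: "norm (euler x n (noise eps N om) i) \<le> q"
  and s: "eps * real i / real N < s" "s \<le> eps * real (Suc i) / real N"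
 shows "integrand (euler_process n q eps N) s om u = G (euler x n (noise eps N om) i) (proj n u)"
proof -
 let ?e = "euler x n (noise eps N om)"
 define T where "T i = eps * real i / real N" for i
 have Tm: "T i \<le> T j" if "i \<le> j" for i j using that N by (auto simp: T_def intro!: divide_right_mono mult_left_mono)
 have ind: "indicat_real {T j<..T (Suc j)} s = (if j = i then 1 else 0)" for j
  using s Tm[of "Suc j" i] Tm[of "Suc i" j] unfolding T_def[symmetric] by (auto simp: indicator_def not_less_eq[symmetric] linorder_neq_iff Suc_le_eq)
 have "integrand (euler_process n q eps N) s om u =
  (\<Sum>j<N. \<Sum>k\<in>modes n. (indicator {T j<..T (Suc j)} s * (g k \<bullet> u)) *\<^sub>R (if norm (?e j) \<le> q then G (?e j) (g k) else 0))"
  unfolding elementary_integrand_def euler_process_def T_def map_map o_def case_prod_beta sum_list_product by (simp cong: if_cong)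
 also have "\<dots> = (\<Sum>j<N. if j = i then (\<Sum>k\<in>modes n. (g k \<bullet> u) *\<^sub>R G (?e i) (g k)) else 0)"
  using q by (intro sum.cong refl) (auto simp: ind)
 also have "\<dots> = G (?e i) (proj n u)"
  using i by (simp add: projection_eq blinfun.sum_right blinfun.scaleR_right)
 finally show ?thesis .
qed

lemma euler_compact:
 "\<exists>E. compact E \<and> (\<forall>v i. i \<le> N --> (\<forall>j<N. \<forall>k\<in>modes n. \<bar>v j k\<bar> \<le> c) --> euler x n v i \<in> E)"
proof -
 have "\<exists>E. compact E \<and> (\<forall>v. (\<forall>j<N. \<forall>k\<in>modes n. \<bar>v j k\<bar> \<le> c) --> euler x n v i \<in> E)" if "i \<le> N" for i
  using that
 proof (induction i)
  case 0
  show ?case by (intro exI[of _ "{x}"]) auto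
 next
  case (Suc i)
  then obtain E where E: "compact E" "\<And>v. (\<forall>j<N. \<forall>k\<in>modes n. \<bar>v j k\<bar> \<le> c) ==> euler x n v i \<in> E" by auto
  have "\<exists>P. compact P \<and> (\<forall>h\<in>E. \<forall>c'. (\<forall>k\<in>J. \<bar>c' k\<bar> \<le> c) --> (h, h + (\<Sum>k\<in>J. c' k *\<^sub>R G h (g k))) \<in> P)"
   if "finite J" for J
   using that
  proof (induction J rule: finite_induct)
   case empty
   have "compact ((\<lambda>h. (h, h)) ` E)" by (intro compact_continuous_image continuous_intros E)
   thus ?case by (intro exI[of _ "(\<lambda>h. (h, h)) ` E"]) auto
  next
   case (insert k J)
   then obtain P where P: "compact P" "\<And>h c'. h \<in> E ==> (\<forall>k\<in>J. \<bar>c' k\<bar> \<le> c) ==> (h, h + (\<Sum>k\<in>J. c' k *\<^sub>R G h (g k))) \<in> P" by blast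
   let ?f = "\<lambda>p. (fst (fst p), snd (fst p) + snd p *\<^sub>R G (fst (fst p)) (g k))"
   have "continuous_on (P \<times> {-c..c}) ?f"
    by (intro continuous_intros continuous_on_compose2[OF G_continuous]) auto
   hence "compact (?f ` (P \<times> {-c..c}))" by (intro compact_continuous_image compact_Times P) auto
   moreover have "(h, h + (\<Sum>l\<in>insert k J. c' l *\<^sub>R G h (g l))) \<in> ?f ` (P \<times> {-c..c})"
    if "h \<in> E" "\<forall>l\<in>insert k J. \<bar>c' l\<bar> \<le> c" for h c'
   proof (rule image_eqI)
    show "(h, h + (\<Sum>l\<in>insert k J. c' l *\<^sub>R G h (g l))) = ?f ((h, h + (\<Sum>l\<in>J. c' l *\<^sub>R G h (g l))), c' k)"
     using insert.hyps by (simp add: add_ac)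
    have "(h, h + (\<Sum>l\<in>J. c' l *\<^sub>R G h (g l))) \<in> P" using that by (intro P(2)) auto
    moreover have "c' k \<in> {-c..c}" using that(2)[rule_format, of k] by (simp add: abs_le_iff)
    ultimately show "((h, h + (\<Sum>l\<in>J. c' l *\<^sub>R G h (g l))), c' k) \<in> P \<times> {-c..c}" by (rule SigmaI)
   qed
   ultimately show ?case by blast
  qed
  from this[OF modes(1), of n] obtain P where P: "compact P"
   "\<And>h c'. h \<in> E ==> (\<forall>k\<in>modes n. \<bar>c' k\<bar> \<le> c) ==> (h, h + (\<Sum>k\<in>modes n. c' k *\<^sub>R G h (g k))) \<in> P" by blast
  have "compact (snd ` P)" by (intro compact_continuous_image continuous_intros P)
  moreover have "euler x n v (Suc i) \<in> snd ` P" if "\<forall>j<N. \<forall>k\<in>modes n. \<bar>v j k\<bar> \<le> c" for v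
   using P(2)[OF E(2)[OF that], of "v i"] that Suc.prems by (intro image_eqI[rotated]) auto
  ultimately show ?case by blast
 qed
 then obtain E where E: "\<And>i. i \<le> N ==> compact (E i)"
  "\<And>i v. i \<le> N ==> (\<forall>j<N. \<forall>k\<in>modes n. \<bar>v j k\<bar> \<le> c) ==> euler x n v i \<in> E i" by metis
 have "compact (\<Union>i\<in>{..N}. E i)" using E(1) by (intro compact_UN) auto
 thus ?thesis using E(2) by (intro exI[of _ "\<Union>i\<in>{..N}. E i"]) auto
qed

lemma noise_cost_component:
 assumes "N > 0" "noise_cost n N v \<le> r" "j < N" "k \<in> modes n"
 shows "\<bar>v j k\<bar> \<le> sqrt r"
proof -
 have "(v j k)^2 \<le> (\<Sum>k\<in>modes n. (v j k)\<^sup>2)"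
  using assms(4) modes(1) by (intro member_le_sum) auto
 also have "\<dots> \<le> (\<Sum>i<N. \<Sum>k\<in>modes n. (v i k)\<^sup>2)"
  using assms(3) by (intro member_le_sum[of j "{..<N}" "\<lambda>i. \<Sum>k\<in>modes n. (v i k)\<^sup>2"]) (auto intro: sum_nonneg)
 also have "\<dots> \<le> noise_cost n N v"
  unfolding noise_cost_def using assms(1) mult_right_mono[of 1 "real N" "\<Sum>i<N. \<Sum>k\<in>modes n. (v i k)\<^sup>2"]
  by (simp add: sum_nonneg)
 finally have "(v j k)^2 \<le> r" using assms(2) by simp
 hence "sqrt ((v j k)^2) \<le> sqrt r" by (rule real_sqrt_le_mono)
 thus ?thesis by simp
qed

end

context mild_process
begin

lemma exceptional_set_Union:
 assumes "\<And>j. j < (N :: nat) ==> \<exists>A\<in>sets M. prob A \<le> p \<and> (\<forall>om\<in>space M - A. Q j om)"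
 shows "\<exists>A\<in>sets M. prob A \<le> real N * p \<and> (\<forall>om\<in>space M - A. \<forall>j<N. Q j om)"
proof -
 obtain B where B: "\<And>j. j < N ==> B j \<in> sets M" "\<And>j. j < N ==> prob (B j) \<le> p"
  "\<And>j om. j < N ==> om \<in> space M - B j ==> Q j om" using assms by metis
 have U: "(\<Union>j<N. B j) \<in> sets M" using B(1) by auto
 have "prob (\<Union>j<N. B j) \<le> (\<Sum>j<N. prob (B j))"
  using B(1) by (intro finite_measure_subadditive_finite) auto
 also have "\<dots> \<le> (\<Sum>j<N. p)" using B(2) by (intro sum_mono) auto
 finally have "prob (\<Union>j<N. B j) \<le> real N * p" by simp
 thus ?thesis using B(3) U by (intro bexI[OF _ U]) auto
qed

lemma integrand_bound:
 assumes N: "N > 0" "0 < eps" and i: "i < N" and q: "norm (euler x n (noise eps N om) i) \<le> q"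
  and s: "eps * real i / real N < s" "s \<le> eps * real (Suc i) / real N" and t: "t - s \<in> {0..1}"
  and b: "norm (X s om - euler x n (noise eps N om) i) \<le> b"
  and \<delta>: "hs_norm g K (\<lambda>u. G (euler x n (noise eps N om) i) (u - proj n u)) \<le> \<delta>"
  and m: "\<And>k. k \<in> modes n ==> norm (S (t - s) (G (euler x n (noise eps N om) i) (g k)) - G (euler x n (noise eps N om) i) (g k)) \<le> m"
 shows "hs2 g K (\<lambda>u. S (t - s) (G (X s om) u) - integrand (euler_process n q eps N) s om u)
  \<le> ennreal (2 * C^2 * (\<Lambda> * b)^2 + 4 * C^2 * \<delta>^2 + 4 * real n * m^2)"
proof -
 define e where "e = euler x n (noise eps N om) i"
 define pr where "pr = proj n"
 define D where "D u = S (t - s) (G e (pr u)) - G e (pr u)" for u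
 have split: "S (t - s) (G (X s om) u) - integrand (euler_process n q eps N) s om u =
   S (t - s) (G (X s om) u - G e u) + (S (t - s) (G e (u - pr u)) + D u)" for u
  unfolding euler_process_integrand[OF N i q s] D_def e_def pr_def
  by (simp add: blinfun.diff_right)
 have St: "norm (S (t - s)) \<le> C" by (rule C(2)[OF t])
 have b0: "0 \<le> b" by (rule order_trans[OF norm_ge_zero b])
 have "hilbert_schmidt g K (\<lambda>u. G (X s om) u - G e u) ==> hs2 g K (\<lambda>u. G (X s om) u - G e u) \<le> ennreal ((\<Lambda> * b)^2)"
  using b \<Lambda> by (intro hs2_le_square order_trans[OF lipschitz] mult_left_mono) (auto simp: e_def)
 hence 1: "hs2 g K (\<lambda>u. S (t - s) (G (X s om) u - G e u)) \<le> ennreal (C^2) * ennreal ((\<Lambda> * b)^2)"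
  using hilbert_schmidt_diff[OF hs hs] by (intro order_trans[OF hs2_blinfun_le[OF St]] mult_left_mono) auto
 have 2: "hs2 g K (\<lambda>u. S (t - s) (G e (u - pr u))) \<le> ennreal (C^2) * ennreal (\<delta>^2)"
  using \<delta> unfolding e_def pr_def
  by (intro order_trans[OF hs2_blinfun_le[OF St]] mult_left_mono hs2_le_square G_complement_hilbert_schmidt) auto
 have pg: "pr (g k) = (if k \<in> modes n then g k else 0)" if k: "k \<in> K" for k
 proof -
  have "pr (g k) = (\<Sum>j\<in>modes n. (if j = k then 1 else 0) *\<^sub>R g j)"
   unfolding pr_def projection_eq using k subsetD[OF modes(2)]
   by (intro sum.cong refl) (simp add: basis_inner[OF wiener_family.onb[OF wiener_family_axioms]])
  also have "\<dots> = (\<Sum>j\<in>modes n. if j = k then g j else 0)" by (intro sum.cong) auto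
  finally show ?thesis using modes(1)[of n] by simp
 qed
 have "hs2 g K D \<le> (\<integral>\<^sup>+k. ennreal (m^2) * indicator (modes n) k \<partial>count_space K)"
  unfolding hs2_def
 proof (rule nn_integral_mono)
  fix k assume "k \<in> space (count_space K)"
  hence k: "k \<in> K" by simp
  show "ennreal ((norm (D (g k)))^2) \<le> ennreal (m^2) * indicator (modes n) k"
  proof (cases "k \<in> modes n")
   case True
   thus ?thesis using m[OF True] pg[OF k] by (auto simp: D_def e_def intro!: ennreal_leI power_mono)
  next
   case False
   thus ?thesis using pg[OF k] by (simp add: D_def)
  qed
 qed
 also have "\<dots> = ennreal (m^2) * of_nat (card (modes n))"
  using modes by (simp add: nn_integral_cmult nn_integral_indicator emeasure_count_space)
 also have "\<dots> \<le> ennreal (m^2) * of_nat n"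
  using card_mono[of "{..<n}" "modes n"] by (intro mult_left_mono) (auto simp: modes_def)
 also have "\<dots> = ennreal (real n * m^2)" by (simp add: ennreal_of_nat_eq_real_of_nat ennreal_mult mult.commute)
 finally have 3: "hs2 g K D \<le> ennreal (real n * m^2)" .
 have "hs2 g K (\<lambda>u. S (t - s) (G (X s om) u) - integrand (euler_process n q eps N) s om u)
  \<le> 2 * hs2 g K (\<lambda>u. S (t - s) (G (X s om) u - G e u)) + 2 * hs2 g K (\<lambda>u. S (t - s) (G e (u - pr u)) + D u)"
  unfolding split by (rule hs2_add_le)
 also have "\<dots> \<le> 2 * (ennreal (C^2) * ennreal ((\<Lambda> * b)^2)) + 2 * (2 * (ennreal (C^2) * ennreal (\<delta>^2)) + 2 * ennreal (real n * m^2))"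
  by (intro add_mono mult_left_mono 1 order_trans[OF hs2_add_le] 2 3) auto
 also have "\<dots> = ennreal (2 * (C^2 * (\<Lambda> * b)^2) + 2 * (2 * (C^2 * \<delta>^2) + 2 * (real n * m^2)))"
 proof -
  have e2: "2 * ennreal a = ennreal (2 * a)" if "0 \<le> a" for a using that by (simp add: ennreal_mult)
  show ?thesis by (simp add: e2 flip: ennreal_mult ennreal_plus)
 qed
 also have "\<dots> = ennreal (2 * C^2 * (\<Lambda> * b)^2 + 4 * C^2 * \<delta>^2 + 4 * real n * m^2)"
  by (rule arg_cong[where f = ennreal]) (simp add: algebra_simps)
 finally show ?thesis .
qed

lemma grid_bound:
 assumes N: "N > 0" "0 < eps" "eps \<le> 1" "j \<le> N" and \<delta>: "\<delta> > 0" and \<eta>: "\<eta> > 0"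
 shows "\<exists>A\<in>sets M. prob A \<le> 3 * exp (- \<delta>\<^sup>2 / (64 * \<eta>)) \<and>
  (\<forall>om\<in>space M - A. (\<forall>i\<le>N. norm (euler x n (noise eps N om) i) \<le> q) -->
   (\<integral>\<^sup>+s\<in>{0..eps * real j / real N}. hs2 g K (\<lambda>u. S (eps * real j / real N - s) (G (X s om) u)
     - integrand (euler_process n q eps N) s om u) \<partial>lborel) \<le> ennreal \<eta> -->
   norm (X (eps * real j / real N) om - euler x n (noise eps N om) j)
    \<le> norm (S (eps * real j / real N) x - x) + norm (drift (eps * real j / real N) om) + \<delta>)"
proof -
 define T where "T = eps * real j / real N"
 have T: "T \<in> {0..1}"
 proof -
  have "eps * real j \<le> 1 * real N" using N by (intro mult_mono) auto
  thus ?thesis using N by (simp add: T_def)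
 qed
 have "has_int T (\<lambda>s om u. S (T - s) (G (X s om) u) - integrand (euler_process n q eps N) s om u)
  (\<lambda>om. Y T om - stoch_int (euler_process n q eps N) T om)"
  using N by (intro has_int_diff Y T has_int_elementary euler_process_elementary) auto
 from has_int_exponential_bound[OF this _ \<delta> \<eta>] T obtain A where A: "A \<in> sets M" "prob A \<le> 3 * exp (- \<delta>\<^sup>2 / (64 * \<eta>))"
  "\<And>om. om \<in> space M - A ==> (\<integral>\<^sup>+s\<in>{0..T}. hs2 g K (\<lambda>u. S (T - s) (G (X s om) u)
     - integrand (euler_process n q eps N) s om u) \<partial>lborel) \<le> ennreal \<eta> ==>
   norm (Y T om - stoch_int (euler_process n q eps N) T om) \<le> \<delta>" by auto
 obtain Z where Z: "Z \<in> null_sets M" "\<And>om. om \<in> space M - Z ==> X T om = S T x + drift T om + Y T om"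
  using X_eq[OF T] unfolding drift_def[symmetric] by (auto elim!: AE_E3)
 have AZ: "A \<union> Z \<in> sets M" "prob (A \<union> Z) \<le> 3 * exp (- \<delta>\<^sup>2 / (64 * \<eta>))"
  using A(1,2) Z(1) by (auto simp: measure_Un_null_set)
 show ?thesis
  unfolding T_def[symmetric]
 proof (intro bexI[OF _ AZ(1)] conjI ballI impI)
  show "prob (A \<union> Z) \<le> 3 * exp (- \<delta>\<^sup>2 / (64 * \<eta>))" by (rule AZ(2))
  fix om assume om: "om \<in> space M - (A \<union> Z)" and q: "\<forall>i\<le>N. norm (euler x n (noise eps N om) i) \<le> q"
   and le: "(\<integral>\<^sup>+s\<in>{0..T}. hs2 g K (\<lambda>u. S (T - s) (G (X s om) u)
     - integrand (euler_process n q eps N) s om u) \<partial>lborel) \<le> ennreal \<eta>"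
  have I: "stoch_int (euler_process n q eps N) T om = euler x n (noise eps N om) j - x"
   unfolding T_def by (rule euler_process_integral) (use N q in auto)
  have "norm (Y T om - (euler x n (noise eps N om) j - x)) \<le> \<delta>"
   unfolding I[symmetric] by (rule A(3)[OF _ le]) (use om in auto)
  moreover have D: "X T om - euler x n (noise eps N om) j = (S T x - x) + drift T om + (Y T om - (euler x n (noise eps N om) j - x))"
   using Z(2)[of om] om by simp
  ultimately show "norm (X T om - euler x n (noise eps N om) j) \<le> norm (S T x - x) + norm (drift T om) + \<delta>"
   unfolding D using norm_triangle_ineq[of "(S T x - x) + drift T om" "Y T om - (euler x n (noise eps N om) j - x)"]
    norm_triangle_ineq[of "S T x - x" "drift T om"] by linarith
 qed
qed

lemma exponential_integral_bound:
 assumes c: "c \<ge> 0" "\<kappa> > 0" "eps > 0" and T: "0 \<le> T" "T \<le> eps" and w: "0 \<le> w" "w \<le> c / (2 * \<kappa>)"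
 shows "(\<integral>\<^sup>+s\<in>{0..T}. ennreal (c * exp (2 * \<kappa> * s / eps) + w) \<partial>lborel) \<le> ennreal (eps * c / (2 * \<kappa>) * exp (2 * \<kappa> * T / eps))"
proof -
 define H where "H s = eps * c / (2 * \<kappa>) * exp (2 * \<kappa> * s / eps) + w * s" for s
 have "(\<integral>\<^sup>+s\<in>{0..T}. ennreal (c * exp (2 * \<kappa> * s / eps) + w) \<partial>lborel) = ennreal (H T - H 0)"
 proof (rule nn_integral_FTC_Icc)
  fix s
  show "DERIV H s :> c * exp (2 * \<kappa> * s / eps) + w"
   unfolding H_def using c by (auto intro!: derivative_eq_intros simp: field_simps)
  show "0 \<le> c * exp (2 * \<kappa> * s / eps) + w" using c w by simp
 qed (use T in auto)
 also have "w * T \<le> c / (2 * \<kappa>) * eps" using w T c by (intro mult_mono) auto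
 hence "ennreal (H T - H 0) \<le> ennreal (eps * c / (2 * \<kappa>) * exp (2 * \<kappa> * T / eps))"
  unfolding H_def by (intro ennreal_leI) (simp add: mult.commute)
 finally show ?thesis .
qed

definition euler_close :: "real => real => real => nat => nat => real => bool" where
 "euler_close R r \<rho> n N eps \<longleftrightarrow> (\<exists>A\<in>sets M. prob A \<le> 5 * real N * exp (- R / eps) \<and>
  (\<forall>om\<in>space M - A. noise_cost n N (noise eps N om) \<le> r -->
   (\<forall>t\<in>{0..1}. norm (X (eps * t) om - euler x n (noise eps N om) (block_index N t)) \<le> \<rho>)))"

theorem euler_exponential_approximation:
 assumes R: "R > 0" and r: "r > 0" and \<rho>: "\<rho> > 0"
 shows "\<exists>m. \<forall>n\<ge>m. \<forall>N\<ge>m. \<exists>eps0>0. eps0 \<le> 1 \<and> (\<forall>eps\<in>{0<..eps0}. euler_close R r \<rho> n N eps)"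
proof -
 define q where "q = (1 + norm x) * exp (\<Lambda> * sqrt r)"
 have q: "q > 0" by (simp add: q_def add_pos_nonneg)
 define \<theta> where "\<theta> = 1 / (16 * C)"
 have \<theta>: "\<theta> > 0" "\<theta> \<le> 1/16" using C(1) by (auto simp: \<theta>_def field_simps)
 define \<kappa> where "\<kappa> = 64 * C^2 * \<Lambda>^2 * R / \<theta>^2"
 have \<kappa>: "\<kappa> > 0" using C(1) \<Lambda> R \<theta> by (simp add: \<kappa>_def)
 define \<rho>0 where "\<rho>0 = min \<rho> 1 * exp (- \<kappa>)"
 have \<rho>0: "\<rho>0 > 0" using \<rho> by (simp add: \<rho>0_def)
 define c0 where "c0 = 2 * C^2 * (\<Lambda> * \<rho>0)^2"
 have c0: "c0 > 0" using C(1) \<Lambda> \<rho>0 by (simp add: c0_def)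
 define \<delta> where "\<delta> = sqrt (c0 / (16 * C^2 * \<kappa>))"
 have \<delta>: "\<delta> > 0" "4 * C^2 * \<delta>^2 = c0 / (4 * \<kappa>)" using c0 C(1) \<kappa> by (auto simp: \<delta>_def field_simps)
 obtain m1 where m1: "\<And>n h. n \<ge> m1 ==> norm h < q ==> hs_norm g K (\<lambda>u. G h (u - proj n u)) \<le> \<delta>"
  using G_complement_small[OF q \<delta>(1)] by auto
 define L where "L = 64 * C^2 * \<Lambda>^2 * (1 + q)^2 * (R + 1)"
 have L: "L \<ge> 0" using R by (simp add: L_def)
 obtain m2 :: nat where m2: "L / (\<rho>0 / (128 * C))^2 \<le> real m2" using real_arch_simple by blast
 show ?thesis
 proof (intro exI[of _ "max (max m1 m2) 1"] allI impI)
  fix n N assume "max (max m1 m2) 1 \<le> n" and N': "max (max m1 m2) 1 \<le> N"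
  hence n: "n \<ge> m1" and N: "N > 0" "N \<ge> m2" by auto
  have L16: "16 * C * sqrt (L / real N) \<le> \<rho>0 / 8"
  proof -
   have d: "0 < (\<rho>0 / (128 * C))^2" using \<rho>0 C(1) by simp
   have "L / (\<rho>0 / (128 * C))^2 \<le> real N" using m2 N(2) by linarith
   hence "L \<le> (\<rho>0 / (128 * C))^2 * real N" unfolding pos_divide_le_eq[OF d] by (simp only: mult.commute)
   hence "L / real N \<le> (\<rho>0 / (128 * C))^2" using N(1) by (simp only: pos_divide_le_eq of_nat_0_less_iff)
   hence "sqrt (L / real N) \<le> \<rho>0 / (128 * C)" using \<rho>0 C(1) by (intro real_le_lsqrt) (auto simp: L)
   hence "16 * C * sqrt (L / real N) \<le> 16 * C * (\<rho>0 / (128 * C))" using C(1) by (intro mult_left_mono) auto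
   thus ?thesis using C(1) by simp
  qed
  define m where "m = sqrt (c0 / (16 * \<kappa> * real (n + 1)))"
  have m: "m > 0" using c0 \<kappa> by (simp add: m_def)
  have m4: "4 * real n * m^2 \<le> c0 / (4 * \<kappa>)"
  proof -
   have "4 * real n * m^2 = c0 / (4 * \<kappa>) * (real n / real (n + 1))"
    using c0 \<kappa> by (simp add: m_def del: of_nat_Suc of_nat_add)
   also have "\<dots> \<le> c0 / (4 * \<kappa>) * 1" using c0 \<kappa> by (intro mult_left_mono) auto
   finally show ?thesis by simp
  qed
  obtain E where E: "compact E"
   "\<And>v i. i \<le> N ==> \<forall>j<N. \<forall>k\<in>modes n. \<bar>v j k\<bar> \<le> sqrt r ==> euler x n v i \<in> E"
   using euler_compact[of N n "sqrt r"] by blast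
  define E' where "E' = insert x E \<union> (\<Union>k\<in>modes n. (\<lambda>h. G h (g k)) ` E)"
  have E': "compact E'" unfolding E'_def
   using modes(1) by (intro compact_Un compact_insert compact_UN compact_continuous_image continuous_on_subset[OF G_continuous] E) auto
  obtain d where d: "d > 0" "\<And>s h. s \<in> {0..d} ==> h \<in> E' ==> norm (S s h - h) \<le> min (\<theta> * \<rho>0 / 2) m"
   using semigroup_tendsto_uniformly_on_compact[OF semigroup E', of "min (\<theta> * \<rho>0 / 2) m"] \<theta> \<rho>0 m by auto
  define z where "z = (\<theta> * \<rho>0 / (2 * C * (1 + q)))^2 / (cost \<nu> + 1)"
  have z: "z > 0" using \<theta> \<rho>0 C(1) q cost_nonneg[of \<nu>] by (auto simp: z_def intro!: divide_pos_pos)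
  define eps0 where "eps0 = min (min d z) 1"
  have eps0: "eps0 > 0" "eps0 \<le> 1" using d z by (auto simp: eps0_def)
  show "\<exists>eps0>0. eps0 \<le> 1 \<and> (\<forall>eps\<in>{0<..eps0}. euler_close R r \<rho> n N eps)"
  proof (intro exI[of _ eps0] conjI eps0 ballI)
   fix eps assume "eps \<in> {0<..eps0}"
   hence eps: "0 < eps" "eps \<le> 1" "eps \<le> d" "eps \<le> z" by (auto simp: eps0_def)
   have drift_small: "C * (1 + q) * sqrt (eps * cost \<nu>) \<le> \<theta> * \<rho>0 / 2"
   proof -
    have c: "cost \<nu> + 1 > 0" using cost_nonneg[of \<nu>] by simp
    have "eps * cost \<nu> \<le> z * (cost \<nu> + 1)" using eps cost_nonneg[of \<nu>] by (intro mult_mono) auto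
    also have "\<dots> = (\<theta> * \<rho>0 / (2 * C * (1 + q)))^2" using c by (simp add: z_def)
    finally have "sqrt (eps * cost \<nu>) \<le> \<theta> * \<rho>0 / (2 * C * (1 + q))"
     using \<theta> \<rho>0 C(1) q eps cost_nonneg[of \<nu>] by (intro real_le_lsqrt) auto
    hence "C * (1 + q) * sqrt (eps * cost \<nu>) \<le> C * (1 + q) * (\<theta> * \<rho>0 / (2 * C * (1 + q)))"
     using C(1) q by (intro mult_left_mono) auto
    also have "C * (1 + q) * (\<theta> * \<rho>0 / (2 * C * (1 + q))) = \<theta> * \<rho>0 / 2"
    proof -
     have "a * (y / (2 * a)) = y / 2" if "a \<noteq> 0" for a y :: real using that by simp
     from this[of "C * (1 + q)"] show ?thesis using C(1) q by (simp only: mult.assoc) simp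
    qed
    finally show ?thesis .
   qed
   define T where "T j = eps * real j / real N" for j
   define b where "b j = \<rho>0 * exp (\<kappa> * (real j / real N))" for j
   have T0: "T 0 = 0" by (simp add: T_def)
   have Tm: "T i \<le> T j" if "i \<le> j" for i j
    using that N eps by (auto simp: T_def intro!: divide_right_mono mult_left_mono)
   have TN: "T N = eps" using N by (simp add: T_def)
   have TS: "T (Suc j) = T j + eps / real N" for j
    by (simp add: T_def distrib_left add_divide_distrib add.commute)
   have Tle: "0 \<le> T j" "T j \<le> eps" if "j \<le> N" for j using Tm[of 0 j] Tm[OF that] TN T0 by auto
   have bpos: "0 < b j" "\<rho>0 \<le> b j" for j
    using \<rho>0 \<kappa> N mult_left_mono[of 1 "exp (\<kappa> * (real j / real N))" \<rho>0] by (auto simp: b_def)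
   have ble: "b j \<le> min \<rho> 1" if "j \<le> N" for j
   proof -
    have "\<kappa> * (real j / real N) \<le> \<kappa> * 1" using that N \<kappa> by (intro mult_left_mono) auto
    hence "b j \<le> \<rho>0 * exp \<kappa>" using \<rho>0 unfolding b_def by (intro mult_left_mono) auto
    also have "\<dots> = min \<rho> 1" by (simp add: \<rho>0_def mult.assoc flip: exp_add)
    finally show ?thesis .
   qed
   define \<eta> where "\<eta> j = eps * c0 / (2 * \<kappa>) * exp (2 * \<kappa> * T j / eps)" for j
   have \<eta>: "\<eta> j > 0" for j using eps c0 \<kappa> by (simp add: \<eta>_def)
   have b2: "(b j)^2 = \<rho>0^2 * exp (2 * \<kappa> * T j / eps)" for j
    using eps by (simp add: b_def T_def power_mult_distrib flip: exp_double)
   have \<eta>b: "64 * \<eta> j * R = eps * (\<theta> * b j)^2" for j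
   proof -
    have "64 * \<eta> j * R = eps * (64 * C^2 * \<Lambda>^2 * R / \<kappa>) * (b j)^2"
     unfolding b2 \<eta>_def c0_def by (simp add: power_mult_distrib)
    also have "64 * C^2 * \<Lambda>^2 * R / \<kappa> = \<theta>^2" using C(1) \<Lambda> R \<theta> by (simp add: \<kappa>_def)
    finally show ?thesis by (simp add: power_mult_distrib)
   qed
   have exp_eq: "exp (- (\<theta> * b j)\<^sup>2 / (64 * \<eta> j)) = exp (- R / eps)" for j
   proof -
    have "(\<theta> * b j)^2 / (64 * \<eta> j) = R / eps"
     using \<eta>b[of j] eps \<eta>[of j] by (simp add: frac_eq_eq mult_ac)
    thus ?thesis by simp
   qed
   let ?eu = "\<lambda>om i. euler x n (noise eps N om) i"
   let ?D = "\<lambda>j om s u. S (T j - s) (G (X s om) u) - integrand (euler_process n q eps N) s om u"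
   let ?P = "\<lambda>j om. (\<forall>i\<le>N. norm (?eu om i) \<le> q) -->
     (\<integral>\<^sup>+s\<in>{0..T j}. hs2 g K (?D j om s) \<partial>lborel) \<le> ennreal (\<eta> j) -->
     norm (X (T j) om - ?eu om j) \<le> norm (S (T j) x - x) + norm (drift (T j) om) + \<theta> * b j"
   have "\<exists>A\<in>sets M. prob A \<le> 3 * exp (- R / eps) \<and> (\<forall>om\<in>space M - A. ?P j om)"
    if "j < N" for j
    using grid_bound[of N eps j "\<theta> * b j" "\<eta> j" n q] that N eps \<theta> bpos[of j] \<eta>[of j]
    unfolding exp_eq T_def by simp
   hence "\<exists>A\<in>sets M. prob A \<le> real N * (3 * exp (- R / eps)) \<and> (\<forall>om\<in>space M - A. \<forall>j<N. ?P j om)"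
    by (rule exceptional_set_Union)
   then obtain A1 where A1: "A1 \<in> sets M" "prob A1 \<le> real N * (3 * exp (- R / eps))"
    and A1': "\<forall>om\<in>space M - A1. \<forall>j<N. ?P j om"
    by (elim bexE conjE)
   let ?h = "eps / real N"
   have hpos: "0 < ?h" using eps N by simp
   let ?Q = "\<lambda>j om. \<forall>e b d0 d1. norm (X (T j) om - e) \<le> d0 --> (\<forall>s\<in>{0..?h}. norm (S s e - e) \<le> d1) -->
     norm e + b \<le> q --> (\<forall>s\<in>{0..T j}. norm (X s om) \<le> q) --> 0 < b -->
     C * d0 + d1 + (1 + C) * (C * (1 + q) * sqrt ((T j + ?h) * cost \<nu>))
      + 16 * C * sqrt (64 * C^2 * \<Lambda>^2 * (1 + q)^2 * ?h * (R / eps + 1)) \<le> b / 2 -->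
     (\<forall>t\<in>{T j..T j + ?h}. norm (X t om - e) \<le> b)"
   have "\<exists>A\<in>sets M. prob A \<le> 2 * exp (- (R / eps)) \<and> (\<forall>om\<in>space M - A. ?Q j om)" if "j < N" for j
    using that Tle[of j] Tle[of "Suc j"] eps hpos q R by (intro block_bound) (auto simp: TS)
   hence "\<exists>A\<in>sets M. prob A \<le> real N * (2 * exp (- (R / eps))) \<and> (\<forall>om\<in>space M - A. \<forall>j<N. ?Q j om)"
    by (rule exceptional_set_Union)
   then obtain A2 where A2: "A2 \<in> sets M" "prob A2 \<le> real N * (2 * exp (- (R / eps)))"
    and A2': "\<forall>om\<in>space M - A2. \<forall>j<N. ?Q j om"
    by (elim bexE conjE)
   define A where "A = A1 \<union> A2"
   have A: "A \<in> sets M" using A1(1) A2(1) by (auto simp: A_def)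
   have "prob A \<le> prob A1 + prob A2" unfolding A_def by (rule measure_Un_le[OF A1(1) A2(1)])
   also have "\<dots> \<le> 5 * real N * exp (- R / eps)" using A1(2) A2(2) by simp
   finally have pA: "prob A \<le> 5 * real N * exp (- R / eps)" .
   show "euler_close R r \<rho> n N eps"
     unfolding euler_close_def
   proof (intro bexI[OF _ A] conjI pA ballI impI)
    fix om t assume om: "om \<in> space M - A" and nc: "noise_cost n N (noise eps N om) \<le> r" and t: "t \<in> {0..1::real}"
    let ?e = "?eu om"
    have om12: "om \<in> space M - A1" "om \<in> space M - A2" using om by (auto simp: A_def)
    have eq: "1 + norm (?e i) \<le> q" if "i \<le> N" for i unfolding q_def by (rule euler_bound[OF N(1) nc that])
    have eE: "?e i \<in> E" if "i \<le> N" for i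
     using that noise_cost_component[OF N(1) nc] by (intro E(2)) auto
    have block: "\<forall>t\<in>{T j..T (Suc j)}. norm (X t om - ?e j) \<le> b j" if "j < N" for j
     using that
    proof (induction j rule: less_induct)
     case (less j)
     have j: "j < N" "j \<le> N" "Suc j \<le> N" using less.prems by auto
     have in_block: "\<exists>i<j. T i < s \<and> s \<le> T (Suc i)" if "0 < s" "s \<le> T j" for s
     proof -
      define i where "i = (LEAST i. s \<le> T i)"
      have i: "s \<le> T i" "\<And>l. l < i ==> T l < s"
       unfolding i_def using that(2) by (auto intro: LeastI dest: not_less_Least)
      have "i \<le> j" unfolding i_def by (rule Least_le[where P = "\<lambda>i. s \<le> T i", OF that(2)])
      moreover have "i \<noteq> 0" using i(1) that(1) T0 by (cases "i = 0") auto
      ultimately obtain l where "i = Suc l" "l < j" by (cases i) auto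
      thus ?thesis using i by blast
     qed
     have Xle: "norm (X s om) \<le> q" if s: "s \<in> {0..T j}" "0 < j" for s
     proof -
      have "\<exists>i<j. T i \<le> s \<and> s \<le> T (Suc i)"
      proof (cases "s = 0")
       case True thus ?thesis using s(2) T0 Tm[of 0 1] by (intro exI[of _ 0]) auto
      next
       case False thus ?thesis using in_block[of s] s(1) by fastforce
      qed
      then obtain i where i: "i < j" "s \<in> {T i..T (Suc i)}" by auto
      have "norm (X s om - ?e i) \<le> b i" using less.IH[OF i(1)] i j by auto
      thus ?thesis using eq[of i] ble[of i] i j norm_triangle_sub[of "X s om" "?e i"] by auto
     qed
     have int: "(\<integral>\<^sup>+s\<in>{0..T j}. hs2 g K (?D j om s) \<partial>lborel) \<le> ennreal (\<eta> j)"
     proof -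
      have "(\<integral>\<^sup>+s\<in>{0..T j}. hs2 g K (?D j om s) \<partial>lborel) \<le> (\<integral>\<^sup>+s\<in>{0..T j}. ennreal (c0 * exp (2 * \<kappa> * s / eps) + c0 / (2 * \<kappa>)) \<partial>lborel)"
      proof (rule nn_integral_mono_AE)
       have "AE s in lborel. s \<noteq> (0::real)" by (rule AE_lborel_singleton)
       thus "AE s in lborel. hs2 g K (?D j om s) * indicator {0..T j} s \<le> ennreal (c0 * exp (2 * \<kappa> * s / eps) + c0 / (2 * \<kappa>)) * indicator {0..T j} s"
       proof eventually_elim
        case (elim s)
        show ?case
        proof (cases "s \<in> {0..T j}")
         case True
         hence "0 < s" "s \<le> T j" using elim by auto
         from in_block[OF this] obtain i where i: "i < j" "T i < s" "s \<le> T (Suc i)" by blast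
         have iN: "i < N" "i \<le> N" using i j by auto
         have Tj: "T j \<le> 1" "T j \<le> eps" using Tle[OF j(2)] eps by auto
         have "hs2 g K (?D j om s) \<le> ennreal (2 * C^2 * (\<Lambda> * b i)^2 + 4 * C^2 * \<delta>^2 + 4 * real n * m^2)"
         proof (rule integrand_bound[OF N(1) eps(1) iN(1)])
          show "norm (?e i) \<le> q" using eq[OF iN(2)] by simp
          show "eps * real i / real N < s" "s \<le> eps * real (Suc i) / real N" using i(2,3) by (auto simp: T_def)
          show "T j - s \<in> {0..1}" using True Tj by auto
          show "norm (X s om - ?e i) \<le> b i" using less.IH[OF i(1) iN(1)] i by auto
          show "hs_norm g K (\<lambda>u. G (?e i) (u - proj n u)) \<le> \<delta>"
           using eq[OF iN(2)] by (intro m1 n) auto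
          fix k assume k: "k \<in> modes n"
          have "G (?e i) (g k) \<in> E'" using eE[OF iN(2)] k by (auto simp: E'_def)
          thus "norm (S (T j - s) (G (?e i) (g k)) - G (?e i) (g k)) \<le> m"
           using d(2)[of "T j - s" "G (?e i) (g k)"] True Tj eps by auto
         qed
         also have "\<dots> \<le> ennreal (c0 * exp (2 * \<kappa> * s / eps) + c0 / (2 * \<kappa>))"
         proof (rule ennreal_leI)
          have "2 * C^2 * (\<Lambda> * b i)^2 = c0 * exp (2 * \<kappa> * T i / eps)"
           by (simp add: power_mult_distrib b2 c0_def)
          also have "\<dots> \<le> c0 * exp (2 * \<kappa> * s / eps)"
           using i(2) c0 \<kappa> eps by (intro mult_left_mono exp_le_cancel_iff[THEN iffD2] divide_right_mono) auto
          finally have "2 * C^2 * (\<Lambda> * b i)^2 \<le> c0 * exp (2 * \<kappa> * s / eps)" .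
          moreover have "c0 / (4 * \<kappa>) + c0 / (4 * \<kappa>) = c0 / (2 * \<kappa>)" using \<kappa> by (simp add: field_simps)
          ultimately show "2 * C^2 * (\<Lambda> * b i)^2 + 4 * C^2 * \<delta>^2 + 4 * real n * m^2 \<le> c0 * exp (2 * \<kappa> * s / eps) + c0 / (2 * \<kappa>)"
           using m4 \<delta>(2) by linarith
         qed
         finally show ?thesis using True by simp
        qed simp
       qed
      qed
      also have "\<dots> \<le> ennreal (\<eta> j)"
       unfolding \<eta>_def using c0 \<kappa> eps Tle[OF j(2)] by (intro exponential_integral_bound) auto
      finally show ?thesis .
     qed
     have Tjd: "T j \<in> {0..d}" using Tle[OF j(2)] eps by auto
     have Sx: "norm (S (T j) x - x) \<le> \<theta> * \<rho>0 / 2" using d(2)[OF Tjd, of x] by (simp add: E'_def)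
     have dr: "norm (drift (T j) om) \<le> \<theta> * \<rho>0 / 2"
     proof (cases "j = 0")
      case True thus ?thesis using drift_0 T0 \<theta> \<rho>0 by simp
     next
      case False
      hence "norm (drift (T j) om) \<le> C * (1 + q) * sqrt (eps * cost \<nu>)"
       using Tle[OF j(2)] eps Xle by (intro drift_bound) auto
      thus ?thesis using drift_small by linarith
     qed
     have "norm (X (T j) om - ?e j) \<le> norm (S (T j) x - x) + norm (drift (T j) om) + \<theta> * b j"
      by (rule bspec[OF A1' om12(1), rule_format, OF j(1) _ int]) (use eq in fastforce)
     moreover have "\<theta> * \<rho>0 \<le> \<theta> * b j" using \<theta> bpos(2)[of j] by (intro mult_left_mono) auto
     ultimately have Dj: "norm (X (T j) om - ?e j) \<le> 2 * (\<theta> * b j)" using Sx dr by linarith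
     have \<theta>b: "\<theta> * b j \<le> b j / 16" using \<theta>(2) mult_right_mono[OF \<theta>(2), of "b j"] bpos(1)[of j] by simp
     have Xq: "norm (X s om) \<le> q" if "s \<in> {0..T j}" for s
     proof (cases "j = 0")
      case True
      hence "s = T j" using that T0 by simp
      moreover have "b j \<le> 1" using ble[OF j(2)] by simp
      ultimately show ?thesis using Dj \<theta>b eq[OF j(2)] bpos(1)[of j] norm_triangle_sub[of "X (T j) om" "?e j"]
       by (simp only:)
     next
      case False thus ?thesis using Xle that by simp
     qed
     show ?case
     proof
      fix t assume t: "t \<in> {T j..T (Suc j)}"
      show "norm (X t om - ?e j) \<le> b j"
      proof (rule bspec[OF A2' om12(2), rule_format, OF j(1) Dj])
       show "norm (S s (?e j) - ?e j) \<le> \<rho>0 / 8" if "s \<in> {0..?h}" for s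
       proof -
        have "?h \<le> eps" using eps N mult_left_mono[of 1 "real N" eps] by (simp add: field_simps)
        hence "s \<in> {0..d}" using that eps by auto
        hence "norm (S s (?e j) - ?e j) \<le> \<theta> * \<rho>0 / 2" using d(2)[of s "?e j"] eE[OF j(2)] by (simp add: E'_def)
        also have "\<dots> \<le> (1/16) * \<rho>0 / 2" using \<theta> \<rho>0 by (intro divide_right_mono mult_right_mono) auto
        finally show ?thesis using \<rho>0 by simp
       qed
       show "norm (?e j) + b j \<le> q" using eq[OF j(2)] ble[OF j(2)] by simp
       show "norm (X s om) \<le> q" if "s \<in> {0..T j}" for s by (rule Xq[OF that])
       show "0 < b j" by (rule bpos)
       show "t \<in> {T j..T j + ?h}" using t TS by simp
       have c1: "C * (2 * (\<theta> * b j)) = b j / 8" using C(1) by (simp add: \<theta>_def)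
       have c2: "(1 + C) * (C * (1 + q) * sqrt ((T j + ?h) * cost \<nu>)) \<le> \<rho>0 / 16"
       proof -
        have "T j + ?h \<le> eps" using Tle(2)[OF j(3)] TS by simp
        hence "C * (1 + q) * sqrt ((T j + ?h) * cost \<nu>) \<le> C * (1 + q) * sqrt (eps * cost \<nu>)"
         using C(1) q cost_nonneg[of \<nu>] by (intro mult_left_mono real_sqrt_le_mono mult_right_mono) auto
        hence "C * (1 + q) * sqrt ((T j + ?h) * cost \<nu>) \<le> \<theta> * \<rho>0 / 2" using drift_small by linarith
        hence "(1 + C) * (C * (1 + q) * sqrt ((T j + ?h) * cost \<nu>)) \<le> (2 * C) * (\<theta> * \<rho>0 / 2)"
         using C(1) \<theta> \<rho>0 by (intro mult_mono') (use q cost_nonneg[of \<nu>] Tle[OF j(2)] hpos in auto)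
        also have "\<dots> = \<rho>0 / 16" using C(1) by (simp add: \<theta>_def)
        finally show ?thesis .
       qed
       have c3: "16 * C * sqrt (64 * C^2 * \<Lambda>^2 * (1 + q)^2 * ?h * (R / eps + 1)) \<le> \<rho>0 / 8"
       proof -
        have "?h * (R / eps + 1) \<le> (R + 1) / real N" using eps N by (simp add: distrib_left divide_right_mono flip: add_divide_distrib)
        hence "64 * C^2 * \<Lambda>^2 * (1 + q)^2 * (?h * (R / eps + 1)) \<le> 64 * C^2 * \<Lambda>^2 * (1 + q)^2 * ((R + 1) / real N)"
         by (intro mult_left_mono) auto
        also have "\<dots> = L / real N" by (simp add: L_def)
        finally have "64 * C^2 * \<Lambda>^2 * (1 + q)^2 * ?h * (R / eps + 1) \<le> L / real N" by (simp only: mult.assoc)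
        hence "16 * C * sqrt (64 * C^2 * \<Lambda>^2 * (1 + q)^2 * ?h * (R / eps + 1)) \<le> 16 * C * sqrt (L / real N)"
         using C(1) by (intro mult_left_mono real_sqrt_le_mono) auto
        thus ?thesis using L16 by linarith
       qed
       show "C * (2 * (\<theta> * b j)) + \<rho>0 / 8 + (1 + C) * (C * (1 + q) * sqrt ((T j + ?h) * cost \<nu>))
        + 16 * C * sqrt (64 * C^2 * \<Lambda>^2 * (1 + q)^2 * ?h * (R / eps + 1)) \<le> b j / 2"
        using c1 c2 c3 bpos[of j] by linarith
      qed
     qed
    qed
    have "block_index N t < N \<and> eps * t \<in> {T (block_index N t)..T (Suc (block_index N t))}"
    proof (cases "t = 0")
     case True thus ?thesis using N T0 Tm[of 0 1] by (simp add: block_index_0)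
    next
     case False
     hence t': "0 < t" "t \<le> 1" using t by auto
     have "real (block_index N t) / real N < t" "t \<le> real (Suc (block_index N t)) / real N"
      using block_index_mem(1)[OF N(1) t'] unfolding block_def by auto
     hence "eps * (real (block_index N t) / real N) \<le> eps * t" "eps * t \<le> eps * (real (Suc (block_index N t)) / real N)"
      using eps by (intro mult_left_mono; simp)+
     thus ?thesis using block_index_mem(2)[OF N(1) t'] by (simp add: T_def)
    qed
    thus "norm (X (eps * t) om - ?e (block_index N t)) \<le> \<rho>"
     using block[of "block_index N t"] ble[of "block_index N t"] by fastforce
   qed
  qed
 qed
qed

end

section \<open>Gaussian estimates\<close>

lemma std_normal_near:
 assumes s: "0 < s" "s \<le> \<alpha>"
 shows "exp (- (ln (sqrt (2 * pi)) + (\<bar>w\<bar> / s + 1)^2 / 2)) \<le> measure gauss {y. \<bar>s * y - w\<bar> < \<alpha>}"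
proof -
 interpret prob_space gauss by (rule prob_space_normal_density) simp
 define c where "c = exp (- (ln (sqrt (2 * pi)) + (\<bar>w\<bar> / s + 1)^2 / 2))"
 define I where "I = (if w \<ge> 0 then {w / s<..<w / s + 1} else {w / s - 1<..<w / s})"
 have I: "I \<in> sets borel" "emeasure lborel I = 1" by (auto simp: I_def)
 have y: "\<bar>y\<bar> \<le> \<bar>w\<bar> / s + 1 \<and> \<bar>s * y - w\<bar> < \<alpha>" if "y \<in> I" for y
 proof -
  have "\<bar>y - w / s\<bar> < 1" using that by (auto simp: I_def split: if_splits)
  moreover have "s * y - w = s * (y - w / s)" using s by (simp add: right_diff_distrib)
  hence "\<bar>s * y - w\<bar> = s * \<bar>y - w / s\<bar>" using s by (simp add: abs_mult)
  moreover have "s * \<bar>y - w / s\<bar> < s" using mult_strict_left_mono[OF \<open>\<bar>y - w / s\<bar> < 1\<close> s(1)] by simp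
  moreover have "\<bar>w / s\<bar> = \<bar>w\<bar> / s" using s by (simp add: abs_divide)
  ultimately show ?thesis using s by linarith
 qed
 have dens: "c \<le> std_normal_density y" if "y \<in> I" for y
 proof -
  have "\<bar>y\<bar>^2 \<le> (\<bar>w\<bar> / s + 1)^2" by (rule power_mono[OF conjunct1[OF y[OF that]] abs_ge_zero])
  hence "exp (- (\<bar>w\<bar> / s + 1)\<^sup>2 / 2) \<le> exp (- y\<^sup>2 / 2)" unfolding exp_le_cancel_iff power2_abs by linarith
  moreover have "c = 1 / sqrt (2 * pi) * exp (- (\<bar>w\<bar> / s + 1)\<^sup>2 / 2)"
  proof -
   have "exp (- ln (sqrt (2 * pi))) = 1 / sqrt (2 * pi)" by (simp add: exp_minus divide_inverse del: ln_sqrt)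
   moreover have "c = exp (- ln (sqrt (2 * pi)) + (- (\<bar>w\<bar> / s + 1)\<^sup>2 / 2))"
    unfolding c_def by (rule arg_cong[where f = exp]) linarith
   ultimately show ?thesis by (simp only: exp_add)
  qed
  ultimately show ?thesis unfolding std_normal_density_def by (simp add: divide_right_mono)
 qed
 have "ennreal c = (\<integral>\<^sup>+y. ennreal c * indicator I y \<partial>lborel)" using I by (simp add: nn_integral_cmult)
 also have "\<dots> \<le> (\<integral>\<^sup>+y. ennreal (std_normal_density y) * indicator I y \<partial>lborel)"
  using dens by (intro nn_integral_mono) (auto simp: indicator_def intro: ennreal_leI)
 also have "\<dots> = emeasure gauss I" using I by (subst emeasure_density) auto
 also have "\<dots> \<le> emeasure gauss {y. \<bar>s * y - w\<bar> < \<alpha>}" using y by (intro emeasure_mono) auto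
 finally show ?thesis unfolding c_def[symmetric] by (simp add: emeasure_eq_measure)
qed

context mild_process
begin

lemma noise_eq_ninc:
 assumes "N > 0" "eps > 0"
 shows "noise eps N om i k = sqrt (eps / real N) * ninc k (eps * real i / real N) (eps * real (Suc i) / real N) om"
proof -
 have "eps * real (Suc i) / real N - eps * real i / real N = eps / real N"
  by (simp add: distrib_left add_divide_distrib)
 moreover have "sqrt (eps / real N) \<noteq> 0" using assms by simp
 ultimately show ?thesis unfolding noise_def ninc_def by simp
qed

lemma grid_times:
 assumes "N > 0" "eps > 0"
 shows "0 \<le> eps * real i / real N" "eps * real i / real N < eps * real (Suc i) / real N"
proof -
 show "0 \<le> eps * real i / real N" using assms by simp
 have "eps * real i < eps * real (Suc i)" using assms by (intro mult_strict_left_mono) auto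
 thus "eps * real i / real N < eps * real (Suc i) / real N" using assms by (intro divide_strict_right_mono) auto
qed

lemma noise_adapted:
 assumes "N > 0" "eps > 0" "i < j" "k \<in> modes n"
 shows "(\<lambda>om. noise eps N om i k) \<in> borel_measurable (\<F> (eps * real j / real N))"
proof -
 have "eps * real (Suc i) / real N \<le> eps * real j / real N"
  using assms(1-3) by (intro divide_right_mono mult_left_mono; linarith)
 thus ?thesis
 proof (rule measurable_filtration_mono[rotated 2])
  show "(\<lambda>om. noise eps N om i k) \<in> borel_measurable (\<F> (eps * real (Suc i) / real N))"
  unfolding noise_def
  by (rule inc_adapted[OF subsetD[OF modes(2) assms(4)] grid_times(1)[OF assms(1,2)] less_imp_le[OF grid_times(2)[OF assms(1,2)]]])
  show "0 \<le> eps * real (Suc i) / real N" by (rule grid_times(1)[OF assms(1,2)])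
 qed
qed

lemma noise_measurable:
 assumes "N > 0" "eps > 0" "k \<in> modes n"
 shows "(\<lambda>om. noise eps N om i k) \<in> borel_measurable M"
 by (rule measurable_filtration_M[OF noise_adapted[OF assms(1,2) lessI assms(3)] grid_times(1)[OF assms(1,2)]])

lemma noise_cost_exponential_moment:
 assumes N: "N > 0" "eps > 0" and b: "b > 2" and j: "j \<le> N"
 shows "(\<integral>\<^sup>+om. ennreal (exp (real N / eps * (\<Sum>i<j. \<Sum>k\<in>modes n. (noise eps N om i k)\<^sup>2) / b)) \<partial>M)
  \<le> ennreal (sqrt (b / (b - 2)) ^ (j * card (modes n)))"
 using j
proof (induction j)
 case 0
 show ?case by (simp add: emeasure_space_1)
next
 case (Suc j)
 let ?J = "modes n"
 interpret N: prob_space gauss by (rule prob_space_normal_density) simp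
 interpret P: product_prob_space "\<lambda>_::nat. gauss" ?J by unfold_locales
 define Z where "Z om = exp (real N / eps * (\<Sum>i<j. \<Sum>k\<in>?J. (noise eps N om i k)\<^sup>2) / b)" for om
 define s where "s = eps * real j / real N"
 define t where "t = eps * real (Suc j) / real N"
 have st: "0 \<le> s" "s < t" unfolding s_def t_def by (rule grid_times[OF N])+
 have Zm: "Z \<in> borel_measurable (\<F> s)"
  unfolding Z_def[abs_def] s_def
  by (intro borel_measurable_exp[THEN measurable_compose[rotated]] borel_measurable_divide borel_measurable_times
     borel_measurable_const borel_measurable_sum borel_measurable_power noise_adapted N) auto
 define f where "f om y = ennreal (Z om) * (\<Prod>k\<in>?J. ennreal (exp ((y k)^2 / b)))" for om y
 have fm: "(\<lambda>(om, y). f om y) \<in> borel_measurable (\<F> s \<Otimes>\<^sub>M (\<Pi>\<^sub>M k\<in>?J. borel))"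
  unfolding f_def case_prod_beta
 proof (intro borel_measurable_times_ennreal borel_measurable_prod_ennreal)
  show "(\<lambda>p. ennreal (Z (fst p))) \<in> borel_measurable (\<F> s \<Otimes>\<^sub>M (\<Pi>\<^sub>M k\<in>?J. borel))"
   by (intro measurable_compose[OF measurable_compose[OF measurable_fst Zm] measurable_ennreal])
  fix k assume k: "k \<in> ?J"
  have "(\<lambda>p. snd p k) \<in> borel_measurable (\<F> s \<Otimes>\<^sub>M (\<Pi>\<^sub>M k\<in>?J. (borel :: real measure)))"
   by (rule measurable_compose[OF measurable_snd measurable_component_singleton[OF k]])
  thus "(\<lambda>p. ennreal (exp ((snd p k)^2 / b))) \<in> borel_measurable (\<F> s \<Otimes>\<^sub>M (\<Pi>\<^sub>M k\<in>?J. (borel :: real measure)))"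
   by measurable
 qed
 have "(\<integral>\<^sup>+om. ennreal (exp (real N / eps * (\<Sum>i<Suc j. \<Sum>k\<in>?J. (noise eps N om i k)\<^sup>2) / b)) \<partial>M)
  = (\<integral>\<^sup>+om. f om (\<lambda>k\<in>?J. ninc k s t om) \<partial>M)"
 proof (intro nn_integral_cong)
  fix om
  have "real N / eps * (\<Sum>k\<in>?J. (noise eps N om j k)\<^sup>2) / b = (\<Sum>k\<in>?J. (ninc k s t om)\<^sup>2 / b)"
   unfolding noise_eq_ninc[OF N] s_def[symmetric] t_def[symmetric] using N
   by (simp add: power_mult_distrib sum_distrib_left sum_divide_distrib)
  thus "ennreal (exp (real N / eps * (\<Sum>i<Suc j. \<Sum>k\<in>?J. (noise eps N om i k)\<^sup>2) / b)) = f om (\<lambda>k\<in>?J. ninc k s t om)"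
   using modes(1)[of n]
   by (simp add: f_def Z_def distrib_left add_divide_distrib exp_add exp_sum prod_ennreal ennreal_mult')
 qed
 also have "\<dots> = (\<integral>\<^sup>+om. (\<integral>\<^sup>+y. f om y \<partial>(\<Pi>\<^sub>M k\<in>?J. gauss)) \<partial>M)"
  by (rule nn_integral_filtration_ninc[OF modes st fm])
 also have "\<dots> \<le> (\<integral>\<^sup>+om. ennreal (Z om) * ennreal (sqrt (b / (b - 2)) ^ card ?J) \<partial>M)"
 proof (rule nn_integral_mono)
  fix om
  have m: "(\<lambda>y. \<Prod>k\<in>?J. ennreal (exp ((y k)^2 / b))) \<in> borel_measurable (\<Pi>\<^sub>M k\<in>?J. gauss)"
   by (intro borel_measurable_prod_ennreal measurable_compose[OF measurable_component_singleton]) auto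
  have "(\<integral>\<^sup>+y. f om y \<partial>(\<Pi>\<^sub>M k\<in>?J. gauss)) = ennreal (Z om) * (\<Prod>k\<in>?J. \<integral>\<^sup>+y. ennreal (exp (y^2 / b)) \<partial>gauss)"
   unfolding f_def nn_integral_cmult[OF m]
   by (subst P.product_nn_integral_prod) (use modes(1)[of n] in auto)
  also have "(\<Prod>k\<in>?J. \<integral>\<^sup>+y. ennreal (exp (y^2 / b)) \<partial>gauss) \<le> (\<Prod>k\<in>?J. ennreal (sqrt (b / (b - 2))))"
   using normal_exp_square[of "1::real" b 0] b by (intro prod_mono_ennreal) auto
  also have "\<dots> = ennreal (sqrt (b / (b - 2)) ^ card ?J)" using b by (simp add: ennreal_power)
  finally show "(\<integral>\<^sup>+y. f om y \<partial>(\<Pi>\<^sub>M k\<in>?J. gauss)) \<le> ennreal (Z om) * ennreal (sqrt (b / (b - 2)) ^ card ?J)"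
   by (simp add: mult_left_mono)
 qed
 also have "\<dots> = (\<integral>\<^sup>+om. ennreal (Z om) \<partial>M) * ennreal (sqrt (b / (b - 2)) ^ card ?J)"
  by (intro nn_integral_multc measurable_compose[OF measurable_filtration_M[OF Zm st(1)] measurable_ennreal])
 also have "\<dots> \<le> ennreal (sqrt (b / (b - 2)) ^ (j * card ?J)) * ennreal (sqrt (b / (b - 2)) ^ card ?J)"
  unfolding Z_def using Suc by (intro mult_right_mono) auto
 also have "\<dots> = ennreal (sqrt (b / (b - 2)) ^ (Suc j * card ?J))"
  using b by (simp add: ennreal_mult[symmetric] power_add[symmetric] add.commute)
 finally show ?case .
qed

lemma noise_cost_tail:
 assumes N: "N > 0" "eps > 0" and b: "b > 2"
 shows "{om\<in>space M. r < noise_cost n N (noise eps N om)} \<in> sets M"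
  and "prob {om\<in>space M. r < noise_cost n N (noise eps N om)} \<le> sqrt (b / (b - 2)) ^ (N * card (modes n)) * exp (- (r / b) / eps)"
proof -
 have m: "(\<lambda>om. noise_cost n N (noise eps N om)) \<in> borel_measurable M"
  unfolding noise_cost_def
  by (intro borel_measurable_times borel_measurable_const borel_measurable_sum borel_measurable_power noise_measurable N)
 thus s: "{om\<in>space M. r < noise_cost n N (noise eps N om)} \<in> sets M" by measurable
 let ?D = "sqrt (b / (b - 2)) ^ (N * card (modes n))"
 have "ennreal (exp (r / b / eps) * prob {om\<in>space M. r < noise_cost n N (noise eps N om)})
  = (\<integral>\<^sup>+om. ennreal (exp (r / b / eps)) * indicator {om\<in>space M. r < noise_cost n N (noise eps N om)} om \<partial>M)"
  using s by (simp add: nn_integral_cmult ennreal_mult emeasure_eq_measure)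
 also have "\<dots> \<le> (\<integral>\<^sup>+om. ennreal (exp (real N / eps * (\<Sum>i<N. \<Sum>k\<in>modes n. (noise eps N om i k)\<^sup>2) / b)) \<partial>M)"
 proof (rule nn_integral_mono)
  fix om
  show "ennreal (exp (r / b / eps)) * indicator {om\<in>space M. r < noise_cost n N (noise eps N om)} om
   \<le> ennreal (exp (real N / eps * (\<Sum>i<N. \<Sum>k\<in>modes n. (noise eps N om i k)\<^sup>2) / b))"
  proof (cases "r < noise_cost n N (noise eps N om)")
   case True
   have "r / b / eps \<le> noise_cost n N (noise eps N om) / b / eps" using True b N by (intro divide_right_mono) auto
   also have "\<dots> = real N / eps * (\<Sum>i<N. \<Sum>k\<in>modes n. (noise eps N om i k)\<^sup>2) / b" by (simp add: noise_cost_def)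
   finally show ?thesis by (auto simp: indicator_def intro!: ennreal_leI)
  qed simp
 qed
 also have "\<dots> \<le> ennreal ?D" by (rule noise_cost_exponential_moment[OF N b order_refl])
 finally have "exp (r / b / eps) * prob {om\<in>space M. r < noise_cost n N (noise eps N om)} \<le> ?D"
  using b by (simp add: ennreal_le_iff)
 hence "exp (- (r / b / eps)) * (exp (r / b / eps) * prob {om\<in>space M. r < noise_cost n N (noise eps N om)}) \<le> exp (- (r / b / eps)) * ?D"
  by (intro mult_left_mono) auto
 thus "prob {om\<in>space M. r < noise_cost n N (noise eps N om)} \<le> ?D * exp (- (r / b) / eps)"
  by (simp add: mult.assoc[symmetric] exp_add[symmetric] mult.commute)
qed

definition near_noise :: "nat => nat => (nat => nat => real) => real => real => nat => 'w set" where
 "near_noise n N w \<alpha> eps j = {om\<in>space M. \<forall>i<j. \<forall>k\<in>modes n. \<bar>noise eps N om i k - w i k\<bar> < \<alpha>}"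

lemma near_noise_adapted:
 assumes N: "N > 0" "eps > 0"
 shows "near_noise n N w \<alpha> eps j \<in> sets (\<F> (eps * real j / real N))"
proof -
 have sp: "space (\<F> (eps * real j / real N)) = space M" by (rule space_filtration[OF grid_times(1)[OF N]])
 have "near_noise n N w \<alpha> eps j = {om\<in>space (\<F> (eps * real j / real N)). \<forall>i\<in>{..<j}. \<forall>k\<in>modes n. \<bar>noise eps N om i k - w i k\<bar> < \<alpha>}"
  unfolding near_noise_def sp by auto
 also have "\<dots> \<in> sets (\<F> (eps * real j / real N))"
 proof (intro sets.sets_Collect_finite_All modes(1) finite_lessThan)
  fix i k assume "i \<in> {..<j}" "k \<in> modes n"
  hence [measurable]: "(\<lambda>om. noise eps N om i k) \<in> borel_measurable (\<F> (eps * real j / real N))"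
   by (intro noise_adapted N) auto
  show "{om\<in>space (\<F> (eps * real j / real N)). \<bar>noise eps N om i k - w i k\<bar> < \<alpha>} \<in> sets (\<F> (eps * real j / real N))"
   by measurable
 qed
 finally show ?thesis .
qed

lemma near_noise_prob_product:
 assumes N: "N > 0" "eps > 0" and \<alpha>: "sqrt (eps / real N) \<le> \<alpha>"
 shows "(\<Prod>i<j. \<Prod>k\<in>modes n. exp (- (ln (sqrt (2 * pi)) + (\<bar>w i k\<bar> / sqrt (eps / real N) + 1)^2 / 2)))
  \<le> prob (near_noise n N w \<alpha> eps j)"
proof (induction j)
 case 0
 thus ?case by (simp add: near_noise_def prob_space)
next
 case (Suc j)
 define s where "s = eps * real j / real N"
 define t where "t = eps * real (Suc j) / real N"
 have st: "0 \<le> s" "s < t" unfolding s_def t_def by (rule grid_times[OF N])+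
 have q: "0 < sqrt (eps / real N)" using N by simp
 let ?C = "\<lambda>k. {y. \<bar>sqrt (eps / real N) * y - w j k\<bar> < \<alpha>}"
 have "near_noise n N w \<alpha> eps (Suc j) = near_noise n N w \<alpha> eps j \<inter> {om\<in>space M. \<forall>k\<in>modes n. ninc k s t om \<in> ?C k}"
  unfolding near_noise_def s_def t_def by (auto simp: less_Suc_eq noise_eq_ninc[OF N])
 hence "prob (near_noise n N w \<alpha> eps (Suc j)) = prob (near_noise n N w \<alpha> eps j) * (\<Prod>k\<in>modes n. measure gauss (?C k))"
  using prob_inter_ninc[OF modes st near_noise_adapted[OF N, of n w \<alpha> j, folded s_def], of n ?C] by simp
 moreover have "(\<Prod>i<j. \<Prod>k\<in>modes n. exp (- (ln (sqrt (2 * pi)) + (\<bar>w i k\<bar> / sqrt (eps / real N) + 1)^2 / 2)))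
   * (\<Prod>k\<in>modes n. exp (- (ln (sqrt (2 * pi)) + (\<bar>w j k\<bar> / sqrt (eps / real N) + 1)^2 / 2)))
  \<le> prob (near_noise n N w \<alpha> eps j) * (\<Prod>k\<in>modes n. measure gauss (?C k))"
  using std_normal_near[OF q \<alpha>] by (intro mult_mono Suc prod_mono prod_nonneg conjI) auto
 ultimately show ?case by simp
qed

lemma near_noise_prob:
 assumes N: "N > 0" and \<alpha>: "\<alpha> > 0" and a: "noise_cost n N w / 2 < a"
 shows "\<forall>\<^sub>F eps in at_right 0. exp (- a / eps) \<le> prob (near_noise n N w \<alpha> eps N)"
proof -
 define L where "L = ln (sqrt (2 * pi))"
 define Q where "Q eps = (\<Sum>i<N. \<Sum>k\<in>modes n. eps * L + (\<bar>w i k\<bar> * sqrt (real N) + sqrt eps)^2 / 2)" for eps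
 have "(Q \<longlongrightarrow> (\<Sum>i<N. \<Sum>k\<in>modes n. 0 * L + (\<bar>w i k\<bar> * sqrt (real N) + sqrt 0)^2 / 2)) (at_right 0)"
  unfolding Q_def by (intro tendsto_intros) auto
 also have "(\<Sum>i<N. \<Sum>k\<in>modes n. 0 * L + (\<bar>w i k\<bar> * sqrt (real N) + sqrt 0)^2 / 2) = noise_cost n N w / 2"
  by (simp add: noise_cost_def power_mult_distrib sum_distrib_left sum_divide_distrib mult.commute)
 finally have 1: "\<forall>\<^sub>F eps in at_right 0. Q eps < a" using a by (rule order_tendstoD)
 have "((\<lambda>eps. sqrt (eps / real N)) \<longlongrightarrow> sqrt (0 / real N)) (at_right 0)" by (intro tendsto_intros) (use N in auto)
 hence 2: "\<forall>\<^sub>F eps in at_right 0. sqrt (eps / real N) < \<alpha>" using \<alpha> by (intro order_tendstoD) auto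
 have 3: "\<forall>\<^sub>F eps in at_right (0::real). eps > 0" by (simp add: eventually_at_right_less)
 from 1 2 3 show ?thesis
 proof eventually_elim
  case (elim eps)
  have t: "L + (\<bar>w i k\<bar> / sqrt (eps / real N) + 1)^2 / 2 = (eps * L + (\<bar>w i k\<bar> * sqrt (real N) + sqrt eps)^2 / 2) / eps" for i k
  proof -
   have se: "sqrt eps > 0" "(sqrt eps)^2 = eps" using elim by auto
   have "\<bar>w i k\<bar> / sqrt (eps / real N) + 1 = (\<bar>w i k\<bar> * sqrt (real N) + sqrt eps) / sqrt eps"
    using se(1) by (simp add: real_sqrt_divide add_divide_distrib)
   hence "(\<bar>w i k\<bar> / sqrt (eps / real N) + 1)^2 = (\<bar>w i k\<bar> * sqrt (real N) + sqrt eps)^2 / eps"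
    using se(2) by (simp add: power_divide)
   thus ?thesis using elim by (simp add: add_divide_distrib)
  qed
  have "exp (- a / eps) \<le> exp (- (Q eps / eps))" using elim by (simp add: divide_right_mono)
  also have "\<dots> = (\<Prod>i<N. \<Prod>k\<in>modes n. exp (- (L + (\<bar>w i k\<bar> / sqrt (eps / real N) + 1)^2 / 2)))"
   unfolding t Q_def using modes(1)[of n] by (simp add: exp_sum[symmetric] sum_divide_distrib sum_negf)
  also have "\<dots> \<le> prob (near_noise n N w \<alpha> eps N)"
   unfolding L_def using elim N by (intro near_noise_prob_product) auto
  finally show ?case .
 qed
qed

end

section \<open>The path space\<close>

lemma path_dist_le:
 assumes "u \<in> paths" "v \<in> paths"
 shows "mdist path_metric u v \<le> e \<longleftrightarrow> (\<forall>t\<in>{0..1}. dist (u t) (v t) \<le> e)"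
 using cfunspace_mdist_le[OF assms[unfolded path_metric_def], of e] by (simp add: path_metric_def)

lemma openin_path_metric:
 "openin (mtopology_of path_metric) V \<longleftrightarrow> V \<subseteq> paths \<and>
  (\<forall>u\<in>V. \<exists>r>0. \<forall>v\<in>paths. (\<forall>t\<in>{0..1}. dist (u t) (v t) \<le> r) --> v \<in> V)"
proof -
 interpret P: Metric_space "paths" "mdist path_metric" by (rule Metric_space_mspace_mdist)
 have "(\<exists>r>0. P.mcball u r \<subseteq> V) \<longleftrightarrow> (\<exists>r>0. \<forall>v\<in>paths. (\<forall>t\<in>{0..1}. dist (u t) (v t) \<le> r) --> v \<in> V)"
  if "u \<in> paths" for u
 proof -
  have "P.mcball u r \<subseteq> V \<longleftrightarrow> (\<forall>v\<in>paths. (\<forall>t\<in>{0..1}. dist (u t) (v t) \<le> r) --> v \<in> V)" for r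
   using that path_dist_le[OF that, of _ r] unfolding P.mcball_def by blast
  thus ?thesis by simp
 qed
 thus ?thesis
  unfolding mtopology_of_def P.openin_mtopology_mcball Ball_def
  by (intro conj_cong refl arg_cong[where f = All] ext imp_cong) (auto dest: subsetD)
qed

lemma path_open_subset: "openin (mtopology_of path_metric) V ==> V \<subseteq> paths"
 by (simp add: openin_path_metric)

lemma closedin_path_metric_limit:
 assumes C: "closedin (mtopology_of path_metric) C" and \<sigma>: "\<And>m::nat. \<sigma> m \<in> C" and l: "l \<in> paths"
  and lim: "\<And>e. e > 0 ==> \<exists>m. \<forall>t\<in>{0..1}. dist (l t) (\<sigma> m t) \<le> e"
 shows "l \<in> C"
proof (rule ccontr)
 assume "l \<notin> C"
 have "openin (mtopology_of path_metric) (paths - C)" using C by (simp add: closedin_def)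
 then obtain r where r: "r > 0" "\<And>v. v \<in> paths ==> \<forall>t\<in>{0..1}. dist (l t) (v t) \<le> r ==> v \<in> paths - C"
  using l \<open>l \<notin> C\<close> unfolding openin_path_metric by blast
 obtain m where "\<forall>t\<in>{0..1}. dist (l t) (\<sigma> m t) \<le> r" using lim[OF r(1)] by blast
 moreover have "\<sigma> m \<in> paths" using closedin_subset[OF C] \<sigma> by auto
 ultimately show False using r(2) \<sigma> by blast
qed

lemma limitin_path_metric:
 assumes \<sigma>: "\<And>m::nat. \<sigma> m \<in> paths" and l: "l \<in> paths"
  and lim: "\<And>e. e > 0 ==> \<exists>m0. \<forall>m\<ge>m0. \<forall>t\<in>{0..1}. dist (\<sigma> m t) (l t) \<le> e"
 shows "limitin (mtopology_of path_metric) \<sigma> l sequentially"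
proof -
 interpret P: Metric_space "paths" "mdist path_metric" by (rule Metric_space_mspace_mdist)
 show ?thesis
  unfolding mtopology_of_def P.limitin_metric
 proof (intro conjI l allI impI)
  fix e :: real assume e: "e > 0"
  obtain m0 where m0: "\<forall>m\<ge>m0. \<forall>t\<in>{0..1}. dist (\<sigma> m t) (l t) \<le> e / 2" using lim[of "e / 2"] e by auto
  show "\<forall>\<^sub>F m in sequentially. \<sigma> m \<in> paths \<and> mdist path_metric (\<sigma> m) l < e"
  proof (rule eventually_sequentiallyI[of m0])
   fix m assume "m0 \<le> m"
   hence "mdist path_metric (\<sigma> m) l \<le> e / 2" using m0 path_dist_le[OF \<sigma> l] by blast
   thus "\<sigma> m \<in> paths \<and> mdist path_metric (\<sigma> m) l < e" using e \<sigma> by simp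
  qed
 qed
qed

lemma le_on_interval_measurable:
 fixes Z :: "real => 'w => 'h::{real_normed_vector, second_countable_topology}"
 assumes Z: "\<And>t. t \<in> {a..b} ==> Z t \<in> borel_measurable M"
  and cont: "\<And>om. om \<in> space M ==> continuous_on {a..b} (\<lambda>t. Z t om)" and ab: "a < b"
 shows "{om\<in>space M. \<forall>t\<in>{a..b}. dist (Z t om) h \<le> c} \<in> sets M"
proof -
 have cl: "closure ({a<..<b} \<inter> \<rat>) = {a..b}"
  using closure_open_Int_superset[of "{a<..<b}" "\<rat>"] ab by (simp add: Rats_closure_real)
 have "{om\<in>space M. \<forall>t\<in>{a..b}. dist (Z t om) h \<le> c} = {om\<in>space M. \<forall>t\<in>{a<..<b} \<inter> \<rat>. dist (Z t om) h \<le> c}"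
 proof (intro Collect_cong conj_cong refl iffI ballI)
  fix om t assume om: "om \<in> space M" and le: "\<forall>t\<in>{a<..<b} \<inter> \<rat>. dist (Z t om) h \<le> c" and t: "t \<in> {a..b}"
  show "dist (Z t om) h \<le> c"
  proof (rule continuous_le_on_closure[of "{a<..<b} \<inter> \<rat>" "\<lambda>t. dist (Z t om) h"])
   show "continuous_on (closure ({a<..<b} \<inter> \<rat>)) (\<lambda>t. dist (Z t om) h)"
    unfolding cl by (intro continuous_intros cont om)
  qed (use le t cl in auto)
 qed auto
 also have "\<dots> = space M - (\<Union>t\<in>{a<..<b} \<inter> \<rat>. {om\<in>space M. \<not> dist (Z t om) h \<le> c})" by auto
 also have "\<dots> \<in> sets M"
 proof (intro sets.compl_sets sets.countable_UN'')
  show "countable ({a<..<b} \<inter> \<rat>)" using countable_rat by (rule countable_subset[rotated]) auto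
  fix t assume "t \<in> {a<..<b} \<inter> \<rat>"
  hence [measurable]: "Z t \<in> borel_measurable M" by (intro Z) auto
  show "{om\<in>space M. \<not> dist (Z t om) h \<le> c} \<in> sets M" by measurable
 qed
 finally show ?thesis .
qed

definition path_cell :: "nat => 'h::metric_space list => (real => 'h) set" where
 "path_cell m ds = {u \<in> paths. \<forall>i<length ds. \<forall>t\<in>{real i / length ds..real (Suc i) / length ds}. dist (u t) (ds ! i) \<le> 1 / Suc m}"

lemma path_cell_neighbourhood:
 assumes u: "u \<in> paths" and r: "r > 0" and D: "\<And>U. open U ==> U \<noteq> {} ==> \<exists>d\<in>D. d \<in> U"
 shows "\<exists>m ds. set ds \<subseteq> D \<and> u \<in> path_cell m ds \<and> (\<forall>v\<in>path_cell m ds. \<forall>t\<in>{0..1}. dist (u t) (v t) \<le> r)"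
proof -
 have "0 < r / 2" using r by simp
 from reals_Archimedean[OF this] obtain m where "inverse (real (Suc m)) < r / 2" by blast
 hence m: "2 * (1 / real (Suc m)) \<le> r" unfolding inverse_eq_divide by linarith
 define e where "e = 1 / real (Suc m) / 2"
 have e: "e > 0" "e + e = 1 / Suc m" unfolding e_def by (simp, rule field_sum_of_halves)
 have "uniformly_continuous_on {0..1} u"
  using u by (intro compact_uniformly_continuous) (auto simp: mspace_path_metric)
 then obtain d where d: "d > 0" "\<And>s t. s \<in> {0..1} ==> t \<in> {0..1} ==> dist s t < d ==> dist (u s) (u t) < e"
  unfolding uniformly_continuous_on_def using e(1) by (metis dist_commute)
 obtain l where l: "inverse (real (Suc l)) < d" using reals_Archimedean[OF d(1)] by blast
 define N where "N = Suc l"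
 have N: "N > 0" "1 / real N < d" using l by (auto simp: N_def divide_inverse)
 have "\<exists>h\<in>D. dist (u (real i / real N)) h < e" for i
  using D[of "ball (u (real i / real N)) e"] e by auto
 then obtain c where c: "\<And>i. c i \<in> D" "\<And>i. dist (u (real i / real N)) (c i) < e" by metis
 define ds where "ds = map c [0..<N]"
 have ds: "length ds = N" "\<And>i. i < N ==> ds ! i = c i" "set ds \<subseteq> D" using c(1) by (auto simp: ds_def)
 have uc: "u \<in> path_cell m ds"
  unfolding path_cell_def ds(1)
 proof (intro CollectI conjI u allI impI ballI)
  fix i t assume i: "i < N" and t: "t \<in> {real i / real N..real (Suc i) / real N}"
  have r1: "real (Suc i) / real N \<le> 1" "0 \<le> real i / real N" using i by auto
  hence t01: "t \<in> {0..1}" "real i / real N \<in> {0..1}" using t i unfolding atLeastAtMost_iff by (linarith, simp)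
  have "real (Suc i) / real N = real i / real N + 1 / real N" by (simp add: add_divide_distrib)
  hence "\<bar>real i / real N - t\<bar> < d" using t N(2) unfolding atLeastAtMost_iff by linarith
  hence "dist (u (real i / real N)) (u t) < e" using t01 by (intro d(2)) (auto simp: dist_real_def)
  hence "dist (u t) (c i) \<le> e + e"
   using dist_triangle3[of "u t" "c i" "u (real i / real N)"] c(2)[of i] by linarith
  thus "dist (u t) (ds ! i) \<le> 1 / real (Suc m)" using ds(2)[OF i] e(2) by simp
 qed
 have "dist (u t) (v t) \<le> r" if v: "v \<in> path_cell m ds" and t: "t \<in> {0..1}" for v t
 proof -
  have "\<exists>i<N. t \<in> {real i / real N..real (Suc i) / real N}"
  proof (cases "t = 1")
   case True
   thus ?thesis using N by (intro exI[of _ "N - 1"]) auto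
  next
   case False
   define i where "i = nat \<lfloor>t * real N\<rfloor>"
   have "0 \<le> t * real N" using t by simp
   hence i: "real i \<le> t * real N" "t * real N < real (Suc i)" unfolding i_def by (simp_all, linarith+)
   have "t * real N < 1 * real N" using False t N(1) by (intro mult_strict_right_mono) auto
   hence "i < N" using i(1) by simp
   thus ?thesis using i N(1) by (auto simp: pos_divide_le_eq pos_le_divide_eq intro!: exI[of _ i])
  qed
  then obtain i where i: "i < N" "t \<in> {real i / real N..real (Suc i) / real N}" by blast
  hence "dist (u t) (ds ! i) \<le> 1 / Suc m" "dist (v t) (ds ! i) \<le> 1 / Suc m"
   using uc v unfolding path_cell_def ds(1) by blast+
  thus ?thesis using dist_triangle2[of "u t" "v t" "ds ! i"] m by linarith
 qed
 thus ?thesis using uc ds(3) by blast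
qed

lemma path_map_measurable:
 fixes Z :: "real => 'w => 'h::{real_normed_vector, second_countable_topology}"
 assumes Z: "\<And>t. t \<in> {0..1} ==> Z t \<in> borel_measurable M"
  and cont: "\<And>om. om \<in> space M ==> continuous_on {0..1} (\<lambda>t. Z t om)"
 shows "(\<lambda>om. \<lambda>t\<in>{0..1}. Z t om) \<in> measurable M (sigma (paths) {V. openin (mtopology_of path_metric) V})"
proof (rule measurable_measure_of)
 let ?f = "\<lambda>om. \<lambda>t\<in>{0..1}. Z t om"
 show "{V. openin (mtopology_of path_metric) V} \<subseteq> Pow (mspace (path_metric :: (real => 'h) metric))"
  using path_open_subset by blast
 have fm: "?f om \<in> paths" if "om \<in> space M" for om
  using cont[OF that] by (auto simp: mspace_path_metric cong: continuous_on_cong_simp)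
 thus "?f \<in> space M \<rightarrow> paths" by blast
 fix V :: "(real => 'h) set" assume "V \<in> {V. openin (mtopology_of path_metric) V}"
 hence V: "V \<subseteq> paths" "\<And>u. u \<in> V ==> \<exists>r>0. \<forall>v\<in>paths. (\<forall>t\<in>{0..1}. dist (u t) (v t) \<le> r) --> v \<in> V"
  unfolding mem_Collect_eq openin_path_metric by blast+
 obtain D :: "'h set" where D: "countable D" "\<And>U. open U ==> U \<noteq> {} ==> \<exists>d\<in>D. d \<in> U"
  using countable_dense_exists[where 'a = 'h] by blast
 define I where "I = {p. set (snd p) \<subseteq> D \<and> path_cell (fst p) (snd p) \<subseteq> V}"
 have "countable ((UNIV :: nat set) \<times> lists D)" using D(1) by (intro countable_SIGMA countable_lists) auto
 hence I: "countable I" by (rule countable_subset[rotated]) (auto simp: I_def)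
 have "V = (\<Union>p\<in>I. path_cell (fst p) (snd p))"
 proof
  show "V \<subseteq> (\<Union>p\<in>I. path_cell (fst p) (snd p))"
  proof
   fix u assume u: "u \<in> V"
   obtain r where r: "r > 0" "\<forall>v\<in>paths. (\<forall>t\<in>{0..1}. dist (u t) (v t) \<le> r) --> v \<in> V" using V(2)[OF u] by blast
   obtain m ds where m: "set ds \<subseteq> D" "u \<in> path_cell m ds" "\<forall>v\<in>path_cell m ds. \<forall>t\<in>{0..1}. dist (u t) (v t) \<le> r"
    using path_cell_neighbourhood[OF _ r(1) D(2), of u] u V(1) by blast
   have "path_cell m ds \<subseteq> V"
   proof
    fix v assume v: "v \<in> path_cell m ds"
    hence "v \<in> paths" by (simp add: path_cell_def)
    thus "v \<in> V" using r(2) m(3) v by blast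
   qed
   thus "u \<in> (\<Union>p\<in>I. path_cell (fst p) (snd p))" using m by (intro UN_I[of "(m, ds)"]) (auto simp: I_def)
  qed
 qed (auto simp: I_def)
 hence "?f -` V \<inter> space M = (\<Union>p\<in>I. {om\<in>space M. ?f om \<in> path_cell (fst p) (snd p)})" by auto
 also have "\<dots> \<in> sets M"
 proof (rule sets.countable_UN''[OF I])
  have "{om\<in>space M. ?f om \<in> path_cell m ds} \<in> sets M" for m ds
  proof -
   have sub: "{real i / length ds..real (Suc i) / length ds} \<subseteq> {0..1}" if "i < length ds" for i
   proof -
    have "real (Suc i) \<le> length ds" "0 < real (length ds)" using that by linarith+
    hence "real (Suc i) / length ds \<le> 1" "0 \<le> real i / length ds" by (simp_all only: divide_le_eq_1_pos) simp
    thus ?thesis by auto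
   qed
   have "{om\<in>space M. ?f om \<in> path_cell m ds} =
    {om\<in>space M. \<forall>i\<in>{..<length ds}. \<forall>t\<in>{real i / length ds..real (Suc i) / length ds}. dist (Z t om) (ds ! i) \<le> 1 / Suc m}"
   proof (intro Collect_cong conj_cong refl)
    fix om assume om: "om \<in> space M"
    have eq: "?f om t = Z t om" if "i < length ds" "t \<in> {real i / length ds..real (Suc i) / length ds}" for i t
     using subsetD[OF sub[OF that(1)] that(2)] by (rule restrict_apply')
    show "?f om \<in> path_cell m ds \<longleftrightarrow> (\<forall>i\<in>{..<length ds}. \<forall>t\<in>{real i / length ds..real (Suc i) / length ds}. dist (Z t om) (ds ! i) \<le> 1 / Suc m)"
     unfolding path_cell_def using fm[OF om] eq by (auto simp del: restrict_apply of_nat_Suc)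
   qed
   also have "\<dots> \<in> sets M"
   proof (rule sets.sets_Collect_finite_All)
    fix i assume i: "i \<in> {..<length ds}"
    hence lt: "real i / length ds < real (Suc i) / length ds" by (intro divide_strict_right_mono) auto
    show "{om\<in>space M. \<forall>t\<in>{real i / length ds..real (Suc i) / length ds}. dist (Z t om) (ds ! i) \<le> 1 / Suc m} \<in> sets M"
    proof (intro le_on_interval_measurable Z lt)
     show "continuous_on {real i / length ds..real (Suc i) / length ds} (\<lambda>t. Z t om)" if "om \<in> space M" for om
      using i by (intro continuous_on_subset[OF cont[OF that] sub]) simp
     show "t \<in> {0..1}" if "t \<in> {real i / length ds..real (Suc i) / length ds}" for t
      using i by (intro subsetD[OF sub that]) simp
    qed
   qed simp
   finally show ?thesis .
  qed
  thus "{om\<in>space M. ?f om \<in> path_cell (fst p) (snd p)} \<in> sets M" for p .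
 qed
 finally show "?f -` V \<inter> space M \<in> sets M" .
qed

lemma path_law_measure:
 fixes Z :: "real => 'w => 'h::{real_normed_vector, second_countable_topology}"
 assumes Z: "\<And>t. t \<in> {0..1} ==> Z t \<in> borel_measurable M"
  and cont: "\<And>om. om \<in> space M ==> continuous_on {0..1} (\<lambda>t. Z t om)"
  and V: "openin (mtopology_of path_metric) V \<or> closedin (mtopology_of path_metric) V"
 shows "{om\<in>space M. (\<lambda>t\<in>{0..1}. Z t om) \<in> V} \<in> sets M"
  and "measure (path_law M Z) V = measure M {om\<in>space M. (\<lambda>t\<in>{0..1}. Z t om) \<in> V}"
proof -
 let ?P = "sigma (paths) {V. openin (mtopology_of path_metric) V} :: (real => 'h) measure"
 have sub: "{V. openin (mtopology_of path_metric) V} \<subseteq> Pow (mspace (path_metric :: (real => 'h) metric))"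
  using path_open_subset by blast
 have op: "U \<in> sets ?P" if "openin (mtopology_of path_metric) U" for U
  unfolding sets_measure_of[OF sub] using that by (intro sigma_sets.Basic) simp
 have VP: "V \<in> sets ?P"
  using V
 proof
  assume c: "closedin (mtopology_of path_metric) V"
  hence "V = space ?P - (paths - V)" "openin (mtopology_of path_metric) (paths - V)"
   using closedin_subset[OF c] by (auto simp: closedin_def space_measure_of[OF sub])
  thus ?thesis using sets.compl_sets[OF op] by metis
 qed (rule op)
 have m: "(\<lambda>om. \<lambda>t\<in>{0..1}. Z t om) \<in> measurable M ?P" by (rule path_map_measurable[OF Z cont])
 have eq: "(\<lambda>om. \<lambda>t\<in>{0..1}. Z t om) -` V \<inter> space M = {om\<in>space M. (\<lambda>t\<in>{0..1}. Z t om) \<in> V}" by auto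
 show "{om\<in>space M. (\<lambda>t\<in>{0..1}. Z t om) \<in> V} \<in> sets M" using measurable_sets[OF m VP] unfolding eq .
 show "measure (path_law M Z) V = measure M {om\<in>space M. (\<lambda>t\<in>{0..1}. Z t om) \<in> V}"
  unfolding path_law_def measure_distr[OF m VP] eq ..
qed

section \<open>The large deviation principle\<close>

lemma Limsup_ln_prob_le:
 assumes K: "K > 0" and p: "\<And>eps. 0 \<le> p eps" and le: "\<forall>\<^sub>F eps in at_right 0. p eps \<le> K * exp (- a / eps)"
 shows "Limsup (at_right 0) (\<lambda>eps. ereal eps * ln_prob (p eps)) \<le> - ereal a"
proof -
 have "((\<lambda>eps. eps * ln K - a) \<longlongrightarrow> 0 * ln K - a) (at_right 0)" by (intro tendsto_intros)
 hence lim: "((\<lambda>eps. ereal (eps * ln K - a)) \<longlongrightarrow> ereal (- a)) (at_right 0)" by simp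
 have "\<forall>\<^sub>F eps in at_right (0::real). eps > 0" by (simp add: eventually_at_right_less)
 with le have "\<forall>\<^sub>F eps in at_right 0. ereal eps * ln_prob (p eps) \<le> ereal (eps * ln K - a)"
 proof eventually_elim
  case (elim eps)
  show ?case
  proof (cases "p eps = 0")
   case True
   thus ?thesis using elim by (simp add: ln_prob_def)
  next
   case False
   hence p0: "0 < p eps" using p[of eps] by simp
   hence "ln (p eps) \<le> ln (K * exp (- a / eps))" using elim K by (intro ln_mono) auto
   also have "\<dots> = ln K - a / eps" using K by (simp add: ln_mult)
   finally have "eps * ln (p eps) \<le> eps * (ln K - a / eps)" using elim by (intro mult_left_mono) auto
   thus ?thesis using False elim by (simp add: ln_prob_def right_diff_distrib)
  qed
 qed
 hence "Limsup (at_right 0) (\<lambda>eps. ereal eps * ln_prob (p eps)) \<le> Limsup (at_right 0) (\<lambda>eps. ereal (eps * ln K - a))"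
  by (rule Limsup_mono)
 also have "\<dots> = ereal (- a)" by (rule lim_imp_Limsup[OF trivial_limit_at_right_real lim])
 finally show ?thesis by simp
qed

lemma Liminf_ln_prob_ge:
 assumes ge: "\<forall>\<^sub>F eps in at_right 0. exp (- a / eps) / 2 \<le> p eps"
 shows "- ereal a \<le> Liminf (at_right 0) (\<lambda>eps. ereal eps * ln_prob (p eps))"
proof -
 have "((\<lambda>eps. - a - eps * ln 2) \<longlongrightarrow> - a - 0 * ln 2) (at_right 0)" by (intro tendsto_intros)
 hence lim: "((\<lambda>eps. ereal (- a - eps * ln 2)) \<longlongrightarrow> ereal (- a)) (at_right 0)" by simp
 have "\<forall>\<^sub>F eps in at_right (0::real). eps > 0" by (simp add: eventually_at_right_less)
 with ge have "\<forall>\<^sub>F eps in at_right 0. ereal (- a - eps * ln 2) \<le> ereal eps * ln_prob (p eps)"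
 proof eventually_elim
  case (elim eps)
  have h: "0 < exp (- a / eps) / 2" by simp
  have p0: "0 < p eps" using less_le_trans[OF h elim(1)] .
  have "ln (exp (- a / eps) / 2) \<le> ln (p eps)" by (rule ln_mono[OF elim(1) h])
  moreover have "ln (exp (- a / eps) / 2) = - a / eps - ln 2" by (simp add: ln_div)
  ultimately have "eps * (- a / eps - ln 2) \<le> eps * ln (p eps)" using elim by (intro mult_left_mono) auto
  thus ?case using p0 elim by (simp add: ln_prob_def right_diff_distrib)
 qed
 hence "Liminf (at_right 0) (\<lambda>eps. ereal (- a - eps * ln 2)) \<le> Liminf (at_right 0) (\<lambda>eps. ereal eps * ln_prob (p eps))"
  by (rule Liminf_mono)
 moreover have "Liminf (at_right 0) (\<lambda>eps. ereal (- a - eps * ln 2)) = ereal (- a)"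
  by (rule lim_imp_Liminf[OF trivial_limit_at_right_real lim])
 ultimately show ?thesis by simp
qed

context coefficient
begin

lemma controlled_path_mspace: "\<phi> \<in> L2 ==> controlled_path G x \<phi> \<in> paths"
 using controlled_path_solution[of \<phi> x] by (simp add: solution_def)

lemma rate_function_controlled_path_le:
 assumes "\<phi> \<in> L2"
 shows "rate_function G x (controlled_path G x \<phi>) \<le> ereal (cost \<phi> / 2)"
proof -
 have "rate_function G x (controlled_path G x \<phi>) \<le> ereal (1 / 2) * ereal (cost \<phi>)"
  unfolding rate_function_def cost_def[symmetric] using assms by (intro ereal_mult_left_mono INF_lower) auto
 thus ?thesis by simp
qed

lemma rate_function_less:
 assumes "rate_function G x u < ereal c"
 shows "\<exists>\<phi>\<in>L2. u = controlled_path G x \<phi> \<and> cost \<phi> / 2 < c"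
proof (rule ccontr)
 assume "\<not> (\<exists>\<phi>\<in>L2. u = controlled_path G x \<phi> \<and> cost \<phi> / 2 < c)"
 hence "ereal (2 * c) \<le> (INF \<psi>\<in>{\<psi> \<in> L2. u = controlled_path G x \<psi>}. ereal (cost \<psi>))"
  by (intro INF_greatest) (auto simp: not_less)
 hence "ereal (1 / 2) * ereal (2 * c) \<le> rate_function G x u"
  unfolding rate_function_def cost_def by (intro ereal_mult_left_mono) auto
 thus False using assms by simp
qed

lemma rate_function_compact:
 "compactin (mtopology_of path_metric) {u \<in> topspace (mtopology_of path_metric). rate_function G x u \<le> ereal r}"
proof -
 interpret P: Metric_space "paths" "mdist path_metric" by (rule Metric_space_mspace_mdist)
 show ?thesis
  unfolding mtopology_of_def P.compactin_sequentially P.topspace_mtopology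
 proof (intro conjI allI impI)
  show "{u \<in> paths. rate_function G x u \<le> ereal r} \<subseteq> paths" by (rule Collect_restrict)
  fix \<sigma> :: "nat => real => 'h" assume "range \<sigma> \<subseteq> {u \<in> paths. rate_function G x u \<le> ereal r}"
  hence \<sigma>: "\<sigma> m \<in> paths" "rate_function G x (\<sigma> m) \<le> ereal r" for m by auto
  have "\<exists>\<phi>\<in>L2. \<sigma> m = controlled_path G x \<phi> \<and> cost \<phi> / 2 < r + 1 / Suc m" for m
   using \<sigma>(2)[of m] by (intro rate_function_less) (auto elim: order.strict_trans1)
  then obtain \<phi> where \<phi>: "\<And>m. \<phi> m \<in> L2" "\<And>m. \<sigma> m = controlled_path G x (\<phi> m)" "\<And>m. cost (\<phi> m) / 2 < r + 1 / Suc m"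
   by metis
  have c: "cost (\<phi> m) \<le> 2 * (r + 1 / Suc m)" for m using mult_left_mono[OF less_imp_le[OF \<phi>(3)[of m]], of 2] by simp
  have "(\<lambda>m. 2 * (r + 1 / Suc m)) \<longlonglongrightarrow> 2 * (r + 0)"
   by (intro tendsto_intros LIMSEQ_Suc[OF lim_1_over_n])
  hence lim: "(\<lambda>m. 2 * (r + 1 / Suc m)) \<longlonglongrightarrow> 2 * r" by simp
  obtain s :: "nat => nat" and \<psi> where s: "strict_mono s" "\<psi> \<in> L2" "cost \<psi> \<le> 2 * r"
   "\<And>e. e > 0 ==> \<exists>m0. \<forall>m\<ge>m0. \<forall>t\<in>{0..1}. norm (controlled_path G x (\<phi> (s m)) t - controlled_path G x \<psi> t) \<le> e"
   using controlled_paths_compact[OF \<phi>(1) c lim] by blast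
  have "limitin (mtopology_of path_metric) (\<sigma> \<circ> s) (controlled_path G x \<psi>) sequentially"
   using s(4) by (intro limitin_path_metric) (simp_all add: \<phi>(2) controlled_path_mspace[OF \<phi>(1)] controlled_path_mspace[OF s(2)] dist_norm)
  moreover have "rate_function G x (controlled_path G x \<psi>) \<le> ereal r"
   by (rule order_trans[OF rate_function_controlled_path_le[OF s(2)]]) (use s(3) in simp)
  ultimately have "controlled_path G x \<psi> \<in> {u \<in> paths. rate_function G x u \<le> ereal r} \<and> strict_mono s \<and>
    limitin P.mtopology (\<sigma> \<circ> s) (controlled_path G x \<psi>) sequentially"
   using s(1) controlled_path_mspace[OF s(2), of x] by (simp add: mtopology_of_def)
  thus "\<exists>l s. l \<in> {u \<in> paths. rate_function G x u \<le> ereal r} \<and> strict_mono s \<and> limitin P.mtopology (\<sigma> \<circ> s) l sequentially"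
   by (intro exI)
 qed
qed

lemma euler_near:
 assumes N: "N > 0" and e: "e > 0"
 shows "\<exists>\<alpha>>0. \<forall>v. (\<forall>i<N. \<forall>k\<in>modes n. \<bar>v i k - w i k\<bar> < \<alpha>) -->
  noise_cost n N v \<le> noise_cost n N w + 1 \<and> (\<forall>i\<le>N. norm (euler x n v i - euler x n w i) \<le> e)"
proof (rule ccontr)
 assume neg: "\<not> ?thesis"
 define P where "P \<alpha> v \<longleftrightarrow> (\<forall>i<N. \<forall>k\<in>modes n. \<bar>v i k - w i k\<bar> < \<alpha>)" for \<alpha> :: real and v
 define Q where "Q v \<longleftrightarrow> noise_cost n N v \<le> noise_cost n N w + 1 \<and> (\<forall>i\<le>N. norm (euler x n v i - euler x n w i) \<le> e)" for v
 have "\<not> (\<exists>\<alpha>>0. \<forall>v. P \<alpha> v --> Q v)" using neg unfolding P_def Q_def .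
 hence PQ: "\<exists>v. P \<alpha> v \<and> \<not> Q v" if "\<alpha> > 0" for \<alpha> using that by blast
 have "\<forall>m. \<exists>v. P (1 / real (Suc m)) v \<and> \<not> Q v" by (intro allI PQ) simp
 from choice[OF this] obtain v where v0: "\<And>m. P (1 / real (Suc m)) (v m)" "\<And>m. \<not> Q (v m)" by blast
 have v: "\<bar>v m i k - w i k\<bar> < 1 / Suc m" if "i < N" "k \<in> modes n" for m i k
  using v0(1)[of m] that unfolding P_def by blast
 define v' where "v' m i k = (if k \<in> modes n then v m i k else w i k)" for m i k
 have lim: "(\<lambda>m. v' m i k) \<longlonglongrightarrow> w i k" if "i < N" for i k
 proof (cases "k \<in> modes n")
  case True
  have "(\<lambda>m. v' m i k - w i k) \<longlonglongrightarrow> 0"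
  proof (rule tendsto_rabs_zero_cancel[OF tendsto_sandwich[of "\<lambda>_. 0"]])
   show "\<forall>\<^sub>F m in sequentially. \<bar>v' m i k - w i k\<bar> \<le> 1 / Suc m"
    using v[OF that True] True by (intro always_eventually allI less_imp_le) (simp add: v'_def)
   show "(\<lambda>m. 1 / real (Suc m)) \<longlonglongrightarrow> 0" by (rule LIMSEQ_Suc[OF lim_1_over_n])
  qed auto
  thus ?thesis by (simp add: LIM_zero_iff)
 qed (simp add: v'_def)
 have "(\<lambda>m. noise_cost n N (v' m)) \<longlonglongrightarrow> noise_cost n N w"
  unfolding noise_cost_def by (intro tendsto_intros lim) auto
 hence 1: "\<forall>\<^sub>F m in sequentially. noise_cost n N (v' m) < noise_cost n N w + 1" by (rule order_tendstoD) simp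
 have "\<forall>\<^sub>F m in sequentially. norm (euler x n (v' m) i - euler x n w i) < e" if "i \<le> N" for i
  using euler_tendsto[of N v' w i x n] lim that e unfolding tendsto_iff dist_norm by simp
 hence 2: "\<forall>\<^sub>F m in sequentially. \<forall>i\<in>{..N}. norm (euler x n (v' m) i - euler x n w i) < e"
  by (intro eventually_ball_finite) auto
 have "\<forall>\<^sub>F m in sequentially. False"
  using 1 2
 proof eventually_elim
  case (elim m)
  have "noise_cost n N (v' m) = noise_cost n N (v m)" by (simp add: noise_cost_def v'_def)
  moreover have "euler x n (v' m) i = euler x n (v m) i" if "i \<le> N" for i
   by (intro euler_cong) (simp add: v'_def)
  ultimately have "Q (v m)" using elim unfolding Q_def by (auto intro: less_imp_le)
  thus False using v0(2) by blast
 qed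
 thus False by simp
qed

lemma controlled_path_separation:
 assumes C: "closedin (mtopology_of path_metric) C"
  and sep: "\<And>\<phi>. \<phi> \<in> L2 ==> cost \<phi> \<le> r ==> controlled_path G x \<phi> \<notin> C"
 shows "\<exists>\<rho>>0. \<forall>u\<in>C. \<forall>\<phi>\<in>L2. cost \<phi> \<le> r --> \<not> (\<forall>t\<in>{0..1}. dist (controlled_path G x \<phi> t) (u t) \<le> \<rho>)"
proof (rule ccontr)
 assume neg: "\<not> ?thesis"
 define P where "P \<rho> u \<phi> \<longleftrightarrow> (\<forall>t\<in>{0..1}. dist (controlled_path G x \<phi> t) (u t) \<le> \<rho>)" for \<rho> u \<phi>
 have "\<not> (\<exists>\<rho>>0. \<forall>u\<in>C. \<forall>\<phi>\<in>L2. cost \<phi> \<le> r --> \<not> P \<rho> u \<phi>)" using neg unfolding P_def .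
 have ex: "\<exists>p. fst p \<in> C \<and> snd p \<in> L2 \<and> cost (snd p) \<le> r \<and> P \<rho> (fst p) (snd p)" if \<rho>: "\<rho> > 0" for \<rho>
 proof -
  obtain u \<phi> where "u \<in> C" "\<phi> \<in> L2" "cost \<phi> \<le> r" "P \<rho> u \<phi>"
   using \<open>\<not> (\<exists>\<rho>>0. \<forall>u\<in>C. \<forall>\<phi>\<in>L2. cost \<phi> \<le> r --> \<not> P \<rho> u \<phi>)\<close> \<rho> by blast
  thus ?thesis by (intro exI[of _ "(u, \<phi>)"]) simp
 qed
 have "\<forall>m. \<exists>p. fst p \<in> C \<and> snd p \<in> L2 \<and> cost (snd p) \<le> r \<and> P (1 / real (Suc m)) (fst p) (snd p)" by (intro allI ex) simp
 from choice[OF this] obtain p where p: "\<forall>m. fst (p m) \<in> C \<and> snd (p m) \<in> L2 \<and> cost (snd (p m)) \<le> r \<and> P (1 / real (Suc m)) (fst (p m)) (snd (p m))" by blast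
 define u where "u m = fst (p m)" for m
 define \<phi> where "\<phi> m = snd (p m)" for m
 have u: "u m \<in> C" "\<phi> m \<in> L2" "cost (\<phi> m) \<le> r"
  "t \<in> {0..1} ==> dist (controlled_path G x (\<phi> m) t) (u m t) \<le> 1 / real (Suc m)" for m t
  using p unfolding u_def \<phi>_def P_def by blast+
 obtain s :: "nat => nat" and \<psi> where s: "strict_mono s" "\<psi> \<in> L2" "cost \<psi> \<le> r"
  "\<And>e. e > 0 ==> \<exists>m0. \<forall>m\<ge>m0. \<forall>t\<in>{0..1}. norm (controlled_path G x (\<phi> (s m)) t - controlled_path G x \<psi> t) \<le> e"
  using controlled_paths_compact[where \<phi> = \<phi> and \<rho> = "\<lambda>_. r" and r = r and x = x, OF u(2,3) tendsto_const] by blast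
 have "controlled_path G x \<psi> \<in> C"
 proof (rule closedin_path_metric_limit[OF C, of "\<lambda>m. u (s m)"])
  fix e :: real assume e: "e > 0"
  obtain m0 where m0: "\<forall>m\<ge>m0. \<forall>t\<in>{0..1}. norm (controlled_path G x (\<phi> (s m)) t - controlled_path G x \<psi> t) \<le> e / 2"
   using s(4)[of "e / 2"] e by auto
  have e2: "0 < e / 2" using e by simp
  obtain m1 where m1: "inverse (real (Suc m1)) < e / 2" using reals_Archimedean[OF e2] by blast
  define m where "m = max m0 m1"
  have "m1 \<le> s m" using seq_suble[OF s(1), of m] by (simp add: m_def)
  hence "1 / real (Suc (s m)) \<le> 1 / real (Suc m1)" by (intro divide_left_mono) auto
  hence sm: "1 / real (Suc (s m)) \<le> e / 2" using m1 unfolding inverse_eq_divide by linarith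
  have "dist (controlled_path G x \<psi> t) (u (s m) t) \<le> e" if t: "t \<in> {0..1}" for t
  proof -
   have "dist (controlled_path G x (\<phi> (s m)) t) (controlled_path G x \<psi> t) \<le> e / 2"
    using m0 t unfolding dist_norm m_def by simp
   thus ?thesis
    using u(4)[OF t, of "s m"] sm dist_triangle3[of "controlled_path G x \<psi> t" "u (s m) t" "controlled_path G x (\<phi> (s m)) t"] by linarith
  qed
  thus "\<exists>m. \<forall>t\<in>{0..1}. dist (controlled_path G x \<psi> t) (u (s m) t) \<le> e" by blast
 qed (use u s controlled_path_mspace in auto)
 thus False using sep s by blast
qed

end

context mild_process
begin

lemma block_index_le: "N > 0 ==> t \<in> {0..1} ==> block_index N t \<le> N"
 using block_index_mem(2)[of N t] by (cases "t = 0") (auto simp: block_index_0)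

lemma upper_bound:
 assumes W: "closedin (mtopology_of path_metric) W" and a: "0 < a'" "a' < a"
  and sep: "\<And>\<phi>. \<phi> \<in> L2 ==> cost \<phi> \<le> 2 * a ==> controlled_path G x \<phi> \<notin> W"
 shows "\<exists>K>0. \<forall>\<^sub>F eps in at_right 0. prob {om\<in>space M. (\<lambda>t\<in>{0..1}. X (eps * t) om) \<in> W} \<le> K * exp (- a' / eps)"
proof -
 obtain \<rho> where \<rho>: "\<rho> > 0" "\<And>u \<phi>. u \<in> W ==> \<phi> \<in> L2 ==> cost \<phi> \<le> 2 * a ==> \<not> (\<forall>t\<in>{0..1}. dist (controlled_path G x \<phi> t) (u t) \<le> \<rho>)"
  using controlled_path_separation[OF W sep] by blast
 have pos: "0 < a" "0 < 2 * a" "0 < \<rho> / 2" using a \<rho>(1) by auto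
 obtain m1 where m1: "\<forall>n\<ge>m1. \<forall>N\<ge>m1. \<exists>eps0>0. eps0 \<le> 1 \<and> (\<forall>eps\<in>{0<..eps0}. euler_close a (2 * a) (\<rho> / 2) n N eps)"
  using euler_exponential_approximation[OF pos] by blast
 obtain m2 where m2: "m2 > 0" "\<forall>n\<ge>m2. \<forall>N\<ge>m2. \<forall>\<phi>\<in>L2. cost \<phi> \<le> 2 * a -->
  (\<forall>t\<in>{0..1}. norm (controlled_path G x \<phi> t - euler x n (control_increment \<phi> N) (block_index N t)) \<le> \<rho> / 2)"
  using euler_approximation[OF pos(2,3), of x] by blast
 define N where "N = max m1 m2"
 have N: "N > 0" "m1 \<le> N" "m2 \<le> N" using m2(1) by (auto simp: N_def)
 obtain eps0 where eps0: "eps0 > 0" "eps0 \<le> 1" "\<And>eps. eps \<in> {0<..eps0} ==> euler_close a (2 * a) (\<rho> / 2) N N eps"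
  using m1[rule_format, OF N(2) N(2)] by blast
 define b where "b = 2 * a / a'"
 have b: "b > 2" "2 * a / b = a'" using a by (auto simp: b_def field_simps)
 define D where "D = sqrt (b / (b - 2)) ^ (N * card (modes N))"
 have D: "D > 0" using b(1) by (simp add: D_def)
 have "\<forall>\<^sub>F eps in at_right 0. eps \<in> {0<..eps0}"
  using eps0(1) by (auto simp: eventually_at_right_field intro!: exI[of _ eps0])
 hence "\<forall>\<^sub>F eps in at_right 0. prob {om\<in>space M. (\<lambda>t\<in>{0..1}. X (eps * t) om) \<in> W} \<le> (5 * real N + D) * exp (- a' / eps)"
 proof eventually_elim
  case (elim eps)
  hence eps: "eps > 0" by simp
  obtain A where A: "A \<in> sets M" "prob A \<le> 5 * real N * exp (- a / eps)"
   "\<And>om t. om \<in> space M - A ==> noise_cost N N (noise eps N om) \<le> 2 * a ==> t \<in> {0..1} ==>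
    norm (X (eps * t) om - euler x N (noise eps N om) (block_index N t)) \<le> \<rho> / 2"
   using eps0(3)[OF elim] unfolding euler_close_def by blast
  let ?B = "{om\<in>space M. 2 * a < noise_cost N N (noise eps N om)}"
  note B = noise_cost_tail[OF N(1) eps b(1), of "2 * a" N]
  have "{om\<in>space M. (\<lambda>t\<in>{0..1}. X (eps * t) om) \<in> W} \<subseteq> A \<union> ?B"
  proof
   fix om assume "om \<in> {om\<in>space M. (\<lambda>t\<in>{0..1}. X (eps * t) om) \<in> W}"
   hence om: "om \<in> space M" "(\<lambda>t\<in>{0..1}. X (eps * t) om) \<in> W" by auto
   show "om \<in> A \<union> ?B"
   proof (rule ccontr)
    assume "om \<notin> A \<union> ?B"
    hence o: "om \<in> space M - A" "noise_cost N N (noise eps N om) \<le> 2 * a" using om(1) by auto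
    let ?\<phi> = "step_control N N (noise eps N om)"
    have \<phi>: "?\<phi> \<in> L2" "cost ?\<phi> \<le> 2 * a" using step_control(1,2)[OF N(1), of N "noise eps N om"] o(2) by auto
    have "dist (controlled_path G x ?\<phi> t) ((\<lambda>t\<in>{0..1}. X (eps * t) om) t) \<le> \<rho>" if t: "t \<in> {0..1}" for t
    proof -
     have 1: "norm (controlled_path G x ?\<phi> t - euler x N (noise eps N om) (block_index N t)) \<le> \<rho> / 2"
      using m2(2)[rule_format, OF N(3) N(3) \<phi> t] euler_step_control[OF N(1) block_index_le[OF N(1) t], of x N "noise eps N om"] by simp
     have 2: "norm (X (eps * t) om - euler x N (noise eps N om) (block_index N t)) \<le> \<rho> / 2" by (rule A(3)[OF o t])
     have "dist (controlled_path G x ?\<phi> t) (X (eps * t) om) \<le> \<rho>"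
      using dist_triangle2[of "controlled_path G x ?\<phi> t" "X (eps * t) om" "euler x N (noise eps N om) (block_index N t)"] 1 2
      unfolding dist_norm by linarith
     thus ?thesis using t by simp
    qed
    thus False using \<rho>(2)[OF om(2) \<phi>] by blast
   qed
  qed
  hence "prob {om\<in>space M. (\<lambda>t\<in>{0..1}. X (eps * t) om) \<in> W} \<le> prob (A \<union> ?B)"
   using A(1) B(1) by (intro finite_measure_mono) auto
  also have "\<dots> \<le> prob A + prob ?B" by (rule measure_Un_le[OF A(1) B(1)])
  also have "\<dots> \<le> 5 * real N * exp (- a / eps) + D * exp (- a' / eps)"
   using A(2) B(2) unfolding b(2) D_def[symmetric] by (rule add_mono)
  also have "\<dots> \<le> 5 * real N * exp (- a' / eps) + D * exp (- a' / eps)"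
   using a eps by (intro add_right_mono mult_left_mono) (auto simp: divide_right_mono)
  also have "\<dots> = (5 * real N + D) * exp (- a' / eps)" by (simp add: distrib_right)
  finally show ?case .
 qed
 thus ?thesis using D by (intro exI[of _ "5 * real N + D"]) auto
qed

lemma lower_bound:
 assumes V: "openin (mtopology_of path_metric) V" and \<phi>: "\<phi> \<in> L2" "controlled_path G x \<phi> \<in> V" "cost \<phi> / 2 < a"
  and meas: "\<And>eps. eps \<in> {0<..1} ==> {om\<in>space M. (\<lambda>t\<in>{0..1}. X (eps * t) om) \<in> V} \<in> sets M"
 shows "\<forall>\<^sub>F eps in at_right 0. exp (- a / eps) / 2 \<le> prob {om\<in>space M. (\<lambda>t\<in>{0..1}. X (eps * t) om) \<in> V}"
proof -
 obtain r where r: "r > 0" "\<And>v. v \<in> paths ==> \<forall>t\<in>{0..1}. dist (controlled_path G x \<phi> t) (v t) \<le> r ==> v \<in> V"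
  using V \<phi>(2) unfolding openin_path_metric by blast
 have pos: "0 < a + 1" "0 < cost \<phi> + 1" "0 < r / 3" using \<phi>(3) cost_nonneg[of \<phi>] r(1) by auto
 obtain m1 where m1: "\<forall>n\<ge>m1. \<forall>N\<ge>m1. \<exists>eps0>0. eps0 \<le> 1 \<and> (\<forall>eps\<in>{0<..eps0}. euler_close (a + 1) (cost \<phi> + 1) (r / 3) n N eps)"
  using euler_exponential_approximation[OF pos] by blast
 obtain m2 where m2: "m2 > 0" "\<forall>n\<ge>m2. \<forall>N\<ge>m2. \<forall>\<phi>'\<in>L2. cost \<phi>' \<le> cost \<phi> + 1 -->
  (\<forall>t\<in>{0..1}. norm (controlled_path G x \<phi>' t - euler x n (control_increment \<phi>' N) (block_index N t)) \<le> r / 3)"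
  using euler_approximation[OF pos(2,3), of x] by blast
 define N where "N = max m1 m2"
 have N: "N > 0" "m1 \<le> N" "m2 \<le> N" using m2(1) by (auto simp: N_def)
 obtain eps0 where eps0: "eps0 > 0" "eps0 \<le> 1" "\<And>eps. eps \<in> {0<..eps0} ==> euler_close (a + 1) (cost \<phi> + 1) (r / 3) N N eps"
  using m1[rule_format, OF N(2) N(2)] by blast
 define w where "w = control_increment \<phi> N"
 have w: "noise_cost N N w \<le> cost \<phi>" unfolding w_def by (rule control_increment_cost[OF \<phi>(1) N(1)])
 obtain \<alpha> where \<alpha>: "\<alpha> > 0" "\<And>v. \<forall>i<N. \<forall>k\<in>modes N. \<bar>v i k - w i k\<bar> < \<alpha> ==>
  noise_cost N N v \<le> noise_cost N N w + 1 \<and> (\<forall>i\<le>N. norm (euler x N v i - euler x N w i) \<le> r / 3)"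
  using euler_near[OF N(1) pos(3), of N w x] by blast
 have "noise_cost N N w / 2 < a" using w \<phi>(3) by linarith
 note near = near_noise_prob[OF N(1) \<alpha>(1) this]
 have ev: "\<forall>\<^sub>F eps in at_right 0. eps \<in> {0<..min eps0 (1 / (10 * real N))}"
 proof -
  have "0 < min eps0 (1 / (10 * real N))" using eps0(1) N(1) by simp
  thus ?thesis by (auto simp: eventually_at_right_field intro!: exI[of _ "min eps0 (1 / (10 * real N))"])
 qed
 from near ev show ?thesis
 proof eventually_elim
  case (elim eps)
  hence eps: "eps > 0" "eps \<in> {0<..eps0}" "eps \<le> 1 / (10 * real N)" "eps \<in> {0<..1}" using eps0(2) by auto
  obtain A where A: "A \<in> sets M" "prob A \<le> 5 * real N * exp (- (a + 1) / eps)"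
   "\<And>om t. om \<in> space M - A ==> noise_cost N N (noise eps N om) \<le> cost \<phi> + 1 ==> t \<in> {0..1} ==>
    norm (X (eps * t) om - euler x N (noise eps N om) (block_index N t)) \<le> r / 3"
   using eps0(3)[OF eps(2)] unfolding euler_close_def by blast
  let ?V = "{om\<in>space M. (\<lambda>t\<in>{0..1}. X (eps * t) om) \<in> V}"
  have "near_noise N N w \<alpha> eps N \<subseteq> A \<union> ?V"
  proof
   fix om assume "om \<in> near_noise N N w \<alpha> eps N"
   hence om: "om \<in> space M" and nr: "\<forall>i<N. \<forall>k\<in>modes N. \<bar>noise eps N om i k - w i k\<bar> < \<alpha>"
    unfolding near_noise_def by auto
   note nr' = \<alpha>(2)[OF nr]
   show "om \<in> A \<union> ?V"
   proof (rule ccontr)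
    assume no: "om \<notin> A \<union> ?V"
    hence oA: "om \<in> space M - A" using om by auto
    have nc: "noise_cost N N (noise eps N om) \<le> cost \<phi> + 1" using nr' w by linarith
    have "continuous_on {0..1} (\<lambda>t. X (eps * t) om)"
     using eps(4) mult_le_one by (intro continuous_on_compose2[OF X_continuous[OF om]] continuous_intros) auto
    hence P: "(\<lambda>t\<in>{0..1}. X (eps * t) om) \<in> paths"
     by (simp add: mspace_path_metric cong: continuous_on_cong_simp)
    have "dist (controlled_path G x \<phi> t) ((\<lambda>t\<in>{0..1}. X (eps * t) om) t) \<le> r" if t: "t \<in> {0..1}" for t
    proof -
     have c: "cost \<phi> \<le> cost \<phi> + 1" by simp
     have 1: "norm (controlled_path G x \<phi> t - euler x N w (block_index N t)) \<le> r / 3"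
      unfolding w_def by (rule m2(2)[rule_format, OF N(3) N(3) \<phi>(1) c t])
     have 2: "norm (X (eps * t) om - euler x N (noise eps N om) (block_index N t)) \<le> r / 3" by (rule A(3)[OF oA nc t])
     have 3: "norm (euler x N (noise eps N om) (block_index N t) - euler x N w (block_index N t)) \<le> r / 3"
      using nr' block_index_le[OF N(1) t] by blast
     have "dist (controlled_path G x \<phi> t) (X (eps * t) om) \<le> r"
      using dist_triangle2[of "controlled_path G x \<phi> t" "X (eps * t) om" "euler x N w (block_index N t)"]
       dist_triangle[of "X (eps * t) om" "euler x N w (block_index N t)" "euler x N (noise eps N om) (block_index N t)"] 1 2 3
      unfolding dist_norm by linarith
     thus ?thesis using t by simp
    qed
    hence "(\<lambda>t\<in>{0..1}. X (eps * t) om) \<in> V" using r(2)[OF P] by blast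
    thus False using no om by blast
   qed
  qed
  hence "prob (near_noise N N w \<alpha> eps N) \<le> prob (A \<union> ?V)"
   using A(1) meas[OF eps(4)] by (intro finite_measure_mono) auto
  also have "\<dots> \<le> prob A + prob ?V" by (rule measure_Un_le[OF A(1) meas[OF eps(4)]])
  finally have "exp (- a / eps) \<le> 5 * real N * exp (- (a + 1) / eps) + prob ?V" using elim(1) A(2) by linarith
  moreover have "5 * real N * exp (- (a + 1) / eps) \<le> exp (- a / eps) / 2"
  proof -
   have "eps * (10 * real N) \<le> 1" using eps(3) N(1) by (simp add: pos_le_divide_eq)
   hence "10 * real N \<le> 1 / eps" using eps(1) by (simp add: pos_le_divide_eq mult.commute)
   hence "10 * real N \<le> exp (1 / eps)" using exp_ge_add_one_self[of "1 / eps"] by linarith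
   hence "10 * real N * exp (- (a + 1) / eps) \<le> exp (1 / eps) * exp (- (a + 1) / eps)" by (intro mult_right_mono) auto
   also have "\<dots> = exp (- a / eps)"
    unfolding mult_exp_exp add_divide_distrib[symmetric] by simp
   finally show ?thesis by linarith
  qed
  ultimately show ?case by linarith
 qed
qed

end

lemma (in brownian_family) predictable_time_measurable:
 assumes f: "f \<in> borel_measurable (predictable_sigma M \<F> T)" and t: "t \<in> {0..T}"
 shows "(\<lambda>om. f (t, om)) \<in> borel_measurable M"
proof (rule measurable_compose[OF _ f])
 let ?G = "{{0} \<times> A | A. A \<in> sets (\<F> 0)} \<union> {{a<..b} \<times> A | a b A. 0 \<le> a \<and> a \<le> b \<and> b \<le> T \<and> A \<in> sets (\<F> a)}"
 have sp: "A \<subseteq> space M" "A \<in> sets M" if "A \<in> sets (\<F> a)" "0 \<le> a" for A a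
  using sets.sets_into_space[OF sets_filtration_M[OF that]] sets_filtration_M[OF that] by auto
 show "(\<lambda>om. (t, om)) \<in> measurable M (predictable_sigma M \<F> T)"
  unfolding predictable_sigma_def
 proof (rule measurable_measure_of)
  show "?G \<subseteq> Pow ({0..T} \<times> space M)"
  proof
   fix y assume "y \<in> ?G"
   then consider A where "y = {0} \<times> A" "A \<in> sets (\<F> 0)"
    | a b A where "y = {a<..b} \<times> A" "0 \<le> a" "a \<le> b" "b \<le> T" "A \<in> sets (\<F> a)" by blast
   thus "y \<in> Pow ({0..T} \<times> space M)"
   proof cases
    case 1
    thus ?thesis using sp(1)[of A 0] t by auto
   next
    case 2
    thus ?thesis using sp(1)[of A a] by auto
   qed
  qed
  show "(\<lambda>om. (t, om)) \<in> space M \<rightarrow> {0..T} \<times> space M" using t by auto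
  fix y assume "y \<in> ?G"
  then consider A where "y = {0} \<times> A" "A \<in> sets (\<F> 0)"
   | a b A where "y = {a<..b} \<times> A" "0 \<le> a" "a \<le> b" "b \<le> T" "A \<in> sets (\<F> a)" by blast
  thus "(\<lambda>om. (t, om)) -` y \<inter> space M \<in> sets M"
  proof cases
   case 1
   hence "(\<lambda>om. (t, om)) -` y \<inter> space M = (if t = 0 then A else {})" using sp(1)[of A 0] by auto
   thus ?thesis using sp(2)[of A 0] 1 by simp
  next
   case 2
   hence "(\<lambda>om. (t, om)) -` y \<inter> space M = (if t \<in> {a<..b} then A else {})" using sp(1)[of A a] by auto
   thus ?thesis using sp(2)[of A a] 2 by simp
  qed
 qed
qed

theorem (in mild_process) small_time_large_deviations:
 assumes meas: "\<And>t. t \<in> {0..1} ==> X t \<in> borel_measurable M"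
 shows "large_deviation_principle (mtopology_of path_metric)
      (\<lambda>eps. path_law M (\<lambda>t. X (eps * t))) (rate_function G x)"
 unfolding large_deviation_principle_def
proof (intro conjI allI impI)
 have unit: "eps * t \<in> {0..1}" if "eps \<in> {0<..1}" "t \<in> {0..1}" for eps t :: real
  using that mult_le_one[of eps t] by auto
 have scaled: "X (eps * t) \<in> borel_measurable M" if "eps \<in> {0<..1}" "t \<in> {0..1}" for eps t
  by (rule meas[OF unit[OF that]])
 have cont: "continuous_on {0..1} (\<lambda>t. X (eps * t) om)" if "eps \<in> {0<..1}" "om \<in> space M" for eps om
  by (intro continuous_on_compose2[OF X_continuous[OF that(2)]] continuous_intros) (use unit[OF that(1)] in blast)
 have law: "{om\<in>space M. (\<lambda>t\<in>{0..1}. X (eps * t) om) \<in> V} \<in> sets M"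
  "measure (path_law M (\<lambda>t. X (eps * t))) V = prob {om\<in>space M. (\<lambda>t\<in>{0..1}. X (eps * t) om) \<in> V}"
  if "eps \<in> {0<..1}" "openin (mtopology_of path_metric) V \<or> closedin (mtopology_of path_metric) V" for eps V
  using path_law_measure[of "\<lambda>t. X (eps * t)" M V, OF scaled[OF that(1)] cont[OF that(1)] that(2)] by auto
 have small: "\<forall>\<^sub>F eps in at_right (0::real). eps \<in> {0<..1}"
  by (auto simp: eventually_at_right_field intro!: exI[of _ 1])
 show "compactin (mtopology_of path_metric) {u \<in> topspace (mtopology_of path_metric). rate_function G x u \<le> ereal r}" for r
  by (rule rate_function_compact)
 show "- (INF u\<in>V. rate_function G x u) \<le> Liminf (at_right 0) (\<lambda>eps. ereal eps * ln_prob (measure (path_law M (\<lambda>t. X (eps * t))) V))"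
  (is "_ \<le> ?L") if V: "openin (mtopology_of path_metric) V" for V
 proof -
  have "- ?L \<le> rate_function G x u" if u: "u \<in> V" for u
  proof (rule dense_ge)
   fix z assume z: "rate_function G x u < z"
   show "- ?L \<le> z"
   proof (cases z)
    case (real a)
    then obtain \<phi> where \<phi>: "\<phi> \<in> L2" "u = controlled_path G x \<phi>" "cost \<phi> / 2 < a"
     using rate_function_less[of x u a] z by auto
    have "\<forall>\<^sub>F eps in at_right 0. exp (- a / eps) / 2 \<le> prob {om\<in>space M. (\<lambda>t\<in>{0..1}. X (eps * t) om) \<in> V}"
     using u law(1) V unfolding \<phi>(2) by (intro lower_bound[OF V \<phi>(1) _ \<phi>(3)]) auto
    with small have "\<forall>\<^sub>F eps in at_right 0. exp (- a / eps) / 2 \<le> measure (path_law M (\<lambda>t. X (eps * t))) V"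
     by eventually_elim (use law(2) V in auto)
    from Liminf_ln_prob_ge[OF this] show ?thesis unfolding real by (subst ereal_uminus_le_reorder)
   qed (use z in auto)
  qed
  hence "- ?L \<le> (INF u\<in>V. rate_function G x u)" by (rule INF_greatest)
  thus ?thesis by (subst ereal_uminus_le_reorder)
 qed
 show "Limsup (at_right 0) (\<lambda>eps. ereal eps * ln_prob (measure (path_law M (\<lambda>t. X (eps * t))) W)) \<le> - (INF u\<in>W. rate_function G x u)"
  (is "?L \<le> - ?I") if W: "closedin (mtopology_of path_metric) W" for W
 proof -
  have "?I \<le> - ?L"
  proof (rule dense_le)
   fix z assume z: "z < ?I"
   have "?L \<le> - z"
   proof (cases z)
    case (real a')
    show ?thesis
    proof (cases "0 < a'")
     case False
     have "\<forall>\<^sub>F eps in at_right 0. measure (path_law M (\<lambda>t. X (eps * t))) W \<le> 1 * exp (- 0 / eps)"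
      using small by eventually_elim (use law(2) W prob_le_1 in auto)
     hence "?L \<le> - ereal 0" by (intro Limsup_ln_prob_le[of 1]) auto
     also have "\<dots> \<le> - z" using False real by simp
     finally show ?thesis .
    next
     case True
     obtain a where a: "a' < a" "ereal a < ?I" using ereal_dense2[OF z] real by auto
     have "controlled_path G x \<phi> \<notin> W" if \<phi>: "\<phi> \<in> L2" "cost \<phi> \<le> 2 * a" for \<phi>
     proof
      assume "controlled_path G x \<phi> \<in> W"
      hence "?I \<le> rate_function G x (controlled_path G x \<phi>)" by (rule INF_lower)
      also have "\<dots> \<le> ereal (cost \<phi> / 2)" by (rule rate_function_controlled_path_le[OF \<phi>(1)])
      also have "\<dots> \<le> ereal a" using \<phi>(2) by simp
      finally show False using a(2) by simp
     qed
     from upper_bound[OF W True a(1) this] obtain k where k: "k > 0"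
      "\<forall>\<^sub>F eps in at_right 0. prob {om\<in>space M. (\<lambda>t\<in>{0..1}. X (eps * t) om) \<in> W} \<le> k * exp (- a' / eps)" by blast
     from small k(2) have "\<forall>\<^sub>F eps in at_right 0. measure (path_law M (\<lambda>t. X (eps * t))) W \<le> k * exp (- a' / eps)"
      by eventually_elim (use law(2) W in auto)
     thus ?thesis unfolding real by (intro Limsup_ln_prob_le[OF k(1)]) auto
    qed
   next
    case PInf
    thus ?thesis using z less_top by (simp only: ereal_infty_less(1)) simp
   next
    case MInf
    thus ?thesis by (simp only: ereal_uminus_uminus ereal_less_eq(1))
   qed
   have flip: "l \<le> - z ==> z \<le> - l" for l :: ereal
    using ereal_uminus_le_reorder[of "- l" "- z"] by (simp only: ereal_uminus_uminus)
   show "z \<le> - ?L" by (rule flip[OF \<open>?L \<le> - z\<close>])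
  qed
  have flip: "i \<le> - l ==> l \<le> - i" for i l :: ereal
   using ereal_uminus_le_reorder[of "- l" "- i"] by (simp only: ereal_uminus_uminus)
  show ?thesis by (rule flip[OF \<open>?I \<le> - ?L\<close>])
 qed
qed

theorem corollary4:
  fixes S :: "real \<Rightarrow> 'h::{real_inner, banach, second_countable_topology} \<Rightarrow>\<^sub>L 'h"
    and A :: "('h \<times> 'h) set"
    and F :: "real \<Rightarrow> 'h \<Rightarrow> 'h"
    and G :: "'h \<Rightarrow> 'u::{real_inner, banach, second_countable_topology} \<Rightarrow>\<^sub>L 'h"
    and \<nu> :: "real \<Rightarrow> real" and \<Lambda> :: real
    and M :: "'w measure" and \<F> :: "real \<Rightarrow> 'w measure"
    and g :: "nat \<Rightarrow> 'u" and K :: "nat set"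
    and \<beta> :: "nat \<Rightarrow> real \<Rightarrow> 'w \<Rightarrow> real"
    and x :: 'h and X :: "real \<Rightarrow> 'w \<Rightarrow> 'h"
  assumes "strongly_continuous_semigroup S"
    and "A = semigroup_generator S"
    and "orthonormal_basis g K"
    and "(\<lambda>(t, y). F t y) \<in> borel_measurable (restrict_space borel {0..1} \<Otimes>\<^sub>M borel)"
    and "\<And>y. hilbert_schmidt g K (G y)"
    and "\<nu> \<in> L2_unit_interval"
    and "0 < \<Lambda>"
    and "\<And>t y z. t \<in> {0..1} \<Longrightarrow> norm (F t y - F t z) \<le> \<nu> t * norm (y - z)"
    and "\<And>t y. t \<in> {0..1} \<Longrightarrow> norm (F t y) \<le> \<nu> t * (1 + norm y)"
    and "\<And>y z. hs_norm g K (\<lambda>u. G y u - G z u) \<le> \<Lambda> * norm (y - z)"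
    and "\<And>y. hs_norm g K (G y) \<le> \<Lambda> * (1 + norm y)"
    and "prob_space M"
    and "usual_filtration M \<F>"
    and "independent_brownian_motions M \<F> K \<beta>"
    and A1: "\<And>r::real. 0 < r \<Longrightarrow>
      (\<lambda>n. SUP h\<in>{h. norm h < r}. ereal (hs_norm g K (\<lambda>u. G h (u - basis_projection g K n u))))
        \<longlonglongrightarrow> 0"
    and A2: "\<And>a. a \<in> {0<..1} \<Longrightarrow>
      uniformly_equicontinuous_on {a..1} ((\<lambda>\<epsilon> t. S (\<epsilon> * t)) ` {0<..1})"
    and "continuous_mild_solution M \<F> g K \<beta> S F G x X"
  shows "large_deviation_principle (mtopology_of path_metric)
           (\<lambda>\<epsilon>. path_law M (\<lambda>t. X (\<epsilon> * t))) (rate_function G x)"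
proof -
 interpret prob_space M by (rule assms(12))
 note usual = assms(13)[unfolded usual_filtration_def]
 interpret wiener_family M \<F> K \<beta> g
 proof unfold_locales
  show "subalgebra M (\<F> t)" if "0 \<le> t" for t using usual that by blast
  show "sets (\<F> s) \<subseteq> sets (\<F> t)" if "0 \<le> s" "s \<le> t" for s t using usual that by blast
  show "independent_brownian_motions M \<F> K \<beta>" by (rule assms(14))
  show "orthonormal_basis g K" by (rule assms(3))
 qed
 have mild: "mild_solution M \<F> g K \<beta> S F G x X" and cont: "\<And>om. om \<in> space M ==> continuous_on {0..1} (\<lambda>t. X t om)"
  using assms(17) unfolding continuous_mild_solution_def by blast+
 have "\<forall>t\<in>{0..1}. \<exists>Y. has_stochastic_integral M \<F> g K \<beta> t (\<lambda>s om u. S (t - s) (G (X s om) u)) Y \<and>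
    (AE om in M. X t om = S t x + (LINT s:{0..t}|lborel. S (t - s) (F s (X s om))) + Y om)"
  using mild unfolding mild_solution_def by (elim conjE)
 from bchoice[OF this] obtain Y where Y: "\<And>t. t \<in> {0..1} ==> has_stochastic_integral M \<F> g K \<beta> t (\<lambda>s om u. S (t - s) (G (X s om) u)) (Y t)"
  "\<And>t. t \<in> {0..1} ==> AE om in M. X t om = S t x + (LINT s:{0..t}|lborel. S (t - s) (F s (X s om))) + Y t om"
  by blast
 obtain C where C: "1 \<le> C" "\<forall>t\<in>{0..1}. norm (S t) \<le> C" using semigroup_bounded[OF assms(1)] by blast
 interpret mild_process M \<F> K \<beta> g G \<Lambda> S F \<nu> x X C Y
 proof unfold_locales
  show "has_int t (\<lambda>s om u. S (t - s) (G (X s om) u)) (Y t)" if "t \<in> {0..1}" for t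
   by (rule has_stochastic_integral_imp_has_int[OF Y(1)[OF that]])
  show "orthonormal_basis g K" by (rule assms(3))
  show "hilbert_schmidt g K (G y)" for y by (rule assms(5))
  show "0 < \<Lambda>" by (rule assms(7))
  show "hs_norm g K (\<lambda>u. G y u - G z u) \<le> \<Lambda> * norm (y - z)" for y z by (rule assms(10))
  show "hs_norm g K (G y) \<le> \<Lambda> * (1 + norm y)" for y by (rule assms(11))
  show "(\<lambda>n. SUP h\<in>{h. norm h < r}. ereal (hs_norm g K (\<lambda>u. G h (u - basis_projection g K n u)))) \<longlonglongrightarrow> 0"
   if "0 < r" for r by (rule A1[OF that])
  show "strongly_continuous_semigroup S" by (rule assms(1))
  show "\<nu> \<in> L2_unit_interval" by (rule assms(6))
  show "norm (F t y) \<le> \<nu> t * (1 + norm y)" if "t \<in> {0..1}" for t y by (rule assms(9)[OF that])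
  show "continuous_on {0..1} (\<lambda>t. X t om)" if "om \<in> space M" for om by (rule cont[OF that])
  show "1 \<le> C" by (rule C(1))
  show "norm (S t) \<le> C" if "t \<in> {0..1}" for t using C(2) that by blast
  show "AE om in M. X t om = S t x + (LINT s:{0..t}|lborel. S (t - s) (F s (X s om))) + Y t om" if "t \<in> {0..1}" for t
   by (rule Y(2)[OF that])
 qed
 show ?thesis
 proof (rule small_time_large_deviations)
  fix t :: real assume t: "t \<in> {0..1}"
  have "(\<lambda>(t, om). X t om) \<in> borel_measurable (predictable_sigma M \<F> 1)" using mild unfolding mild_solution_def by (elim conjE)
  from predictable_time_measurable[OF this t] show "X t \<in> borel_measurable M" by simp
 qed
qed

end
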